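(* Let $(R,\mathfrak m,k)$ be a Noetherian local ring of prime characteristic $p$. Let $I$ and $\mathfrak a$ be $\mathfrak m$-primary ideals. Suppose $I=J+uR$ for some $u\in R$, where $J$ is an ideal of finite projective dimension such that $R/J^{[q]}$ is Artinian Gorenstein for all $q\gg0$. Then the difference between any two of the following three numerical functions of $q=p^n$ is bounded as $q\to\infty$: (1) $\lambda\big(\operatorname{Hom}_R(R/\mathfrak a,\,R/I^{[q]})\big)$; (2) $\lambda\big(\operatorname{Tor}_1^R(R/I,{}^{f^n}\!R)\otimes_R R/\mathfrak a\big)$; (3) $\lambda\big(\operatorname{Tor}_2^R(R/I^{[q]},\,R/\mathfrak a)\big)$.
   Context: $q=p^n$ is a varying power of $p$; $I^{[q]}$ is the ideal generated by the $q$-th powers of the generators of $I$; $\lambda$ denotes length. $f:R\to R$, $f(r)=r^p$, is the Frobenius endomorphism, and ${}^{f^n}\!R$ denotes $R$ regarded as an $R$-module by restriction of scalars along $f^n:R\to R$, $r\mapsto r^{q}$. The Frobenius functor $F^n(-)$ is base change along $f^n:R\to{}^{f^n}\!R$, with $F^n(R/I)\cong R/I^{[q]}$, and its left derived functors are $\operatorname{Tor}_i^R(-,{}^{f^n}\!R)$; these are regarded as $R$-modules via the ordinary multiplication on the target copy ${}^{f^n}\!R$ of $R$, and the tensor product in (2) is taken with respect to this structure. *)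

theory Defs
  imports Complex_Main "HOL-Algebra.Algebra" "HOL-Library.Extended_Nat"
begin

section \<open>Rings and ideals\<close>

definition local_ring :: "('a, 'r) ring_scheme \<Rightarrow> 'a set \<Rightarrow> bool" where
  "local_ring R m \<longleftrightarrow> cring R \<and> maximalideal m R \<and> (\<forall>m'. maximalideal m' R \<longrightarrow> m' = m)"

definition artinian_ring :: "('a, 'r) ring_scheme \<Rightarrow> bool" where
  "artinian_ring R \<longleftrightarrow> ring R \<and>
     (\<forall>A :: nat \<Rightarrow> 'a set. (\<forall>i. ideal (A i) R) \<and> (\<forall>i. A (Suc i) \<subseteq> A i)
        \<longrightarrow> (\<exists>n. \<forall>k\<ge>n. A k = A n))"

text \<open>The order of \<open>1\<close> in the additive group; \<^const>\<open>group.ord\<close> is \<open>0\<close> if that order is infinite.\<close>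
definition characteristic :: "('a, 'r) ring_scheme \<Rightarrow> nat" where
  "characteristic R = group.ord (add_monoid R) \<one>\<^bsub>R\<^esub>"

definition radical :: "('a, 'r) ring_scheme \<Rightarrow> 'a set \<Rightarrow> 'a set" where
  "radical R I = {x \<in> carrier R. \<exists>n::nat. x [^]\<^bsub>R\<^esub> n \<in> I}"

definition primary_ideal :: "('a, 'r) ring_scheme \<Rightarrow> 'a set \<Rightarrow> bool" where
  "primary_ideal R Q \<longleftrightarrow> ideal Q R \<and> Q \<noteq> carrier R \<and>
     (\<forall>x\<in>carrier R. \<forall>y\<in>carrier R. x \<otimes>\<^bsub>R\<^esub> y \<in> Q \<longrightarrow> x \<in> Q \<or> y \<in> radical R Q)"

definition primary_to :: "('a, 'r) ring_scheme \<Rightarrow> 'a set \<Rightarrow> 'a set \<Rightarrow> bool" where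
  "primary_to R m Q \<longleftrightarrow> primary_ideal R Q \<and> radical R Q = m"

text \<open>The ideal \<open>I\<^sup>[\<^sup>q\<^sup>]\<close>.  All of \<open>I\<close> is used as its generating set; in characteristic \<open>p\<close> and for
  \<open>q\<close> a power of \<open>p\<close> any other generating set of \<open>I\<close> yields the same ideal, since \<open>r \<mapsto> r\<^sup>q\<close> is additive.\<close>
definition frobenius_power :: "('a, 'r) ring_scheme \<Rightarrow> 'a set \<Rightarrow> nat \<Rightarrow> 'a set" where
  "frobenius_power R I q = Idl\<^bsub>R\<^esub> ((\<lambda>x. x [^]\<^bsub>R\<^esub> q) ` I)"

definition frobenius :: "('a, 'r) ring_scheme \<Rightarrow> nat \<Rightarrow> 'a \<Rightarrow> 'a" where
  "frobenius R p r = r [^]\<^bsub>R\<^esub> p"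


section \<open>Modules\<close>

text \<open>The record type \<^type>\<open>module_ext\<close> extends rings; its ring multiplication and unit carry no
  information for a module.\<close>

definition self_module :: "('a, 'r) ring_scheme \<Rightarrow> ('a, 'a) module" where
  "self_module R = \<lparr>carrier = carrier R, monoid.mult = (\<otimes>\<^bsub>R\<^esub>), monoid.one = \<one>\<^bsub>R\<^esub>,
     ring.zero = \<zero>\<^bsub>R\<^esub>, ring.add = (\<oplus>\<^bsub>R\<^esub>), smult = (\<otimes>\<^bsub>R\<^esub>)\<rparr>"

definition quot_module :: "('a, 'b) module \<Rightarrow> 'b set \<Rightarrow> ('a, 'b set) module" where
  "quot_module M K = \<lparr>carrier = a_rcosets\<^bsub>M\<^esub> K,
     monoid.mult = undefined, monoid.one = undefined, ring.zero = K,
     ring.add = set_add M, smult = (\<lambda>r T. \<Union>x\<in>T. K +>\<^bsub>M\<^esub> (r \<odot>\<^bsub>M\<^esub> x))\<rparr>"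

definition ideal_module :: "('a, 'r) ring_scheme \<Rightarrow> 'a set \<Rightarrow> ('a, 'a) module" where
  "ideal_module R J = (self_module R)\<lparr>carrier := J\<rparr>"

definition cyclic_module :: "('a, 'r) ring_scheme \<Rightarrow> 'a set \<Rightarrow> ('a, 'a set) module" where
  "cyclic_module R I = quot_module (self_module R) I"

definition mod_hom :: "('a, 'r) ring_scheme \<Rightarrow> ('a, 'b) module \<Rightarrow> ('a, 'c) module \<Rightarrow> ('b \<Rightarrow> 'c) set"
  where "mod_hom R M N = {h \<in> carrier M \<rightarrow> carrier N.
     (\<forall>x\<in>carrier M. \<forall>y\<in>carrier M. h (x \<oplus>\<^bsub>M\<^esub> y) = h x \<oplus>\<^bsub>N\<^esub> h y) \<and>
     (\<forall>r\<in>carrier R. \<forall>x\<in>carrier M. h (r \<odot>\<^bsub>M\<^esub> x) = r \<odot>\<^bsub>N\<^esub> h x)}"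

text \<open>\<open>Hom\<^sub>R(M, N)\<close>; extensionality makes a map on the carrier a unique HOL function.\<close>
definition hom_module ::
    "('a, 'r) ring_scheme \<Rightarrow> ('a, 'b) module \<Rightarrow> ('a, 'c) module \<Rightarrow> ('a, 'b \<Rightarrow> 'c) module" where
  "hom_module R M N = \<lparr>carrier = mod_hom R M N \<inter> extensional (carrier M),
     monoid.mult = undefined, monoid.one = undefined,
     ring.zero = (\<lambda>x\<in>carrier M. \<zero>\<^bsub>N\<^esub>),
     ring.add = (\<lambda>g h. \<lambda>x\<in>carrier M. g x \<oplus>\<^bsub>N\<^esub> h x),
     smult = (\<lambda>r h. \<lambda>x\<in>carrier M. r \<odot>\<^bsub>N\<^esub> h x)\<rparr>"

definition module_length :: "('a, 'r) ring_scheme \<Rightarrow> ('a, 'b) module \<Rightarrow> enat" where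
  "module_length R M = Sup {enat n | n. \<exists>N :: nat \<Rightarrow> 'b set.
     (\<forall>i\<le>n. submodule (N i) R M) \<and> (\<forall>i<n. N i \<subset> N (Suc i))}"

definition submodule_span :: "('a, 'r) ring_scheme \<Rightarrow> ('a, 'b) module \<Rightarrow> 'b set \<Rightarrow> 'b set" where
  "submodule_span R M A = \<Inter>{K. submodule K R M \<and> A \<subseteq> K}"

text \<open>The free module on \<open>T\<close>: finitely supported functions \<open>T \<rightarrow> R\<close>, extended by \<open>0\<close> off \<open>T\<close>.\<close>
definition free_module :: "('a, 'r) ring_scheme \<Rightarrow> 'x set \<Rightarrow> ('a, 'x \<Rightarrow> 'a) module" where
  "free_module R T = \<lparr>
     carrier = {c. (\<forall>x\<in>T. c x \<in> carrier R) \<and> (\<forall>x. x \<notin> T \<longrightarrow> c x = \<zero>\<^bsub>R\<^esub>) \<and> finite {x. c x \<noteq> \<zero>\<^bsub>R\<^esub>}},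
     monoid.mult = undefined, monoid.one = undefined,
     ring.zero = (\<lambda>x. \<zero>\<^bsub>R\<^esub>),
     ring.add = (\<lambda>c d x. c x \<oplus>\<^bsub>R\<^esub> d x),
     smult = (\<lambda>r c x. r \<otimes>\<^bsub>R\<^esub> c x)\<rparr>"

definition free_basis :: "('a, 'r) ring_scheme \<Rightarrow> 'x \<Rightarrow> 'x \<Rightarrow> 'a" where
  "free_basis R x = (\<lambda>y. if y = x then \<one>\<^bsub>R\<^esub> else \<zero>\<^bsub>R\<^esub>)"

text \<open>The linear map from a free module to \<open>M\<close> that sends the basis element of \<open>x\<close> to \<open>g x\<close>.\<close>
definition free_lift ::
    "('a, 'r) ring_scheme \<Rightarrow> ('a, 'b) module \<Rightarrow> ('x \<Rightarrow> 'b) \<Rightarrow> ('x \<Rightarrow> 'a) \<Rightarrow> 'b" where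
  "free_lift R M g c = (\<Oplus>\<^bsub>M\<^esub>x\<in>{x. c x \<noteq> \<zero>\<^bsub>R\<^esub>}. c x \<odot>\<^bsub>M\<^esub> g x)"


section \<open>Tensor products\<close>

text \<open>
  For a ring homomorphism \<open>\<phi> : R \<rightarrow> S\<close>, an \<open>R\<close>-module \<open>M\<close> and an \<open>S\<close>-module \<open>N\<close>, this section
  constructs \<open>M \<otimes>\<^sub>R N\<close>, where \<open>R\<close> acts on \<open>N\<close> through \<open>\<phi>\<close>, as an \<open>S\<close>-module through the action of \<open>S\<close>
  on \<open>N\<close>: the free \<open>S\<close>-module on \<open>M \<times> N\<close> modulo the relations below.  For \<open>\<phi> = id\<close> this is the usual
  tensor product of \<open>R\<close>-modules; for \<open>N = S\<close> it is base change along \<open>\<phi>\<close>, so that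
  \<open>R = S\<close>, \<open>\<phi> = f\<^sup>n\<close> gives the Frobenius functor with its \<open>R\<close>-structure from the target copy of \<open>R\<close>.
\<close>

definition tensor_relations :: "('a, 'r) ring_scheme \<Rightarrow> ('s, 't) ring_scheme \<Rightarrow> ('a \<Rightarrow> 's)
    \<Rightarrow> ('a, 'b) module \<Rightarrow> ('s, 'c) module \<Rightarrow> ('b \<times> 'c \<Rightarrow> 's) set" where
  "tensor_relations R S \<phi> M N =
    (let F = free_module S (carrier M \<times> carrier N); e = free_basis S in
       {e (x \<oplus>\<^bsub>M\<^esub> x', y) \<ominus>\<^bsub>F\<^esub> (e (x, y) \<oplus>\<^bsub>F\<^esub> e (x', y)) | x x' y.
          x \<in> carrier M \<and> x' \<in> carrier M \<and> y \<in> carrier N} \<union>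
       {e (x, y \<oplus>\<^bsub>N\<^esub> y') \<ominus>\<^bsub>F\<^esub> (e (x, y) \<oplus>\<^bsub>F\<^esub> e (x, y')) | x y y'.
          x \<in> carrier M \<and> y \<in> carrier N \<and> y' \<in> carrier N} \<union>
       {e (r \<odot>\<^bsub>M\<^esub> x, y) \<ominus>\<^bsub>F\<^esub> e (x, \<phi> r \<odot>\<^bsub>N\<^esub> y) | r x y.
          r \<in> carrier R \<and> x \<in> carrier M \<and> y \<in> carrier N} \<union>
       {e (x, s \<odot>\<^bsub>N\<^esub> y) \<ominus>\<^bsub>F\<^esub> s \<odot>\<^bsub>F\<^esub> e (x, y) | s x y.
          s \<in> carrier S \<and> x \<in> carrier M \<and> y \<in> carrier N})"

definition tensor_kernel :: "('a, 'r) ring_scheme \<Rightarrow> ('s, 't) ring_scheme \<Rightarrow> ('a \<Rightarrow> 's)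
    \<Rightarrow> ('a, 'b) module \<Rightarrow> ('s, 'c) module \<Rightarrow> ('b \<times> 'c \<Rightarrow> 's) set" where
  "tensor_kernel R S \<phi> M N =
     submodule_span S (free_module S (carrier M \<times> carrier N)) (tensor_relations R S \<phi> M N)"

definition tensor_over :: "('a, 'r) ring_scheme \<Rightarrow> ('s, 't) ring_scheme \<Rightarrow> ('a \<Rightarrow> 's)
    \<Rightarrow> ('a, 'b) module \<Rightarrow> ('s, 'c) module \<Rightarrow> ('s, ('b \<times> 'c \<Rightarrow> 's) set) module" where
  "tensor_over R S \<phi> M N =
     quot_module (free_module S (carrier M \<times> carrier N)) (tensor_kernel R S \<phi> M N)"

definition pure_tensor :: "('a, 'r) ring_scheme \<Rightarrow> ('s, 't) ring_scheme \<Rightarrow> ('a \<Rightarrow> 's)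
    \<Rightarrow> ('a, 'b) module \<Rightarrow> ('s, 'c) module \<Rightarrow> 'b \<times> 'c \<Rightarrow> ('b \<times> 'c \<Rightarrow> 's) set" where
  "pure_tensor R S \<phi> M N z =
     tensor_kernel R S \<phi> M N +>\<^bsub>free_module S (carrier M \<times> carrier N)\<^esub> free_basis S z"

text \<open>\<open>h \<otimes> N : M \<otimes>\<^sub>R N \<rightarrow> M' \<otimes>\<^sub>R N\<close> for \<open>R\<close>-linear \<open>h : M \<rightarrow> M'\<close>; the image of a coset under the
  linear extension of \<open>(x, y) \<mapsto> h x \<otimes> y\<close> is a singleton.\<close>
definition tensor_map :: "('a, 'r) ring_scheme \<Rightarrow> ('s, 't) ring_scheme \<Rightarrow> ('a \<Rightarrow> 's)
    \<Rightarrow> ('a, 'b) module \<Rightarrow> ('s, 'c) module \<Rightarrow> ('d \<Rightarrow> 'b)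
    \<Rightarrow> ('d \<times> 'c \<Rightarrow> 's) set \<Rightarrow> ('b \<times> 'c \<Rightarrow> 's) set" where
  "tensor_map R S \<phi> M' N h T = the_elem
     (free_lift S (tensor_over R S \<phi> M' N) (\<lambda>(x, y). pure_tensor R S \<phi> M' N (h x, y)) ` T)"

definition tensor_product :: "('a, 'r) ring_scheme \<Rightarrow> ('a, 'b) module \<Rightarrow> ('a, 'c) module
    \<Rightarrow> ('a, ('b \<times> 'c \<Rightarrow> 'a) set) module" where
  "tensor_product R M N = tensor_over R R (\<lambda>r. r) M N"


section \<open>Projective resolutions and Tor\<close>

text \<open>The lifting property is required for test modules of restricted size only, because HOL cannot
  quantify over types inside a formula.  This loses nothing: the test modules include the canonical surjection onto
  \<open>P\<close> from the free module on \<open>carrier P\<close>, and if that splits, then \<open>P\<close> is a direct summand of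
  a free module and lifts against all surjections.\<close>
definition projective_module :: "('a, 'r) ring_scheme \<Rightarrow> ('a, 'b) module \<Rightarrow> bool" where
  "projective_module R P \<longleftrightarrow> module R P \<and>
     (\<forall>(A :: ('a, 'b \<Rightarrow> 'a) module) (B :: ('a, 'b) module) g h.
        module R A \<and> module R B \<and> g \<in> mod_hom R A B \<and> g ` carrier A = carrier B \<and> h \<in> mod_hom R P B
        \<longrightarrow> (\<exists>h'\<in>mod_hom R P A. \<forall>x\<in>carrier P. g (h' x) = h x))"

text \<open>\<open>\<dots> \<rightarrow> P\<^sub>1 \<rightarrow> P\<^sub>0 \<rightarrow> M \<rightarrow> 0\<close> with \<open>d i : P (i + 1) \<rightarrow> P i\<close> and augmentation \<open>e\<close>.\<close>
definition projective_resolution :: "('a, 'r) ring_scheme \<Rightarrow> ('a, 'm) module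
    \<Rightarrow> (nat \<Rightarrow> ('a, 'b) module) \<Rightarrow> (nat \<Rightarrow> 'b \<Rightarrow> 'b) \<Rightarrow> ('b \<Rightarrow> 'm) \<Rightarrow> bool" where
  "projective_resolution R M P d e \<longleftrightarrow>
     (\<forall>i. projective_module R (P i)) \<and>
     (\<forall>i. d i \<in> mod_hom R (P (Suc i)) (P i)) \<and> e \<in> mod_hom R (P 0) M \<and>
     e ` carrier (P 0) = carrier M \<and>
     d 0 ` carrier (P (Suc 0)) = a_kernel (P 0) M e \<and>
     (\<forall>i. d (Suc i) ` carrier (P (Suc (Suc i))) = a_kernel (P (Suc i)) (P i) (d i))"

text \<open>
  Resolutions of a module with elements in \<open>'m\<close> are formed by modules with elements in
  \<open>('a + 'm) list \<Rightarrow> 'a\<close>.  This is large enough: lists over \<open>'a + 'm\<close> are at least as numerous as the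
  elements of \<open>M\<close> and of every free \<open>R\<close>-module with basis in that list type, so free resolutions exist
  there, and so does a projective resolution of minimal length (cut off a free resolution at a
  projective syzygy).
\<close>

definition finite_proj_dim :: "('a, 'r) ring_scheme \<Rightarrow> ('a, 'm) module \<Rightarrow> bool" where
  "finite_proj_dim R M \<longleftrightarrow>
     (\<exists>(P :: nat \<Rightarrow> ('a, ('a + 'm) list \<Rightarrow> 'a) module) d e n.
        projective_resolution R M P d e \<and> (\<forall>i>n. carrier (P i) = {\<zero>\<^bsub>P i\<^esub>}))"

text \<open>Homology at \<open>i\<close> of a complex with differentials \<open>d i : C (i + 1) \<rightarrow> C i\<close>.\<close>
fun homology :: "(nat \<Rightarrow> ('a, 'b) module) \<Rightarrow> (nat \<Rightarrow> 'b \<Rightarrow> 'b) \<Rightarrow> nat \<Rightarrow> ('a, 'b set) module" where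
  "homology C d 0 = quot_module (C 0) (d 0 ` carrier (C (Suc 0)))"
| "homology C d (Suc i) =
     quot_module ((C (Suc i))\<lparr>carrier := a_kernel (C (Suc i)) (C i) (d i)\<rparr>)
       (d (Suc i) ` carrier (C (Suc (Suc i))))"

text \<open>\<open>Tor\<^sub>i\<^sup>R(M, N)\<close> as an \<open>S\<close>-module, for an \<open>S\<close>-module \<open>N\<close> on which \<open>R\<close> acts through \<open>\<phi> : R \<rightarrow> S\<close>:
  the homology of \<open>P \<otimes>\<^sub>R N\<close> for a projective resolution \<open>P\<close> of \<open>M\<close>, which by the comparison theorem
  is independent of \<open>P\<close> up to isomorphism of \<open>S\<close>-modules.\<close>
definition Tor_over :: "('a, 'r) ring_scheme \<Rightarrow> ('s, 't) ring_scheme \<Rightarrow> ('a \<Rightarrow> 's) \<Rightarrow> nat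
    \<Rightarrow> ('a, 'm) module \<Rightarrow> ('s, 'c) module
    \<Rightarrow> ('s, ((('a + 'm) list \<Rightarrow> 'a) \<times> 'c \<Rightarrow> 's) set set) module" where
  "Tor_over R S \<phi> i M N =
    (let (P, d) = (SOME (P, d). \<exists>e. projective_resolution R M P d e)
     in homology (\<lambda>j. tensor_over R S \<phi> (P j) N) (\<lambda>j. tensor_map R S \<phi> (P j) N (d j)) i)"

definition Tor :: "('a, 'r) ring_scheme \<Rightarrow> nat \<Rightarrow> ('a, 'm) module \<Rightarrow> ('a, 'c) module
    \<Rightarrow> ('a, ((('a + 'm) list \<Rightarrow> 'a) \<times> 'c \<Rightarrow> 'a) set set) module" where
  "Tor R i M N = Tor_over R R (\<lambda>r. r) i M N"

text \<open>\<open>Tor\<^sub>i\<^sup>R(M, R)\<close> with \<open>R\<close> acting on the second argument through \<open>f\<^sup>n\<close>, as a module over the target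
  copy of \<open>R\<close>: the \<open>i\<close>-th left derived functor of the Frobenius functor \<open>F\<^sup>n\<close>.\<close>
definition Tor_frobenius :: "('a, 'r) ring_scheme \<Rightarrow> nat \<Rightarrow> nat \<Rightarrow> nat \<Rightarrow> ('a, 'm) module
    \<Rightarrow> ('a, ((('a + 'm) list \<Rightarrow> 'a) \<times> 'a \<Rightarrow> 'a) set set) module" where
  "Tor_frobenius R p n i M = Tor_over R R (frobenius R p ^^ n) i M (self_module R)"


section \<open>Gorenstein rings\<close>

text \<open>Extension is only required along inclusions into modules with elements in \<open>'a\<close>; these
  contain the inclusions of the ideals in \<open>R\<close>, which suffice by Baer's criterion.\<close>
definition injective_module :: "('a, 'r) ring_scheme \<Rightarrow> ('a, 'b) module \<Rightarrow> bool" where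
  "injective_module R E \<longleftrightarrow> module R E \<and>
     (\<forall>(B :: ('a, 'a) module) A h.
        module R B \<and> submodule A R B \<and> h \<in> mod_hom R (B\<lparr>carrier := A\<rparr>) E
        \<longrightarrow> (\<exists>h'\<in>mod_hom R B E. \<forall>x\<in>A. h' x = h x))"

definition injective_resolution :: "('a, 'r) ring_scheme \<Rightarrow> ('a, 'm) module
    \<Rightarrow> (nat \<Rightarrow> ('a, 'b) module) \<Rightarrow> (nat \<Rightarrow> 'b \<Rightarrow> 'b) \<Rightarrow> ('m \<Rightarrow> 'b) \<Rightarrow> bool" where
  "injective_resolution R M E d e \<longleftrightarrow>
     (\<forall>i. injective_module R (E i)) \<and>
     (\<forall>i. d i \<in> mod_hom R (E i) (E (Suc i))) \<and> e \<in> mod_hom R M (E 0) \<and>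
     inj_on e (carrier M) \<and>
     e ` carrier M = a_kernel (E 0) (E (Suc 0)) (d 0) \<and>
     (\<forall>i. d i ` carrier (E i) = a_kernel (E (Suc i)) (E (Suc (Suc i))) (d (Suc i)))"

text \<open>Only used for Noetherian \<open>R\<close>.  Then a module and its injective hull have at most
  \<open>max {|R|, |M|, \<aleph>\<^sub>0}\<close> elements: Baer's criterion involves finitely generated ideals only, so countably
  many rounds of adjoining extensions produce an injective module.  Hence minimal injective
  resolutions can be realised on the type \<open>('a + 'm) list\<close>.\<close>
definition finite_inj_dim :: "('a, 'r) ring_scheme \<Rightarrow> ('a, 'm) module \<Rightarrow> bool" where
  "finite_inj_dim R M \<longleftrightarrow>
     (\<exists>(E :: nat \<Rightarrow> ('a, ('a + 'm) list) module) d e n.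
        injective_resolution R M E d e \<and> (\<forall>i>n. carrier (E i) = {\<zero>\<^bsub>E i\<^esub>}))"

definition gorenstein_local_ring :: "('a, 'r) ring_scheme \<Rightarrow> bool" where
  "gorenstein_local_ring R \<longleftrightarrow>
     (\<exists>m. local_ring R m) \<and> noetherian_ring R \<and> finite_inj_dim R (self_module R)"

end

theory Submission
  imports Defs
begin

text \<open>
  Write \<open>q = p\<^sup>n\<close>, and \<open>I\<^sub>q, J\<^sub>q\<close> for the ideals generated by the \<open>q\<close>-th powers of elements of \<open>I\<close> and \<open>J\<close>.
  Let \<open>c\<^sub>1, \<dots>, c\<^sub>s\<close> generate \<open>I\<close>, let \<open>F = R\<^sup>s\<close>, and let \<open>Z\<close> be the module of relations between the
  \<open>c\<^sub>k\<^sup>q\<close>.  All three functions are read off from \<open>Z\<close>.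

  Functions (2) and (3).  Dimension shifting gives \<open>Tor\<^sub>2(R / I\<^sub>q, R / \<aa>) = (Z \<inter> \<aa> F) / \<aa> Z\<close>.  The first Tor of \<open>R / I\<close>
  along Frobenius is \<open>Z / B\<close>, where \<open>B\<close> is generated by the images of finitely many generating relations
  between the \<open>c\<^sub>k\<close> themselves, so (2) is the length of \<open>Z / (B + \<aa> Z)\<close>.  Both lengths differ from that of \<open>Z / \<aa> Z\<close> by a
  bounded amount: \<open>Z / (Z \<inter> \<aa> F)\<close> embeds into \<open>F / \<aa> F\<close>, and \<open>(B + \<aa> Z) / \<aa> Z\<close> is killed by \<open>\<aa>\<close> and generated by a number of
  elements that does not depend on \<open>n\<close>.  This holds for every \<open>n\<close>.

  Functions (1) and (2).  Choose the generators so that the last one is \<open>u\<close> and the others generate \<open>J\<close>.  The last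
  coordinate maps \<open>Z\<close> onto \<open>J\<^sub>q : u\<^sup>q = J\<^sub>q : I\<^sub>q\<close>, and the kernel consists of the relations between the \<open>q\<close>-th powers of
  the generators of \<open>J\<close>.  Because \<open>J\<close> has finite projective dimension, Frobenius keeps its resolution exact (Peskine and
  Szpiro), so this kernel lies in \<open>B\<close>, and (2) becomes a length of quotients of ideals, namely that of
  \<open>(J\<^sub>q : I\<^sub>q)\<close> modulo \<open>\<aa> (J\<^sub>q : I\<^sub>q)\<close> and the image of \<open>B\<close>, which contains \<open>J\<^sub>q\<close>.  On the other hand, (1) is the length of
  \<open>(I\<^sub>q : \<aa>) / I\<^sub>q\<close>.  When \<open>R / J\<^sub>q\<close> is Artinian Gorenstein, \<open>K \<mapsto> J\<^sub>q : K\<close> is an inclusion-reversing involution on the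
  ideals above \<open>J\<^sub>q\<close>.  It turns chains between \<open>I\<^sub>q\<close> and \<open>I\<^sub>q : \<aa>\<close> into chains between \<open>J\<^sub>q + \<aa> (J\<^sub>q : I\<^sub>q)\<close> and \<open>J\<^sub>q : I\<^sub>q\<close>, so
  (1) is the length of \<open>J\<^sub>q : I\<^sub>q\<close> modulo \<open>J\<^sub>q + \<aa> (J\<^sub>q : I\<^sub>q)\<close>.  The two differ by the
  image of \<open>B\<close>, which is again bounded.

  Two classical theorems enter, each in the form needed here.  For \<open>base_change_acyclic\<close>, a maximal regular sequence
  \<open>x\<^sub>1, \<dots>, x\<^sub>d\<close> in \<open>J\<close> leaves a socle element modulo \<open>(x\<^sub>1, \<dots>, x\<^sub>d)\<close>, as \<open>J\<close> contains powers of all elements of \<open>m\<close>, and this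
  bounds the length of the minimal resolution by \<open>d\<close>.  Each \<open>x\<^sub>j\<close> kills \<open>R / J\<close>, so it is homotopic to zero on the resolution, and
  \<open>x\<^sub>j\<^sup>q\<close> is homotopic to zero after base change; descending along the sequence yields exactness.  For
  \<open>gorenstein_double_annihilator\<close>, the property of extending homomorphisms from ideals is passed down a finite injective
  resolution of an Artinian local ring from cosyzygy to cosyzygy until it reaches the ring itself.
\<close>

section \<open>Modules, submodules and quotients\<close>

lemma submodule_subset: "submodule K R M \<Longrightarrow> x \<in> K \<Longrightarrow> x \<in> carrier M"
  using subgroup.subset[of K "add_monoid M"] by (auto simp: submodule_def)

lemma submodule_zero: "submodule K R M \<Longrightarrow> \<zero>\<^bsub>M\<^esub> \<in> K"
  using subgroup.one_closed[of K "add_monoid M"] by (simp add: submodule_def)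

lemma submodule_add: "submodule K R M \<Longrightarrow> x \<in> K \<Longrightarrow> y \<in> K \<Longrightarrow> x \<oplus>\<^bsub>M\<^esub> y \<in> K"
  using subgroup.m_closed[of K "add_monoid M"] by (simp add: submodule_def)

lemma submodule_smult: "submodule K R M \<Longrightarrow> r \<in> carrier R \<Longrightarrow> x \<in> K \<Longrightarrow> r \<odot>\<^bsub>M\<^esub> x \<in> K"
  by (rule submodule.smult_closed)

lemma submodule_inv: "submodule K R M \<Longrightarrow> x \<in> K \<Longrightarrow> \<ominus>\<^bsub>M\<^esub> x \<in> K"
  using subgroup.m_inv_closed[of K "add_monoid M"] by (simp add: submodule_def a_inv_def)

lemma submodule_minus:
  assumes "module R M" "submodule K R M" "x \<in> K" "y \<in> K"
  shows "x \<ominus>\<^bsub>M\<^esub> y \<in> K"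
proof -
  interpret M: module R M by fact
  show ?thesis using assms by (simp add: M.minus_eq submodule_add submodule_inv submodule_subset)
qed

lemma submoduleI':
  fixes M (structure)
  assumes "module R M" "K \<subseteq> carrier M" "\<zero> \<in> K"
    "\<And>x y. x \<in> K \<Longrightarrow> y \<in> K \<Longrightarrow> x \<oplus> y \<in> K"
    "\<And>r x. r \<in> carrier R \<Longrightarrow> x \<in> K \<Longrightarrow> r \<odot> x \<in> K"
  shows "submodule K R M"
proof -
  interpret M: module R M by fact
  have "\<ominus> x \<in> K" if "x \<in> K" for x
  proof -
    have "\<ominus> x = (\<ominus>\<^bsub>R\<^esub> \<one>\<^bsub>R\<^esub>) \<odot> x"
      using that assms(2) by (subst M.smult_l_minus) auto
    then show ?thesis using assms(5)[of "\<ominus>\<^bsub>R\<^esub> \<one>\<^bsub>R\<^esub>" x] that by simp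
  qed
  then show ?thesis using assms by (intro M.submoduleI) auto
qed

lemma submodule_Int:
  assumes "module R M" "submodule K R M" "submodule L R M"
  shows "submodule (K \<inter> L) R M"
  by (intro submoduleI'[OF assms(1)])
    (use submodule_subset[OF assms(2)] submodule_zero[OF assms(2)] submodule_zero[OF assms(3)] in
     \<open>auto simp: submodule_add[OF assms(2)] submodule_add[OF assms(3)]
       submodule_smult[OF assms(2)] submodule_smult[OF assms(3)]\<close>)

lemma submodule_add_cancel:
  fixes M (structure)
  assumes "module R M" "submodule K R M" "x \<in> carrier M" "y \<in> K" "x \<oplus> y \<in> K"
  shows "x \<in> K"
proof -
  interpret M: module R M by fact
  have "y \<in> carrier M" by (rule submodule_subset[OF assms(2,4)])
  then have "x = (x \<oplus> y) \<ominus> y"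
    using assms(3) by (simp add: M.minus_eq M.a_assoc M.r_neg)
  then show ?thesis using submodule_minus[OF assms(1,2,5,4)] by simp
qed

lemma submodule_minus_iff:
  assumes "module R M" "submodule K R M" "x \<in> carrier M" "y \<in> K"
  shows "x \<ominus>\<^bsub>M\<^esub> y \<in> K \<longleftrightarrow> x \<in> K"
proof -
  interpret M: module R M by fact
  have "y \<in> carrier M" by (rule submodule_subset[OF assms(2,4)])
  then show ?thesis
    using submodule_minus[OF assms(1,2) _ assms(4)] submodule_add_cancel[OF assms(1,2,3) submodule_inv[OF assms(2,4)]]
      assms(3) by (auto simp: M.minus_eq)
qed

lemma module_minus_cancel:
  fixes M (structure)
  assumes "module R M" "x \<in> carrier M" "y \<in> carrier M"
  shows "(x \<ominus> y) \<oplus> y = x" "y \<oplus> (x \<ominus> y) = x" "(x \<oplus> y) \<ominus> y = x"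
    "x \<ominus> y = \<zero> \<longleftrightarrow> x = y" "(y \<oplus> x) \<ominus> y = x"
proof -
  interpret M: module R M by fact
  show 1: "(x \<ominus> y) \<oplus> y = x" using assms by (simp add: M.minus_eq M.a_assoc M.l_neg)
  then show "y \<oplus> (x \<ominus> y) = x" using assms by (simp add: M.a_comm)
  show 2: "(x \<oplus> y) \<ominus> y = x" using assms by (simp add: M.minus_eq M.a_assoc M.r_neg)
  then show "(y \<oplus> x) \<ominus> y = x" using assms by (simp add: M.a_comm)
  show "x \<ominus> y = \<zero> \<longleftrightarrow> x = y" using 1 assms by (metis M.l_zero M.minus_eq M.r_neg)
qed

subsection \<open>Linear maps\<close>

lemma mod_hom_closed: "h \<in> mod_hom R M N \<Longrightarrow> x \<in> carrier M \<Longrightarrow> h x \<in> carrier N"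
  and mod_hom_add: "h \<in> mod_hom R M N \<Longrightarrow> x \<in> carrier M \<Longrightarrow> y \<in> carrier M \<Longrightarrow> h (x \<oplus>\<^bsub>M\<^esub> y) = h x \<oplus>\<^bsub>N\<^esub> h y"
  and mod_hom_smult: "h \<in> mod_hom R M N \<Longrightarrow> r \<in> carrier R \<Longrightarrow> x \<in> carrier M \<Longrightarrow> h (r \<odot>\<^bsub>M\<^esub> x) = r \<odot>\<^bsub>N\<^esub> h x"
  by (auto simp: mod_hom_def)

lemma mod_homI:
  assumes "\<And>x. x \<in> carrier M \<Longrightarrow> h x \<in> carrier N"
    "\<And>x y. x \<in> carrier M \<Longrightarrow> y \<in> carrier M \<Longrightarrow> h (x \<oplus>\<^bsub>M\<^esub> y) = h x \<oplus>\<^bsub>N\<^esub> h y"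
    "\<And>r x. r \<in> carrier R \<Longrightarrow> x \<in> carrier M \<Longrightarrow> h (r \<odot>\<^bsub>M\<^esub> x) = r \<odot>\<^bsub>N\<^esub> h x"
  shows "h \<in> mod_hom R M N"
  using assms by (auto simp: mod_hom_def)

lemma mod_hom_zero:
  fixes M (structure)
  assumes "module R M" "module R N" "h \<in> mod_hom R M N"
  shows "h \<zero> = \<zero>\<^bsub>N\<^esub>"
proof -
  interpret M: module R M by fact
  interpret N: module R N by fact
  have "h \<zero> = h (\<zero>\<^bsub>R\<^esub> \<odot> \<zero>)" by simp
  also have "\<dots> = \<zero>\<^bsub>R\<^esub> \<odot>\<^bsub>N\<^esub> h \<zero>"
    by (rule mod_hom_smult[OF assms(3)]) auto
  finally show ?thesis using mod_hom_closed[OF assms(3)] by simp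
qed

lemma mod_hom_inv:
  fixes N (structure)
  assumes "module R M" "module R N" "h \<in> mod_hom R M N" "x \<in> carrier M"
  shows "h (\<ominus>\<^bsub>M\<^esub> x) = \<ominus> h x"
proof -
  interpret M: module R M by fact
  interpret N: module R N by fact
  have "h (\<ominus>\<^bsub>M\<^esub> x) \<oplus> h x = \<zero>"
    using assms mod_hom_zero[OF assms(1-3)] by (subst mod_hom_add[OF assms(3), symmetric]) (auto simp: M.l_neg)
  then show ?thesis using mod_hom_closed[OF assms(3)] assms(4) by (simp add: N.minus_equality)
qed

lemma mod_hom_minus:
  assumes "module R M" "module R N" "h \<in> mod_hom R M N" "x \<in> carrier M" "y \<in> carrier M"
  shows "h (x \<ominus>\<^bsub>M\<^esub> y) = h x \<ominus>\<^bsub>N\<^esub> h y"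
proof -
  interpret M: module R M by fact
  interpret N: module R N by fact
  show ?thesis using assms by (simp add: M.minus_eq N.minus_eq mod_hom_add mod_hom_inv)
qed

lemma submodule_finsum:
  assumes "module R M" "submodule K R M" "finite A" "f \<in> A \<rightarrow> K"
  shows "(\<Oplus>\<^bsub>M\<^esub>i\<in>A. f i) \<in> K"
  using assms(3,4)
proof (induct rule: finite_induct)
  interpret M: module R M by fact
  case empty
  then show ?case using submodule_zero[OF assms(2)] by simp
next
  interpret M: module R M by fact
  case (insert x F)
  then have "f \<in> F \<rightarrow> carrier M" "f x \<in> carrier M"
    using submodule_subset[OF assms(2)] by auto
  then show ?case using insert by (simp add: submodule_add[OF assms(2)])
qed

lemma mod_hom_comp:
  "g \<in> mod_hom R N L \<Longrightarrow> h \<in> mod_hom R M N \<Longrightarrow> (\<lambda>x. g (h x)) \<in> mod_hom R M L"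
  by (auto simp: mod_hom_def Pi_iff)

lemma mod_hom_id: "(\<lambda>x. x) \<in> mod_hom R M M"
  by (auto simp: mod_hom_def)

lemma mod_hom_sum:
  assumes "module R N" "g \<in> mod_hom R M N" "h \<in> mod_hom R M N"
  shows "(\<lambda>x. g x \<oplus>\<^bsub>N\<^esub> h x) \<in> mod_hom R M N"
proof -
  interpret N: module R N by fact
  show ?thesis using assms(2,3)
    by (intro mod_homI) (auto simp: mod_hom_add mod_hom_smult mod_hom_closed N.smult_r_distr N.a_ac)
qed

lemma mod_hom_scale:
  assumes "module R N" "g \<in> mod_hom R M N" "a \<in> carrier R"
  shows "(\<lambda>x. a \<odot>\<^bsub>N\<^esub> g x) \<in> mod_hom R M N"
proof -
  interpret N: module R N by fact
  show ?thesis using assms(2,3)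
    apply (intro mod_homI)
      apply (auto simp: mod_hom_add mod_hom_smult mod_hom_closed N.smult_r_distr simp flip: N.smult_assoc1)
    apply (simp add: N.m_comm)
    done
qed

lemma mod_hom_neg:
  assumes "module R N" "g \<in> mod_hom R M N"
  shows "(\<lambda>x. \<ominus>\<^bsub>N\<^esub> g x) \<in> mod_hom R M N"
proof -
  interpret N: module R N by fact
  show ?thesis using assms(2)
    by (intro mod_homI) (auto simp: mod_hom_add mod_hom_smult mod_hom_closed N.smult_r_minus N.minus_add)
qed

lemma mod_hom_diff:
  assumes "module R N" "g \<in> mod_hom R M N" "h \<in> mod_hom R M N"
  shows "(\<lambda>x. g x \<ominus>\<^bsub>N\<^esub> h x) \<in> mod_hom R M N"
proof -
  interpret N: module R N by fact
  show ?thesis unfolding N.minus_eq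
    by (rule mod_hom_sum[OF assms(1,2) mod_hom_neg[OF assms(1,3)]])
qed

lemma mod_hom_zero_map:
  assumes "module R N"
  shows "(\<lambda>x. \<zero>\<^bsub>N\<^esub>) \<in> mod_hom R M N"
proof -
  interpret N: module R N by fact
  show ?thesis by (intro mod_homI) auto
qed

lemma a_kernel_iff: "x \<in> a_kernel M N h \<longleftrightarrow> x \<in> carrier M \<and> h x = \<zero>\<^bsub>N\<^esub>"
  by (auto simp: a_kernel_def kernel_def)

lemma submodule_vimage:
  assumes "module R M" "module R N" "h \<in> mod_hom R M N" "submodule K R N"
  shows "submodule {x \<in> carrier M. h x \<in> K} R M"
proof -
  interpret M: module R M by fact
  show ?thesis
    by (intro submoduleI'[OF assms(1)])
      (auto simp: mod_hom_zero[OF assms(1-3)] mod_hom_add[OF assms(3)] mod_hom_smult[OF assms(3)]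
        submodule_zero[OF assms(4)] submodule_add[OF assms(4)] submodule_smult[OF assms(4)])
qed

lemma submodule_carrier: "module R M \<Longrightarrow> submodule (carrier M) R M"
  by (rule module.carrier_is_submodule)

lemma submodule_trivial:
  assumes "module R M" shows "submodule {\<zero>\<^bsub>M\<^esub>} R M"
proof -
  interpret M: module R M by fact
  show ?thesis by (intro submoduleI'[OF assms]) auto
qed

lemma submodule_a_kernel:
  assumes "module R M" "module R N" "h \<in> mod_hom R M N"
  shows "submodule (a_kernel M N h) R M"
proof -
  have "a_kernel M N h = {x \<in> carrier M. h x \<in> {\<zero>\<^bsub>N\<^esub>}}" by (auto simp: a_kernel_iff)
  then show ?thesis using submodule_vimage[OF assms submodule_trivial[OF assms(2)]] by simp
qed

lemma submodule_image:
  fixes N (structure)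
  assumes "module R M" "module R N" "h \<in> mod_hom R M N" "submodule K R M"
  shows "submodule (h ` K) R N"
proof (rule submoduleI'[OF assms(2)])
  show "h ` K \<subseteq> carrier N" using mod_hom_closed[OF assms(3)] submodule_subset[OF assms(4)] by auto
  show "\<zero> \<in> h ` K" using mod_hom_zero[OF assms(1-3)] submodule_zero[OF assms(4)] by (metis imageI)
next
  fix x y assume "x \<in> h ` K" "y \<in> h ` K"
  then obtain x' y' where "x = h x'" "y = h y'" "x' \<in> K" "y' \<in> K" by blast
  then show "x \<oplus> y \<in> h ` K"
    using mod_hom_add[OF assms(3), of x' y'] submodule_subset[OF assms(4)] submodule_add[OF assms(4)] by (metis imageI)
next
  fix r x assume "r \<in> carrier R" "x \<in> h ` K"
  then obtain x' where "x = h x'" "x' \<in> K" by blast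
  then show "r \<odot> x \<in> h ` K"
    using mod_hom_smult[OF assms(3), of r x'] submodule_subset[OF assms(4)] submodule_smult[OF assms(4)] \<open>r \<in> _\<close> by (metis imageI)
qed

subsection \<open>Restriction of the carrier\<close>

lemma restr_module: "module R M \<Longrightarrow> submodule K R M \<Longrightarrow> module R (M\<lparr>carrier := K\<rparr>)"
  by (rule submodule.submodule_is_module)

lemma restr_simps [simp]: "carrier (M\<lparr>carrier := K\<rparr>) = K" "ring.add (M\<lparr>carrier := K\<rparr>) = ring.add M"
  "ring.zero (M\<lparr>carrier := K\<rparr>) = ring.zero M" "smult (M\<lparr>carrier := K\<rparr>) = smult (M::('a,'b) module)"
  by auto

lemma submodule_restr:
  assumes "module R M" "submodule K R M"
  shows "submodule L R (M\<lparr>carrier := K\<rparr>) \<longleftrightarrow> submodule L R M \<and> L \<subseteq> K"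
proof
  assume L: "submodule L R (M\<lparr>carrier := K\<rparr>)"
  have "L \<subseteq> K" using submodule_subset[OF L] by auto
  moreover have "submodule L R M"
    using submodule_zero[OF L] submodule_add[OF L] submodule_smult[OF L] \<open>L \<subseteq> K\<close> submodule_subset[OF assms(2)]
    by (intro submoduleI'[OF assms(1)]) auto
  ultimately show "submodule L R M \<and> L \<subseteq> K" by simp
next
  assume L: "submodule L R M \<and> L \<subseteq> K"
  then show "submodule L R (M\<lparr>carrier := K\<rparr>)"
    using submodule_zero[of L R M] submodule_add[of L R M] submodule_smult[of L R M]
    by (intro submoduleI'[OF restr_module[OF assms]]) auto
qed

subsection \<open>Cosets\<close>

lemma coset_eq_iff:
  fixes M (structure)
  assumes "module R M" "submodule K R M" "x \<in> carrier M" "y \<in> carrier M"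
  shows "K +> x = K +> y \<longleftrightarrow> x \<ominus> y \<in> K"
proof -
  interpret M: module R M by fact
  interpret K: abelian_subgroup K M
    by (rule abelian_subgroupI3) (use assms in \<open>auto simp: additive_subgroup_def submodule_def intro: M.abelian_group_axioms\<close>)
  show ?thesis using assms K.a_rcos_module[of y x] K.a_repr_independence'[of x y] K.a_rcos_self[of x]
    by (auto simp: M.minus_eq)
qed

lemma coset_self:
  assumes "module R M" "submodule K R M" "x \<in> carrier M"
  shows "x \<in> K +>\<^bsub>M\<^esub> x"
proof -
  interpret M: module R M by fact
  show ?thesis using submodule_zero[OF assms(2)] assms(3) by (auto simp: a_r_coset_def' intro!: bexI[of _ "\<zero>\<^bsub>M\<^esub>"])
qed

lemma coset_zero:
  assumes "module R M" "submodule K R M"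
  shows "K +>\<^bsub>M\<^esub> \<zero>\<^bsub>M\<^esub> = K"
proof -
  interpret M: module R M by fact
  show ?thesis using submodule_subset[OF assms(2)] by (auto simp: a_r_coset_def')
qed

lemma coset_eq_zero_iff:
  fixes M (structure)
  assumes "module R M" "submodule K R M" "x \<in> carrier M"
  shows "K +> x = K \<longleftrightarrow> x \<in> K"
proof -
  interpret M: module R M by fact
  have "x \<ominus> \<zero> = x" using assms by (simp add: M.minus_eq)
  then show ?thesis using coset_eq_iff[OF assms M.zero_closed] coset_zero[OF assms(1,2)] by simp
qed

subsection \<open>Quotients\<close>

lemma quot_carrier: "carrier (quot_module M K) = (\<lambda>x. K +>\<^bsub>M\<^esub> x) ` carrier M"
  by (auto simp: quot_module_def A_RCOSETS_def')

lemma quot_zero: "\<zero>\<^bsub>quot_module M K\<^esub> = K"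
  by (simp add: quot_module_def)

lemma quot_add:
  fixes M (structure)
  assumes "module R M" "submodule K R M" "x \<in> carrier M" "y \<in> carrier M"
  shows "(K +> x) \<oplus>\<^bsub>quot_module M K\<^esub> (K +> y) = K +> (x \<oplus> y)"
proof -
  interpret M: module R M by fact
  interpret K: abelian_subgroup K M
    by (rule abelian_subgroupI3) (use assms in \<open>auto simp: additive_subgroup_def submodule_def intro: M.abelian_group_axioms\<close>)
  show ?thesis using assms K.a_rcos_sum[of x y] by (simp add: quot_module_def)
qed

lemma quot_smult:
  fixes M (structure)
  assumes "module R M" "submodule K R M" "x \<in> carrier M" "r \<in> carrier R"
  shows "r \<odot>\<^bsub>quot_module M K\<^esub> (K +> x) = K +> (r \<odot> x)"
proof -
  interpret M: module R M by fact
  have "K +> (r \<odot> y) = K +> (r \<odot> x)" if y: "y \<in> K +> x" for y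
  proof -
    obtain k where k: "k \<in> K" "y = k \<oplus> x" using y by (auto simp: a_r_coset_def')
    then have kc: "k \<in> carrier M" using submodule_subset[OF assms(2)] by blast
    then have y: "y \<in> carrier M" using k assms by simp
    have "r \<odot> y \<ominus> r \<odot> x = r \<odot> k"
      using k kc assms by (simp add: M.smult_r_distr module_minus_cancel[OF assms(1)])
    then show ?thesis using k assms y submodule_smult[OF assms(2,4)] by (subst coset_eq_iff[OF assms(1,2)]) auto
  qed
  then have "(\<Union>y\<in>K +> x. K +> (r \<odot> y)) = (\<Union>y\<in>K +> x. K +> (r \<odot> x))"
    by (rule SUP_cong[OF refl])
  also have "\<dots> = K +> (r \<odot> x)" using coset_self[OF assms(1-3)] by auto
  finally show ?thesis by (simp add: quot_module_def)
qed

lemma module_of_surjection: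
  fixes M (structure)
  assumes "module R M" and car: "carrier N = h ` carrier M" and zero: "\<zero>\<^bsub>N\<^esub> = h \<zero>"
    and add: "\<And>x y. x \<in> carrier M \<Longrightarrow> y \<in> carrier M \<Longrightarrow> h x \<oplus>\<^bsub>N\<^esub> h y = h (x \<oplus> y)"
    and sm: "\<And>r x. r \<in> carrier R \<Longrightarrow> x \<in> carrier M \<Longrightarrow> r \<odot>\<^bsub>N\<^esub> h x = h (r \<odot> x)"
  shows "module R N"
proof -
  interpret M: module R M by fact
  show ?thesis
  proof (rule moduleI[OF M.R.is_cring])
    show "abelian_group N"
    proof (rule abelian_groupI)
      show "\<exists>y\<in>carrier N. y \<oplus>\<^bsub>N\<^esub> x = \<zero>\<^bsub>N\<^esub>" if x: "x \<in> carrier N" for x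
      proof -
        obtain x' where x': "x' \<in> carrier M" "x = h x'" using x car by auto
        then have "h (\<ominus> x') \<oplus>\<^bsub>N\<^esub> x = \<zero>\<^bsub>N\<^esub>" by (simp add: add zero M.l_neg)
        then show ?thesis using x' car by auto
      qed
    qed (auto simp: car add zero M.a_ac)
  qed (auto simp: car sm add M.smult_l_distr M.smult_r_distr M.smult_assoc1)
qed

lemma quot_is_module:
  fixes M (structure)
  assumes "module R M" "submodule K R M"
  shows "module R (quot_module M K)"
  by (rule module_of_surjection[where h = "\<lambda>x. K +> x", OF assms(1) quot_carrier])
    (simp_all add: quot_zero coset_zero[OF assms] quot_add[OF assms] quot_smult[OF assms])

lemma quot_proj_hom:
  assumes "module R M" "submodule K R M"
  shows "(\<lambda>x. K +>\<^bsub>M\<^esub> x) \<in> mod_hom R M (quot_module M K)"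
  by (intro mod_homI) (auto simp: quot_carrier quot_add[OF assms] quot_smult[OF assms])

lemma quot_lift:
  fixes M (structure)
  assumes "module R M" "submodule K R M" "module R N" "h \<in> mod_hom R M N" "\<And>x. x \<in> K \<Longrightarrow> h x = \<zero>\<^bsub>N\<^esub>"
  shows "(\<lambda>T. the_elem (h ` T)) \<in> mod_hom R (quot_module M K) N"
    and "x \<in> carrier M \<Longrightarrow> the_elem (h ` (K +> x)) = h x"
proof -
  interpret M: module R M by fact
  interpret N: module R N by fact
  show *: "the_elem (h ` (K +> x)) = h x" if x: "x \<in> carrier M" for x
  proof -
    have "h y = h x" if y: "y \<in> K +> x" for y
    proof -
      obtain k where k: "k \<in> K" "y = k \<oplus> x" using y by (auto simp: a_r_coset_def')
      then show ?thesis using x submodule_subset[OF assms(2)] assms(4,5) by (simp add: mod_hom_add mod_hom_closed)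
    qed
    then have "h ` (K +> x) = {h x}" using coset_self[OF assms(1,2) x] by blast
    then show ?thesis by simp
  qed
  show "(\<lambda>T. the_elem (h ` T)) \<in> mod_hom R (quot_module M K) N"
    using assms(4) by (intro mod_homI) (auto simp: quot_carrier quot_add[OF assms(1,2)] quot_smult[OF assms(1,2)] *
       mod_hom_add mod_hom_closed mod_hom_smult)
qed

subsection \<open>Spans\<close>

lemma span_submodule:
  fixes M (structure)
  assumes "module R M" "A \<subseteq> carrier M"
  shows "submodule (submodule_span R M A) R M"
proof -
  have c: "submodule (carrier M) R M" by (rule submodule_carrier) fact
  show ?thesis unfolding submodule_span_def
  proof (rule submoduleI'[OF assms(1)])
    show "\<Inter> {K. submodule K R M \<and> A \<subseteq> K} \<subseteq> carrier M" using c assms(2) by blast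
    show "\<zero> \<in> \<Inter> {K. submodule K R M \<and> A \<subseteq> K}" using submodule_zero by auto
  next
    fix x y assume "x \<in> \<Inter> {K. submodule K R M \<and> A \<subseteq> K}" "y \<in> \<Inter> {K. submodule K R M \<and> A \<subseteq> K}"
    then show "x \<oplus> y \<in> \<Inter> {K. submodule K R M \<and> A \<subseteq> K}"
      by (simp add: submodule_add[of _ R M])
  next
    fix r x assume "r \<in> carrier R" "x \<in> \<Inter> {K. submodule K R M \<and> A \<subseteq> K}"
    then show "r \<odot> x \<in> \<Inter> {K. submodule K R M \<and> A \<subseteq> K}"
      by (simp add: submodule_smult[of _ R M])
  qed
qed

lemma span_superset: "A \<subseteq> submodule_span R M A"
  by (auto simp: submodule_span_def)

lemma span_least: "submodule K R M \<Longrightarrow> A \<subseteq> K \<Longrightarrow> submodule_span R M A \<subseteq> K"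
  by (auto simp: submodule_span_def)

lemma span_mono: "A \<subseteq> B \<Longrightarrow> submodule_span R M A \<subseteq> submodule_span R M B"
  unfolding submodule_span_def by blast

lemma hom_eq_on_span:
  assumes "module R M" "module R N" "g \<in> mod_hom R M N" "h \<in> mod_hom R M N"
    "\<And>x. x \<in> A \<Longrightarrow> g x = h x" "A \<subseteq> carrier M" "x \<in> submodule_span R M A"
  shows "g x = h x"
proof -
  interpret M: module R M by fact
  interpret N: module R N by fact
  have "submodule {x \<in> carrier M. g x = h x} R M"
    using assms(3,4) mod_hom_zero[OF assms(1,2,3)] mod_hom_zero[OF assms(1,2,4)]
    by (intro submoduleI'[OF assms(1)]) (auto simp: mod_hom_add mod_hom_smult)
  from span_least[OF this, of A] assms(5-7) show ?thesis by auto
qed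

definition submodule_sum :: "('a, 'b) module \<Rightarrow> 'b set \<Rightarrow> 'b set \<Rightarrow> 'b set" where
  "submodule_sum M K L = {x \<oplus>\<^bsub>M\<^esub> y | x y. x \<in> K \<and> y \<in> L}"

lemma sum_submodule:
  fixes M (structure)
  assumes "module R M" "submodule K R M" "submodule L R M"
  shows "submodule (submodule_sum M K L) R M"
proof -
  interpret M: module R M by fact
  note K = submodule_subset[OF assms(2)] and L = submodule_subset[OF assms(3)]
  show ?thesis
  proof (rule submoduleI'[OF assms(1)])
    show "submodule_sum M K L \<subseteq> carrier M" unfolding submodule_sum_def using K L by auto
    have "\<zero> = \<zero> \<oplus> \<zero>" by simp
    then show "\<zero> \<in> submodule_sum M K L"
      unfolding submodule_sum_def using submodule_zero[OF assms(2)] submodule_zero[OF assms(3)] by blast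
  next
    fix x y assume "x \<in> submodule_sum M K L" "y \<in> submodule_sum M K L"
    then obtain a b c d where *: "x = a \<oplus> b" "y = c \<oplus> d" "a \<in> K" "c \<in> K" "b \<in> L" "d \<in> L"
      by (auto simp: submodule_sum_def)
    moreover have "x \<oplus> y = (a \<oplus> c) \<oplus> (b \<oplus> d)"
      using * K[of a] K[of c] L[of b] L[of d] by (simp add: M.a_ac)
    ultimately show "x \<oplus> y \<in> submodule_sum M K L"
      unfolding submodule_sum_def using submodule_add[OF assms(2)] submodule_add[OF assms(3)] by blast
  next
    fix r x assume r: "r \<in> carrier R" "x \<in> submodule_sum M K L"
    then obtain a b where *: "x = a \<oplus> b" "a \<in> K" "b \<in> L" by (auto simp: submodule_sum_def)
    then have "r \<odot> x = r \<odot> a \<oplus> r \<odot> b" using K L r by (simp add: M.smult_r_distr)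
    then show "r \<odot> x \<in> submodule_sum M K L" unfolding submodule_sum_def
      using * r submodule_smult[OF assms(2)] submodule_smult[OF assms(3)] by blast
  qed
qed

lemma sum_upper:
  fixes M (structure)
  assumes "module R M" "submodule K R M" "submodule L R M"
  shows "K \<subseteq> submodule_sum M K L" "L \<subseteq> submodule_sum M K L"
proof -
  interpret M: module R M by fact
  have "x = x \<oplus> \<zero>" if "x \<in> K" for x using that submodule_subset[OF assms(2)] by simp
  then show "K \<subseteq> submodule_sum M K L" unfolding submodule_sum_def using submodule_zero[OF assms(3)] by blast
  have "x = \<zero> \<oplus> x" if "x \<in> L" for x using that submodule_subset[OF assms(3)] by simp
  then show "L \<subseteq> submodule_sum M K L" unfolding submodule_sum_def using submodule_zero[OF assms(2)] by blast
qed

lemma sum_least: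
  "submodule N R M \<Longrightarrow> K \<subseteq> N \<Longrightarrow> L \<subseteq> N \<Longrightarrow> submodule_sum M K L \<subseteq> N"
  unfolding submodule_sum_def using submodule_add[of N R M] by auto

lemma submodule_sum_mono: "K \<subseteq> K' \<Longrightarrow> L \<subseteq> L' \<Longrightarrow> submodule_sum M K L \<subseteq> submodule_sum M K' L'"
  unfolding submodule_sum_def by blast

section \<open>Free and projective modules\<close>

lemma free_simps:
  "\<zero>\<^bsub>free_module R T\<^esub> = (\<lambda>x. \<zero>\<^bsub>R\<^esub>)"
  "c \<oplus>\<^bsub>free_module R T\<^esub> d = (\<lambda>x. c x \<oplus>\<^bsub>R\<^esub> d x)"
  "r \<odot>\<^bsub>free_module R T\<^esub> c = (\<lambda>x. r \<otimes>\<^bsub>R\<^esub> c x)"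
  by (simp_all add: free_module_def)

lemma free_mem_iff:
  "c \<in> carrier (free_module R T) \<longleftrightarrow> (\<forall>x\<in>T. c x \<in> carrier R) \<and> (\<forall>x. x \<notin> T \<longrightarrow> c x = \<zero>\<^bsub>R\<^esub>) \<and> finite {x. c x \<noteq> \<zero>\<^bsub>R\<^esub>}"
  by (simp add: free_module_def)

lemma free_mem_finite_iff:
  "finite T \<Longrightarrow> c \<in> carrier (free_module R T) \<longleftrightarrow> (\<forall>x\<in>T. c x \<in> carrier R) \<and> (\<forall>x. x \<notin> T \<longrightarrow> c x = \<zero>\<^bsub>R\<^esub>)"
  unfolding free_mem_iff by (auto intro: finite_subset[of _ T])

lemma free_mem_closed: "cring R \<Longrightarrow> c \<in> carrier (free_module R T) \<Longrightarrow> c x \<in> carrier R"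
proof -
  assume "cring R" and c: "c \<in> carrier (free_module R T)"
  interpret cring R by fact
  show "c x \<in> carrier R" using c by (cases "x \<in> T") (auto simp: free_mem_iff)
qed

lemma free_mem_off: "c \<in> carrier (free_module R T) \<Longrightarrow> x \<notin> T \<Longrightarrow> c x = \<zero>\<^bsub>R\<^esub>"
  by (simp add: free_mem_iff)

lemma free_mem_support: "c \<in> carrier (free_module R T) \<Longrightarrow> finite {x. c x \<noteq> \<zero>\<^bsub>R\<^esub>}"
  by (simp add: free_mem_iff)

lemma free_is_module:
  fixes R (structure)
  assumes "cring R"
  shows "module R (free_module R T)"
proof -
  interpret cring R by fact
  let ?F = "free_module R T"
  have add: "(\<lambda>x. c x \<oplus> d x) \<in> carrier ?F" if "c \<in> carrier ?F" "d \<in> carrier ?F" for c d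
  proof -
    have "{x. c x \<oplus> d x \<noteq> \<zero>} \<subseteq> {x. c x \<noteq> \<zero>} \<union> {x. d x \<noteq> \<zero>}" by auto
    then have "finite {x. c x \<oplus> d x \<noteq> \<zero>}"
      using that by (auto simp: free_mem_iff intro: finite_subset)
    then show ?thesis using that by (simp add: free_mem_iff)
  qed
  have sm: "(\<lambda>x. r \<otimes> c x) \<in> carrier ?F" if "r \<in> carrier R" "c \<in> carrier ?F" for c r
  proof -
    have "{x. r \<otimes> c x \<noteq> \<zero>} \<subseteq> {x. c x \<noteq> \<zero>}" using that by auto
    then have "finite {x. r \<otimes> c x \<noteq> \<zero>}"
      using that by (auto simp: free_mem_iff intro: finite_subset)
    then show ?thesis using that by (simp add: free_mem_iff)
  qed
  note [simp] = free_mem_closed[OF assms, of _ T]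
  show ?thesis
  proof (rule moduleI)
    show "cring R" by fact
    show "abelian_group ?F"
    proof (rule abelian_groupI)
      show "\<zero>\<^bsub>?F\<^esub> \<in> carrier ?F" by (simp add: free_simps free_mem_iff)
      show "\<exists>d\<in>carrier ?F. d \<oplus>\<^bsub>?F\<^esub> c = \<zero>\<^bsub>?F\<^esub>" if "c \<in> carrier ?F" for c
        using that sm[of "\<ominus> \<one>" c]
        by (intro bexI[of _ "\<lambda>x. (\<ominus> \<one>) \<otimes> c x"]) (auto simp: free_simps l_minus l_neg)
    qed (auto simp: free_simps add a_ac)
  qed (auto simp: free_simps sm l_distr r_distr m_assoc)
qed

lemma free_basis_closed:
  assumes "cring R" "x \<in> T"
  shows "free_basis R x \<in> carrier (free_module R T)"
proof -
  interpret cring R by fact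
  have "{y. free_basis R x y \<noteq> \<zero>\<^bsub>R\<^esub>} \<subseteq> {x}" by (auto simp: free_basis_def)
  then have "finite {y. free_basis R x y \<noteq> \<zero>\<^bsub>R\<^esub>}" using finite_subset by blast
  then show ?thesis using assms by (auto simp: free_mem_iff free_basis_def)
qed

lemma free_subset:
  assumes "T \<subseteq> T'" "cring R" "c \<in> carrier (free_module R T)"
  shows "c \<in> carrier (free_module R T')"
  using assms(1,3) free_mem_closed[OF assms(2,3)] unfolding free_mem_iff by auto

lemma free_generated:
  fixes R (structure)
  assumes "cring R" "submodule K R (free_module R T)" "\<And>x. x \<in> T \<Longrightarrow> free_basis R x \<in> K"
    and c: "c \<in> carrier (free_module R T)"
  shows "c \<in> K"
proof -
  interpret cring R by fact
  have "\<forall>c\<in>carrier (free_module R T). {x. c x \<noteq> \<zero>} \<subseteq> A \<longrightarrow> c \<in> K" if "finite A" for A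
    using that
  proof induct
    case empty
    show ?case
    proof (intro ballI impI)
      fix c assume "c \<in> carrier (free_module R T)" "{x. c x \<noteq> \<zero>} \<subseteq> {}"
      then have "c = \<zero>\<^bsub>free_module R T\<^esub>" by (auto simp: free_simps)
      then show "c \<in> K" using submodule_zero[OF assms(2)] by simp
    qed
  next
    case (insert x A)
    show ?case
    proof (intro ballI impI)
      fix c assume c: "c \<in> carrier (free_module R T)" "{x. c x \<noteq> \<zero>} \<subseteq> insert x A"
      show "c \<in> K"
      proof (cases "x \<in> T")
        case True
        have "finite {y. (c(x := \<zero>)) y \<noteq> \<zero>}"
          by (rule finite_subset[OF _ free_mem_support[OF c(1)]]) auto
        then have "c(x := \<zero>) \<in> carrier (free_module R T)"
          using c(1) by (auto simp: free_mem_iff)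
        moreover have "{y. (c(x := \<zero>)) y \<noteq> \<zero>} \<subseteq> A" using c(2) by auto
        ultimately have 1: "c(x := \<zero>) \<in> K" using insert(3) by blast
        have "c = c(x := \<zero>) \<oplus>\<^bsub>free_module R T\<^esub> (c x \<odot>\<^bsub>free_module R T\<^esub> free_basis R x)"
          using free_mem_closed[OF assms(1) c(1)] by (auto simp: free_simps free_basis_def)
        also have "\<dots> \<in> K" using 1 assms(3)[OF True] free_mem_closed[OF assms(1) c(1)]
          by (intro submodule_add[OF assms(2)] submodule_smult[OF assms(2)])
        finally show ?thesis .
      next
        case False
        then have "{x. c x \<noteq> \<zero>} \<subseteq> A" using c free_mem_off[OF c(1)] by auto
        then show ?thesis using insert(3) c(1) by auto
      qed
    qed
  qed
  from this[OF free_mem_support[OF c]] show ?thesis using c by auto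
qed

lemma hom_eq_free:
  assumes "cring R" "module R M" "g \<in> mod_hom R (free_module R T) M" "h \<in> mod_hom R (free_module R T) M"
    "\<And>x. x \<in> T \<Longrightarrow> g (free_basis R x) = h (free_basis R x)" "c \<in> carrier (free_module R T)"
  shows "g c = h c"
proof -
  note F = free_is_module[OF assms(1), of T]
  have B: "free_basis R ` T \<subseteq> carrier (free_module R T)" using free_basis_closed[OF assms(1)] by auto
  note S = span_submodule[OF F B]
  have "c \<in> submodule_span R (free_module R T) (free_basis R ` T)"
    by (rule free_generated[OF assms(1) S _ assms(6)]) (rule subsetD[OF span_superset imageI])
  from hom_eq_on_span[OF F assms(2-4) _ B this] show ?thesis using assms(5) by auto
qed

lemma free_lift_superset:
  fixes M (structure)
  assumes "module R M" "g \<in> A \<rightarrow> carrier M" "finite A" "{x. c x \<noteq> \<zero>\<^bsub>R\<^esub>} \<subseteq> A" "\<And>x. x \<in> A \<Longrightarrow> c x \<in> carrier R"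
  shows "free_lift R M g c = (\<Oplus>x\<in>A. c x \<odot> g x)"
proof -
  interpret M: module R M by fact
  have "c x \<odot> g x = \<zero>" if "x \<in> A - {x. c x \<noteq> \<zero>\<^bsub>R\<^esub>}" for x
    using that assms(2) by (auto simp: Pi_iff)
  then show ?thesis unfolding free_lift_def using assms
    by (intro M.add.finprod_mono_neutral_cong_left) auto
qed

lemma free_lift_hom:
  fixes M (structure)
  assumes "module R M" "g \<in> T \<rightarrow> carrier M"
  shows "free_lift R M g \<in> mod_hom R (free_module R T) M"
proof -
  interpret M: module R M by fact
  have cr: "cring R" by (rule M.R.is_cring)
  interpret F: module R "free_module R T" by (rule free_is_module[OF cr])
  note cl = free_mem_closed[OF cr]
  have sup: "{x. c x \<noteq> \<zero>\<^bsub>R\<^esub>} \<subseteq> T" if "c \<in> carrier (free_module R T)" for c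
    using that by (auto simp: free_mem_iff)
  show ?thesis
  proof (rule mod_homI)
    fix c assume c: "c \<in> carrier (free_module R T)"
    show "free_lift R M g c \<in> carrier M"
      unfolding free_lift_def using assms(2) sup[OF c] cl[OF c] by (intro M.M.finsum_closed) auto
    fix d assume d: "d \<in> carrier (free_module R T)"
    let ?A = "{x. c x \<noteq> \<zero>\<^bsub>R\<^esub>} \<union> {x. d x \<noteq> \<zero>\<^bsub>R\<^esub>}"
    have A: "finite ?A" "?A \<subseteq> T" using sup[OF c] sup[OF d] free_mem_support[OF c] free_mem_support[OF d] by auto
    have g: "g \<in> ?A \<rightarrow> carrier M" using A assms(2) by auto
    have "free_lift R M g (c \<oplus>\<^bsub>free_module R T\<^esub> d) = (\<Oplus>x\<in>?A. (c x \<oplus>\<^bsub>R\<^esub> d x) \<odot> g x)"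
      by (subst free_lift_superset[OF assms(1) g A(1)]) (auto simp: free_simps cl[OF c] cl[OF d])
    also have "\<dots> = (\<Oplus>x\<in>?A. c x \<odot> g x \<oplus> d x \<odot> g x)"
      using cl[OF c] cl[OF d] g by (intro M.M.finsum_cong') (auto simp: M.smult_l_distr Pi_iff)
    also have "\<dots> = (\<Oplus>x\<in>?A. c x \<odot> g x) \<oplus> (\<Oplus>x\<in>?A. d x \<odot> g x)"
      using cl[OF c] cl[OF d] g by (intro M.M.finsum_addf) (auto simp: Pi_iff)
    also have "\<dots> = free_lift R M g c \<oplus> free_lift R M g d"
      using cl[OF c] cl[OF d] by (subst (1 2) free_lift_superset[OF assms(1) g A(1)]) auto
    finally show "free_lift R M g (c \<oplus>\<^bsub>free_module R T\<^esub> d) = free_lift R M g c \<oplus> free_lift R M g d" .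
  next
    fix r c assume r: "r \<in> carrier R" and c: "c \<in> carrier (free_module R T)"
    let ?A = "{x. c x \<noteq> \<zero>\<^bsub>R\<^esub>}"
    have A: "finite ?A" "?A \<subseteq> T" using sup[OF c] free_mem_support[OF c] by auto
    have g: "g \<in> ?A \<rightarrow> carrier M" using A assms(2) by auto
    have "free_lift R M g (r \<odot>\<^bsub>free_module R T\<^esub> c) = (\<Oplus>x\<in>?A. (r \<otimes>\<^bsub>R\<^esub> c x) \<odot> g x)"
      using r by (subst free_lift_superset[OF assms(1) g A(1)]) (auto simp: free_simps cl[OF c])
    also have "\<dots> = (\<Oplus>x\<in>?A. r \<odot> (c x \<odot> g x))"
      using cl[OF c] r g by (intro M.M.finsum_cong') (auto simp: M.smult_assoc1 Pi_iff)
    also have "\<dots> = r \<odot> free_lift R M g c" unfolding free_lift_def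
      using cl[OF c] r g A by (intro M.finsum_smult_ldistr[symmetric]) (auto simp: Pi_iff)
    finally show "free_lift R M g (r \<odot>\<^bsub>free_module R T\<^esub> c) = r \<odot> free_lift R M g c" .
  qed
qed

lemma free_lift_basis:
  assumes "module R M" "g x \<in> carrier M"
  shows "free_lift R M g (free_basis R x) = g x"
proof -
  interpret M: module R M by fact
  have "free_lift R M g (free_basis R x) = (\<Oplus>\<^bsub>M\<^esub>y\<in>{x}. free_basis R x y \<odot>\<^bsub>M\<^esub> g y)"
    using assms by (intro free_lift_superset[OF assms(1)]) (auto simp: free_basis_def)
  also have "\<dots> = g x" using assms by (subst M.M.finsum_insert) (auto simp: free_basis_def)
  finally show ?thesis .
qed

lemma hom_eq_free_lift:
  assumes "cring R" "module R M" "h \<in> mod_hom R (free_module R T) M" "c \<in> carrier (free_module R T)"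
    "\<And>x. x \<in> T \<Longrightarrow> h (free_basis R x) = g x"
  shows "h c = free_lift R M g c"
proof (rule hom_eq_free[OF assms(1-3) _ _ assms(4)])
  have g: "g x \<in> carrier M" if "x \<in> T" for x
    using mod_hom_closed[OF assms(3) free_basis_closed[OF assms(1) that]] assms(5)[OF that] by simp
  then show "free_lift R M g \<in> mod_hom R (free_module R T) M" by (intro free_lift_hom[OF assms(2)]) auto
  show "h (free_basis R x) = free_lift R M g (free_basis R x)" if "x \<in> T" for x
    using g[OF that] assms(5)[OF that] by (simp add: free_lift_basis[OF assms(2)])
qed

lemma free_lift_in_submodule:
  assumes "module R M" "submodule K R M" "g \<in> T \<rightarrow> K" "c \<in> carrier (free_module R T)"
  shows "free_lift R M g c \<in> K"
proof -
  interpret M: module R M by fact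
  have "{x. c x \<noteq> \<zero>\<^bsub>R\<^esub>} \<subseteq> T" using assms(4) by (auto simp: free_mem_iff)
  then show ?thesis unfolding free_lift_def
    using assms(3) free_mem_closed[OF M.R.is_cring assms(4)]
    by (intro submodule_finsum[OF assms(1,2) free_mem_support[OF assms(4)]])
       (auto intro!: submodule_smult[OF assms(2)])
qed

lemma free_lift_image:
  assumes "module R M" "g \<in> T \<rightarrow> carrier M"
  shows "free_lift R M g ` carrier (free_module R T) = submodule_span R M (g ` T)"
proof
  interpret M: module R M by fact
  have cr: "cring R" by (rule M.R.is_cring)
  have gT: "g ` T \<subseteq> carrier M" using assms(2) by auto
  have "g \<in> T \<rightarrow> submodule_span R M (g ` T)" using span_superset[of "g ` T" R M] by auto
  from free_lift_in_submodule[OF assms(1) span_submodule[OF assms(1) gT] this]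
  show "free_lift R M g ` carrier (free_module R T) \<subseteq> submodule_span R M (g ` T)" by auto
  have "g ` T \<subseteq> free_lift R M g ` carrier (free_module R T)"
  proof
    fix y assume "y \<in> g ` T"
    then obtain x where x: "x \<in> T" "y = g x" by blast
    moreover have "g x \<in> carrier M" using assms(2) x by auto
    ultimately have "y = free_lift R M g (free_basis R x)" using free_lift_basis[OF assms(1), of g x] by simp
    then show "y \<in> free_lift R M g ` carrier (free_module R T)" using free_basis_closed[OF cr x(1)] by (rule image_eqI)
  qed
  then show "submodule_span R M (g ` T) \<subseteq> free_lift R M g ` carrier (free_module R T)"
    by (intro span_least submodule_image[OF free_is_module[OF cr] assms(1) free_lift_hom[OF assms]]
        submodule_carrier[OF free_is_module[OF cr]])
qed

text
  \<open>The defining lifting property only tests modules of bounded size, but it splits the surjection from the free module on the carrier of \<open>P\<close>; a retract of a free module lifts along every map.\<close>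
lemma projective_lift:
  assumes "projective_module R P" "module R U" "module R Y" "g \<in> mod_hom R U Y" "h \<in> mod_hom R P Y"
    "\<And>x. x \<in> carrier P \<Longrightarrow> h x \<in> g ` carrier U"
  shows "\<exists>h'\<in>mod_hom R P U. \<forall>x\<in>carrier P. g (h' x) = h x"
proof -
  have P: "module R P" using assms(1) by (simp add: projective_module_def)
  interpret P: module R P by fact
  have cr: "cring R" by (rule P.R.is_cring)
  let ?F = "free_module R (carrier P)"
  have F: "module R ?F" by (rule free_is_module[OF cr])
  let ?\<pi> = "free_lift R P (\<lambda>x. x)"
  have pi: "?\<pi> \<in> mod_hom R ?F P" by (rule free_lift_hom[OF P]) auto
  have pb: "?\<pi> (free_basis R x) = x" if "x \<in> carrier P" for x using that by (rule free_lift_basis[OF P])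
  have onto: "?\<pi> ` carrier ?F = carrier P"
    using mod_hom_closed[OF pi] pb free_basis_closed[OF cr, of _ "carrier P"] by (force simp: image_iff)
  obtain s where s: "s \<in> mod_hom R P ?F" "\<And>x. x \<in> carrier P \<Longrightarrow> ?\<pi> (s x) = x"
    using assms(1) F P pi onto mod_hom_id unfolding projective_module_def by blast
  have "\<forall>x\<in>carrier P. \<exists>y. y \<in> carrier U \<and> g y = h x" using assms(6) by (auto simp: image_iff) metis
  then obtain k where k: "\<And>x. x \<in> carrier P \<Longrightarrow> k x \<in> carrier U" "\<And>x. x \<in> carrier P \<Longrightarrow> g (k x) = h x"
    by (metis bchoice)
  let ?L = "free_lift R U k"
  have L: "?L \<in> mod_hom R ?F U" using k by (intro free_lift_hom[OF assms(2)]) auto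
  have "g (?L c) = h (?\<pi> c)" if "c \<in> carrier ?F" for c
    using k pb by (intro hom_eq_free[OF cr assms(3) mod_hom_comp[OF assms(4) L] mod_hom_comp[OF assms(5) pi] _ that])
      (simp add: free_lift_basis[OF assms(2)])
  then show ?thesis using s mod_hom_closed[OF s(1)] by (intro bexI[OF _ mod_hom_comp[OF L s(1)]]) auto
qed

lemma free_projective:
  assumes "cring R"
  shows "projective_module R (free_module R T)"
  unfolding projective_module_def
proof (intro conjI allI impI free_is_module[OF assms])
  fix A :: "('a, ('c \<Rightarrow> 'a) \<Rightarrow> 'a) module" and B :: "('a, 'c \<Rightarrow> 'a) module" and g h
  assume *: "module R A \<and> module R B \<and> g \<in> mod_hom R A B \<and> g ` carrier A = carrier B \<and> h \<in> mod_hom R (free_module R T) B"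
  have "h (free_basis R x) \<in> g ` carrier A" if "x \<in> T" for x :: 'c
    using * mod_hom_closed[of h R "free_module R T" B, OF _ free_basis_closed[OF assms that]] by simp
  then have "\<forall>x\<in>T. \<exists>y. y \<in> carrier A \<and> g y = h (free_basis R x)" by (auto simp: image_iff) metis
  then obtain k where k: "\<And>x. x \<in> T \<Longrightarrow> k x \<in> carrier A" "\<And>x. x \<in> T \<Longrightarrow> g (k x) = h (free_basis R x)"
    by (metis bchoice)
  let ?L = "free_lift R A k"
  have L: "?L \<in> mod_hom R (free_module R T) A" using k * by (intro free_lift_hom) auto
  have "g (?L c) = h c" if "c \<in> carrier (free_module R T)" for c
  proof (rule hom_eq_free[OF assms _ mod_hom_comp[OF _ L] _ _ that])
    show "g (?L (free_basis R x)) = h (free_basis R x)" if "x \<in> T" for x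
      using * k[OF that] by (simp add: free_lift_basis)
  qed (use * in auto)
  then show "\<exists>h'\<in>mod_hom R (free_module R T) A. \<forall>x\<in>carrier (free_module R T). g (h' x) = h x"
    using L by blast
qed

section \<open>Tensor products\<close>

context
  fixes R :: "('a, 'r) ring_scheme" and S :: "('s, 't) ring_scheme" and \<phi> :: "'a \<Rightarrow> 's"
    and M :: "('a, 'b) module" and N :: "('s, 'c) module"
  assumes M: "module R M" and N: "module S N" and phi: "\<phi> \<in> carrier R \<rightarrow> carrier S"
begin

interpretation M: module R M by (rule M)
interpretation N: module S N by (rule N)

private abbreviation "F \<equiv> free_module S (carrier M \<times> carrier N)"
private abbreviation "T \<equiv> tensor_over R S \<phi> M N"
private abbreviation "K \<equiv> tensor_kernel R S \<phi> M N"
private abbreviation "pt \<equiv> pure_tensor R S \<phi> M N"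
private abbreviation "e \<equiv> free_basis S"

private lemma F: "module S F" by (rule free_is_module[OF N.R.is_cring])

interpretation F: module S F by (rule F)

private lemma e: "x \<in> carrier M \<Longrightarrow> y \<in> carrier N \<Longrightarrow> e (x, y) \<in> carrier F"
  by (rule free_basis_closed[OF N.R.is_cring]) auto

private lemma rel: "tensor_relations R S \<phi> M N \<subseteq> carrier F"
  unfolding tensor_relations_def Let_def using phi e by (auto simp: Pi_iff)

private lemma K: "submodule K S F"
  unfolding tensor_kernel_def by (rule span_submodule[OF F rel])

lemma tensor_is_module: "module S T"
  unfolding tensor_over_def by (rule quot_is_module[OF F K])

lemma pure_closed: "x \<in> carrier M \<Longrightarrow> y \<in> carrier N \<Longrightarrow> pt (x, y) \<in> carrier T"
  unfolding tensor_over_def pure_tensor_def quot_carrier using e by auto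

private lemma relI: "a \<ominus>\<^bsub>F\<^esub> b \<in> tensor_relations R S \<phi> M N \<Longrightarrow> a \<in> carrier F \<Longrightarrow> b \<in> carrier F \<Longrightarrow> K +>\<^bsub>F\<^esub> a = K +>\<^bsub>F\<^esub> b"
  using span_superset[of "tensor_relations R S \<phi> M N" S F]
  by (subst coset_eq_iff[OF F K]) (auto simp: tensor_kernel_def)

lemma pure_add_left:
  assumes "x \<in> carrier M" "x' \<in> carrier M" "y \<in> carrier N"
  shows "pt (x \<oplus>\<^bsub>M\<^esub> x', y) = pt (x, y) \<oplus>\<^bsub>T\<^esub> pt (x', y)"
proof -
  have "pt (x \<oplus>\<^bsub>M\<^esub> x', y) = K +>\<^bsub>F\<^esub> (e (x, y) \<oplus>\<^bsub>F\<^esub> e (x', y))" unfolding pure_tensor_def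
    by (rule relI) (use assms e in \<open>auto simp: tensor_relations_def Let_def\<close>)
  then show ?thesis unfolding tensor_over_def pure_tensor_def using assms e by (simp add: quot_add[OF F K])
qed

lemma pure_add_right:
  assumes "x \<in> carrier M" "y' \<in> carrier N" "y \<in> carrier N"
  shows "pt (x, y \<oplus>\<^bsub>N\<^esub> y') = pt (x, y) \<oplus>\<^bsub>T\<^esub> pt (x, y')"
proof -
  have "pt (x, y \<oplus>\<^bsub>N\<^esub> y') = K +>\<^bsub>F\<^esub> (e (x, y) \<oplus>\<^bsub>F\<^esub> e (x, y'))" unfolding pure_tensor_def
    by (rule relI) (use assms e in \<open>auto simp: tensor_relations_def Let_def\<close>)
  then show ?thesis unfolding tensor_over_def pure_tensor_def using assms e by (simp add: quot_add[OF F K])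
qed

lemma pure_balanced:
  assumes "x \<in> carrier M" "r \<in> carrier R" "y \<in> carrier N"
  shows "pt (r \<odot>\<^bsub>M\<^esub> x, y) = pt (x, \<phi> r \<odot>\<^bsub>N\<^esub> y)"
  unfolding pure_tensor_def
proof (rule relI)
  show "e (r \<odot>\<^bsub>M\<^esub> x, y) \<ominus>\<^bsub>F\<^esub> e (x, \<phi> r \<odot>\<^bsub>N\<^esub> y) \<in> tensor_relations R S \<phi> M N"
    unfolding tensor_relations_def Let_def using assms by blast
qed (use assms e phi in \<open>auto simp: Pi_iff\<close>)

lemma pure_smult:
  assumes "x \<in> carrier M" "s \<in> carrier S" "y \<in> carrier N"
  shows "pt (x, s \<odot>\<^bsub>N\<^esub> y) = s \<odot>\<^bsub>T\<^esub> pt (x, y)"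
proof -
  have "pt (x, s \<odot>\<^bsub>N\<^esub> y) = K +>\<^bsub>F\<^esub> (s \<odot>\<^bsub>F\<^esub> e (x, y))" unfolding pure_tensor_def
    by (rule relI) (use assms e in \<open>auto simp: tensor_relations_def Let_def\<close>)
  then show ?thesis unfolding tensor_over_def pure_tensor_def using assms e by (simp add: quot_smult[OF F K])
qed

lemma tensor_generated:
  assumes "submodule L S T" "\<And>x y. x \<in> carrier M \<Longrightarrow> y \<in> carrier N \<Longrightarrow> pt (x, y) \<in> L" "z \<in> carrier T"
  shows "z \<in> L"
proof -
  obtain c where c: "c \<in> carrier F" "z = K +>\<^bsub>F\<^esub> c" using assms(3) by (auto simp: tensor_over_def quot_carrier)
  have pr: "(\<lambda>x. K +>\<^bsub>F\<^esub> x) \<in> mod_hom S F T" unfolding tensor_over_def by (rule quot_proj_hom[OF F K])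
  have "submodule {c \<in> carrier F. K +>\<^bsub>F\<^esub> c \<in> L} S F"
    by (rule submodule_vimage[OF F tensor_is_module pr assms(1)])
  from free_generated[OF N.R.is_cring this _ c(1)] show ?thesis
    using assms(2) c(2) e by (auto simp: pure_tensor_def)
qed

lemma hom_eq_tensor:
  assumes "module S Q" "g \<in> mod_hom S T Q" "h \<in> mod_hom S T Q"
    "\<And>x y. x \<in> carrier M \<Longrightarrow> y \<in> carrier N \<Longrightarrow> g (pt (x, y)) = h (pt (x, y))" "z \<in> carrier T"
  shows "g z = h z"
proof -
  have "pt ` (carrier M \<times> carrier N) \<subseteq> carrier T" using pure_closed by auto
  note S = span_submodule[OF tensor_is_module this]
  have "z \<in> submodule_span S T (pt ` (carrier M \<times> carrier N))"
    by (rule tensor_generated[OF S _ assms(5)]) (rule subsetD[OF span_superset imageI], simp)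
  from hom_eq_on_span[OF tensor_is_module assms(1-3) _ _ this] show ?thesis
    using assms(4) pure_closed by auto
qed

lemma tensor_universal:
  assumes Q: "module S Q"
    and b: "\<And>x y. x \<in> carrier M \<Longrightarrow> y \<in> carrier N \<Longrightarrow> b (x, y) \<in> carrier Q"
    "\<And>x x' y. x \<in> carrier M \<Longrightarrow> x' \<in> carrier M \<Longrightarrow> y \<in> carrier N \<Longrightarrow> b (x \<oplus>\<^bsub>M\<^esub> x', y) = b (x, y) \<oplus>\<^bsub>Q\<^esub> b (x', y)"
    "\<And>x y y'. x \<in> carrier M \<Longrightarrow> y \<in> carrier N \<Longrightarrow> y' \<in> carrier N \<Longrightarrow> b (x, y \<oplus>\<^bsub>N\<^esub> y') = b (x, y) \<oplus>\<^bsub>Q\<^esub> b (x, y')"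
    "\<And>r x y. r \<in> carrier R \<Longrightarrow> x \<in> carrier M \<Longrightarrow> y \<in> carrier N \<Longrightarrow> b (r \<odot>\<^bsub>M\<^esub> x, y) = b (x, \<phi> r \<odot>\<^bsub>N\<^esub> y)"
    "\<And>s x y. s \<in> carrier S \<Longrightarrow> x \<in> carrier M \<Longrightarrow> y \<in> carrier N \<Longrightarrow> b (x, s \<odot>\<^bsub>N\<^esub> y) = s \<odot>\<^bsub>Q\<^esub> b (x, y)"
  defines "\<theta> \<equiv> \<lambda>Z. the_elem (free_lift S Q b ` Z)"
  shows "\<theta> \<in> mod_hom S T Q"
    and "\<And>x y. x \<in> carrier M \<Longrightarrow> y \<in> carrier N \<Longrightarrow> \<theta> (pt (x, y)) = b (x, y)"
proof -
  interpret Q: module S Q by (rule Q)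
  let ?L = "free_lift S Q b"
  have L: "?L \<in> mod_hom S F Q" using b(1) by (intro free_lift_hom[OF Q]) auto
  have Lb: "?L (e (x, y)) = b (x, y)" if "x \<in> carrier M" "y \<in> carrier N" for x y
    using b(1)[OF that] by (rule free_lift_basis[OF Q])
  have ph: "\<And>r. r \<in> carrier R \<Longrightarrow> \<phi> r \<in> carrier S" using phi by auto
  have "?L z = \<zero>\<^bsub>Q\<^esub>" if "z \<in> tensor_relations R S \<phi> M N" for z
  proof -
    have "\<exists>u v. z = u \<ominus>\<^bsub>F\<^esub> v \<and> u \<in> carrier F \<and> v \<in> carrier F \<and> ?L u = ?L v"
      using that unfolding tensor_relations_def Let_def
      apply (elim UnE CollectE exE conjE)
         apply (rule exI, rule exI, rule conjI, assumption)
         apply (use e b in \<open>simp add: Lb mod_hom_add[OF L]\<close>)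
         apply (rule exI, rule exI, rule conjI, assumption)
         apply (use e b in \<open>simp add: Lb mod_hom_add[OF L]\<close>)
         apply (rule exI, rule exI, rule conjI, assumption)
         apply (use e b ph in \<open>simp add: Lb\<close>)
         apply (rule exI, rule exI, rule conjI, assumption)
         apply (use e b in \<open>simp add: Lb mod_hom_smult[OF L]\<close>)
      done
    then obtain u v where z: "z = u \<ominus>\<^bsub>F\<^esub> v" "u \<in> carrier F" "v \<in> carrier F" "?L u = ?L v" by blast
    then show ?thesis using mod_hom_minus[OF F Q L z(2,3)] mod_hom_closed[OF L]
      by (simp add: module_minus_cancel[OF Q])
  qed
  then have "tensor_relations R S \<phi> M N \<subseteq> a_kernel F Q ?L" using rel by (auto simp: a_kernel_iff)
  then have "K \<subseteq> a_kernel F Q ?L" unfolding tensor_kernel_def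
    by (intro span_least submodule_a_kernel[OF F Q L])
  then have ker: "\<And>x. x \<in> K \<Longrightarrow> ?L x = \<zero>\<^bsub>Q\<^esub>" by (auto simp: a_kernel_iff)
  show "\<theta> \<in> mod_hom S T Q" unfolding \<theta>_def tensor_over_def
    by (rule quot_lift(1)[OF F K Q L ker])
  show "\<theta> (pt (x, y)) = b (x, y)" if "x \<in> carrier M" "y \<in> carrier N" for x y
    unfolding \<theta>_def pure_tensor_def using quot_lift(2)[OF F K Q L ker e[OF that]] Lb[OF that] by simp
qed

end

lemma tensor_map:
  assumes "module R M" "module R M'" "module S N" "\<phi> \<in> carrier R \<rightarrow> carrier S" "h \<in> mod_hom R M M'"
  shows "tensor_map R S \<phi> M' N h \<in> mod_hom S (tensor_over R S \<phi> M N) (tensor_over R S \<phi> M' N)"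
    and "\<And>x y. x \<in> carrier M \<Longrightarrow> y \<in> carrier N \<Longrightarrow>
      tensor_map R S \<phi> M' N h (pure_tensor R S \<phi> M N (x, y)) = pure_tensor R S \<phi> M' N (h x, y)"
proof -
  interpret N: module S N by fact
  have tm: "tensor_map R S \<phi> M' N h = (\<lambda>Z. the_elem (free_lift S (tensor_over R S \<phi> M' N)
     (\<lambda>(x, y). pure_tensor R S \<phi> M' N (h x, y)) ` Z))" by (rule ext) (simp add: tensor_map_def)
  note [simp] = pure_closed[OF assms(2-4)] pure_add_left[OF assms(2-4)] pure_add_right[OF assms(2-4)]
    pure_balanced[OF assms(2-4)] pure_smult[OF assms(2-4)] mod_hom_closed[OF assms(5)] mod_hom_add[OF assms(5)]
    mod_hom_smult[OF assms(5)]
  note U = tensor_universal[OF assms(1,3,4) tensor_is_module[OF assms(2-4)],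
      where b = "\<lambda>(x, y). pure_tensor R S \<phi> M' N (h x, y)"]
  show "tensor_map R S \<phi> M' N h \<in> mod_hom S (tensor_over R S \<phi> M N) (tensor_over R S \<phi> M' N)"
    unfolding tm by (rule U) auto
  show "tensor_map R S \<phi> M' N h (pure_tensor R S \<phi> M N (x, y)) = pure_tensor R S \<phi> M' N (h x, y)"
    if "x \<in> carrier M" "y \<in> carrier N" for x y
    unfolding tm by (subst U(2)) (use that in auto)
qed

section \<open>Lengths of intervals of submodules\<close>

definition has_chain :: "('a, 'r) ring_scheme \<Rightarrow> ('a, 'b) module \<Rightarrow> nat \<Rightarrow> 'b set \<Rightarrow> 'b set \<Rightarrow> bool" where
  "has_chain R M n A B \<longleftrightarrow> (\<exists>N. (\<forall>i\<le>n. submodule (N i) R M) \<and> (\<forall>i<n. N i \<subset> N (Suc i)) \<and> A \<subseteq> N 0 \<and> N n \<subseteq> B)"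

text \<open>The length of \<open>B / A\<close>, computed inside \<open>M\<close> so that no quotient module has to be formed.\<close>
definition interval_length :: "('a, 'r) ring_scheme \<Rightarrow> ('a, 'b) module \<Rightarrow> 'b set \<Rightarrow> 'b set \<Rightarrow> enat" where
  "interval_length R M A B = Sup {enat n | n. has_chain R M n A B}"

lemma interval_length_le_iff: "interval_length R M A B \<le> c \<longleftrightarrow> (\<forall>n. has_chain R M n A B \<longrightarrow> enat n \<le> c)"
  unfolding interval_length_def by (auto simp: Sup_le_iff)

lemma chain_subset: "\<forall>i<n. L i \<subset> L (Suc i) \<Longrightarrow> i \<le> j \<Longrightarrow> j \<le> n \<Longrightarrow> L i \<subseteq> L j"
proof (induction j)
  case (Suc j)
  then show ?case
  proof (cases "i = Suc j")
    case False
    then have "L i \<subseteq> L j" using Suc by simp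
    also have "L j \<subset> L (Suc j)" using Suc.prems by simp
    finally show ?thesis by (rule psubset_imp_subset)
  qed simp
qed simp

lemma has_chain_length: "has_chain R M n A B \<Longrightarrow> enat n \<le> interval_length R M A B"
  unfolding interval_length_def by (auto intro: Sup_upper)

lemma interval_length_le:
  assumes "\<And>n. has_chain R M n A B \<Longrightarrow> has_chain R M' n A' B'"
  shows "interval_length R M A B \<le> interval_length R M' A' B'"
  unfolding interval_length_le_iff using assms has_chain_length by blast

lemma interval_length_cong:
  assumes "\<And>n. has_chain R M n A B \<longleftrightarrow> has_chain R' M' n A' B'"
  shows "interval_length R M A B = interval_length R' M' A' B'"
  unfolding interval_length_def using assms by simp

lemma has_chain_mono: "has_chain R M n A B \<Longrightarrow> A' \<subseteq> A \<Longrightarrow> B \<subseteq> B' \<Longrightarrow> has_chain R M n A' B'"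
  unfolding has_chain_def by (meson subset_trans)

lemma interval_length_mono: "A' \<subseteq> A \<Longrightarrow> B \<subseteq> B' \<Longrightarrow> interval_length R M A B \<le> interval_length R M A' B'"
  by (rule interval_length_le) (rule has_chain_mono)

lemma module_length_interval:
  fixes M :: "('a, 'b) module" (structure)
  assumes "module R M"
  shows "module_length R M = interval_length R M {\<zero>} (carrier M)"
proof -
  have "(\<exists>N :: nat \<Rightarrow> 'b set. (\<forall>i\<le>n. submodule (N i) R M) \<and> (\<forall>i<n. N i \<subset> N (Suc i))) \<longleftrightarrow>
      has_chain R M n {\<zero>} (carrier M)" for n
  proof -
    have "{\<zero>} \<subseteq> N 0 \<and> N n \<subseteq> carrier M" if "\<forall>i\<le>n. submodule (N i) R M" for N
      using submodule_zero[of "N 0" R M] submodule_subset[of "N n" R M] that by auto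
    then show ?thesis unfolding has_chain_def by meson
  qed
  then show ?thesis unfolding module_length_def interval_length_def by simp
qed

lemma has_chain_0: "submodule A R M \<Longrightarrow> A \<subseteq> B \<Longrightarrow> has_chain R M 0 A B"
  unfolding has_chain_def by (intro exI[of _ "\<lambda>_. A"]) auto

lemma has_chain_Suc:
  assumes "has_chain R M n A P" "P \<subset> Q" "submodule Q R M"
  shows "has_chain R M (Suc n) A Q"
proof -
  obtain N where N: "\<forall>i\<le>n. submodule (N i) R M" "\<forall>i<n. N i \<subset> N (Suc i)" "A \<subseteq> N 0" "N n \<subseteq> P"
    using assms(1) unfolding has_chain_def by blast
  have "(N(Suc n := Q)) i \<subset> (N(Suc n := Q)) (Suc i)" if "i < Suc n" for i
    using that N(2,4) assms(2) by (cases "i = n") auto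
  then show ?thesis unfolding has_chain_def using N assms(3)
    by (intro exI[of _ "N(Suc n := Q)"]) auto
qed

lemma has_chain_append:
  assumes "has_chain R M a A B" "has_chain R M b B C"
  shows "has_chain R M (a + b) A C"
proof -
  obtain N where N: "\<forall>i\<le>a. submodule (N i) R M" "\<forall>i<a. N i \<subset> N (Suc i)" "A \<subseteq> N 0" "N a \<subseteq> B"
    using assms(1) unfolding has_chain_def by blast
  obtain L where L: "\<forall>i\<le>b. submodule (L i) R M" "\<forall>i<b. L i \<subset> L (Suc i)" "B \<subseteq> L 0" "L b \<subseteq> C"
    using assms(2) unfolding has_chain_def by blast
  have "has_chain R M (a + k) A (if k = 0 then B else L k)" if "k \<le> b" for k
    using that
  proof (induction k)
    case 0
    then show ?case using assms(1) by simp
  next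
    case (Suc k)
    have sub: "(if k = 0 then B else L k) \<subseteq> L k" using L(3) by auto
    moreover have "L k \<subset> L (Suc k)" using L(2) Suc.prems by simp
    ultimately have "(if k = 0 then B else L k) \<subset> L (Suc k)" by (rule subset_psubset_trans)
    moreover have "submodule (L (Suc k)) R M" using L(1) Suc.prems by simp
    moreover have "has_chain R M (a + k) A (if k = 0 then B else L k)" using Suc by simp
    ultimately have "has_chain R M (Suc (a + k)) A (L (Suc k))" by (intro has_chain_Suc)
    then show ?case by simp
  qed
  from this[of b] have "has_chain R M (a + b) A (if b = 0 then B else L b)" by simp
  moreover have "(if b = 0 then B else L b) \<subseteq> C" using L(3,4) by auto
  ultimately show ?thesis using has_chain_mono by blast
qed

text
  \<open>Each step of a chain stays strict after intersecting with \<open>B\<close> or after adding \<open>B\<close>: by the modular law it cannot collapse in both.\<close>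
lemma has_chain_split:
  fixes M (structure)
  assumes M: "module R M" and B: "submodule B R M" and "A \<subseteq> B" "B \<subseteq> C" "submodule A R M" "submodule C R M"
    and "has_chain R M n A C"
  shows "\<exists>a b. n \<le> a + b \<and> has_chain R M a A B \<and> has_chain R M b B C"
proof -
  interpret M: module R M by fact
  obtain N where N: "\<forall>i\<le>n. submodule (N i) R M" "\<forall>i<n. N i \<subset> N (Suc i)" "A \<subseteq> N 0" "N n \<subseteq> C"
    using assms(7) unfolding has_chain_def by blast
  have "\<exists>a b. k \<le> a + b \<and> has_chain R M a A (N k \<inter> B) \<and> has_chain R M b B (submodule_sum M (N k) B)" if "k \<le> n" for k
    using that
  proof (induction k)
    case 0
    have "submodule (N 0) R M" using N(1) by simp
    then have "B \<subseteq> submodule_sum M (N 0) B" by (rule sum_upper(2)[OF M _ B])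
    then show ?case using assms N(3) by (intro exI[of _ 0]) (auto intro!: has_chain_0)
  next
    case (Suc k)
    then obtain a b where ab: "k \<le> a + b" "has_chain R M a A (N k \<inter> B)" "has_chain R M b B (submodule_sum M (N k) B)" by auto
    let ?P = "N k" and ?Q = "N (Suc k)"
    have P: "submodule ?P R M" and Q: "submodule ?Q R M" and PQ: "?P \<subset> ?Q" using N Suc.prems by auto
    have s1: "?P \<inter> B \<subseteq> ?Q \<inter> B" using PQ by auto
    have s2: "submodule_sum M ?P B \<subseteq> submodule_sum M ?Q B" using PQ by (intro submodule_sum_mono) auto
    show ?case
    proof (cases "?P \<inter> B = ?Q \<inter> B")
      case False
      then have "has_chain R M (Suc a) A (?Q \<inter> B)"
        using s1 by (intro has_chain_Suc[OF ab(2)] submodule_Int[OF M Q B]) auto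
      moreover have "has_chain R M b B (submodule_sum M ?Q B)" by (rule has_chain_mono[OF ab(3) _ s2]) simp
      ultimately show ?thesis using ab(1) by (intro exI[of _ "Suc a"] exI[of _ b]) auto
    next
      case True
      have "submodule_sum M ?P B \<noteq> submodule_sum M ?Q B"
      proof
        assume eq: "submodule_sum M ?P B = submodule_sum M ?Q B"
        obtain y where y: "y \<in> ?Q" "y \<notin> ?P" using PQ by auto
        have "y \<in> submodule_sum M ?P B" using y sum_upper(1)[OF M Q B] eq by auto
        then obtain x b where xb: "y = x \<oplus> b" "x \<in> ?P" "b \<in> B" by (auto simp: submodule_sum_def)
        have c: "x \<in> carrier M" "b \<in> carrier M" using xb submodule_subset[OF P] submodule_subset[OF B] by auto
        have "y \<ominus> x \<in> ?Q" using submodule_minus[OF M Q y(1)] xb(2) PQ by auto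
        moreover have "y \<ominus> x = b" using c xb(1) module_minus_cancel(5)[OF M c(2,1)] by simp
        ultimately have "b \<in> ?P" using xb(3) True by auto
        then show False using xb y submodule_add[OF P] by auto
      qed
      then have "has_chain R M (Suc b) B (submodule_sum M ?Q B)"
        using s2 by (intro has_chain_Suc[OF ab(3)] sum_submodule[OF M Q B]) auto
      moreover have "has_chain R M a A (?Q \<inter> B)" using ab(2) True by simp
      ultimately show ?thesis using ab(1) by (intro exI[of _ a] exI[of _ "Suc b"]) auto
    qed
  qed
  from this[of n] obtain a b where ab: "n \<le> a + b" "has_chain R M a A (N n \<inter> B)" "has_chain R M b B (submodule_sum M (N n) B)"
    by auto
  have "submodule_sum M (N n) B \<subseteq> C" using sum_least[OF assms(6) N(4) assms(4)] .
  then show ?thesis using ab has_chain_mono[OF ab(2), of A B] has_chain_mono[OF ab(3), of B C] by auto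
qed

lemma interval_length_attained:
  assumes "submodule A R M" "A \<subseteq> B" "interval_length R M A B = enat k"
  shows "has_chain R M k A B"
proof -
  let ?S = "{enat n | n. has_chain R M n A B}"
  have ne: "?S \<noteq> {}" using has_chain_0[OF assms(1,2)] by auto
  have "?S \<subseteq> enat ` {..k}"
  proof
    fix x assume "x \<in> ?S"
    then obtain n where n: "x = enat n" "has_chain R M n A B" by blast
    then have "enat n \<le> enat k" using has_chain_length[OF n(2)] assms(3) by simp
    then show "x \<in> enat ` {..k}" using n by simp
  qed
  then have fin: "finite ?S" by (rule finite_subset) simp
  have "Sup ?S \<in> ?S" using Max_in[OF fin ne] Max_Sup[OF fin ne] by simp
  then show ?thesis using assms(3) unfolding interval_length_def by auto
qed

lemma interval_length_add:
  assumes M: "module R M" and "submodule A R M" "submodule B R M" "submodule C R M" "A \<subseteq> B" "B \<subseteq> C"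
  shows "interval_length R M A C = interval_length R M A B + interval_length R M B C"
proof (rule antisym)
  show "interval_length R M A C \<le> interval_length R M A B + interval_length R M B C"
    unfolding interval_length_le_iff
  proof (intro allI impI)
    fix n assume "has_chain R M n A C"
    then obtain a b where ab: "n \<le> a + b" "has_chain R M a A B" "has_chain R M b B C"
      using has_chain_split[OF M assms(3,5,6,2,4)] by blast
    have "enat n \<le> enat a + enat b" using ab(1) by simp
    also have "\<dots> \<le> interval_length R M A B + interval_length R M B C"
      by (intro add_mono has_chain_length ab)
    finally show "enat n \<le> interval_length R M A B + interval_length R M B C" .
  qed
  show "interval_length R M A B + interval_length R M B C \<le> interval_length R M A C"
  proof (cases "interval_length R M A C")
    case (enat k)
    have "interval_length R M A B \<le> enat k" "interval_length R M B C \<le> enat k"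
      using interval_length_mono[of A A B C R M] interval_length_mono[of A B C C R M] assms enat by auto
    then obtain a b where ab: "interval_length R M A B = enat a" "interval_length R M B C = enat b"
      by (metis enat_ile)
    have "has_chain R M (a + b) A C"
      by (rule has_chain_append[OF interval_length_attained[OF assms(2,5) ab(1)] interval_length_attained[OF assms(3,6) ab(2)]])
    from has_chain_length[OF this] show ?thesis using ab by simp
  qed simp
qed

lemma interval_length_restr:
  assumes "module R M" "submodule K R M" "B \<subseteq> K"
  shows "interval_length R (M\<lparr>carrier := K\<rparr>) A B = interval_length R M A B"
proof (rule interval_length_cong)
  show "has_chain R (M\<lparr>carrier := K\<rparr>) n A B \<longleftrightarrow> has_chain R M n A B" for n
  proof
    show "has_chain R (M\<lparr>carrier := K\<rparr>) n A B \<Longrightarrow> has_chain R M n A B"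
      unfolding has_chain_def submodule_restr[OF assms(1,2)] by blast
    assume "has_chain R M n A B"
    then obtain N where N: "\<forall>i\<le>n. submodule (N i) R M" "\<forall>i<n. N i \<subset> N (Suc i)" "A \<subseteq> N 0" "N n \<subseteq> B"
      unfolding has_chain_def by blast
    then have "\<forall>i\<le>n. N i \<subseteq> K" using chain_subset[OF N(2), of _ n] N(4) assms(3) by blast
    then show "has_chain R (M\<lparr>carrier := K\<rparr>) n A B"
      unfolding has_chain_def submodule_restr[OF assms(1,2)] using N by blast
  qed
qed

text
  \<open>Preimages keep a chain strict because \<open>h\<close> is onto; images do because every member of a chain above the preimage of \<open>A\<close> contains the kernel.\<close>
lemma interval_length_vimage:
  assumes M: "module R M" and N: "module R N" and h: "h \<in> mod_hom R M N" and onto: "h ` carrier M = carrier N"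
    and A: "submodule A R N" and B: "submodule B R N"
  shows "interval_length R N A B = interval_length R M {x \<in> carrier M. h x \<in> A} {x \<in> carrier M. h x \<in> B}"
proof (rule antisym; rule interval_length_le)
  fix n assume "has_chain R N n A B"
  then obtain L where L: "\<forall>i\<le>n. submodule (L i) R N" "\<forall>i<n. L i \<subset> L (Suc i)" "A \<subseteq> L 0" "L n \<subseteq> B"
    unfolding has_chain_def by blast
  let ?L = "\<lambda>i. {x \<in> carrier M. h x \<in> L i}"
  have "?L i \<subset> ?L (Suc i)" if i: "i < n" for i
  proof -
    obtain y where y: "y \<in> L (Suc i)" "y \<notin> L i" using L(2) i by blast
    have "submodule (L (Suc i)) R N" using L(1) i by simp
    then have "y \<in> carrier N" using y(1) by (rule submodule_subset)
    then obtain x where "x \<in> carrier M" "y = h x" using onto by blast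
    moreover have "?L i \<subseteq> ?L (Suc i)" using L(2) i by blast
    ultimately show ?thesis using y by blast
  qed
  moreover have "submodule (?L i) R M" if "i \<le> n" for i using that L(1) submodule_vimage[OF M N h] by blast
  moreover have "{x \<in> carrier M. h x \<in> A} \<subseteq> ?L 0" "?L n \<subseteq> {x \<in> carrier M. h x \<in> B}" using L by auto
  ultimately show "has_chain R M n {x \<in> carrier M. h x \<in> A} {x \<in> carrier M. h x \<in> B}"
    unfolding has_chain_def by (intro exI[of _ ?L] conjI allI impI)
next
  fix n assume "has_chain R M n {x \<in> carrier M. h x \<in> A} {x \<in> carrier M. h x \<in> B}"
  then obtain L where L: "\<forall>i\<le>n. submodule (L i) R M" "\<forall>i<n. L i \<subset> L (Suc i)" "{x \<in> carrier M. h x \<in> A} \<subseteq> L 0"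
     "L n \<subseteq> {x \<in> carrier M. h x \<in> B}"
    unfolding has_chain_def by (elim exE conjE) (rule that)
  have ker: "x \<in> L i" if "i \<le> n" "x \<in> carrier M" "h x = \<zero>\<^bsub>N\<^esub>" for i x
    using that(1)
  proof (induction i)
    case 0
    then show ?case using L(3) that submodule_zero[OF A] by auto
  next
    case (Suc i)
    then show ?case using L(2)[rule_format, of i] by auto
  qed
  have "h ` L i \<subset> h ` L (Suc i)" if i: "i < n" for i
  proof -
    have Li: "submodule (L i) R M" "submodule (L (Suc i)) R M" "L i \<subset> L (Suc i)" using i L by auto
    obtain y where y: "y \<in> L (Suc i)" "y \<notin> L i" using Li(3) by blast
    have yc: "y \<in> carrier M" using submodule_subset[OF Li(2) y(1)] .
    have "h y \<notin> h ` L i"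
    proof
      assume "h y \<in> h ` L i"
      then obtain x where x: "x \<in> L i" "h y = h x" by blast
      have xc: "x \<in> carrier M" using submodule_subset[OF Li(1) x(1)] .
      interpret M: module R M by fact
      have "h (y \<ominus>\<^bsub>M\<^esub> x) = \<zero>\<^bsub>N\<^esub>" using mod_hom_minus[OF M N h yc xc] x mod_hom_closed[OF h xc]
        by (simp add: module_minus_cancel[OF N])
      then have "y \<ominus>\<^bsub>M\<^esub> x \<in> L i" using ker[of i] i yc xc by simp
      then show False using submodule_minus_iff[OF M Li(1) yc x(1)] y by simp
    qed
    then show ?thesis using y Li(3) by blast
  qed
  moreover have "submodule (h ` L i) R N" if "i \<le> n" for i using that L(1) submodule_image[OF M N h] by blast
  moreover have "A \<subseteq> h ` L 0"
  proof
    fix y assume y: "y \<in> A"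
    then have "y \<in> carrier N" by (rule submodule_subset[OF A])
    then obtain x where "x \<in> carrier M" "y = h x" using onto by blast
    then show "y \<in> h ` L 0" using L(3) y by blast
  qed
  moreover have "h ` L n \<subseteq> B" using L(4) by blast
  ultimately show "has_chain R N n A B" unfolding has_chain_def by (intro exI[of _ "\<lambda>i. h ` L i"]) blast
qed

lemma module_length_surj:
  assumes "module R M" "module R N" "h \<in> mod_hom R M N" "h ` carrier M = carrier N"
  shows "module_length R N = interval_length R M (a_kernel M N h) (carrier M)"
proof -
  have "{x \<in> carrier M. h x \<in> {\<zero>\<^bsub>N\<^esub>}} = a_kernel M N h" by (auto simp: a_kernel_iff)
  moreover have "{x \<in> carrier M. h x \<in> carrier N} = carrier M" using mod_hom_closed[OF assms(3)] by auto
  ultimately show ?thesis using interval_length_vimage[OF assms submodule_trivial[OF assms(2)] submodule_carrier[OF assms(2)]]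
    unfolding module_length_interval[OF assms(2)] by simp
qed

text \<open>\<open>Z / (Z \<inter> W)\<close> embeds into \<open>M / W\<close>: adding \<open>W\<close> to a chain between \<open>Z \<inter> W\<close> and \<open>Z\<close> keeps it strict.\<close>
lemma interval_length_Int_le:
  fixes M (structure)
  assumes M: "module R M" and Z: "submodule Z R M" and W: "submodule W R M"
  shows "interval_length R M (Z \<inter> W) Z \<le> interval_length R M W (carrier M)"
proof (rule interval_length_le)
  fix n assume "has_chain R M n (Z \<inter> W) Z"
  then obtain L where L: "\<forall>i\<le>n. submodule (L i) R M" "\<forall>i<n. L i \<subset> L (Suc i)" "Z \<inter> W \<subseteq> L 0" "L n \<subseteq> Z"
    unfolding has_chain_def by blast
  note up = chain_subset[OF L(2)]
  interpret M: module R M by fact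
  have "submodule_sum M (L i) W \<subset> submodule_sum M (L (Suc i)) W" if i: "i < n" for i
  proof -
    have Li: "submodule (L i) R M" "submodule (L (Suc i)) R M" "L i \<subset> L (Suc i)" using i L by auto
    obtain y where y: "y \<in> L (Suc i)" "y \<notin> L i" using Li(3) by blast
    have "y \<notin> submodule_sum M (L i) W"
    proof
      assume "y \<in> submodule_sum M (L i) W"
      then obtain x b where xb: "y = x \<oplus> b" "x \<in> L i" "b \<in> W" by (auto simp: submodule_sum_def)
      have c: "x \<in> carrier M" "b \<in> carrier M" using xb submodule_subset[OF Li(1)] submodule_subset[OF W] by auto
      have "y \<ominus> x \<in> L (Suc i)" using submodule_minus[OF M Li(2) y(1)] xb(2) Li(3) by auto
      moreover have "y \<ominus> x = b" using c xb(1) module_minus_cancel(5)[OF M c(2,1)] by simp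
      ultimately have "b \<in> Z \<inter> W" using xb(3) L(4) up[of "Suc i" n] i by auto
      then have "b \<in> L i" using L(3) up[of 0 i] i by auto
      then show False using xb y submodule_add[OF Li(1)] by auto
    qed
    moreover have "y \<in> submodule_sum M (L (Suc i)) W" using sum_upper(1)[OF M Li(2) W] y by auto
    ultimately show ?thesis using submodule_sum_mono[of "L i" "L (Suc i)" W W M] Li(3) by blast
  qed
  moreover have s: "submodule (submodule_sum M (L i) W) R M" if "i \<le> n" for i using that L(1) sum_submodule[OF M _ W] by blast
  moreover have "W \<subseteq> submodule_sum M (L 0) W" using sum_upper(2)[OF M _ W] L(1) by blast
  moreover have "submodule_sum M (L n) W \<subseteq> carrier M" using submodule_subset[OF s[of n]] by auto
  ultimately show "has_chain R M n W (carrier M)" unfolding has_chain_def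
    by (intro exI[of _ "\<lambda>i. submodule_sum M (L i) W"]) blast
qed

section \<open>The ring as a module\<close>

lemma self_simps [simp]: "carrier (self_module R) = carrier R" "ring.add (self_module R) = ring.add R"
  "ring.zero (self_module R) = ring.zero R" "smult (self_module R) = monoid.mult R"
  by (simp_all add: self_module_def)

lemma self_is_module:
  assumes "cring R" shows "module R (self_module R)"
proof -
  interpret cring R by fact
  show ?thesis
    by (intro moduleI abelian_groupI)
      (auto simp: assms l_distr r_distr m_assoc a_ac intro: exI[of _ "\<ominus>\<^bsub>R\<^esub> _"] l_neg bexI[of _ "\<ominus>\<^bsub>R\<^esub> _"])
qed

lemma self_a_inv [simp]: "a_inv (self_module R) = a_inv R"
  by (rule ext) (simp add: a_inv_def m_inv_def)

lemma self_minus [simp]: "a_minus (self_module R) x y = a_minus R x y"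
  by (simp add: a_minus_def)

lemma self_coset [simp]: "a_r_coset (self_module R) = a_r_coset R"
  by (intro ext) (simp add: a_r_coset_def')

lemma submodule_self_iff:
  assumes "cring R" shows "submodule I R (self_module R) \<longleftrightarrow> ideal I R"
proof -
  interpret cring R by fact
  interpret M: module R "self_module R" by (rule self_is_module[OF assms])
  show ?thesis
  proof
    assume I: "submodule I R (self_module R)"
    have sub: "subgroup I (add_monoid R)"
      using I by (simp add: submodule_def subgroup_def m_inv_def)
    show "ideal I R"
    proof (rule idealI[OF ring_axioms sub])
      fix a x assume "a \<in> I" "x \<in> carrier R"
      then show "x \<otimes>\<^bsub>R\<^esub> a \<in> I" "a \<otimes>\<^bsub>R\<^esub> x \<in> I"
        using submodule_smult[OF I, of x a] submodule_subset[OF I, of a] m_comm[of x a] by auto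
    qed
  next
    assume "ideal I R"
    then interpret I: ideal I R .
    show "submodule I R (self_module R)"
      by (rule submoduleI'[OF self_is_module[OF assms]]) (auto intro: I.I_l_closed)
  qed
qed

definition colon :: "('a, 'r) ring_scheme \<Rightarrow> 'a set \<Rightarrow> 'a set \<Rightarrow> 'a set" where
  "colon R K L = {t \<in> carrier R. \<forall>x\<in>L. t \<otimes>\<^bsub>R\<^esub> x \<in> K}"

lemma colon_ideal:
  assumes "cring R" "ideal K R" "L \<subseteq> carrier R"
  shows "ideal (colon R K L) R"
proof -
  interpret cring R by fact
  interpret K: ideal K R by fact
  show ?thesis unfolding submodule_self_iff[OF assms(1), symmetric]
    by (rule submoduleI'[OF self_is_module[OF assms(1)]])
      (use assms(3) in \<open>auto simp: colon_def l_distr m_assoc subset_iff K.I_l_closed\<close>)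
qed

text \<open>The map \<open>r \<mapsto> r g\<close> pulls chains above \<open>A\<close> back to chains of ideals above \<open>I\<close>.\<close>
lemma interval_length_cyclic_le:
  fixes M (structure)
  assumes M: "module R M" and A: "submodule A R M" and g: "g \<in> carrier M" and ag: "\<And>r. r \<in> I \<Longrightarrow> r \<odot> g \<in> A"
    and I: "I \<subseteq> carrier R"
    and C: "\<And>y. y \<in> C \<Longrightarrow> \<exists>x\<in>A. \<exists>r\<in>carrier R. y = x \<oplus> r \<odot> g"
  shows "interval_length R M A C \<le> interval_length R (self_module R) I (carrier R)"
proof (rule interval_length_le)
  interpret M: module R M by fact
  fix n assume "has_chain R M n A C"
  then obtain L where L: "\<forall>i\<le>n. submodule (L i) R M" "\<forall>i<n. L i \<subset> L (Suc i)" "A \<subseteq> L 0" "L n \<subseteq> C"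
    unfolding has_chain_def by blast
  note up = chain_subset[OF L(2)]
  let ?K = "\<lambda>i. {r \<in> carrier R. r \<odot> g \<in> L i}"
  have hom: "(\<lambda>r. r \<odot> g) \<in> mod_hom R (self_module R) M"
    by (rule mod_homI) (auto simp: g M.smult_l_distr M.smult_assoc1)
  have "submodule (?K i) R (self_module R)" if "i \<le> n" for i
    using submodule_vimage[OF self_is_module[OF M.R.is_cring] M hom, of "L i"] L(1) that by simp
  moreover have "?K i \<subset> ?K (Suc i)" if i: "i < n" for i
  proof -
    have Li: "submodule (L i) R M" "submodule (L (Suc i)) R M" "L i \<subset> L (Suc i)" using i L by auto
    obtain y where y: "y \<in> L (Suc i)" "y \<notin> L i" using Li(3) by blast
    then have "y \<in> C" using up[of "Suc i" n] i L(4) by auto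
    then obtain x r where xr: "x \<in> A" "r \<in> carrier R" "y = x \<oplus> r \<odot> g" using C by blast
    have x: "x \<in> L i" "x \<in> L (Suc i)" using xr(1) L(3) up[of 0 i] up[of 0 "Suc i"] i by auto
    have "r \<odot> g \<in> L (Suc i)"
      using submodule_add_cancel[OF M Li(2) _ x(2), of "r \<odot> g"] xr g y(1) submodule_subset[OF A xr(1)]
      by (simp add: M.a_comm)
    moreover have "r \<odot> g \<notin> L i" using xr x y submodule_add[OF Li(1)] by auto
    ultimately show ?thesis using xr(2) Li(3) by blast
  qed
  moreover have "I \<subseteq> ?K 0" using ag I L(3) by auto
  ultimately show "has_chain R (self_module R) n I (carrier R)" unfolding has_chain_def
    by (intro exI[of _ ?K]) auto
qed

text \<open>Adjoining the generators one at a time adds at most the length of \<open>R / I\<close> each time.\<close>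
lemma interval_length_generators_le:
  fixes M (structure)
  assumes M: "module R M" and A: "submodule A R M" and "finite G" "G \<subseteq> carrier M"
    and "\<And>r g. r \<in> I \<Longrightarrow> g \<in> G \<Longrightarrow> r \<odot> g \<in> A" and I: "I \<subseteq> carrier R"
    and B: "B \<subseteq> submodule_span R M (A \<union> G)"
  shows "interval_length R M A B \<le> enat (card G) * interval_length R (self_module R) I (carrier R)"
proof -
  interpret M: module R M by fact
  let ?l = "interval_length R (self_module R) I (carrier R)"
  have "\<exists>C. submodule C R M \<and> A \<subseteq> C \<and> G \<subseteq> C \<and> interval_length R M A C \<le> enat (card G) * ?l"
    using assms(3-5)
  proof (induction rule: finite_induct)
    case empty
    have "n = 0" if "has_chain R M n A A" for n
    proof (rule ccontr)
      assume "n \<noteq> 0"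
      obtain L where L: "\<forall>i<n. L i \<subset> L (Suc i)" "A \<subseteq> L 0" "L n \<subseteq> A"
        using \<open>has_chain R M n A A\<close> unfolding has_chain_def by blast
      have "L 0 \<subset> L n" using L(1) \<open>n \<noteq> 0\<close>
      proof (induction n)
        case (Suc n) then show ?case by (cases "n = 0") auto
      qed simp
      then show False using L by auto
    qed
    then have "interval_length R M A A \<le> 0" unfolding interval_length_le_iff by (auto simp: zero_enat_def)
    then show ?case using A by (intro exI[of _ A]) (auto simp: zero_enat_def[symmetric])
  next
    case (insert g G)
    then obtain C where C: "submodule C R M" "A \<subseteq> C" "G \<subseteq> C" "interval_length R M A C \<le> enat (card G) * ?l" by auto
    have g: "g \<in> carrier M" using insert by simp
    have Rg: "submodule ((\<lambda>r. r \<odot> g) ` carrier R) R M"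
    proof -
      have "(\<lambda>r. r \<odot> g) \<in> mod_hom R (self_module R) M"
        by (rule mod_homI) (auto simp: g M.smult_l_distr M.smult_assoc1)
      from submodule_image[OF self_is_module[OF M.R.is_cring] M this submodule_carrier[OF self_is_module[OF M.R.is_cring]]]
      show ?thesis by simp
    qed
    let ?D = "submodule_sum M C ((\<lambda>r. r \<odot> g) ` carrier R)"
    have D: "submodule ?D R M" by (rule sum_submodule[OF M C(1) Rg])
    have CD: "C \<subseteq> ?D" and gD: "(\<lambda>r. r \<odot> g) ` carrier R \<subseteq> ?D" using sum_upper[OF M C(1) Rg] by auto
    have "\<one>\<^bsub>R\<^esub> \<odot> g \<in> ?D" using gD by blast
    then have gD: "g \<in> ?D" using g by simp
    have "interval_length R M C ?D \<le> ?l"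
      by (rule interval_length_cyclic_le[OF M C(1) g _ I]) (use insert C(2) in \<open>auto simp: submodule_sum_def\<close>)
    then have "interval_length R M A ?D \<le> enat (card G) * ?l + ?l"
      unfolding interval_length_add[OF M A C(1) D C(2) CD] by (intro add_mono C(4))
    also have "\<dots> = enat (card (insert g G)) * ?l" using insert(1,2)
      by (simp add: eSuc_enat[symmetric] mult_eSuc add.commute)
    finally show ?case using D CD C(2,3) gD by (intro exI[of _ ?D]) auto
  qed
  then obtain C where C: "submodule C R M" "A \<subseteq> C" "G \<subseteq> C" "interval_length R M A C \<le> enat (card G) * ?l" by auto
  have "B \<subseteq> C" using B span_least[OF C(1), of "A \<union> G"] C by auto
  from interval_length_mono[OF order.refl this] C(4) show ?thesis by (rule order.trans)
qed

section \<open>Tensor products with, and homomorphisms between, cyclic modules\<close>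

definition ideal_smult :: "('a, 'r) ring_scheme \<Rightarrow> ('a, 'b) module \<Rightarrow> 'a set \<Rightarrow> 'b set \<Rightarrow> 'b set" where
  "ideal_smult R M I U = submodule_span R M {r \<odot>\<^bsub>M\<^esub> x | r x. r \<in> I \<and> x \<in> U}"

lemma ideal_smult_submodule:
  assumes "module R M" "I \<subseteq> carrier R" "U \<subseteq> carrier M"
  shows "submodule (ideal_smult R M I U) R M"
proof -
  interpret M: module R M by fact
  show ?thesis unfolding ideal_smult_def by (rule span_submodule[OF assms(1)]) (use assms in auto)
qed

lemma ideal_smult_mem: "r \<in> I \<Longrightarrow> x \<in> U \<Longrightarrow> r \<odot>\<^bsub>M\<^esub> x \<in> ideal_smult R M I U"
  unfolding ideal_smult_def by (rule subsetD[OF span_superset]) blast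

lemma ideal_smult_least:
  "submodule K R M \<Longrightarrow> (\<And>r x. r \<in> I \<Longrightarrow> x \<in> U \<Longrightarrow> r \<odot>\<^bsub>M\<^esub> x \<in> K) \<Longrightarrow> ideal_smult R M I U \<subseteq> K"
  unfolding ideal_smult_def by (rule span_least) auto

lemma ideal_smult_image:
  assumes M: "module R M" and N: "module R N" and h: "h \<in> mod_hom R M N" and I: "I \<subseteq> carrier R" and U: "U \<subseteq> carrier M"
  shows "h ` ideal_smult R M I U = ideal_smult R N I (h ` U)"
proof
  have hU: "h ` U \<subseteq> carrier N" using U mod_hom_closed[OF h] by auto
  note S = ideal_smult_submodule[OF N I hU] and S' = ideal_smult_submodule[OF M I U]
  interpret M: module R M by fact
  have "ideal_smult R M I U \<subseteq> {x \<in> carrier M. h x \<in> ideal_smult R N I (h ` U)}"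
  proof (rule ideal_smult_least[OF submodule_vimage[OF M N h S]])
    fix r x assume rx: "r \<in> I" "x \<in> U"
    then have c: "r \<in> carrier R" "x \<in> carrier M" using I U by auto
    then show "r \<odot>\<^bsub>M\<^esub> x \<in> {x \<in> carrier M. h x \<in> ideal_smult R N I (h ` U)}"
      using ideal_smult_mem[of r I "h x" "h ` U" N R] rx mod_hom_smult[OF h c] by simp
  qed
  then show "h ` ideal_smult R M I U \<subseteq> ideal_smult R N I (h ` U)" by auto
  show "ideal_smult R N I (h ` U) \<subseteq> h ` ideal_smult R M I U"
  proof (rule ideal_smult_least[OF submodule_image[OF M N h S']])
    fix r y assume "r \<in> I" "y \<in> h ` U"
    then obtain x where x: "x \<in> U" "y = h x" "r \<in> I" by auto
    then have c: "r \<in> carrier R" "x \<in> carrier M" using I U by auto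
    show "r \<odot>\<^bsub>N\<^esub> y \<in> h ` ideal_smult R M I U"
      using ideal_smult_mem[of r I x U M R] x mod_hom_smult[OF h c] by (metis imageI)
  qed
qed

lemma cyclic_is_module: "cring R \<Longrightarrow> ideal I R \<Longrightarrow> module R (cyclic_module R I)"
  unfolding cyclic_module_def by (intro quot_is_module) (auto simp: self_is_module submodule_self_iff)

lemma cyclic_simps:
  fixes R (structure)
  assumes "cring R" "ideal I R"
  shows "carrier (cyclic_module R I) = (\<lambda>x. I +> x) ` carrier R" "\<zero>\<^bsub>cyclic_module R I\<^esub> = I"
    "x \<in> carrier R \<Longrightarrow> y \<in> carrier R \<Longrightarrow> (I +> x) \<oplus>\<^bsub>cyclic_module R I\<^esub> (I +> y) = I +> (x \<oplus> y)"
    "r \<in> carrier R \<Longrightarrow> x \<in> carrier R \<Longrightarrow> r \<odot>\<^bsub>cyclic_module R I\<^esub> (I +> x) = I +> (r \<otimes> x)"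
    "x \<in> carrier R \<Longrightarrow> I +> x = I \<longleftrightarrow> x \<in> I"
    "x \<in> carrier R \<Longrightarrow> y \<in> carrier R \<Longrightarrow> I +> x = I +> y \<longleftrightarrow> x \<ominus> y \<in> I"
proof -
  have M: "module R (self_module R)" and I: "submodule I R (self_module R)"
    using assms by (auto simp: self_is_module submodule_self_iff)
  show "carrier (cyclic_module R I) = (\<lambda>x. I +> x) ` carrier R" "\<zero>\<^bsub>cyclic_module R I\<^esub> = I"
    "x \<in> carrier R \<Longrightarrow> y \<in> carrier R \<Longrightarrow> (I +> x) \<oplus>\<^bsub>cyclic_module R I\<^esub> (I +> y) = I +> (x \<oplus> y)"
    "r \<in> carrier R \<Longrightarrow> x \<in> carrier R \<Longrightarrow> r \<odot>\<^bsub>cyclic_module R I\<^esub> (I +> x) = I +> (r \<otimes> x)"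
    unfolding cyclic_module_def using quot_carrier[of "self_module R" I] quot_add[OF M I, of x y] quot_smult[OF M I, of x r]
    by (simp_all add: quot_zero)
  show "x \<in> carrier R \<Longrightarrow> I +> x = I \<longleftrightarrow> x \<in> I" using coset_eq_zero_iff[OF M I, of x] by simp
  show "x \<in> carrier R \<Longrightarrow> y \<in> carrier R \<Longrightarrow> I +> x = I +> y \<longleftrightarrow> x \<ominus> y \<in> I"
    using coset_eq_iff[OF M I, of x y] by simp
qed

text \<open>An arbitrary representative; modulo \<open>K\<close>, its products with elements of \<open>K : I\<close> do not depend on the choice.\<close>
definition coset_rep :: "('a, 'r) ring_scheme \<Rightarrow> 'a set \<Rightarrow> 'a set \<Rightarrow> 'a" where
  "coset_rep R I C = (SOME r. r \<in> carrier R \<and> I +>\<^bsub>R\<^esub> r = C)"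

lemma coset_rep:
  fixes R (structure)
  assumes "cring R" "ideal I R" "C \<in> carrier (cyclic_module R I)"
  shows "coset_rep R I C \<in> carrier R" "I +> coset_rep R I C = C"
proof -
  have "\<exists>r. r \<in> carrier R \<and> I +> r = C" using assms by (auto simp: cyclic_simps)
  from someI_ex[OF this] show "coset_rep R I C \<in> carrier R" "I +> coset_rep R I C = C"
    unfolding coset_rep_def by auto
qed

lemma coset_rep_diff:
  fixes R (structure)
  assumes "cring R" "ideal I R" "r \<in> carrier R"
  shows "coset_rep R I (I +> r) \<ominus> r \<in> I"
  using coset_rep[OF assms(1,2), of "I +> r"] assms by (simp add: cyclic_simps)

text \<open>\<open>M \<otimes> R / I = M / I M\<close>: the map \<open>x \<otimes> (I + r) \<mapsto> r x\<close> is well defined modulo \<open>I M\<close>.\<close>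
lemma module_length_tensor_cyclic:
  fixes R (structure)
  assumes cr: "cring R" and M: "module R M" and I: "ideal I R"
  shows "module_length R (tensor_product R M (cyclic_module R I)) =
    interval_length R M (ideal_smult R M I (carrier M)) (carrier M)"
proof -
  interpret M: module R M by fact
  interpret I: ideal I R by fact
  let ?N = "cyclic_module R I"
  let ?T = "tensor_product R M ?N"
  have N: "module R ?N" by (rule cyclic_is_module[OF cr I])
  have id: "(\<lambda>r. r) \<in> carrier R \<rightarrow> carrier R" by simp
  have T: "module R ?T" unfolding tensor_product_def by (rule tensor_is_module[OF M N id])
  note cs = cyclic_simps[OF cr I]
  let ?p = "pure_tensor R R (\<lambda>r. r) M ?N"
  define \<tau> where "\<tau> x = ?p (x, I +> \<one>)" for x
  have one: "I +> \<one> \<in> carrier ?N" by (auto simp: cs)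
  note pa = pure_add_left[OF M N id, folded tensor_product_def] and pb = pure_balanced[OF M N id]
    and ps = pure_smult[OF M N id, folded tensor_product_def] and pc = pure_closed[OF M N id, folded tensor_product_def]
  have \<tau>: "\<tau> \<in> mod_hom R M ?T"
    unfolding \<tau>_def using one by (intro mod_homI) (auto simp: pc pa pb ps)
  have pure: "?p (x, I +> r) = \<tau> (r \<odot>\<^bsub>M\<^esub> x)" if "x \<in> carrier M" "r \<in> carrier R" for x r
    using that one by (simp add: \<tau>_def pb cs)
  have onto: "\<tau> ` carrier M = carrier ?T"
  proof
    show "\<tau> ` carrier M \<subseteq> carrier ?T" using mod_hom_closed[OF \<tau>] by auto
    have "submodule (\<tau> ` carrier M) R ?T" by (rule submodule_image[OF M T \<tau> submodule_carrier[OF M]])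
    note S = this[unfolded tensor_product_def]
    show "carrier ?T \<subseteq> \<tau> ` carrier M"
    proof
      fix z assume "z \<in> carrier ?T"
      then show "z \<in> \<tau> ` carrier M" unfolding tensor_product_def
        by (intro tensor_generated[OF M N id S, of z]) (auto simp: cs pure)
    qed
  qed
  let ?K = "ideal_smult R M I (carrier M)"
  have K: "submodule ?K R M" by (rule ideal_smult_submodule[OF M]) (auto intro: I.Icarr)
  let ?Q = "quot_module M ?K"
  have Q: "module R ?Q" by (rule quot_is_module[OF M K])
  define b where "b = (\<lambda>(x, C). ?K +>\<^bsub>M\<^esub> (coset_rep R I C \<odot>\<^bsub>M\<^esub> x))"
  have b: "b (x, I +> r) = ?K +>\<^bsub>M\<^esub> (r \<odot>\<^bsub>M\<^esub> x)" if "x \<in> carrier M" "r \<in> carrier R" for x r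
  proof -
    let ?r = "coset_rep R I (I +> r)"
    have rc: "?r \<in> carrier R" using coset_rep(1)[OF cr I] that by (simp add: cs)
    have "(?r \<ominus> r) \<odot>\<^bsub>M\<^esub> x \<in> ?K" using coset_rep_diff[OF cr I that(2)] that by (intro ideal_smult_mem)
    moreover have "(?r \<ominus> r) \<odot>\<^bsub>M\<^esub> x = ?r \<odot>\<^bsub>M\<^esub> x \<ominus>\<^bsub>M\<^esub> r \<odot>\<^bsub>M\<^esub> x"
      using rc that by (simp add: M.R.minus_eq M.M.minus_eq M.smult_l_distr M.smult_l_minus)
    ultimately show ?thesis unfolding b_def using rc that by (simp add: coset_eq_iff[OF M K])
  qed
  note qs = quot_add[OF M K] quot_smult[OF M K] quot_carrier[of M ?K]
  have "\<exists>\<theta>\<in>mod_hom R ?T ?Q. \<forall>x\<in>carrier M. \<forall>C\<in>carrier ?N. \<theta> (?p (x, C)) = b (x, C)"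
  proof (rule bexI)
    show "\<forall>x\<in>carrier M. \<forall>C\<in>carrier ?N. the_elem (free_lift R ?Q b ` ?p (x, C)) = b (x, C)"
      by (intro ballI, rule tensor_universal(2)[OF M N id Q])
        (auto simp: b cs qs M.smult_r_distr M.smult_l_distr M.R.m_comm simp flip: M.smult_assoc1)
    show "(\<lambda>Z. the_elem (free_lift R ?Q b ` Z)) \<in> mod_hom R ?T ?Q" unfolding tensor_product_def
      by (rule tensor_universal(1)[OF M N id Q])
        (auto simp: b cs qs M.smult_r_distr M.smult_l_distr M.R.m_comm simp flip: M.smult_assoc1)
  qed
  then obtain \<theta> where \<theta>: "\<theta> \<in> mod_hom R ?T ?Q" "\<And>x C. x \<in> carrier M \<Longrightarrow> C \<in> carrier ?N \<Longrightarrow> \<theta> (?p (x, C)) = b (x, C)" by blast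
  have \<theta>\<tau>: "\<theta> (\<tau> x) = ?K +>\<^bsub>M\<^esub> x" if "x \<in> carrier M" for x
    using \<theta>(2)[OF that one] b[OF that] that unfolding \<tau>_def by simp
  have "a_kernel M ?T \<tau> = ?K"
  proof
    show "a_kernel M ?T \<tau> \<subseteq> ?K"
    proof
      fix x assume "x \<in> a_kernel M ?T \<tau>"
      then have x: "x \<in> carrier M" "\<tau> x = \<zero>\<^bsub>?T\<^esub>" by (auto simp: a_kernel_iff)
      then have "?K +>\<^bsub>M\<^esub> x = ?K" using \<theta>\<tau>[of x] mod_hom_zero[OF T Q \<theta>(1)] by (simp add: quot_zero)
      then show "x \<in> ?K" using coset_eq_zero_iff[OF M K x(1)] by simp
    qed
    show "?K \<subseteq> a_kernel M ?T \<tau>"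
    proof (rule ideal_smult_least[OF submodule_a_kernel[OF M T \<tau>]])
      fix r x assume rx: "r \<in> I" "x \<in> carrier M"
      then have r: "r \<in> carrier R" by (auto intro: I.Icarr)
      interpret T: module R ?T by fact
      have "\<tau> (r \<odot>\<^bsub>M\<^esub> x) = ?p (x, I +> r)" using pure[OF rx(2) r] by simp
      also have "I +> r = I" using rx(1) cs(5)[OF r] by simp
      also have "?p (x, I) = ?p (x, \<zero> \<odot>\<^bsub>?N\<^esub> (I +> \<one>))"
        using cs(5)[OF M.R.zero_closed] by (simp add: cs(4))
      also have "\<dots> = \<zero>\<^bsub>?T\<^esub>" using rx one by (subst ps) (auto simp: pc)
      finally show "r \<odot>\<^bsub>M\<^esub> x \<in> a_kernel M ?T \<tau>" using rx r by (simp add: a_kernel_iff)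
    qed
  qed
  then show ?thesis using module_length_surj[OF M T \<tau> onto] by simp
qed

text \<open>A homomorphism on \<open>R / I\<close> is determined by the image of \<open>1\<close>, which may be any element killed by \<open>I\<close>.\<close>
lemma module_length_hom_cyclic:
  fixes R (structure)
  assumes cr: "cring R" and I: "ideal I R" and K: "ideal K R"
  shows "module_length R (hom_module R (cyclic_module R I) (cyclic_module R K)) =
    interval_length R (self_module R) K (colon R K I)"
proof -
  interpret cring R by fact
  interpret I: ideal I R by fact
  interpret K: ideal K R by fact
  let ?A = "cyclic_module R I" and ?B = "cyclic_module R K" and ?S = "self_module R"
  note csI = cyclic_simps[OF cr I] and csK = cyclic_simps[OF cr K]
  have A: "module R ?A" and B: "module R ?B" and S: "module R ?S"
    using cyclic_is_module[OF cr I] cyclic_is_module[OF cr K] self_is_module[OF cr] by auto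
  interpret A: module R ?A by fact
  interpret B: module R ?B by fact
  let ?H = "hom_module R ?A ?B"
  let ?X = "colon R K I"
  have Xi: "submodule ?X R ?S" using colon_ideal[OF cr K] I.a_subset submodule_self_iff[OF cr] by auto
  let ?D = "?S\<lparr>carrier := ?X\<rparr>"
  have D: "module R ?D" by (rule restr_module[OF S Xi])
  have Xc: "t \<in> carrier R" if "t \<in> ?X" for t using that by (simp add: colon_def)
  have car: "h \<in> carrier ?H \<longleftrightarrow> h \<in> mod_hom R ?A ?B \<and> h \<in> extensional (carrier ?A)" for h
    by (simp add: hom_module_def)
  have ops: "h \<oplus>\<^bsub>?H\<^esub> k = (\<lambda>x\<in>carrier ?A. h x \<oplus>\<^bsub>?B\<^esub> k x)" "r \<odot>\<^bsub>?H\<^esub> h = (\<lambda>x\<in>carrier ?A. r \<odot>\<^bsub>?B\<^esub> h x)"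
    "\<zero>\<^bsub>?H\<^esub> = (\<lambda>x\<in>carrier ?A. \<zero>\<^bsub>?B\<^esub>)" for h k r
    by (auto simp: hom_module_def)
  define \<sigma> where "\<sigma> t = (\<lambda>C\<in>carrier ?A. K +> (coset_rep R I C \<otimes> t))" for t
  have \<sigma>: "\<sigma> t (I +> r) = K +> (r \<otimes> t)" if t: "t \<in> ?X" and r: "r \<in> carrier R" for t r
  proof -
    let ?r = "coset_rep R I (I +> r)"
    have rc: "?r \<in> carrier R" using coset_rep(1)[OF cr I] r by (simp add: csI)
    have "(?r \<ominus> r) \<otimes> t \<in> K" using coset_rep_diff[OF cr I r] t m_comm[of t "?r \<ominus> r"] rc r by (auto simp: colon_def)
    moreover have "(?r \<ominus> r) \<otimes> t = ?r \<otimes> t \<ominus> r \<otimes> t"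
      using rc r Xc[OF t] by (simp add: minus_eq l_distr l_minus)
    ultimately show ?thesis unfolding \<sigma>_def using rc r Xc[OF t] by (simp add: csI csK)
  qed
  have \<sigma>H: "\<sigma> t \<in> carrier ?H" if t: "t \<in> ?X" for t
  proof -
    have "\<sigma> t \<in> mod_hom R ?A ?B"
      by (rule mod_homI) (use t Xc[OF t] in \<open>auto simp: csI csK \<sigma> l_distr m_assoc\<close>)
    then show ?thesis unfolding car by (simp add: \<sigma>_def)
  qed
  have \<sigma>e: "\<sigma> t \<in> extensional (carrier ?A)" for t by (simp add: \<sigma>_def)
  have ext: "h = k" if "h \<in> extensional (carrier ?A)" "k \<in> extensional (carrier ?A)" "\<And>r. r \<in> carrier R \<Longrightarrow> h (I +> r) = k (I +> r)" for h k
    using that by (intro extensionalityI[of h "carrier ?A" k]) (auto simp: csI)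
  have hom: "\<sigma> \<in> mod_hom R ?D ?H"
  proof (rule mod_homI)
    fix x assume x: "x \<in> carrier ?D" then show "\<sigma> x \<in> carrier ?H" using \<sigma>H by simp
    fix y assume y: "y \<in> carrier ?D"
    have xy: "x \<oplus> y \<in> ?X" using submodule_add[OF Xi, of x y] x y by simp
    have "\<sigma> (x \<oplus> y) = \<sigma> x \<oplus>\<^bsub>?H\<^esub> \<sigma> y"
      by (rule ext[OF \<sigma>e]) (use x y xy Xc in \<open>auto simp: \<sigma> ops csI csK r_distr\<close>)
    then show "\<sigma> (x \<oplus>\<^bsub>?D\<^esub> y) = \<sigma> x \<oplus>\<^bsub>?H\<^esub> \<sigma> y" by simp
  next
    fix r x assume r: "r \<in> carrier R" and x: "x \<in> carrier ?D"
    have rx: "r \<otimes> x \<in> ?X" using submodule_smult[OF Xi r, of x] x by simp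
    have "\<sigma> (r \<otimes> x) = r \<odot>\<^bsub>?H\<^esub> \<sigma> x"
      by (rule ext[OF \<sigma>e]) (use r x rx Xc in \<open>auto simp: \<sigma> ops csI csK m_lcomm\<close>)
    then show "\<sigma> (r \<odot>\<^bsub>?D\<^esub> x) = r \<odot>\<^bsub>?H\<^esub> \<sigma> x" by simp
  qed
  have onto: "\<sigma> ` carrier ?D = carrier ?H"
  proof
    show "\<sigma> ` carrier ?D \<subseteq> carrier ?H" using \<sigma>H by auto
    show "carrier ?H \<subseteq> \<sigma> ` carrier ?D"
    proof
      fix h assume h: "h \<in> carrier ?H"
      then have hh: "h \<in> mod_hom R ?A ?B" by (simp add: car)
      have "h (I +> \<one>) \<in> carrier ?B" using mod_hom_closed[OF hh] by (simp add: csI)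
      then obtain t where t: "t \<in> carrier R" "h (I +> \<one>) = K +> t" by (auto simp: csK)
      have hr: "h (I +> r) = K +> (r \<otimes> t)" if "r \<in> carrier R" for r
        using mod_hom_smult[OF hh that, of "I +> \<one>"] that t by (simp add: csI csK)
      have "t \<otimes> r \<in> K" if r: "r \<in> I" for r
      proof -
        have rc: "r \<in> carrier R" using r by (rule I.Icarr)
        have "I +> r = \<zero>\<^bsub>?A\<^esub>" using r rc by (simp add: csI)
        then have "K +> (r \<otimes> t) = K" using hr[OF rc] mod_hom_zero[OF A B hh] by (simp add: csK)
        then show ?thesis using rc t(1) by (simp add: csK m_comm)
      qed
      then have tX: "t \<in> ?X" using t by (simp add: colon_def)
      have "h = \<sigma> t" by (rule ext[OF _ \<sigma>e]) (use h in \<open>simp_all add: car hr \<sigma>[OF tX]\<close>)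
      then show "h \<in> \<sigma> ` carrier ?D" using tX by simp
    qed
  qed
  have zero: "\<sigma> \<zero> = \<zero>\<^bsub>?H\<^esub>"
    by (rule ext[OF \<sigma>e]) (use submodule_zero[OF Xi] in \<open>auto simp: \<sigma> ops csI csK\<close>)
  have H: "module R ?H"
    by (rule module_of_surjection[where h = \<sigma>, OF D]) (use onto zero mod_hom_add[OF hom] mod_hom_smult[OF hom] in auto)
  have "a_kernel ?D ?H \<sigma> = K"
  proof (rule equalityI; rule subsetI)
    fix t assume "t \<in> a_kernel ?D ?H \<sigma>"
    then have t: "t \<in> ?X" "\<sigma> t = \<zero>\<^bsub>?H\<^esub>" by (auto simp: a_kernel_iff)
    have "\<sigma> t (I +> \<one>) = K" using t(2) by (simp add: ops csI csK)
    then show "t \<in> K" using \<sigma>[OF t(1) one_closed] Xc[OF t(1)] by (simp add: csK)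
  next
    fix t assume t: "t \<in> K"
    then have tc: "t \<in> carrier R" by (rule K.Icarr)
    then have tX: "t \<in> ?X" using t I.Icarr K.I_r_closed by (auto simp: colon_def)
    have "\<sigma> t = \<zero>\<^bsub>?H\<^esub>"
      by (rule ext[OF \<sigma>e]) (use t tc in \<open>auto simp: \<sigma>[OF tX] ops csI csK K.I_l_closed\<close>)
    then show "t \<in> a_kernel ?D ?H \<sigma>" using tX by (simp add: a_kernel_iff)
  qed
  then have "module_length R ?H = interval_length R ?D K ?X"
    using module_length_surj[OF D H hom onto] by simp
  also have "\<dots> = interval_length R ?S K ?X" by (rule interval_length_restr[OF S Xi]) simp
  finally show ?thesis .
qed

section \<open>Comparison of projective resolutions\<close>

lemma projective_is_module: "projective_module R P \<Longrightarrow> module R P"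
  by (simp add: projective_module_def)

lemma resolution_facts:
  fixes M (structure)
  assumes "projective_resolution R M P d e"
  shows "module R (P i)" "projective_module R (P i)" "d i \<in> mod_hom R (P (Suc i)) (P i)" "e \<in> mod_hom R (P 0) M"
    "e ` carrier (P 0) = carrier M"
    "x \<in> carrier (P (Suc 0)) \<Longrightarrow> e (d 0 x) = \<zero>"
    "x \<in> carrier (P (Suc (Suc i))) \<Longrightarrow> d i (d (Suc i) x) = \<zero>\<^bsub>P i\<^esub>"
    "x \<in> carrier (P 0) \<Longrightarrow> e x = \<zero> \<Longrightarrow> x \<in> d 0 ` carrier (P (Suc 0))"
    "x \<in> carrier (P (Suc i)) \<Longrightarrow> d i x = \<zero>\<^bsub>P i\<^esub> \<Longrightarrow> x \<in> d (Suc i) ` carrier (P (Suc (Suc i)))"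
proof -
  note * = assms[unfolded projective_resolution_def]
  show "module R (P i)" "projective_module R (P i)" "d i \<in> mod_hom R (P (Suc i)) (P i)" "e \<in> mod_hom R (P 0) M"
    "e ` carrier (P 0) = carrier M" using * by (auto simp: projective_is_module)
  have k: "d 0 ` carrier (P (Suc 0)) = a_kernel (P 0) M e"
     "d (Suc i) ` carrier (P (Suc (Suc i))) = a_kernel (P (Suc i)) (P i) (d i)" using * by auto
  show "x \<in> carrier (P (Suc 0)) \<Longrightarrow> e (d 0 x) = \<zero>" using k(1) by (auto simp: a_kernel_iff set_eq_iff)
  show "x \<in> carrier (P (Suc (Suc i))) \<Longrightarrow> d i (d (Suc i) x) = \<zero>\<^bsub>P i\<^esub>" using k(2) by (auto simp: a_kernel_iff set_eq_iff)
  show "x \<in> carrier (P 0) \<Longrightarrow> e x = \<zero> \<Longrightarrow> x \<in> d 0 ` carrier (P (Suc 0))" unfolding k(1) by (auto simp: a_kernel_iff)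
  show "x \<in> carrier (P (Suc i)) \<Longrightarrow> d i x = \<zero>\<^bsub>P i\<^esub> \<Longrightarrow> x \<in> d (Suc i) ` carrier (P (Suc (Suc i)))"
    unfolding k(2) by (auto simp: a_kernel_iff)
qed

lemma chain_map_exists:
  fixes P :: "nat \<Rightarrow> ('a, 'b) module" and P' :: "nat \<Rightarrow> ('a, 'c) module"
  assumes M: "module R M" and P: "projective_resolution R M P d e" and P': "projective_resolution R M P' d' e'"
  shows "\<exists>F. (\<forall>i. F i \<in> mod_hom R (P i) (P' i)) \<and> (\<forall>x\<in>carrier (P 0). e' (F 0 x) = e x) \<and>
    (\<forall>i. \<forall>x\<in>carrier (P (Suc i)). d' i (F (Suc i) x) = F i (d i x))"
proof -
  note r = resolution_facts[OF P] and r' = resolution_facts[OF P']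
  let ?P = "\<lambda>n F. F \<in> mod_hom R (P n) (P' n) \<and> (\<forall>x\<in>carrier (P (Suc n)). F (d n x) \<in> d' n ` carrier (P' (Suc n)))
     \<and> (n = 0 \<longrightarrow> (\<forall>x\<in>carrier (P 0). e' (F x) = e x))"
  let ?Q = "\<lambda>n F F'. \<forall>x\<in>carrier (P (Suc n)). d' n (F' x) = F (d n x)"
  have "\<exists>F. \<forall>n. ?P n (F n) \<and> ?Q n (F n) (F (Suc n))"
  proof (rule dependent_nat_choice)
    have "e x \<in> e' ` carrier (P' 0)" if "x \<in> carrier (P 0)" for x
      unfolding r'(5) using mod_hom_closed[OF r(4) that] .
    from projective_lift[OF r(2) r'(1) M r'(4) r(4) this]
    obtain F where F: "F \<in> mod_hom R (P 0) (P' 0)" "\<forall>x\<in>carrier (P 0). e' (F x) = e x" by blast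
    have "F (d 0 x) \<in> d' 0 ` carrier (P' (Suc 0))" if x: "x \<in> carrier (P (Suc 0))" for x
    proof (rule r'(8))
      have dx: "d 0 x \<in> carrier (P 0)" by (rule mod_hom_closed[OF r(3) x])
      then show "F (d 0 x) \<in> carrier (P' 0)" by (rule mod_hom_closed[OF F(1)])
      show "e' (F (d 0 x)) = \<zero>\<^bsub>M\<^esub>" using F(2) dx r(6)[OF x] by simp
    qed
    then show "\<exists>F. ?P 0 F" using F by blast
  next
    fix F n assume F: "?P n F"
    have c: "(\<lambda>x. F (d n x)) \<in> mod_hom R (P (Suc n)) (P' n)" using F mod_hom_comp[OF _ r(3)] by blast
    have "F (d n x) \<in> d' n ` carrier (P' (Suc n))" if "x \<in> carrier (P (Suc n))" for x using F that by blast
    from projective_lift[OF r(2) r'(1) r'(1) r'(3) c this]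
    obtain F' where F': "F' \<in> mod_hom R (P (Suc n)) (P' (Suc n))" "\<forall>x\<in>carrier (P (Suc n)). d' n (F' x) = F (d n x)" by blast
    have "F' (d (Suc n) x) \<in> d' (Suc n) ` carrier (P' (Suc (Suc n)))" if x: "x \<in> carrier (P (Suc (Suc n)))" for x
    proof (rule r'(9))
      have dx: "d (Suc n) x \<in> carrier (P (Suc n))" by (rule mod_hom_closed[OF r(3) x])
      then show "F' (d (Suc n) x) \<in> carrier (P' (Suc n))" by (rule mod_hom_closed[OF F'(1)])
      have "F \<in> mod_hom R (P n) (P' n)" using F by blast
      from mod_hom_zero[OF r(1) r'(1) this]
      show "d' n (F' (d (Suc n) x)) = \<zero>\<^bsub>P' n\<^esub>" using F'(2) dx r(7)[OF x] by simp
    qed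
    then show "\<exists>F'. ?P (Suc n) F' \<and> ?Q n F F'" using F' by blast
  qed
  then obtain F where F: "\<And>n. ?P n (F n)" "\<And>n. ?Q n (F n) (F (Suc n))" by blast
  then show ?thesis by (intro exI[of _ F]) auto
qed

text
  \<open>The homotopy is built degree by degree: what remains of \<open>F\<close> after subtracting the part already found is a cycle, hence lifts along the next differential.\<close>
lemma chain_homotopy_exists:
  fixes P :: "nat \<Rightarrow> ('a, 'b) module" and P' :: "nat \<Rightarrow> ('a, 'c) module"
  assumes M: "module R M" and M': "module R M'" and P: "projective_resolution R M P d e" and P': "projective_resolution R M' P' d' e'"
    and F: "\<And>i. F i \<in> mod_hom R (P i) (P' i)" "\<And>x. x \<in> carrier (P 0) \<Longrightarrow> e' (F 0 x) = \<zero>\<^bsub>M'\<^esub>"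
      "\<And>i x. x \<in> carrier (P (Suc i)) \<Longrightarrow> d' i (F (Suc i) x) = F i (d i x)"
  shows "\<exists>s. (\<forall>i. s i \<in> mod_hom R (P i) (P' (Suc i))) \<and> (\<forall>x\<in>carrier (P 0). F 0 x = d' 0 (s 0 x)) \<and>
    (\<forall>i. \<forall>x\<in>carrier (P (Suc i)). F (Suc i) x = d' (Suc i) (s (Suc i) x) \<oplus>\<^bsub>P' (Suc i)\<^esub> s i (d i x))"
proof -
  note r = resolution_facts[OF P] and r' = resolution_facts[OF P']
  let ?D = "\<lambda>n s x. F (Suc n) x \<ominus>\<^bsub>P' (Suc n)\<^esub> s (d n x)"
  let ?P = "\<lambda>n s. s \<in> mod_hom R (P n) (P' (Suc n)) \<and> (\<forall>x\<in>carrier (P (Suc n)). ?D n s x \<in> d' (Suc n) ` carrier (P' (Suc (Suc n))))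
     \<and> (n = 0 \<longrightarrow> (\<forall>x\<in>carrier (P 0). F 0 x = d' 0 (s x)))"
  let ?Q = "\<lambda>n s s'. \<forall>x\<in>carrier (P (Suc n)). d' (Suc n) (s' x) = ?D n s x"
  have Dh: "?D n s \<in> mod_hom R (P (Suc n)) (P' (Suc n))" if "s \<in> mod_hom R (P n) (P' (Suc n))" for n s
    by (rule mod_hom_diff[OF r'(1) F(1) mod_hom_comp[OF that r(3)]])
  have "\<exists>s. \<forall>n. ?P n (s n) \<and> ?Q n (s n) (s (Suc n))"
  proof (rule dependent_nat_choice)
    have "F 0 x \<in> d' 0 ` carrier (P' (Suc 0))" if x: "x \<in> carrier (P 0)" for x
      by (rule r'(8)[OF mod_hom_closed[OF F(1) x] F(2)[OF x]])
    from projective_lift[OF r(2) r'(1) r'(1) r'(3) F(1) this]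
    obtain s where s: "s \<in> mod_hom R (P 0) (P' (Suc 0))" "\<forall>x\<in>carrier (P 0). d' 0 (s x) = F 0 x" by blast
    have "?D 0 s x \<in> d' (Suc 0) ` carrier (P' (Suc (Suc 0)))" if x: "x \<in> carrier (P (Suc 0))" for x
    proof (rule r'(9)[OF mod_hom_closed[OF Dh[OF s(1)] x]])
      have dx: "d 0 x \<in> carrier (P 0)" by (rule mod_hom_closed[OF r(3) x])
      have "d' 0 (?D 0 s x) = d' 0 (F (Suc 0) x) \<ominus>\<^bsub>P' 0\<^esub> d' 0 (s (d 0 x))"
        by (rule mod_hom_minus[OF r'(1) r'(1) r'(3) mod_hom_closed[OF F(1) x] mod_hom_closed[OF s(1) dx]])
      then show "d' 0 (?D 0 s x) = \<zero>\<^bsub>P' 0\<^esub>"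
        using s(2) dx F(3)[OF x] mod_hom_closed[OF F(1) dx] module_minus_cancel(4)[OF r'(1), of "F 0 (d 0 x)" 0 "F 0 (d 0 x)"] by simp
    qed
    then show "\<exists>s. ?P 0 s" using s by (intro exI[of _ s]) auto
  next
    fix s n assume s: "?P n s"
    then have sh: "s \<in> mod_hom R (P n) (P' (Suc n))" by blast
    have "?D n s x \<in> d' (Suc n) ` carrier (P' (Suc (Suc n)))" if "x \<in> carrier (P (Suc n))" for x using s that by blast
    from projective_lift[OF r(2) r'(1) r'(1) r'(3) Dh[OF sh] this]
    obtain s' where s': "s' \<in> mod_hom R (P (Suc n)) (P' (Suc (Suc n)))" "\<forall>x\<in>carrier (P (Suc n)). d' (Suc n) (s' x) = ?D n s x" by blast
    have "?D (Suc n) s' x \<in> d' (Suc (Suc n)) ` carrier (P' (Suc (Suc (Suc n))))" if x: "x \<in> carrier (P (Suc (Suc n)))" for x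
    proof (rule r'(9)[OF mod_hom_closed[OF Dh[OF s'(1)] x]])
      have dx: "d (Suc n) x \<in> carrier (P (Suc n))" by (rule mod_hom_closed[OF r(3) x])
      interpret M': module R "P' (Suc n)" by (rule r'(1))
      have "?D n s (d (Suc n) x) = F (Suc n) (d (Suc n) x)"
        using r(7)[OF x] mod_hom_zero[OF r(1) r'(1) sh] mod_hom_closed[OF F(1) dx] by (simp add: M'.minus_eq)
      moreover have "d' (Suc n) (?D (Suc n) s' x) = d' (Suc n) (F (Suc (Suc n)) x) \<ominus>\<^bsub>P' (Suc n)\<^esub> d' (Suc n) (s' (d (Suc n) x))"
        by (rule mod_hom_minus[OF r'(1) r'(1) r'(3) mod_hom_closed[OF F(1) x] mod_hom_closed[OF s'(1) dx]])
      ultimately show "d' (Suc n) (?D (Suc n) s' x) = \<zero>\<^bsub>P' (Suc n)\<^esub>"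
        using s'(2) dx F(3)[OF x] mod_hom_closed[OF F(1) dx]
          module_minus_cancel(4)[OF r'(1), of "F (Suc n) (d (Suc n) x)" "Suc n" "F (Suc n) (d (Suc n) x)"] by simp
    qed
    then show "\<exists>s'. ?P (Suc n) s' \<and> ?Q n s s'" using s' by (intro exI[of _ s']) auto
  qed
  then obtain s where s: "\<And>n. ?P n (s n)" "\<And>n. ?Q n (s n) (s (Suc n))" by blast
  have "F (Suc i) x = d' (Suc i) (s (Suc i) x) \<oplus>\<^bsub>P' (Suc i)\<^esub> s i (d i x)" if x: "x \<in> carrier (P (Suc i))" for i x
  proof -
    have "s i \<in> mod_hom R (P i) (P' (Suc i))" using s(1) by blast
    from mod_hom_closed[OF this mod_hom_closed[OF r(3) x]] mod_hom_closed[OF F(1) x]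
    show ?thesis using s(2)[of i] x module_minus_cancel(1)[OF r'(1)] by simp
  qed
  then show ?thesis using s(1) by (intro exI[of _ s]) auto
qed

text \<open>The difference of the two lifts covers zero.\<close>
lemma lift_of_identity_homotopic:
  assumes M: "module R M" and P: "projective_resolution R M P d e"
    and h: "\<And>i. h i \<in> mod_hom R (P i) (P i)" and h0: "\<And>x. x \<in> carrier (P 0) \<Longrightarrow> e (h 0 x) = e x"
    and hd: "\<And>i x. x \<in> carrier (P (Suc i)) \<Longrightarrow> d i (h (Suc i) x) = h i (d i x)"
  shows "\<exists>s. (\<forall>i. s i \<in> mod_hom R (P i) (P (Suc i))) \<and>
    (\<forall>i. \<forall>x\<in>carrier (P (Suc i)). h (Suc i) x \<ominus>\<^bsub>P (Suc i)\<^esub> x = d (Suc i) (s (Suc i) x) \<oplus>\<^bsub>P (Suc i)\<^esub> s i (d i x))"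
proof -
  note r = resolution_facts[OF P] and hc = mod_hom_closed[OF h]
  have "\<exists>s. (\<forall>i. s i \<in> mod_hom R (P i) (P (Suc i))) \<and> (\<forall>x\<in>carrier (P 0). h 0 x \<ominus>\<^bsub>P 0\<^esub> x = d 0 (s 0 x)) \<and>
    (\<forall>i. \<forall>x\<in>carrier (P (Suc i)). h (Suc i) x \<ominus>\<^bsub>P (Suc i)\<^esub> x = d (Suc i) (s (Suc i) x) \<oplus>\<^bsub>P (Suc i)\<^esub> s i (d i x))"
  proof (rule chain_homotopy_exists[OF M M P P, where F = "\<lambda>i x. h i x \<ominus>\<^bsub>P i\<^esub> x"])
    show "(\<lambda>x. h i x \<ominus>\<^bsub>P i\<^esub> x) \<in> mod_hom R (P i) (P i)" for i by (rule mod_hom_diff[OF r(1) h mod_hom_id])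
    show "e (h 0 x \<ominus>\<^bsub>P 0\<^esub> x) = \<zero>\<^bsub>M\<^esub>" if x: "x \<in> carrier (P 0)" for x
      using mod_hom_minus[OF r(1) M r(4) hc[OF x] x] h0[OF x]
        module_minus_cancel(4)[OF M mod_hom_closed[OF r(4) x] mod_hom_closed[OF r(4) x]] by simp
    show "d i (h (Suc i) x \<ominus>\<^bsub>P (Suc i)\<^esub> x) = h i (d i x) \<ominus>\<^bsub>P i\<^esub> d i x" if x: "x \<in> carrier (P (Suc i))" for i x
      using mod_hom_minus[OF r(1) r(1) r(3) hc[OF x] x] hd[OF x] by simp
  qed
  then show ?thesis by (elim exE conjE) (intro exI conjI)
qed

section \<open>Base change of maps between free modules\<close>

text
  \<open>The matrix of \<open>h\<close> with \<open>\<psi>\<close> applied to its entries, as a linear map over \<open>S\<close>; for \<open>\<psi> = f\<^sup>n\<close> this is the Frobenius functor on maps of free modules.\<close>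
definition base_change :: "('s, 't) ring_scheme \<Rightarrow> ('a, 'r) ring_scheme \<Rightarrow> ('a \<Rightarrow> 's) \<Rightarrow> 'y set \<Rightarrow> (('x \<Rightarrow> 'a) \<Rightarrow> ('y \<Rightarrow> 'a))
    \<Rightarrow> ('x \<Rightarrow> 's) \<Rightarrow> ('y \<Rightarrow> 's)" where
  "base_change S R \<psi> U h = free_lift S (free_module S U) (\<lambda>x. \<psi> \<circ> h (free_basis R x))"

text \<open>This is \<open>I\<close> times the free module on \<open>T\<close>.\<close>
definition ideal_vectors :: "('a, 'r) ring_scheme \<Rightarrow> 'a set \<Rightarrow> 'x set \<Rightarrow> ('x \<Rightarrow> 'a) set" where
  "ideal_vectors R I T = {v \<in> carrier (free_module R T). \<forall>x. v x \<in> I}"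

lemma ideal_vectors_submodule:
  assumes "cring R" "ideal I R"
  shows "submodule (ideal_vectors R I T) R (free_module R T)"
proof -
  interpret I: ideal I R by fact
  interpret F: module R "free_module R T" by (rule free_is_module[OF assms(1)])
  show ?thesis
  proof (rule submoduleI'[OF free_is_module[OF assms(1)]])
    show "ideal_vectors R I T \<subseteq> carrier (free_module R T)" by (auto simp: ideal_vectors_def)
    show "\<zero>\<^bsub>free_module R T\<^esub> \<in> ideal_vectors R I T"
      unfolding ideal_vectors_def using F.M.zero_closed by (simp add: free_simps)
  next
    fix x y assume "x \<in> ideal_vectors R I T" "y \<in> ideal_vectors R I T"
    then show "x \<oplus>\<^bsub>free_module R T\<^esub> y \<in> ideal_vectors R I T"
      unfolding ideal_vectors_def using F.M.a_closed[of x y] by (simp add: free_simps)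
  next
    fix r x assume "r \<in> carrier R" "x \<in> ideal_vectors R I T"
    then show "r \<odot>\<^bsub>free_module R T\<^esub> x \<in> ideal_vectors R I T"
      unfolding ideal_vectors_def using F.smult_closed[of r x] by (simp add: free_simps I.I_l_closed)
  qed
qed

lemma hom_of_ideal_vector:
  assumes cr: "cring R" and M: "module R M" and h: "h \<in> mod_hom R (free_module R T) M" and K: "submodule K R M"
    and IK: "\<And>r m. r \<in> I \<Longrightarrow> m \<in> carrier M \<Longrightarrow> r \<odot>\<^bsub>M\<^esub> m \<in> K" and v: "v \<in> ideal_vectors R I T"
  shows "h v \<in> K"
proof -
  interpret M: module R M by fact
  have vF: "v \<in> carrier (free_module R T)" and vI: "\<And>x. v x \<in> I" using v by (auto simp: ideal_vectors_def)
  have "h v = free_lift R M (\<lambda>x. h (free_basis R x)) v" by (rule hom_eq_free_lift[OF cr M h vF]) simp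
  also have "\<dots> \<in> K" unfolding free_lift_def
  proof (intro submodule_finsum[OF M K free_mem_support[OF vF]] Pi_I)
    fix x assume "x \<in> {x. v x \<noteq> \<zero>\<^bsub>R\<^esub>}"
    then have "x \<in> T" using free_mem_off[OF vF] by auto
    then have "h (free_basis R x) \<in> carrier M" by (intro mod_hom_closed[OF h] free_basis_closed[OF cr])
    then show "v x \<odot>\<^bsub>M\<^esub> h (free_basis R x) \<in> K" by (rule IK[OF vI])
  qed
  finally show ?thesis .
qed

lemma ideal_vectors_hom:
  assumes cr: "cring R" and I: "ideal I R" and h: "h \<in> mod_hom R (free_module R T) (free_module R U)"
    and v: "v \<in> ideal_vectors R I T"
  shows "h v \<in> ideal_vectors R I U"
proof (rule hom_of_ideal_vector[OF cr free_is_module[OF cr] h ideal_vectors_submodule[OF cr I] _ v])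
  interpret I: ideal I R by fact
  interpret U: module R "free_module R U" by (rule free_is_module[OF cr])
  fix r m assume rm: "r \<in> I" "m \<in> carrier (free_module R U)"
  then have "r \<odot>\<^bsub>free_module R U\<^esub> m \<in> carrier (free_module R U)" by (intro U.smult_closed I.Icarr)
  then show "r \<odot>\<^bsub>free_module R U\<^esub> m \<in> ideal_vectors R I U"
    unfolding ideal_vectors_def using rm free_mem_closed[OF cr rm(2)] by (simp add: free_simps I.I_r_closed)
qed

context
  fixes R :: "('a, 'r) ring_scheme" and S :: "('s, 't) ring_scheme" and \<psi> :: "'a \<Rightarrow> 's"
  assumes R: "cring R" and S: "cring S" and psi: "\<psi> \<in> ring_hom R S"
begin

interpretation R: cring R by (rule R)
interpretation S: cring S by (rule S)
interpretation psi: ring_hom_cring R S \<psi>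
  by (intro ring_hom_cring.intro ring_hom_cring_axioms.intro psi R S)

lemma psi_vector: "v \<in> carrier (free_module R T) \<Longrightarrow> \<psi> \<circ> v \<in> carrier (free_module S T)"
proof -
  assume v: "v \<in> carrier (free_module R T)"
  have "{x. (\<psi> \<circ> v) x \<noteq> \<zero>\<^bsub>S\<^esub>} \<subseteq> {x. v x \<noteq> \<zero>\<^bsub>R\<^esub>}" by auto
  from finite_subset[OF this free_mem_support[OF v]] show ?thesis using v by (auto simp: free_mem_iff)
qed

lemma psi_basis: "\<psi> \<circ> free_basis R x = free_basis S x"
  by (auto simp: free_basis_def)

lemma psi_vector_add: "v \<in> carrier (free_module R T) \<Longrightarrow> w \<in> carrier (free_module R T) \<Longrightarrow>
   \<psi> \<circ> (v \<oplus>\<^bsub>free_module R T\<^esub> w) = (\<psi> \<circ> v) \<oplus>\<^bsub>free_module S T\<^esub> (\<psi> \<circ> w)"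
  by (auto simp: free_simps free_mem_closed[OF R])

lemma psi_vector_smult: "r \<in> carrier R \<Longrightarrow> v \<in> carrier (free_module R T) \<Longrightarrow>
   \<psi> \<circ> (r \<odot>\<^bsub>free_module R T\<^esub> v) = \<psi> r \<odot>\<^bsub>free_module S T\<^esub> (\<psi> \<circ> v)"
  by (auto simp: free_simps free_mem_closed[OF R])

lemma base_change_hom:
  assumes "h \<in> mod_hom R (free_module R T) (free_module R U)"
  shows "base_change S R \<psi> U h \<in> mod_hom S (free_module S T) (free_module S U)"
  unfolding base_change_def
  by (rule free_lift_hom[OF free_is_module[OF S]])
    (use psi_vector mod_hom_closed[OF assms] free_basis_closed[OF R, of _ T] in blast)

lemma base_change_basis:
  assumes "h \<in> mod_hom R (free_module R T) (free_module R U)" "x \<in> T"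
  shows "base_change S R \<psi> U h (free_basis S x) = \<psi> \<circ> h (free_basis R x)"
  unfolding base_change_def
  by (rule free_lift_basis[where g = "\<lambda>x. \<psi> \<circ> h (free_basis R x)", OF free_is_module[OF S] psi_vector[OF mod_hom_closed[OF assms(1) free_basis_closed[OF R assms(2)]]]])

lemma base_change_psi:
  assumes h: "h \<in> mod_hom R (free_module R T) (free_module R U)" and v: "v \<in> carrier (free_module R T)"
  shows "base_change S R \<psi> U h (\<psi> \<circ> v) = \<psi> \<circ> h v"
proof -
  let ?FT = "free_module R T" and ?FU = "free_module R U"
  note FT = free_is_module[OF R, of T] and FU = free_is_module[OF R, of U]
  note ST = free_is_module[OF S, of T] and SU = free_is_module[OF S, of U]
  note b = base_change_hom[OF h]
  have hc: "h v \<in> carrier ?FU" if "v \<in> carrier ?FT" for v using mod_hom_closed[OF h that] .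
  let ?K = "{v \<in> carrier ?FT. base_change S R \<psi> U h (\<psi> \<circ> v) = \<psi> \<circ> h v}"
  interpret FT: module R ?FT by (rule FT)
  have "submodule ?K R ?FT"
  proof (rule submoduleI'[OF FT])
    have z: "\<psi> \<circ> \<zero>\<^bsub>free_module R T'\<^esub> = \<zero>\<^bsub>free_module S T'\<^esub>" for T' :: "'z set" by (auto simp: free_simps)
    show "\<zero>\<^bsub>?FT\<^esub> \<in> ?K" using z[of T] z[of U] mod_hom_zero[OF FT FU h] mod_hom_zero[OF ST SU b] by simp
  qed (auto simp: psi_vector_add psi_vector_smult psi_vector hc mod_hom_add[OF h] mod_hom_add[OF b] mod_hom_smult[OF h] mod_hom_smult[OF b])
  from free_generated[OF R this _ v] show ?thesis
    using base_change_basis[OF h] by (simp add: free_basis_closed[OF R] psi_basis)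
qed

lemma base_change_eqI:
  assumes "h \<in> mod_hom R (free_module R T) (free_module R U)" "k \<in> mod_hom S (free_module S T) (free_module S U)"
    "\<And>x. x \<in> T \<Longrightarrow> k (free_basis S x) = \<psi> \<circ> h (free_basis R x)" "v \<in> carrier (free_module S T)"
  shows "base_change S R \<psi> U h v = k v"
  by (rule hom_eq_free[OF S free_is_module[OF S] base_change_hom[OF assms(1)] assms(2) _ assms(4)])
    (simp add: base_change_basis[OF assms(1)] assms(3))

lemma base_change_comp:
  assumes h: "h \<in> mod_hom R (free_module R T) (free_module R U)" and k: "k \<in> mod_hom R (free_module R U) (free_module R V)"
    and v: "v \<in> carrier (free_module S T)"
  shows "base_change S R \<psi> V (\<lambda>x. k (h x)) v = base_change S R \<psi> V k (base_change S R \<psi> U h v)"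
  by (rule base_change_eqI[OF mod_hom_comp[OF k h] mod_hom_comp[OF base_change_hom[OF k] base_change_hom[OF h]] _ v])
    (simp add: base_change_basis[OF h] base_change_psi[OF k] mod_hom_closed[OF h] free_basis_closed[OF R])

lemma base_change_add:
  assumes h: "h \<in> mod_hom R (free_module R T) (free_module R U)" and k: "k \<in> mod_hom R (free_module R T) (free_module R U)"
    and v: "v \<in> carrier (free_module S T)"
  shows "base_change S R \<psi> U (\<lambda>x. h x \<oplus>\<^bsub>free_module R U\<^esub> k x) v = base_change S R \<psi> U h v \<oplus>\<^bsub>free_module S U\<^esub> base_change S R \<psi> U k v"
  by (rule base_change_eqI[OF mod_hom_sum[OF free_is_module[OF R] h k]
        mod_hom_sum[OF free_is_module[OF S] base_change_hom[OF h] base_change_hom[OF k]] _ v])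
    (simp add: base_change_basis[OF h] base_change_basis[OF k] psi_vector_add mod_hom_closed[OF h] mod_hom_closed[OF k] free_basis_closed[OF R])

lemma base_change_scale:
  assumes r: "r \<in> carrier R" and v: "v \<in> carrier (free_module S T)"
  shows "base_change S R \<psi> T (\<lambda>x. r \<odot>\<^bsub>free_module R T\<^esub> x) v = \<psi> r \<odot>\<^bsub>free_module S T\<^esub> v"
  by (rule base_change_eqI[OF mod_hom_scale[OF free_is_module[OF R] mod_hom_id r]
        mod_hom_scale[OF free_is_module[OF S] mod_hom_id] _ v])
    (simp_all add: r psi_vector_smult[of _ _ T] free_basis_closed[OF R] psi_basis)

lemma base_change_id:
  assumes v: "v \<in> carrier (free_module S T)"
  shows "base_change S R \<psi> T (\<lambda>x. x) v = v"
  by (rule base_change_eqI[OF mod_hom_id mod_hom_id _ v]) (simp add: psi_basis)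

lemma base_change_cong:
  assumes h: "h \<in> mod_hom R (free_module R T) (free_module R U)" and k: "\<And>v. v \<in> carrier (free_module R T) \<Longrightarrow> h v = k v"
    and v: "v \<in> carrier (free_module S T)"
  shows "base_change S R \<psi> U h v = base_change S R \<psi> U k v"
proof -
  have "base_change S R \<psi> U k v = base_change S R \<psi> U h v"
    unfolding base_change_def[of S R \<psi> U k]
    by (rule hom_eq_free_lift[OF S free_is_module[OF S] base_change_hom[OF h] v, symmetric])
      (simp add: base_change_basis[OF h] k free_basis_closed[OF R])
  then show ?thesis by simp
qed

lemma base_change_zero:
  assumes h: "h \<in> mod_hom R (free_module R T) (free_module R U)" and z: "\<And>v. v \<in> carrier (free_module R T) \<Longrightarrow> h v = \<zero>\<^bsub>free_module R U\<^esub>"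
    and v: "v \<in> carrier (free_module S T)"
  shows "base_change S R \<psi> U h v = \<zero>\<^bsub>free_module S U\<^esub>"
  by (rule base_change_eqI[OF h mod_hom_zero_map[OF free_is_module[OF S]] _ v])
    (auto simp: z free_basis_closed[OF R] free_simps)

end

section \<open>Computation of Tor from a free resolution\<close>

lemma pure_zero_left:
  fixes M (structure)
  assumes R: "cring R" and S: "cring S" and psi: "\<psi> \<in> ring_hom R S" and M: "module R M" and N: "module S N" and y: "y \<in> carrier N"
  shows "pure_tensor R S \<psi> M N (\<zero>, y) = \<zero>\<^bsub>tensor_over R S \<psi> M N\<^esub>"
proof -
  interpret psi: ring_hom_cring R S \<psi> by (intro ring_hom_cring.intro ring_hom_cring_axioms.intro psi R S)
  interpret M: module R M by fact
  interpret N: module S N by fact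
  have p: "\<psi> \<in> carrier R \<rightarrow> carrier S" by auto
  interpret T: module S "tensor_over R S \<psi> M N" by (rule tensor_is_module[OF M N p])
  let ?p = "pure_tensor R S \<psi> M N"
  have "?p (\<zero>, y) = ?p (\<zero>\<^bsub>R\<^esub> \<odot> \<zero>, y)" by simp
  also have "\<dots> = ?p (\<zero>, \<zero>\<^bsub>S\<^esub> \<odot>\<^bsub>N\<^esub> y)" by (subst pure_balanced[OF M N p]) (auto simp: y)
  also have "\<dots> = \<zero>\<^bsub>S\<^esub> \<odot>\<^bsub>tensor_over R S \<psi> M N\<^esub> ?p (\<zero>, y)" by (rule pure_smult[OF M N p]) (auto simp: y)
  also have "\<dots> = \<zero>\<^bsub>tensor_over R S \<psi> M N\<^esub>" using pure_closed[OF M N p M.M.zero_closed y] by simp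
  finally show ?thesis .
qed

lemma submodule_restr_minus:
  assumes "module R M" "submodule K R M" "x \<in> K" "y \<in> K"
  shows "x \<ominus>\<^bsub>M\<lparr>carrier := K\<rparr>\<^esub> y = x \<ominus>\<^bsub>M\<^esub> y"
proof -
  interpret K: module R "M\<lparr>carrier := K\<rparr>" by (rule restr_module[OF assms(1,2)])
  have c: "x \<in> carrier M" "y \<in> carrier M" using submodule_subset[OF assms(2)] assms(3,4) by auto
  have "(x \<ominus>\<^bsub>M\<lparr>carrier := K\<rparr>\<^esub> y) \<oplus>\<^bsub>M\<^esub> y = x"
    using module_minus_cancel(1)[OF restr_module[OF assms(1,2)], of x y] assms(3,4) by simp
  moreover have "x \<ominus>\<^bsub>M\<lparr>carrier := K\<rparr>\<^esub> y \<in> carrier M"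
    using submodule_subset[OF assms(2)] K.M.minus_closed[of x y] assms(3,4) by simp
  ultimately show ?thesis using module_minus_cancel(3)[OF assms(1) _ c(2)] by metis
qed

lemma module_minus_rearrange:
  fixes M (structure)
  assumes M: "module R M" and v: "v \<in> carrier M" "a \<in> carrier M" "b \<in> carrier M" "q \<in> carrier M"
  shows "v \<ominus> (a \<ominus> b) = ((b \<oplus> q \<oplus> v) \<ominus> a) \<ominus> q"
proof -
  interpret M: module R M by fact
  have "(b \<oplus> q \<oplus> v) \<ominus> a = q \<oplus> (v \<ominus> (a \<ominus> b))"
    using v by (simp add: M.minus_eq M.minus_add M.a_ac)
  then show ?thesis using module_minus_cancel(5)[OF M, of "v \<ominus> (a \<ominus> b)" q] v by simp
qed

text
  \<open>A cyclic module \<open>N = S \<nu>\<close> with annihilator \<open>c\<close> turns \<open>P\<^sub>i \<otimes> N\<close> into the base-changed free module modulo \<open>c\<close>.  For an arbitrary projective resolution \<open>P\<close> this holds only up to homotopy: comparison maps \<open>f : P \<rightarrow> G\<close> and \<open>g : G \<rightarrow> P\<close> induce \<open>\<alpha>\<close> and \<open>\<beta>\<close> below, and the homotopies from \<open>g f\<close> and \<open>f g\<close> to the identity show that \<open>\<beta>\<close> is bijective on homology.  The cycles of the free complex are given as vectors over \<open>S\<close> whose differential has entries in \<open>c\<close>, so that the quotient by \<open>c\<close> need not be formed.\<close>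
lemma homology_of_tensored_resolution:
  fixes P :: "nat \<Rightarrow> ('a, 'b) module" and T :: "nat \<Rightarrow> 'x set" and N :: "('s, 'c) module" and j :: nat
  assumes R: "cring R" and S: "cring S" and psi: "\<psi> \<in> ring_hom R S"
    and M: "module R M" and P: "projective_resolution R M P d e"
    and G: "projective_resolution R M (\<lambda>i. free_module R (T i)) \<delta> \<epsilon>"
    and N: "module S N" and nu: "\<nu> \<in> carrier N" and gen: "\<And>y. y \<in> carrier N \<Longrightarrow> \<exists>s\<in>carrier S. y = s \<odot>\<^bsub>N\<^esub> \<nu>"
    and c_def: "c = {s \<in> carrier S. s \<odot>\<^bsub>N\<^esub> \<nu> = \<zero>\<^bsub>N\<^esub>}"
  defines "H \<equiv> homology (\<lambda>j. tensor_over R S \<psi> (P j) N) (\<lambda>j. tensor_map R S \<psi> (P j) N (d j)) (Suc j)"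
    and "V \<equiv> {v \<in> carrier (free_module S (T (Suc j))). base_change S R \<psi> (T j) (\<delta> j) v \<in> ideal_vectors S c (T j)}"
  shows "module S H" and "submodule V S (free_module S (T (Suc j)))"
    and "\<exists>\<pi>\<in>mod_hom S (free_module S (T (Suc j))\<lparr>carrier := V\<rparr>) H. \<pi> ` V = carrier H \<and>
      (\<forall>v\<in>V. \<pi> v = \<zero>\<^bsub>H\<^esub> \<longleftrightarrow> (\<exists>w\<in>carrier (free_module S (T (Suc (Suc j)))). \<exists>u\<in>ideal_vectors S c (T (Suc j)).
         v = base_change S R \<psi> (T (Suc j)) (\<delta> (Suc j)) w \<oplus>\<^bsub>free_module S (T (Suc j))\<^esub> u))"
proof -
  interpret psi: ring_hom_cring R S \<psi> by (intro ring_hom_cring.intro ring_hom_cring_axioms.intro psi R S)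
  interpret N: module S N by fact
  note rP = resolution_facts[OF P] and rG = resolution_facts[OF G]
  have p: "\<psi> \<in> carrier R \<rightarrow> carrier S" by auto
  have pS: "\<psi> r \<in> carrier S" if "r \<in> carrier R" for r using that by simp
  let ?F = "\<lambda>i. free_module R (T i)" and ?FS = "\<lambda>i. free_module S (T i)"
  have FSm: "module S (?FS i)" for i by (rule free_is_module[OF S])
  \<comment> \<open>comparison with the given resolution\<close>
  obtain f where f: "\<And>i. f i \<in> mod_hom R (P i) (?F i)" "\<And>x. x \<in> carrier (P 0) \<Longrightarrow> \<epsilon> (f 0 x) = e x"
    "\<And>i x. x \<in> carrier (P (Suc i)) \<Longrightarrow> \<delta> i (f (Suc i) x) = f i (d i x)"
    using chain_map_exists[OF M P G] by blast
  obtain g where g: "\<And>i. g i \<in> mod_hom R (?F i) (P i)" "\<And>x. x \<in> carrier (?F 0) \<Longrightarrow> e (g 0 x) = \<epsilon> x"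
    "\<And>i x. x \<in> carrier (?F (Suc i)) \<Longrightarrow> d i (g (Suc i) x) = g i (\<delta> i x)"
    using chain_map_exists[OF M G P] by blast
  note fc = mod_hom_closed[OF f(1)] and gc = mod_hom_closed[OF g(1)] and dc = mod_hom_closed[OF rP(3)] and \<delta>c = mod_hom_closed[OF rG(3)]
  have "\<exists>s. (\<forall>i. s i \<in> mod_hom R (P i) (P (Suc i))) \<and>
    (\<forall>i. \<forall>x\<in>carrier (P (Suc i)). g (Suc i) (f (Suc i) x) \<ominus>\<^bsub>P (Suc i)\<^esub> x = d (Suc i) (s (Suc i) x) \<oplus>\<^bsub>P (Suc i)\<^esub> s i (d i x))"
    by (rule lift_of_identity_homotopic[OF M P mod_hom_comp[OF g(1) f(1)]]) (simp_all add: f g fc gc)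
  then obtain s where s: "\<And>i. s i \<in> mod_hom R (P i) (P (Suc i))"
    "\<And>i x. x \<in> carrier (P (Suc i)) \<Longrightarrow> g (Suc i) (f (Suc i) x) \<ominus>\<^bsub>P (Suc i)\<^esub> x = d (Suc i) (s (Suc i) x) \<oplus>\<^bsub>P (Suc i)\<^esub> s i (d i x)"
    by blast
  have "\<exists>t. (\<forall>i. t i \<in> mod_hom R (?F i) (?F (Suc i))) \<and>
    (\<forall>i. \<forall>x\<in>carrier (?F (Suc i)). f (Suc i) (g (Suc i) x) \<ominus>\<^bsub>?F (Suc i)\<^esub> x = \<delta> (Suc i) (t (Suc i) x) \<oplus>\<^bsub>?F (Suc i)\<^esub> t i (\<delta> i x))"
    by (rule lift_of_identity_homotopic[OF M G mod_hom_comp[OF f(1) g(1)]]) (simp_all add: f g fc gc)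
  then obtain t where t: "\<And>i. t i \<in> mod_hom R (?F i) (?F (Suc i))"
    "\<And>i x. x \<in> carrier (?F (Suc i)) \<Longrightarrow> f (Suc i) (g (Suc i) x) \<ominus>\<^bsub>?F (Suc i)\<^esub> x = \<delta> (Suc i) (t (Suc i) x) \<oplus>\<^bsub>?F (Suc i)\<^esub> t i (\<delta> i x)"
    by blast
  \<comment> \<open>the ideal annihilating \<open>\<nu>\<close>\<close>
  have cI: "ideal c S" unfolding submodule_self_iff[OF S, symmetric] c_def
    by (rule submoduleI'[OF self_is_module[OF S]]) (auto simp: nu N.smult_l_distr N.smult_assoc1)
  interpret c: ideal c S by (rule cI)
  let ?IV = "\<lambda>i. ideal_vectors S c (T i)"
  have IV: "submodule (?IV i) S (?FS i)" for i by (rule ideal_vectors_submodule[OF S cI])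
  \<comment> \<open>the tensored complex\<close>
  define C where "C i = tensor_over R S \<psi> (P i) N" for i
  define pt where "pt i = pure_tensor R S \<psi> (P i) N" for i
  define \<Delta> where "\<Delta> i = tensor_map R S \<psi> (P i) N (d i)" for i
  have C: "module S (C i)" for i unfolding C_def by (rule tensor_is_module[OF rP(1) N p])
  note pc = pure_closed[OF rP(1) N p, folded C_def pt_def] and pal = pure_add_left[OF rP(1) N p, folded C_def pt_def]
    and par = pure_add_right[OF rP(1) N p, folded C_def pt_def] and pb = pure_balanced[OF rP(1) N p, folded C_def pt_def]
    and ps = pure_smult[OF rP(1) N p, folded C_def pt_def] and pz = pure_zero_left[OF R S psi rP(1) N, folded C_def pt_def]
    and heq = hom_eq_tensor[OF rP(1) N p, folded C_def pt_def]
  have tm: "tensor_map R S \<psi> (P k) N h \<in> mod_hom S (C i) (C k)"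
      "\<And>x y. x \<in> carrier (P i) \<Longrightarrow> y \<in> carrier N \<Longrightarrow> tensor_map R S \<psi> (P k) N h (pt i (x, y)) = pt k (h x, y)"
    if "h \<in> mod_hom R (P i) (P k)" for h i k
    using tensor_map[OF rP(1) rP(1) N p that] unfolding C_def pt_def by auto
  have \<Delta>: "\<Delta> i \<in> mod_hom S (C (Suc i)) (C i)"
      "\<And>x y. x \<in> carrier (P (Suc i)) \<Longrightarrow> y \<in> carrier N \<Longrightarrow> \<Delta> i (pt (Suc i) (x, y)) = pt i (d i x, y)" for i
    using tm[OF rP(3)] unfolding \<Delta>_def by auto
  have \<Delta>\<Delta>: "\<Delta> i (\<Delta> (Suc i) z) = \<zero>\<^bsub>C i\<^esub>" if "z \<in> carrier (C (Suc (Suc i)))" for i z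
    by (rule heq[OF C mod_hom_comp[OF \<Delta>(1) \<Delta>(1)] mod_hom_zero_map[OF C] _ that]) (simp add: \<Delta>(2) dc rP(7) pz)
  have cC: "r \<odot>\<^bsub>C i\<^esub> z = \<zero>\<^bsub>C i\<^esub>" if r: "r \<in> c" and z: "z \<in> carrier (C i)" for r i z
  proof (rule heq[OF C mod_hom_scale[OF C mod_hom_id] mod_hom_zero_map[OF C] _ z])
    interpret Ci: module S "C i" by (rule C)
    show rS: "r \<in> carrier S" using r by (rule c.Icarr)
    fix x y assume x: "x \<in> carrier (P i)" and y: "y \<in> carrier N"
    obtain s where s: "s \<in> carrier S" "y = s \<odot>\<^bsub>N\<^esub> \<nu>" using gen[OF y] by blast
    have "r \<odot>\<^bsub>N\<^esub> y = s \<odot>\<^bsub>N\<^esub> (r \<odot>\<^bsub>N\<^esub> \<nu>)" using rS s nu by (simp add: N.smult_assoc1[symmetric] psi.S.m_comm)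
    also have "r \<odot>\<^bsub>N\<^esub> \<nu> = \<zero>\<^bsub>N\<^esub>" using r unfolding c_def by blast
    also have "s \<odot>\<^bsub>N\<^esub> \<zero>\<^bsub>N\<^esub> = \<zero>\<^bsub>N\<^esub>" by (rule N.smult_r_null[OF s(1)])
    finally have "r \<odot>\<^bsub>N\<^esub> y = \<zero>\<^bsub>S\<^esub> \<odot>\<^bsub>N\<^esub> y" using y by simp
    then have "r \<odot>\<^bsub>C i\<^esub> pt i (x, y) = \<zero>\<^bsub>S\<^esub> \<odot>\<^bsub>C i\<^esub> pt i (x, y)"
      using ps[OF x rS y] ps[OF x _ y, of "\<zero>\<^bsub>S\<^esub>"] by simp
    then show "r \<odot>\<^bsub>C i\<^esub> pt i (x, y) = \<zero>\<^bsub>C i\<^esub>" using pc[OF x y] by simp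
  qed
  \<comment> \<open>the map from the free complex\<close>
  define \<beta> where "\<beta> i = free_lift S (C i) (\<lambda>k. pt i (g i (free_basis R k), \<nu>))" for i
  have bas: "free_basis R k \<in> carrier (?F i)" if "k \<in> T i" for k i using free_basis_closed[OF R that] .
  have \<beta>: "\<beta> i \<in> mod_hom S (?FS i) (C i)" for i
    unfolding \<beta>_def by (rule free_lift_hom[OF C]) (auto intro!: pc gc bas nu)
  note \<beta>c = mod_hom_closed[OF \<beta>]
  have \<beta>b: "\<beta> i (free_basis S k) = pt i (g i (free_basis R k), \<nu>)" if "k \<in> T i" for i k
    unfolding \<beta>_def by (rule free_lift_basis[OF C]) (auto intro!: pc gc bas nu that)
  have \<beta>psi: "\<beta> i (\<psi> \<circ> w) = pt i (g i w, \<nu>)" if w: "w \<in> carrier (?F i)" for i w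
  proof -
    let ?K = "{w \<in> carrier (?F i). \<beta> i (\<psi> \<circ> w) = pt i (g i w, \<nu>)}"
    interpret Fi: module R "?F i" by (rule rG(1))
    have "submodule ?K R (?F i)"
    proof (rule submoduleI'[OF rG(1)])
      have "\<psi> \<circ> \<zero>\<^bsub>?F i\<^esub> = \<zero>\<^bsub>?FS i\<^esub>" by (auto simp: free_simps)
      then show "\<zero>\<^bsub>?F i\<^esub> \<in> ?K"
        using mod_hom_zero[OF FSm C \<beta>] mod_hom_zero[OF rG(1) rP(1) g(1)] pz[OF nu] by simp
    next
      fix x y assume xy: "x \<in> ?K" "y \<in> ?K"
      then have "\<beta> i (\<psi> \<circ> (x \<oplus>\<^bsub>?F i\<^esub> y)) = \<beta> i (\<psi> \<circ> x) \<oplus>\<^bsub>C i\<^esub> \<beta> i (\<psi> \<circ> y)"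
        by (simp add: psi_vector_add[OF R S psi] mod_hom_add[OF \<beta>] psi_vector[OF R S psi])
      then show "x \<oplus>\<^bsub>?F i\<^esub> y \<in> ?K" using xy by (simp add: mod_hom_add[OF g(1)] pal gc nu)
    next
      fix r x assume xy: "r \<in> carrier R" "x \<in> ?K"
      then have "\<beta> i (\<psi> \<circ> (r \<odot>\<^bsub>?F i\<^esub> x)) = \<psi> r \<odot>\<^bsub>C i\<^esub> \<beta> i (\<psi> \<circ> x)"
        by (simp add: psi_vector_smult[OF R S psi] mod_hom_smult[OF \<beta>] psi_vector[OF R S psi])
      then show "r \<odot>\<^bsub>?F i\<^esub> x \<in> ?K" using xy by (simp add: mod_hom_smult[OF g(1)] pb ps gc nu)
    qed auto
    from free_generated[OF R this _ w] show ?thesis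
      by (simp add: bas psi_basis[OF R S psi] \<beta>b)
  qed
  note bc = base_change_hom[OF R S psi] and bcb = base_change_basis[OF R S psi]
  define D where "D i = base_change S R \<psi> (T i) (\<delta> i)" for i
  have D: "D i \<in> mod_hom S (?FS (Suc i)) (?FS i)" for i unfolding D_def by (rule bc[OF rG(3)])
  note Dc = mod_hom_closed[OF D]
  have \<beta>D: "\<beta> i (D i v) = \<Delta> i (\<beta> (Suc i) v)" if "v \<in> carrier (?FS (Suc i))" for i v
    by (rule hom_eq_free[OF S C mod_hom_comp[OF \<beta> D] mod_hom_comp[OF \<Delta>(1) \<beta>] _ that])
      (simp add: D_def bcb[OF rG(3)] \<beta>psi \<delta>c bas \<beta>b \<Delta>(2) gc nu g(3))
  have \<beta>IV: "\<beta> i v = \<zero>\<^bsub>C i\<^esub>" if "v \<in> ?IV i" for i v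
    using hom_of_ideal_vector[OF S C \<beta> submodule_trivial[OF C] _ that] cC by simp
  \<comment> \<open>the map to the free complex modulo \<open>c\<close>\<close>
  let ?Q = "\<lambda>i. quot_module (?FS i) (?IV i)"
  have Q: "module S (?Q i)" for i by (rule quot_is_module[OF FSm IV])
  define cl where "cl i v = ?IV i +>\<^bsub>?FS i\<^esub> v" for i v
  have cl: "cl i \<in> mod_hom S (?FS i) (?Q i)" for i unfolding cl_def by (rule quot_proj_hom[OF FSm IV])
  have cl_eq: "cl i v = cl i w \<longleftrightarrow> v \<ominus>\<^bsub>?FS i\<^esub> w \<in> ?IV i" if "v \<in> carrier (?FS i)" "w \<in> carrier (?FS i)" for i v w
    unfolding cl_def by (rule coset_eq_iff[OF FSm IV that])
  have cl_zero: "cl i v = \<zero>\<^bsub>?Q i\<^esub> \<longleftrightarrow> v \<in> ?IV i" if "v \<in> carrier (?FS i)" for i v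
    unfolding cl_def quot_zero by (rule coset_eq_zero_iff[OF FSm IV that])
  have Qc: "\<exists>v\<in>carrier (?FS i). q = cl i v" if "q \<in> carrier (?Q i)" for i q using that by (auto simp: quot_carrier cl_def)
  define \<sigma> where "\<sigma> y = (SOME s. s \<in> carrier S \<and> y = s \<odot>\<^bsub>N\<^esub> \<nu>)" for y
  have \<sigma>: "\<sigma> y \<in> carrier S" "y = \<sigma> y \<odot>\<^bsub>N\<^esub> \<nu>" if "y \<in> carrier N" for y
    using someI_ex[of "\<lambda>s. s \<in> carrier S \<and> y = s \<odot>\<^bsub>N\<^esub> \<nu>"] gen[OF that] unfolding \<sigma>_def by auto
  have pv: "\<psi> \<circ> f i x \<in> carrier (?FS i)" if "x \<in> carrier (P i)" for i x by (rule psi_vector[OF R S psi fc[OF that]])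
  define b where "b i = (\<lambda>(x, y). cl i (\<sigma> y \<odot>\<^bsub>?FS i\<^esub> (\<psi> \<circ> f i x)))" for i
  have b: "b i (x, s \<odot>\<^bsub>N\<^esub> \<nu>) = cl i (s \<odot>\<^bsub>?FS i\<^esub> (\<psi> \<circ> f i x))" if x: "x \<in> carrier (P i)" and sS: "s \<in> carrier S" for i x s
  proof -
    interpret FS: module S "?FS i" by (rule FSm)
    let ?s = "\<sigma> (s \<odot>\<^bsub>N\<^esub> \<nu>)" and ?w = "\<psi> \<circ> f i x"
    have sc: "?s \<in> carrier S" "s \<odot>\<^bsub>N\<^esub> \<nu> = ?s \<odot>\<^bsub>N\<^esub> \<nu>" using \<sigma>[of "s \<odot>\<^bsub>N\<^esub> \<nu>"] sS nu by auto
    have "(?s \<ominus>\<^bsub>S\<^esub> s) \<odot>\<^bsub>N\<^esub> \<nu> = ?s \<odot>\<^bsub>N\<^esub> \<nu> \<ominus>\<^bsub>N\<^esub> s \<odot>\<^bsub>N\<^esub> \<nu>"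
      using sc(1) sS nu by (simp add: psi.S.minus_eq N.M.minus_eq N.smult_l_distr N.smult_l_minus)
    also have "\<dots> = \<zero>\<^bsub>N\<^esub>" using sc sS nu by (subst module_minus_cancel(4)[OF N]) auto
    finally have "?s \<ominus>\<^bsub>S\<^esub> s \<in> c" unfolding c_def using sc(1) sS by simp
    then have "\<forall>k. ((?s \<ominus>\<^bsub>S\<^esub> s) \<odot>\<^bsub>?FS i\<^esub> ?w) k \<in> c"
      using free_mem_closed[OF S pv[OF x]] by (simp add: free_simps c.I_r_closed)
    then have "(?s \<ominus>\<^bsub>S\<^esub> s) \<odot>\<^bsub>?FS i\<^esub> ?w \<in> ?IV i" unfolding ideal_vectors_def using pv[OF x] sc(1) sS by simp
    moreover have "(?s \<ominus>\<^bsub>S\<^esub> s) \<odot>\<^bsub>?FS i\<^esub> ?w = ?s \<odot>\<^bsub>?FS i\<^esub> ?w \<ominus>\<^bsub>?FS i\<^esub> s \<odot>\<^bsub>?FS i\<^esub> ?w"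
      using sc(1) sS pv[OF x] by (simp add: psi.S.minus_eq FS.M.minus_eq FS.smult_l_distr FS.smult_l_minus)
    ultimately show ?thesis unfolding b_def using sc(1) sS pv[OF x] by (simp add: cl_eq)
  qed
  have "\<exists>\<alpha>. \<alpha> \<in> mod_hom S (C i) (?Q i) \<and> (\<forall>x\<in>carrier (P i). \<forall>y\<in>carrier N. \<alpha> (pt i (x, y)) = b i (x, y))" for i
  proof -
    interpret FS: module S "?FS i" by (rule FSm)
    interpret Pi: module R "P i" by (rule rP(1))
    interpret Qi: module S "?Q i" by (rule Q)
    have 1: "b i (x, y) \<in> carrier (?Q i)" if x: "x \<in> carrier (P i)" and y: "y \<in> carrier N" for x y
      unfolding b_def using mod_hom_closed[OF cl, of _ i] \<sigma>(1)[OF y] pv[OF x] by simp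
    have 2: "b i (x \<oplus>\<^bsub>P i\<^esub> x', y) = b i (x, y) \<oplus>\<^bsub>?Q i\<^esub> b i (x', y)"
      if x: "x \<in> carrier (P i)" "x' \<in> carrier (P i)" and y: "y \<in> carrier N" for x x' y
      unfolding b_def using \<sigma>(1)[OF y] pv[OF x(1)] pv[OF x(2)] x
      by (simp add: mod_hom_add[OF f(1)] psi_vector_add[OF R S psi] fc FS.smult_r_distr mod_hom_add[OF cl])
    have 3: "b i (x, y \<oplus>\<^bsub>N\<^esub> y') = b i (x, y) \<oplus>\<^bsub>?Q i\<^esub> b i (x, y')"
      if x: "x \<in> carrier (P i)" and y: "y \<in> carrier N" "y' \<in> carrier N" for x y y'
    proof -
      obtain s s' where s: "s \<in> carrier S" "y = s \<odot>\<^bsub>N\<^esub> \<nu>" "s' \<in> carrier S" "y' = s' \<odot>\<^bsub>N\<^esub> \<nu>" using gen y by metis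
      have "y \<oplus>\<^bsub>N\<^esub> y' = (s \<oplus>\<^bsub>S\<^esub> s') \<odot>\<^bsub>N\<^esub> \<nu>" using s nu by (simp add: N.smult_l_distr)
      then have "b i (x, y \<oplus>\<^bsub>N\<^esub> y') = cl i ((s \<oplus>\<^bsub>S\<^esub> s') \<odot>\<^bsub>?FS i\<^esub> (\<psi> \<circ> f i x))" using b[OF x, of "s \<oplus>\<^bsub>S\<^esub> s'"] s by simp
      also have "\<dots> = b i (x, y) \<oplus>\<^bsub>?Q i\<^esub> b i (x, y')" unfolding s(2,4) b[OF x s(1)] b[OF x s(3)]
        using s pv[OF x] by (simp add: FS.smult_l_distr mod_hom_add[OF cl])
      finally show ?thesis .
    qed
    have 5: "b i (x, s' \<odot>\<^bsub>N\<^esub> y) = s' \<odot>\<^bsub>?Q i\<^esub> b i (x, y)"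
      if y2: "s' \<in> carrier S" and x: "x \<in> carrier (P i)" and y1: "y \<in> carrier N" for s' x y
    proof -
      note y = y1 y2
      obtain s where s: "s \<in> carrier S" "y = s \<odot>\<^bsub>N\<^esub> \<nu>" using gen y by metis
      have "s' \<odot>\<^bsub>N\<^esub> y = (s' \<otimes>\<^bsub>S\<^esub> s) \<odot>\<^bsub>N\<^esub> \<nu>" using s y nu by (simp add: N.smult_assoc1)
      then have "b i (x, s' \<odot>\<^bsub>N\<^esub> y) = cl i ((s' \<otimes>\<^bsub>S\<^esub> s) \<odot>\<^bsub>?FS i\<^esub> (\<psi> \<circ> f i x))" using b[OF x, of "s' \<otimes>\<^bsub>S\<^esub> s"] s y by simp
      also have "\<dots> = s' \<odot>\<^bsub>?Q i\<^esub> b i (x, y)" unfolding s(2) b[OF x s(1)]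
        using s y pv[OF x] by (simp add: FS.smult_assoc1 mod_hom_smult[OF cl])
      finally show ?thesis .
    qed
    have 4: "b i (r \<odot>\<^bsub>P i\<^esub> x, y) = b i (x, \<psi> r \<odot>\<^bsub>N\<^esub> y)"
      if r: "r \<in> carrier R" and x: "x \<in> carrier (P i)" and y: "y \<in> carrier N" for r x y
    proof -
      obtain s where s: "s \<in> carrier S" "y = s \<odot>\<^bsub>N\<^esub> \<nu>" using gen y by metis
      have rx: "r \<odot>\<^bsub>P i\<^esub> x \<in> carrier (P i)" using r x by simp
      have "b i (r \<odot>\<^bsub>P i\<^esub> x, y) = cl i (s \<odot>\<^bsub>?FS i\<^esub> (\<psi> r \<odot>\<^bsub>?FS i\<^esub> (\<psi> \<circ> f i x)))"
        unfolding s(2) b[OF rx s(1)] mod_hom_smult[OF f(1) r x] using psi_vector_smult[OF R S psi r fc[OF x]] by simp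
      also have "s \<odot>\<^bsub>?FS i\<^esub> (\<psi> r \<odot>\<^bsub>?FS i\<^esub> (\<psi> \<circ> f i x)) = \<psi> r \<odot>\<^bsub>?FS i\<^esub> (s \<odot>\<^bsub>?FS i\<^esub> (\<psi> \<circ> f i x))"
        using s pS[OF r] pv[OF x] by (simp add: FS.smult_assoc1[symmetric] psi.S.m_comm)
      also have "cl i \<dots> = \<psi> r \<odot>\<^bsub>?Q i\<^esub> b i (x, y)"
        unfolding s(2) b[OF x s(1)] using s pS[OF r] pv[OF x] by (simp add: mod_hom_smult[OF cl])
      also have "\<dots> = b i (x, \<psi> r \<odot>\<^bsub>N\<^esub> y)" using 5[OF pS[OF r] x y] by simp
      finally show ?thesis .
    qed
    note U = tensor_universal[OF rP(1) N p Q, folded C_def pt_def, where b = "b i"]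
    have "the_elem (free_lift S (?Q i) (b i) ` pt i (x, y)) = b i (x, y)" if "x \<in> carrier (P i)" "y \<in> carrier N" for x y
      by (rule U(2)) ((rule 1 2 3 4 5; assumption) | rule that)+
    moreover have "(\<lambda>Z. the_elem (free_lift S (?Q i) (b i) ` Z)) \<in> mod_hom S (C i) (?Q i)"
      by (rule U(1)) (rule 1 2 3 4 5; assumption)+
    ultimately show ?thesis by (intro exI[of _ "\<lambda>Z. the_elem (free_lift S (?Q i) (b i) ` Z)"]) blast
  qed
  then obtain \<alpha> where \<alpha>: "\<And>i. \<alpha> i \<in> mod_hom S (C i) (?Q i)"
    "\<And>i x y. x \<in> carrier (P i) \<Longrightarrow> y \<in> carrier N \<Longrightarrow> \<alpha> i (pt i (x, y)) = b i (x, y)" by metis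
  note \<alpha>c = mod_hom_closed[OF \<alpha>(1)]
  have \<alpha>p: "\<alpha> i (pt i (x, s \<odot>\<^bsub>N\<^esub> \<nu>)) = cl i (s \<odot>\<^bsub>?FS i\<^esub> (\<psi> \<circ> f i x))" if "x \<in> carrier (P i)" "s \<in> carrier S" for i x s
    using \<alpha>(2)[OF that(1), of "s \<odot>\<^bsub>N\<^esub> \<nu>"] b[OF that] that nu by simp
  have \<alpha>1: "\<alpha> i (pt i (x, \<nu>)) = cl i (\<psi> \<circ> f i x)" if x: "x \<in> carrier (P i)" for i x
  proof -
    interpret FS: module S "?FS i" by (rule FSm)
    show ?thesis using \<alpha>p[OF x psi.S.one_closed] nu pv[OF x] by simp
  qed
  have fg: "(\<lambda>x. f i (g i x)) \<in> mod_hom R (?F i) (?F i)" for i by (rule mod_hom_comp[OF f(1) g(1)])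
  have \<alpha>\<beta>: "\<alpha> i (\<beta> i v) = cl i (base_change S R \<psi> (T i) (\<lambda>x. f i (g i x)) v)" if "v \<in> carrier (?FS i)" for i v
    by (rule hom_eq_free[OF S Q mod_hom_comp[OF \<alpha>(1) \<beta>] mod_hom_comp[OF cl bc[OF fg]] _ that])
      (simp add: bcb[OF fg] \<beta>b \<alpha>1 gc bas)
  have \<alpha>D: "\<alpha> i (\<Delta> i z) = cl i (D i v)" if z: "z \<in> carrier (C (Suc i))" and v: "v \<in> carrier (?FS (Suc i))" "\<alpha> (Suc i) z = cl (Suc i) v" for i z v
  proof -
    have h: "(\<lambda>x. cl i (D i x)) \<in> mod_hom S (?FS (Suc i)) (?Q i)" by (rule mod_hom_comp[OF cl D])
    have k: "cl i (D i x) = \<zero>\<^bsub>?Q i\<^esub>" if "x \<in> ?IV (Suc i)" for x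
    proof -
      have "D i x \<in> ?IV i" by (rule ideal_vectors_hom[OF S cI D that])
      then show ?thesis using cl_zero submodule_subset[OF IV] by blast
    qed
    note L = quot_lift[OF FSm IV Q h k, folded cl_def]
    have "\<alpha> i (\<Delta> i z) = the_elem ((\<lambda>x. cl i (D i x)) ` \<alpha> (Suc i) z)"
    proof (rule heq[OF Q mod_hom_comp[OF \<alpha>(1) \<Delta>(1)] mod_hom_comp[OF L(1) \<alpha>(1)] _ z])
      fix x y assume x: "x \<in> carrier (P (Suc i))" and y: "y \<in> carrier N"
      interpret FS: module S "?FS (Suc i)" by (rule FSm)
      obtain s where s: "s \<in> carrier S" "y = s \<odot>\<^bsub>N\<^esub> \<nu>" using gen y by metis
      have "the_elem ((\<lambda>x. cl i (D i x)) ` \<alpha> (Suc i) (pt (Suc i) (x, y))) = cl i (D i (s \<odot>\<^bsub>?FS (Suc i)\<^esub> (\<psi> \<circ> f (Suc i) x)))"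
        unfolding s(2) \<alpha>p[OF x s(1)] by (rule L(2)) (use s pv[OF x] in auto)
      also have "D i (s \<odot>\<^bsub>?FS (Suc i)\<^esub> (\<psi> \<circ> f (Suc i) x)) = s \<odot>\<^bsub>?FS i\<^esub> (\<psi> \<circ> f i (d i x))"
        using mod_hom_smult[OF D s(1) pv[OF x]] base_change_psi[OF R S psi rG(3) fc[OF x]] f(3)[OF x] by (simp add: D_def)
      also have "cl i \<dots> = \<alpha> i (\<Delta> i (pt (Suc i) (x, y)))"
        using \<Delta>(2)[OF x y] \<alpha>p[OF dc[OF x] s(1)] s(2) by simp
      finally show "\<alpha> i (\<Delta> i (pt (Suc i) (x, y))) = the_elem ((\<lambda>x. cl i (D i x)) ` \<alpha> (Suc i) (pt (Suc i) (x, y)))" by simp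
    qed
    also have "\<dots> = cl i (D i v)" unfolding v(2) by (rule L(2)) (simp_all add: v(1))
    finally show ?thesis .
  qed
  have gf: "(\<lambda>x. g i (f i x)) \<in> mod_hom R (P i) (P i)" for i by (rule mod_hom_comp[OF g(1) f(1)])
  have \<beta>\<alpha>: "\<beta> i v = tensor_map R S \<psi> (P i) N (\<lambda>x. g i (f i x)) z" if z: "z \<in> carrier (C i)" and v: "v \<in> carrier (?FS i)" "\<alpha> i z = cl i v" for i z v
  proof -
    note L = quot_lift[OF FSm IV C \<beta> \<beta>IV, folded cl_def]
    have "the_elem (\<beta> i ` \<alpha> i z) = tensor_map R S \<psi> (P i) N (\<lambda>x. g i (f i x)) z"
    proof (rule heq[OF C mod_hom_comp[OF L(1) \<alpha>(1)] tm(1)[OF gf] _ z])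
      fix x y assume x: "x \<in> carrier (P i)" and y: "y \<in> carrier N"
      interpret FS: module S "?FS i" by (rule FSm)
      obtain s where s: "s \<in> carrier S" "y = s \<odot>\<^bsub>N\<^esub> \<nu>" using gen y by metis
      have "the_elem (\<beta> i ` \<alpha> i (pt i (x, y))) = \<beta> i (s \<odot>\<^bsub>?FS i\<^esub> (\<psi> \<circ> f i x))"
        unfolding s(2) \<alpha>p[OF x s(1)] by (rule L(2)) (use s pv[OF x] in auto)
      also have "\<dots> = s \<odot>\<^bsub>C i\<^esub> pt i (g i (f i x), \<nu>)" using mod_hom_smult[OF \<beta> s(1) pv[OF x]] \<beta>psi[OF fc[OF x]] by simp
      also have "\<dots> = tensor_map R S \<psi> (P i) N (\<lambda>x. g i (f i x)) (pt i (x, y))"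
        using ps[OF gc[OF fc[OF x]] s(1) nu] tm(2)[OF gf x y] s(2) by simp
      finally show "the_elem (\<beta> i ` \<alpha> i (pt i (x, y))) = tensor_map R S \<psi> (P i) N (\<lambda>x. g i (f i x)) (pt i (x, y))" .
    qed
    moreover have "the_elem (\<beta> i ` \<alpha> i z) = \<beta> i v" unfolding v(2) by (rule L(2)) (simp_all add: v(1))
    ultimately show ?thesis by simp
  qed
  let ?tm = "\<lambda>i h. tensor_map R S \<psi> (P i) N h"
  have gfz: "?tm (Suc i) (\<lambda>x. g (Suc i) (f (Suc i) x)) z =
      (\<Delta> (Suc i) (?tm (Suc (Suc i)) (s (Suc i)) z) \<oplus>\<^bsub>C (Suc i)\<^esub> ?tm (Suc i) (s i) (\<Delta> i z)) \<oplus>\<^bsub>C (Suc i)\<^esub> z"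
    if z: "z \<in> carrier (C (Suc i))" for i z
  proof (rule heq[OF C tm(1)[OF gf] mod_hom_sum[OF C mod_hom_sum[OF C mod_hom_comp[OF \<Delta>(1) tm(1)[OF s(1)]]
       mod_hom_comp[OF tm(1)[OF s(1)] \<Delta>(1)]] mod_hom_id] _ z])
    fix x y assume x: "x \<in> carrier (P (Suc i))" and y: "y \<in> carrier N"
    note sc = mod_hom_closed[OF s(1)]
    have 1: "d (Suc i) (s (Suc i) x) \<in> carrier (P (Suc i))" "s i (d i x) \<in> carrier (P (Suc i))"
      using dc[OF sc[OF x]] sc[OF dc[OF x]] by auto
    interpret Pi: module R "P (Suc i)" by (rule rP(1))
    have "g (Suc i) (f (Suc i) x) = (d (Suc i) (s (Suc i) x) \<oplus>\<^bsub>P (Suc i)\<^esub> s i (d i x)) \<oplus>\<^bsub>P (Suc i)\<^esub> x"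
      using module_minus_cancel(1)[OF rP(1) gc[OF fc[OF x]] x] s(2)[OF x] by simp
    then show "?tm (Suc i) (\<lambda>x. g (Suc i) (f (Suc i) x)) (pt (Suc i) (x, y)) =
      (\<Delta> (Suc i) (?tm (Suc (Suc i)) (s (Suc i)) (pt (Suc i) (x, y))) \<oplus>\<^bsub>C (Suc i)\<^esub> ?tm (Suc i) (s i) (\<Delta> i (pt (Suc i) (x, y)))) \<oplus>\<^bsub>C (Suc i)\<^esub> pt (Suc i) (x, y)"
      using 1 x y by (simp add: tm(2)[OF gf] tm(2)[OF s(1)] \<Delta>(2) sc dc pal)
  qed
  \<comment> \<open>passage to homology\<close>
  let ?Z = "a_kernel (C (Suc j)) (C j) (\<Delta> j)" and ?B = "\<Delta> (Suc j) ` carrier (C (Suc (Suc j)))"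
  let ?CZ = "C (Suc j)\<lparr>carrier := ?Z\<rparr>"
  have Hq: "H = quot_module ?CZ ?B" unfolding H_def C_def \<Delta>_def by simp
  have Z: "submodule ?Z S (C (Suc j))" by (rule submodule_a_kernel[OF C C \<Delta>(1)])
  have CZ: "module S ?CZ" by (rule restr_module[OF C Z])
  have BZ: "?B \<subseteq> ?Z" using \<Delta>\<Delta> mod_hom_closed[OF \<Delta>(1)] by (auto simp: a_kernel_iff)
  have B: "submodule ?B S (C (Suc j))" by (rule submodule_image[OF C C \<Delta>(1) submodule_carrier[OF C]])
  have B': "submodule ?B S ?CZ" unfolding submodule_restr[OF C Z] using B BZ by simp
  show Hm: "module S H" unfolding Hq by (rule quot_is_module[OF CZ B'])
  have V: "V = {v \<in> carrier (?FS (Suc j)). D j v \<in> ?IV j}" by (simp add: V_def D_def)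
  show Vs: "submodule V S (?FS (Suc j))" unfolding V by (rule submodule_vimage[OF FSm FSm D IV])
  have \<beta>V: "\<beta> (Suc j) v \<in> ?Z" if "v \<in> V" for v
    using that \<beta>D[of v j] \<beta>IV[of "D j v" j] \<beta>c[of v "Suc j"] by (auto simp: V a_kernel_iff)
  define \<pi> where "\<pi> v = ?B +>\<^bsub>?CZ\<^esub> \<beta> (Suc j) v" for v
  have "\<beta> (Suc j) \<in> mod_hom S (?FS (Suc j)\<lparr>carrier := V\<rparr>) ?CZ"
    by (rule mod_homI) (use \<beta>V submodule_subset[OF Vs] in \<open>auto simp: mod_hom_add[OF \<beta>] mod_hom_smult[OF \<beta>]\<close>)
  then have \<pi>: "\<pi> \<in> mod_hom S (?FS (Suc j)\<lparr>carrier := V\<rparr>) H" unfolding Hq \<pi>_def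
    by (intro mod_hom_comp[OF quot_proj_hom[OF CZ B']])
  have \<pi>0: "\<pi> v = \<zero>\<^bsub>H\<^esub> \<longleftrightarrow> \<beta> (Suc j) v \<in> ?B" if "v \<in> V" for v
    unfolding \<pi>_def Hq quot_zero using coset_eq_zero_iff[OF CZ B'] \<beta>V[OF that] by simp
  interpret Cj: module S "C (Suc j)" by (rule C)
  interpret FS: module S "?FS (Suc j)" by (rule FSm)
  have onto: "carrier H \<subseteq> \<pi> ` V"
  proof
    fix q assume "q \<in> carrier H"
    then obtain z where z: "z \<in> ?Z" "q = ?B +>\<^bsub>?CZ\<^esub> z" unfolding Hq quot_carrier by auto
    then have zc: "z \<in> carrier (C (Suc j))" and z0: "\<Delta> j z = \<zero>\<^bsub>C j\<^esub>" by (auto simp: a_kernel_iff)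
    obtain v where v: "v \<in> carrier (?FS (Suc j))" "\<alpha> (Suc j) z = cl (Suc j) v" using Qc[OF \<alpha>c[OF zc]] by blast
    have "cl j (D j v) = \<zero>\<^bsub>?Q j\<^esub>" using \<alpha>D[OF zc v] z0 mod_hom_zero[OF C Q \<alpha>(1)] by simp
    then have vV: "v \<in> V" using cl_zero[OF Dc[OF v(1)]] v(1) by (simp add: V)
    let ?w = "\<Delta> (Suc j) (?tm (Suc (Suc j)) (s (Suc j)) z)"
    have w: "?w \<in> ?B" using mod_hom_closed[OF tm(1)[OF s(1)] zc] by blast
    have wc: "?w \<in> carrier (C (Suc j))" using submodule_subset[OF B w] .
    have "\<beta> (Suc j) v = ?w \<oplus>\<^bsub>C (Suc j)\<^esub> z"
      using \<beta>\<alpha>[OF zc v] gfz[OF zc] z0 mod_hom_zero[OF C C tm(1)[OF s(1)]] wc by simp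
    then have "\<beta> (Suc j) v \<ominus>\<^bsub>C (Suc j)\<^esub> z = ?w" using module_minus_cancel(3)[OF C wc zc] by simp
    moreover have "\<beta> (Suc j) v \<ominus>\<^bsub>?CZ\<^esub> z = \<beta> (Suc j) v \<ominus>\<^bsub>C (Suc j)\<^esub> z"
      using submodule_restr_minus[OF C Z \<beta>V[OF vV] z(1)] by simp
    ultimately have "\<pi> v = q" unfolding \<pi>_def z(2) using coset_eq_iff[OF CZ B'] \<beta>V[OF vV] z(1) w by simp
    then show "q \<in> \<pi> ` V" using vV by blast
  qed
  have kernel: "\<pi> v = \<zero>\<^bsub>H\<^esub> \<longleftrightarrow> (\<exists>w\<in>carrier (?FS (Suc (Suc j))). \<exists>u\<in>?IV (Suc j). v = D (Suc j) w \<oplus>\<^bsub>?FS (Suc j)\<^esub> u)" if vV: "v \<in> V" for v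
  proof -
    have v: "v \<in> carrier (?FS (Suc j))" "D j v \<in> ?IV j" using vV by (auto simp: V)
    show ?thesis
    proof
      assume "\<exists>w\<in>carrier (?FS (Suc (Suc j))). \<exists>u\<in>?IV (Suc j). v = D (Suc j) w \<oplus>\<^bsub>?FS (Suc j)\<^esub> u"
      then obtain w u where w: "w \<in> carrier (?FS (Suc (Suc j)))" "u \<in> ?IV (Suc j)" "v = D (Suc j) w \<oplus>\<^bsub>?FS (Suc j)\<^esub> u" by blast
      have uc: "u \<in> carrier (?FS (Suc j))" using submodule_subset[OF IV w(2)] .
      have "\<beta> (Suc j) v = \<Delta> (Suc j) (\<beta> (Suc (Suc j)) w)"
        unfolding w(3) using mod_hom_add[OF \<beta> Dc[OF w(1)] uc] \<beta>D[OF w(1)] \<beta>IV[OF w(2)] mod_hom_closed[OF \<Delta>(1) \<beta>c[OF w(1)]] by simp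
      then have "\<beta> (Suc j) v \<in> ?B" using \<beta>c[OF w(1)] by blast
      then show "\<pi> v = \<zero>\<^bsub>H\<^esub>" using \<pi>0[OF vV] by simp
    next
      assume "\<pi> v = \<zero>\<^bsub>H\<^esub>"
      then obtain z where z: "z \<in> carrier (C (Suc (Suc j)))" "\<beta> (Suc j) v = \<Delta> (Suc j) z" using \<pi>0[OF vV] by blast
      obtain w where w: "w \<in> carrier (?FS (Suc (Suc j)))" "\<alpha> (Suc (Suc j)) z = cl (Suc (Suc j)) w" using Qc[OF \<alpha>c[OF z(1)]] by blast
      let ?fg = "base_change S R \<psi> (T (Suc j)) (\<lambda>x. f (Suc j) (g (Suc j) x)) v"
      let ?t = "base_change S R \<psi> (T (Suc (Suc j))) (t (Suc j)) v"
      let ?q = "base_change S R \<psi> (T (Suc j)) (t j) (D j v)"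
      have tc: "?t \<in> carrier (?FS (Suc (Suc j)))" by (rule mod_hom_closed[OF bc[OF t(1)] v(1)])
      have qI: "?q \<in> ?IV (Suc j)" by (rule ideal_vectors_hom[OF S cI bc[OF t(1)] v(2)])
      have qc: "?q \<in> carrier (?FS (Suc j))" using submodule_subset[OF IV qI] .
      have fgc: "?fg \<in> carrier (?FS (Suc j))" by (rule mod_hom_closed[OF bc[OF fg] v(1)])
      note Dw = Dc[OF w(1)] and Dt = Dc[OF tc]
      have "cl (Suc j) ?fg = cl (Suc j) (D (Suc j) w)" using \<alpha>\<beta>[OF v(1)] \<alpha>D[OF z(1) w] z(2) by simp
      then have I1: "?fg \<ominus>\<^bsub>?FS (Suc j)\<^esub> D (Suc j) w \<in> ?IV (Suc j)" using cl_eq[OF fgc Dw] by simp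
      have h1: "(\<lambda>x. \<delta> (Suc j) (t (Suc j) x)) \<in> mod_hom R (?F (Suc j)) (?F (Suc j))" by (rule mod_hom_comp[OF rG(3) t(1)])
      have h2: "(\<lambda>x. t j (\<delta> j x)) \<in> mod_hom R (?F (Suc j)) (?F (Suc j))" by (rule mod_hom_comp[OF t(1) rG(3)])
      have "?fg = base_change S R \<psi> (T (Suc j)) (\<lambda>x. (\<delta> (Suc j) (t (Suc j) x) \<oplus>\<^bsub>?F (Suc j)\<^esub> t j (\<delta> j x)) \<oplus>\<^bsub>?F (Suc j)\<^esub> x) v"
        by (rule base_change_cong[OF R S psi fg _ v(1)], subst t(2)[symmetric])
          (auto simp: module_minus_cancel(1)[OF rG(1) fc[OF gc]])
      also have "\<dots> = (D (Suc j) ?t \<oplus>\<^bsub>?FS (Suc j)\<^esub> ?q) \<oplus>\<^bsub>?FS (Suc j)\<^esub> v"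
        using v(1) by (simp add: base_change_add[OF R S psi mod_hom_sum[OF rG(1) h1 h2] mod_hom_id] base_change_add[OF R S psi h1 h2]
          base_change_comp[OF R S psi t(1) rG(3)] base_change_comp[OF R S psi rG(3) t(1)] base_change_id[OF R S psi] D_def)
      finally have fgv: "?fg = (D (Suc j) ?t \<oplus>\<^bsub>?FS (Suc j)\<^esub> ?q) \<oplus>\<^bsub>?FS (Suc j)\<^esub> v" .
      let ?x = "w \<ominus>\<^bsub>?FS (Suc (Suc j))\<^esub> ?t"
      interpret FS2: module S "?FS (Suc (Suc j))" by (rule FSm)
      have xc: "?x \<in> carrier (?FS (Suc (Suc j)))" using w(1) tc by simp
      have Dx: "D (Suc j) ?x = D (Suc j) w \<ominus>\<^bsub>?FS (Suc j)\<^esub> D (Suc j) ?t" by (rule mod_hom_minus[OF FSm FSm D w(1) tc])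
      let ?u = "v \<ominus>\<^bsub>?FS (Suc j)\<^esub> D (Suc j) ?x"
      have "?u = (?fg \<ominus>\<^bsub>?FS (Suc j)\<^esub> D (Suc j) w) \<ominus>\<^bsub>?FS (Suc j)\<^esub> ?q"
        unfolding Dx fgv by (rule module_minus_rearrange[OF FSm v(1) Dw Dt qc])
      then have "?u \<in> ?IV (Suc j)" using submodule_minus[OF FSm IV I1 qI] by simp
      moreover have "v = D (Suc j) ?x \<oplus>\<^bsub>?FS (Suc j)\<^esub> ?u"
        using module_minus_cancel(2)[OF FSm v(1) Dc[OF xc]] by simp
      ultimately show "\<exists>w\<in>carrier (?FS (Suc (Suc j))). \<exists>u\<in>?IV (Suc j). v = D (Suc j) w \<oplus>\<^bsub>?FS (Suc j)\<^esub> u" using xc by blast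
    qed
  qed
  show "\<exists>\<pi>\<in>mod_hom S (?FS (Suc j)\<lparr>carrier := V\<rparr>) H. \<pi> ` V = carrier H \<and>
      (\<forall>v\<in>V. \<pi> v = \<zero>\<^bsub>H\<^esub> \<longleftrightarrow> (\<exists>w\<in>carrier (?FS (Suc (Suc j))). \<exists>u\<in>?IV (Suc j).
         v = base_change S R \<psi> (T (Suc j)) (\<delta> (Suc j)) w \<oplus>\<^bsub>?FS (Suc j)\<^esub> u))"
    using \<pi> onto mod_hom_closed[OF \<pi>] kernel unfolding D_def by (intro bexI[OF _ \<pi>] conjI ballI equalityI) auto
qed

section \<open>Noetherian rings and free resolutions\<close>

lemma noetherian_maximal_ideal:
  assumes "noetherian_ring R" "\<F> \<noteq> {}" "\<And>I. I \<in> \<F> \<Longrightarrow> ideal I R"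
  shows "\<exists>I\<in>\<F>. \<forall>J\<in>\<F>. I \<subseteq> J \<longrightarrow> J = I"
proof (rule subset_Zorn_nonempty[OF assms(2)])
  interpret noetherian_ring R by fact
  fix C assume C: "C \<noteq> {}" "subset.chain \<F> C"
  then have "subset.chain {I. ideal I R} C" using assms(3) unfolding pred_on.chain_def by auto
  then have "\<Union>C \<in> C" using ideal_chain_is_trivial[OF C(1)] by simp
  then show "\<Union>C \<in> \<F>" using C(2) unfolding pred_on.chain_def by auto
qed

definition spanning :: "('a, 'r) ring_scheme \<Rightarrow> ('a, 'b) module \<Rightarrow> 'b set \<Rightarrow> 'b set \<Rightarrow> bool" where
  "spanning R M G K \<longleftrightarrow> G \<subseteq> K \<and> (\<forall>L. submodule L R M \<and> G \<subseteq> L \<longrightarrow> K \<subseteq> L)"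

lemma spanning_iff:
  assumes "module R M" "submodule K R M"
  shows "spanning R M G K \<longleftrightarrow> submodule_span R M G = K"
proof
  assume G: "spanning R M G K"
  have "G \<subseteq> carrier M" using G submodule_subset[OF assms(2)] by (auto simp: spanning_def)
  note S = span_submodule[OF assms(1) this]
  have "\<forall>L. submodule L R M \<and> G \<subseteq> L \<longrightarrow> K \<subseteq> L" using G by (simp add: spanning_def)
  then have "K \<subseteq> submodule_span R M G" using S span_superset[of G R M]
    by (elim allE[of _ "submodule_span R M G"]) simp
  moreover have "submodule_span R M G \<subseteq> K" using G span_least[OF assms(2)] by (simp add: spanning_def)
  ultimately show "submodule_span R M G = K" by simp
next
  assume "submodule_span R M G = K"
  then show "spanning R M G K" unfolding spanning_def
    using span_superset[of G R M] span_least[of _ R M G] by simp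
qed

lemma eval_hom:
  assumes "cring R"
  shows "(\<lambda>v. v x) \<in> mod_hom R (free_module R T) (self_module R)"
  by (rule mod_homI) (auto simp: free_simps free_mem_closed[OF assms])

lemma free_drop: "v \<in> carrier (free_module R (insert x T)) \<Longrightarrow> v x = \<zero>\<^bsub>R\<^esub> \<Longrightarrow> v \<in> carrier (free_module R T)"
  unfolding free_mem_iff by (metis insert_iff)

text
  \<open>By induction on the rank: the values of one coordinate form a finitely generated ideal, and the vectors where it vanishes lie in a free module of smaller rank.\<close>
lemma free_submodule_finitely_generated:
  fixes R (structure)
  assumes N: "noetherian_ring R" and cr: "cring R" and T: "finite T"
  shows "submodule K R (free_module R T) \<Longrightarrow> \<exists>G. finite G \<and> spanning R (free_module R T) G K"
  using T
proof (induction T arbitrary: K rule: finite_induct)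
  case (empty K)
  have "K \<subseteq> {\<lambda>x. \<zero>}" using submodule_subset[OF empty] free_mem_off by fastforce
  then show ?case using submodule_zero[OF empty] by (intro exI[of _ "K"]) (auto simp: spanning_def intro: finite_subset)
next
  case (insert x T K)
  interpret noetherian_ring R by fact
  let ?F = "free_module R (insert x T)" and ?F' = "free_module R T"
  have F: "module R ?F" and F': "module R ?F'" and S: "module R (self_module R)" by (simp_all add: free_is_module self_is_module cr)
  let ?ev = "\<lambda>v. v x"
  have ev: "?ev \<in> mod_hom R ?F (self_module R)" by (rule eval_hom[OF cr])
  have FF': "submodule (L \<inter> carrier ?F') R ?F'" if L: "submodule L R ?F" for L
  proof (rule submoduleI'[OF F'])
    interpret F': module R ?F' by fact
    show "\<zero>\<^bsub>?F'\<^esub> \<in> L \<inter> carrier ?F'" using submodule_zero[OF L] F'.M.zero_closed by (simp add: free_simps)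
  next
    interpret F': module R ?F' by fact
    fix u v assume "u \<in> L \<inter> carrier ?F'" "v \<in> L \<inter> carrier ?F'"
    then show "u \<oplus>\<^bsub>?F'\<^esub> v \<in> L \<inter> carrier ?F'"
      using submodule_add[OF L, of u v] F'.M.a_closed[of u v] by (simp add: free_simps)
  next
    interpret F': module R ?F' by fact
    fix r v assume "r \<in> carrier R" "v \<in> L \<inter> carrier ?F'"
    then show "r \<odot>\<^bsub>?F'\<^esub> v \<in> L \<inter> carrier ?F'"
      using submodule_smult[OF L, of r v] F'.smult_closed[of r v] by (simp add: free_simps)
  qed auto
  have evK: "submodule (?ev ` K) R (self_module R)" by (rule submodule_image[OF F S ev insert(4)])
  then have "ideal (?ev ` K) R" by (simp add: submodule_self_iff[OF cr])
  then obtain A where A: "finite A" "?ev ` K = Idl A" "A \<subseteq> carrier R" using finetely_gen by blast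
  have "A \<subseteq> ?ev ` K" unfolding A(2) by (rule genideal_self[OF A(3)])
  then obtain B where B: "finite B" "B \<subseteq> K" "?ev ` B = A" using finite_subset_image[OF A(1)] by metis
  obtain G where G: "finite G" "spanning R ?F' G (K \<inter> carrier ?F')" using insert(3)[OF FF'[OF insert(4)]] by blast
  have "spanning R ?F (B \<union> G) K" unfolding spanning_def
  proof (intro conjI allI impI)
    show "B \<union> G \<subseteq> K" using B G(2) by (auto simp: spanning_def)
    fix L assume L: "submodule L R ?F \<and> B \<union> G \<subseteq> L"
    then have Ls: "submodule L R ?F" by blast
    have "G \<subseteq> L \<inter> carrier ?F'" using L G(2) by (auto simp: spanning_def)
    then have KL: "K \<inter> carrier ?F' \<subseteq> L" using G(2) FF'[OF Ls] by (auto simp: spanning_def)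
    show "K \<subseteq> L"
    proof
      fix v assume v: "v \<in> K"
      have "ideal (?ev ` (L \<inter> K)) R"
        using submodule_image[OF F S ev submodule_Int[OF F Ls insert(4)]] by (simp add: submodule_self_iff[OF cr])
      then have "Idl A \<subseteq> ?ev ` (L \<inter> K)" by (rule genideal_minimal) (use B L in auto)
      then have "v x \<in> ?ev ` (L \<inter> K)" using v A(2) by auto
      then have "\<exists>w. w \<in> L \<and> w \<in> K \<and> w x = v x" unfolding image_iff by auto
      then obtain w where w: "w \<in> L" "w \<in> K" "w x = v x" by (elim exE conjE)
      have vc: "v \<in> carrier ?F" "w \<in> carrier ?F" using submodule_subset[OF insert(4)] v w by auto
      have d: "v \<ominus>\<^bsub>?F\<^esub> w \<in> K" by (rule submodule_minus[OF F insert(4) v w(2)])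
      have "(v \<ominus>\<^bsub>?F\<^esub> w) x = v x \<ominus> w x" using mod_hom_minus[OF F S ev vc] by simp
      then have "(v \<ominus>\<^bsub>?F\<^esub> w) x = \<zero>" using w(3) free_mem_closed[OF cr vc(1), of x] by (simp add: minus_eq r_neg)
      then have "v \<ominus>\<^bsub>?F\<^esub> w \<in> carrier ?F'" by (rule free_drop[OF submodule_subset[OF insert(4) d]])
      then have "v \<ominus>\<^bsub>?F\<^esub> w \<in> L" using d KL by auto
      then show "v \<in> L" using submodule_minus_iff[OF F Ls vc(1) w(1)] by simp
    qed
  qed
  then show ?case using B(1) G(1) by blast
qed

text
  \<open>For a generating set of least cardinality no relation has a unit coefficient, since otherwise that generator would be superfluous.\<close>
lemma minimal_free_cover:
  fixes R (structure)
  assumes N: "noetherian_ring R" and cr: "cring R" and T: "finite T" and inf: "infinite (UNIV :: 'y set)"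
    and K: "submodule K R (free_module R T)"
  shows "\<exists>(T' :: 'y set) h. finite T' \<and> h \<in> mod_hom R (free_module R T') (free_module R T) \<and> h ` carrier (free_module R T') = K \<and>
    (\<forall>c\<in>carrier (free_module R T'). h c = \<zero>\<^bsub>free_module R T\<^esub> \<longrightarrow> (\<forall>y. c y \<in> Units R \<longrightarrow> c y = \<zero>))"
proof -
  interpret noetherian_ring R by fact
  let ?F = "free_module R T"
  have F: "module R ?F" by (rule free_is_module[OF cr])
  interpret F: module R ?F by fact
  define n where "n = (LEAST n. \<exists>G. finite G \<and> card G = n \<and> spanning R ?F G K)"
  have "\<exists>n G. finite G \<and> card G = n \<and> spanning R ?F G K" using free_submodule_finitely_generated[OF N cr T K] by blast
  then obtain G where G: "finite G" "card G = n" "spanning R ?F G K"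
    using LeastI_ex[of "\<lambda>n. \<exists>G. finite G \<and> card G = n \<and> spanning R ?F G K"] unfolding n_def by blast
  obtain T' :: "'y set" where T': "finite T'" "card T' = n" using infinite_arbitrarily_large[OF inf] by blast
  obtain g where g: "bij_betw g T' G" using finite_same_card_bij[OF T'(1) G(1)] T'(2) G(2) by auto
  then have gT: "g ` T' = G" and gi: "inj_on g T'" by (auto simp: bij_betw_def)
  have GK: "G \<subseteq> K" using G(3) by (simp add: spanning_def)
  have gK: "g \<in> T' \<rightarrow> K" using gT GK by auto
  have gF: "g \<in> T' \<rightarrow> carrier ?F" using gK submodule_subset[OF K] by auto
  let ?h = "free_lift R ?F g" and ?F' = "free_module R T'"
  have h: "?h \<in> mod_hom R ?F' ?F" by (rule free_lift_hom[OF F gF])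
  have im: "?h ` carrier ?F' = K"
    using free_lift_image[OF F gF] G(3) spanning_iff[OF F K] unfolding gT by simp
  have "c y = \<zero>" if c: "c \<in> carrier ?F'" "?h c = \<zero>\<^bsub>?F\<^esub>" and y: "c y \<in> Units R" for c y
  proof (rule ccontr)
    assume "c y \<noteq> \<zero>"
    then have yT: "y \<in> T'" using free_mem_off[OF c(1)] by auto
    define c0 where "c0 = c(y := \<zero>)"
    have c': "c0 \<in> carrier (free_module R (T' - {y}))"
      unfolding c0_def using T'(1) c(1) by (auto simp: free_mem_finite_iff)
    then have c'': "c0 \<in> carrier ?F'" by (intro free_subset[OF _ cr c']) auto
    have cy: "c y \<in> carrier R" using y by (rule Units_closed)
    have e: "free_basis R y \<in> carrier ?F'" by (rule free_basis_closed[OF cr yT])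
    have "c = c0 \<oplus>\<^bsub>?F'\<^esub> (c y \<odot>\<^bsub>?F'\<^esub> free_basis R y)"
      using free_mem_closed[OF cr c(1)] by (auto simp: c0_def free_simps free_basis_def)
    interpret F': module R ?F' by (rule free_is_module[OF cr])
    have "?h c = ?h (c0 \<oplus>\<^bsub>?F'\<^esub> (c y \<odot>\<^bsub>?F'\<^esub> free_basis R y))" using \<open>c = _\<close> by simp
    also have "\<dots> = ?h c0 \<oplus>\<^bsub>?F\<^esub> (c y \<odot>\<^bsub>?F\<^esub> ?h (free_basis R y))"
      using mod_hom_add[OF h c'', of "c y \<odot>\<^bsub>?F'\<^esub> free_basis R y"] mod_hom_smult[OF h cy e] cy e by simp
    also have "?h (free_basis R y) = g y" by (rule free_lift_basis[OF F]) (use gF yT in auto)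
    finally have eq: "?h c0 \<oplus>\<^bsub>?F\<^esub> (c y \<odot>\<^bsub>?F\<^esub> g y) = \<zero>\<^bsub>?F\<^esub>" using c(2) by simp
    let ?S = "submodule_span R ?F (G - {g y})"
    have S: "submodule ?S R ?F" by (rule span_submodule[OF F]) (use GK submodule_subset[OF K] in auto)
    have "g k \<in> G - {g y}" if "k \<in> T' - {y}" for k using that gi gT yT by (auto dest: inj_onD)
    then have "g \<in> (T' - {y}) \<rightarrow> ?S" using span_superset[of "G - {g y}" R ?F] by (intro Pi_I) (rule subsetD)
    then have hc: "?h c0 \<in> ?S" by (rule free_lift_in_submodule[OF F S _ c'])
    have gy: "g y \<in> carrier ?F" using gF yT by auto
    have cg: "c y \<odot>\<^bsub>?F\<^esub> g y \<in> carrier ?F" using cy gy by simp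
    have "(c y \<odot>\<^bsub>?F\<^esub> g y) \<oplus>\<^bsub>?F\<^esub> ?h c0 \<in> ?S"
      using eq submodule_zero[OF S] F.M.a_comm[OF cg submodule_subset[OF S hc]] by simp
    then have "c y \<odot>\<^bsub>?F\<^esub> g y \<in> ?S" by (rule submodule_add_cancel[OF F S cg hc])
    then have iS: "inv (c y) \<odot>\<^bsub>?F\<^esub> (c y \<odot>\<^bsub>?F\<^esub> g y) \<in> ?S"
      by (rule submodule_smult[OF S Units_inv_closed[OF y]])
    have "inv (c y) \<odot>\<^bsub>?F\<^esub> (c y \<odot>\<^bsub>?F\<^esub> g y) = (inv (c y) \<otimes> c y) \<odot>\<^bsub>?F\<^esub> g y"
      by (rule F.smult_assoc1[symmetric, OF Units_inv_closed[OF y] cy gy])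
    also have "\<dots> = g y" using gy Units_l_inv[OF y] by simp
    finally have gS: "g y \<in> ?S" using iS by simp
    have "G \<subseteq> ?S" using gS span_superset[of "G - {g y}" R ?F] by auto
    then have "K \<subseteq> ?S" using G(3) S unfolding spanning_def by blast
    moreover have "?S \<subseteq> K" by (rule span_least[OF K]) (use GK in auto)
    ultimately have "spanning R ?F (G - {g y}) K" using spanning_iff[OF F K] by simp
    then have "n \<le> card (G - {g y})" unfolding n_def using G(1) by (intro Least_le) auto
    moreover have "g y \<in> G" using gT yT by auto
    then have "card (G - {g y}) < card G" by (rule card_Diff1_less[OF G(1)])
    ultimately show False unfolding G(2) by (simp add: not_le)
  qed
  then show ?thesis using T'(1) h im by blast
qed

lemma free_resolution_step_exists:
  fixes R (structure)
  assumes N: "noetherian_ring R" and cr: "cring R" and T0: "finite T0" and inf: "infinite (UNIV :: 'x set)"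
    and K0: "submodule K0 R (free_module R (T0 :: 'x set))"
  shows "\<exists>(T :: nat \<Rightarrow> 'x set) \<delta>. T 0 = T0 \<and> (\<forall>i. finite (T i)) \<and>
    (\<forall>i. \<delta> i \<in> mod_hom R (free_module R (T (Suc i))) (free_module R (T i))) \<and>
    \<delta> 0 ` carrier (free_module R (T (Suc 0))) = K0 \<and>
    (\<forall>i. \<delta> (Suc i) ` carrier (free_module R (T (Suc (Suc i)))) = a_kernel (free_module R (T (Suc i))) (free_module R (T i)) (\<delta> i)) \<and>
    (\<forall>i. \<forall>c\<in>carrier (free_module R (T (Suc i))). \<delta> i c = \<zero>\<^bsub>free_module R (T i)\<^esub> \<longrightarrow> (\<forall>y. c y \<in> Units R \<longrightarrow> c y = \<zero>))"
proof -
  let ?F = "\<lambda>T :: 'x set. free_module R T"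
  let ?D = "\<lambda>T K T' K' h. h \<in> mod_hom R (?F T') (?F T) \<and> h ` carrier (?F T') = K \<and> K' = a_kernel (?F T') (?F T) h \<and>
      (\<forall>c\<in>carrier (?F T'). h c = \<zero>\<^bsub>?F T\<^esub> \<longrightarrow> (\<forall>y. c y \<in> Units R \<longrightarrow> c y = \<zero>))"
  let ?P = "\<lambda>(n::nat) TK. finite (fst TK) \<and> submodule (snd TK) R (?F (fst TK)) \<and> (n = 0 \<longrightarrow> TK = (T0, K0))"
  let ?Q = "\<lambda>(n::nat) TK TK'. \<exists>h. ?D (fst TK) (snd TK) (fst TK') (snd TK') h"
  have "\<exists>f. \<forall>n. ?P n (f n) \<and> ?Q n (f n) (f (Suc n))"
  proof (rule dependent_nat_choice)
    show "\<exists>x. ?P 0 x" using T0 K0 by (intro exI[of _ "(T0, K0)"]) simp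
  next
    fix TK n assume TK: "?P n TK"
    from TK have 1: "finite (fst TK)" "submodule (snd TK) R (?F (fst TK))" by auto
    from minimal_free_cover[OF N cr 1(1) inf 1(2)] obtain T' :: "'x set" and h where
      h: "finite T'" "h \<in> mod_hom R (?F T') (?F (fst TK))" "h ` carrier (?F T') = snd TK"
      "\<forall>c\<in>carrier (?F T'). h c = \<zero>\<^bsub>?F (fst TK)\<^esub> \<longrightarrow> (\<forall>y. c y \<in> Units R \<longrightarrow> c y = \<zero>)" by blast
    have "submodule (a_kernel (?F T') (?F (fst TK)) h) R (?F T')"
      by (rule submodule_a_kernel[OF free_is_module[OF cr] free_is_module[OF cr] h(2)])
    then show "\<exists>TK'. ?P (Suc n) TK' \<and> ?Q n TK TK'" using h
      by (intro exI[of _ "(T', a_kernel (?F T') (?F (fst TK)) h)"]) auto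
  qed
  then obtain f where f': "\<forall>n. ?P n (f n) \<and> ?Q n (f n) (f (Suc n))" by (elim exE) (rule that)
  note f = spec[OF f', THEN conjunct1]
  have "\<forall>n. \<exists>h. ?D (fst (f n)) (snd (f n)) (fst (f (Suc n))) (snd (f (Suc n))) h"
    by (rule allI) (rule spec[OF f', THEN conjunct2])
  from choice[OF this] obtain \<delta> where \<delta>': "\<forall>n. ?D (fst (f n)) (snd (f n)) (fst (f (Suc n))) (snd (f (Suc n))) (\<delta> n)"
    by (elim exE) (rule that)
  note \<delta> = spec[OF \<delta>']
  have f0: "f 0 = (T0, K0)" using f[of 0] by simp
  define T where "T i = fst (f i)" for i
  have h: "\<delta> n \<in> mod_hom R (?F (T (Suc n))) (?F (T n))"
    and im: "\<delta> n ` carrier (?F (T (Suc n))) = snd (f n)"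
    and ker: "snd (f (Suc n)) = a_kernel (?F (T (Suc n))) (?F (T n)) (\<delta> n)"
    and un: "\<forall>c\<in>carrier (?F (T (Suc n))). \<delta> n c = \<zero>\<^bsub>?F (T n)\<^esub> \<longrightarrow> (\<forall>y. c y \<in> Units R \<longrightarrow> c y = \<zero>)" for n
    by (rule \<delta>[of n, folded T_def, THEN conjunct1] \<delta>[of n, folded T_def, THEN conjunct2, THEN conjunct1]
       \<delta>[of n, folded T_def, THEN conjunct2, THEN conjunct2, THEN conjunct1]
       \<delta>[of n, folded T_def, THEN conjunct2, THEN conjunct2, THEN conjunct2])+
  show ?thesis
  proof (rule exI[of _ T], rule exI[of _ \<delta>], intro conjI allI)
    show "T 0 = T0" unfolding T_def f0 by simp
    show "finite (T i)" for i unfolding T_def using f[of i] by simp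
    show "\<delta> i \<in> mod_hom R (?F (T (Suc i))) (?F (T i))" for i by (rule h)
    show "\<delta> 0 ` carrier (?F (T (Suc 0))) = K0" unfolding im f0 by simp
    show "\<delta> (Suc i) ` carrier (?F (T (Suc (Suc i)))) = a_kernel (?F (T (Suc i))) (?F (T i)) (\<delta> i)" for i
      unfolding im ker by (rule refl)
    show "\<forall>c\<in>carrier (?F (T (Suc i))). \<delta> i c = \<zero>\<^bsub>?F (T i)\<^esub> \<longrightarrow> (\<forall>y. c y \<in> Units R \<longrightarrow> c y = \<zero>)" for i
      by (rule un)
  qed
qed

text
  \<open>The ideal \<open>I\<close> placed in a free module of rank one, where the degree-zero term of a resolution of \<open>R / I\<close> lives.\<close>
definition ideal_line :: "('a, 'r) ring_scheme \<Rightarrow> 'a set \<Rightarrow> 'x \<Rightarrow> ('x \<Rightarrow> 'a) set" where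
  "ideal_line R I x = {v \<in> carrier (free_module R {x}). v x \<in> I}"

lemma ideal_line_augmentation:
  fixes R (structure)
  assumes cr: "cring R" and I: "ideal I R"
  shows "(\<lambda>v. I +> v x) \<in> mod_hom R (free_module R {x}) (cyclic_module R I)"
    and "(\<lambda>v. I +> v x) ` carrier (free_module R {x}) = carrier (cyclic_module R I)"
    and "a_kernel (free_module R {x}) (cyclic_module R I) (\<lambda>v. I +> v x) = ideal_line R I x"
    and "submodule (ideal_line R I x) R (free_module R {x})"
proof -
  interpret cring R by fact
  interpret F: module R "free_module R {x}" by (rule free_is_module[OF cr])
  note cs = cyclic_simps[OF cr I] and cl = free_mem_closed[OF cr, of _ "{x}"]
  show h: "(\<lambda>v. I +> v x) \<in> mod_hom R (free_module R {x}) (cyclic_module R I)"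
    by (rule mod_homI) (auto simp: cs cl free_simps)
  have "v \<in> a_kernel (free_module R {x}) (cyclic_module R I) (\<lambda>v. I +> v x) \<longleftrightarrow> v \<in> ideal_line R I x" for v
  proof (cases "v \<in> carrier (free_module R {x})")
    case True
    then have "v x \<in> carrier R" by (rule cl)
    then show ?thesis using cs(5)[of "v x"] True by (simp add: a_kernel_iff ideal_line_def cs(2))
  qed (simp add: a_kernel_iff ideal_line_def)
  then show "a_kernel (free_module R {x}) (cyclic_module R I) (\<lambda>v. I +> v x) = ideal_line R I x"
    by blast
  then show "submodule (ideal_line R I x) R (free_module R {x})"
    using submodule_a_kernel[OF free_is_module[OF cr] cyclic_is_module[OF cr I] h] by simp
  show "(\<lambda>v. I +> v x) ` carrier (free_module R {x}) = carrier (cyclic_module R I)"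
  proof
    show "(\<lambda>v. I +> v x) ` carrier (free_module R {x}) \<subseteq> carrier (cyclic_module R I)" using mod_hom_closed[OF h] by auto
    show "carrier (cyclic_module R I) \<subseteq> (\<lambda>v. I +> v x) ` carrier (free_module R {x})"
    proof
      fix C assume "C \<in> carrier (cyclic_module R I)"
      then obtain r where r: "r \<in> carrier R" "C = I +> r" unfolding cs(1) by blast
      have "r \<odot>\<^bsub>free_module R {x}\<^esub> free_basis R x \<in> carrier (free_module R {x})"
        using r by (intro F.smult_closed free_basis_closed[OF cr]) auto
      moreover have "(r \<odot>\<^bsub>free_module R {x}\<^esub> free_basis R x) x = r" using r by (simp add: free_simps free_basis_def)
      ultimately show "C \<in> (\<lambda>v. I +> v x) ` carrier (free_module R {x})" using r(2)
        by (intro image_eqI[of _ _ "r \<odot>\<^bsub>free_module R {x}\<^esub> free_basis R x"]) auto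
    qed
  qed
qed

lemma minimal_resolution_of_cyclic:
  fixes R (structure)
  assumes N: "noetherian_ring R" and cr: "cring R" and inf: "infinite (UNIV :: 'x set)" and I: "ideal I R"
  shows "\<exists>(T :: nat \<Rightarrow> 'x set) \<delta> \<epsilon>. T 0 = {x0} \<and> (\<forall>i. finite (T i)) \<and>
    projective_resolution R (cyclic_module R I) (\<lambda>i. free_module R (T i)) \<delta> \<epsilon> \<and> (\<forall>v. \<epsilon> v = I +> v x0) \<and>
    (\<forall>i. \<forall>c\<in>carrier (free_module R (T (Suc i))). \<delta> i c = \<zero>\<^bsub>free_module R (T i)\<^esub> \<longrightarrow> (\<forall>y. c y \<in> Units R \<longrightarrow> c y = \<zero>))"
proof -
  note a = ideal_line_augmentation[OF cr I, of x0]
  from free_resolution_step_exists[OF N cr _ inf a(4)] obtain T \<delta> where *: "T 0 = {x0}" "\<forall>i. finite (T i)"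
    "\<forall>i. \<delta> i \<in> mod_hom R (free_module R (T (Suc i))) (free_module R (T i))"
    "\<delta> 0 ` carrier (free_module R (T (Suc 0))) = ideal_line R I x0"
    "\<forall>i. \<delta> (Suc i) ` carrier (free_module R (T (Suc (Suc i)))) = a_kernel (free_module R (T (Suc i))) (free_module R (T i)) (\<delta> i)"
    "\<forall>i. \<forall>c\<in>carrier (free_module R (T (Suc i))). \<delta> i c = \<zero>\<^bsub>free_module R (T i)\<^esub> \<longrightarrow> (\<forall>y. c y \<in> Units R \<longrightarrow> c y = \<zero>)"
    by auto
  have "projective_resolution R (cyclic_module R I) (\<lambda>i. free_module R (T i)) \<delta> (\<lambda>v. I +> v x0)"
    unfolding projective_resolution_def using * a by (simp add: free_projective[OF cr])
  then show ?thesis using * by blast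
qed

text
  \<open>Unlike the minimal resolution, this one starts with prescribed generators, so that those of \<open>J\<close> can be extended by \<open>u\<close>.\<close>
lemma resolution_of_cyclic_from_generators:
  assumes N: "noetherian_ring R" and cr: "cring R" and inf: "infinite (UNIV :: 'x set)"
    and T1: "finite (T1 :: 'x set)" and c: "c \<in> T1 \<rightarrow> carrier R"
  defines "I \<equiv> submodule_span R (self_module R) (c ` T1)"
  shows "\<exists>(T :: nat \<Rightarrow> 'x set) \<delta> \<epsilon>. T 0 = {x0} \<and> T (Suc 0) = T1 \<and> (\<forall>i. finite (T i)) \<and>
    projective_resolution R (cyclic_module R I) (\<lambda>i. free_module R (T i)) \<delta> \<epsilon> \<and>
    (\<forall>k\<in>T1. \<delta> 0 (free_basis R k) = c k \<odot>\<^bsub>free_module R {x0}\<^esub> free_basis R x0)"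
proof -
  interpret cring R by fact
  have S: "module R (self_module R)" by (rule self_is_module[OF cr])
  have I: "ideal I R" unfolding I_def submodule_self_iff[OF cr, symmetric] by (rule span_submodule[OF S]) (use c in auto)
  note a = ideal_line_augmentation[OF cr I, of x0]
  let ?F0 = "free_module R {x0}" and ?F1 = "free_module R T1"
  have F0: "module R ?F0" and F1: "module R ?F1" by (simp_all add: free_is_module[OF cr])
  interpret F0: module R ?F0 by fact
  have e0: "free_basis R x0 \<in> carrier ?F0" by (rule free_basis_closed[OF cr]) simp
  let ?g = "\<lambda>k. c k \<odot>\<^bsub>?F0\<^esub> free_basis R x0"
  have g: "?g \<in> T1 \<rightarrow> carrier ?F0" using c e0 by auto
  let ?D = "free_lift R ?F0 ?g"
  have D: "?D \<in> mod_hom R ?F1 ?F0" by (rule free_lift_hom[OF F0 g])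
  have Db: "?D (free_basis R k) = ?g k" if "k \<in> T1" for k by (rule free_lift_basis[OF F0]) (use g that in auto)
  have D0: "?D v x0 = free_lift R (self_module R) c v" if "v \<in> carrier ?F1" for v
    by (rule hom_eq_free_lift[OF cr S mod_hom_comp[OF eval_hom[OF cr] D] that])
      (use Db c in \<open>auto simp: free_simps free_basis_def Pi_iff\<close>)
  have im: "?D ` carrier ?F1 = ideal_line R I x0"
  proof
    have Iim: "free_lift R (self_module R) c ` carrier ?F1 = I" unfolding I_def by (rule free_lift_image[OF S]) (use c in auto)
    show "?D ` carrier ?F1 \<subseteq> ideal_line R I x0"
      using mod_hom_closed[OF D] D0 Iim unfolding ideal_line_def by auto
    show "ideal_line R I x0 \<subseteq> ?D ` carrier ?F1"
    proof
      fix w assume "w \<in> ideal_line R I x0"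
      then have w: "w \<in> carrier ?F0" "w x0 \<in> I" by (auto simp: ideal_line_def)
      then obtain v where v: "v \<in> carrier ?F1" "w x0 = free_lift R (self_module R) c v" using Iim by blast
      have "w = ?D v"
      proof
        fix x show "w x = ?D v x"
          using D0[OF v(1)] v(2) free_mem_off[OF w(1), of x] free_mem_off[OF mod_hom_closed[OF D v(1)], of x] by (cases "x = x0") auto
      qed
      then show "w \<in> ?D ` carrier ?F1" using v(1) by blast
    qed
  qed
  have K: "submodule (a_kernel ?F1 ?F0 ?D) R ?F1" by (rule submodule_a_kernel[OF F1 F0 D])
  from free_resolution_step_exists[OF N cr T1 inf K] obtain T \<delta> where *: "T 0 = T1" "\<forall>i. finite (T i)"
    "\<forall>i. \<delta> i \<in> mod_hom R (free_module R (T (Suc i))) (free_module R (T i))"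
    "\<delta> 0 ` carrier (free_module R (T (Suc 0))) = a_kernel ?F1 ?F0 ?D"
    "\<forall>i. \<delta> (Suc i) ` carrier (free_module R (T (Suc (Suc i)))) = a_kernel (free_module R (T (Suc i))) (free_module R (T i)) (\<delta> i)"
    by (elim exE conjE) (rule that)
  let ?T = "case_nat {x0} T" and ?\<delta> = "case_nat ?D \<delta>"
  have h: "?\<delta> i \<in> mod_hom R (free_module R (?T (Suc i))) (free_module R (?T i))" for i
  proof (cases i)
    case 0
    then show ?thesis using D *(1) by simp
  next
    case (Suc k)
    then show ?thesis using *(3) by simp
  qed
  have k: "?\<delta> (Suc i) ` carrier (free_module R (?T (Suc (Suc i)))) = a_kernel (free_module R (?T (Suc i))) (free_module R (?T i)) (?\<delta> i)" for i
  proof (cases i)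
    case 0
    then show ?thesis using *(1,4) by simp
  next
    case (Suc k)
    then show ?thesis using *(5) by simp
  qed
  have "projective_resolution R (cyclic_module R I) (\<lambda>i. free_module R (?T i)) ?\<delta> (\<lambda>v. I +>\<^bsub>R\<^esub> v x0)"
    unfolding projective_resolution_def
  proof (intro conjI allI)
    show "projective_module R (free_module R (?T i))" for i by (rule free_projective[OF cr])
    show "?\<delta> i \<in> mod_hom R (free_module R (?T (Suc i))) (free_module R (?T i))" for i by (rule h)
    show "?\<delta> (Suc i) ` carrier (free_module R (?T (Suc (Suc i)))) = a_kernel (free_module R (?T (Suc i))) (free_module R (?T i)) (?\<delta> i)" for i
      by (rule k)
  qed (use a *(1) im in simp_all)
  moreover have "finite (?T i)" for i using *(2) by (cases i) simp_all
  ultimately show ?thesis using *(1) Db by (intro exI[of _ ?T] exI[of _ ?\<delta>] exI[of _ "\<lambda>v. I +>\<^bsub>R\<^esub> v x0"]) simp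
qed

text \<open>The resolution chosen in the definition of Tor is replaced by a given free one.\<close>
lemma Tor_over_cyclic:
  fixes R :: "('a, 'r) ring_scheme" and I :: "'a set" and N :: "('s, 'c) module" and T :: "nat \<Rightarrow> 'x set" and j :: nat
  assumes Nr: "noetherian_ring R" and R: "cring R" and S: "cring S" and psi: "\<psi> \<in> ring_hom R S"
    and I: "ideal I R"
    and G: "projective_resolution R (cyclic_module R I) (\<lambda>i. free_module R (T i)) \<delta> \<epsilon>"
    and N: "module S N" and nu: "\<nu> \<in> carrier N" and gen: "\<And>y. y \<in> carrier N \<Longrightarrow> \<exists>s\<in>carrier S. y = s \<odot>\<^bsub>N\<^esub> \<nu>"
    and c: "c = {s \<in> carrier S. s \<odot>\<^bsub>N\<^esub> \<nu> = \<zero>\<^bsub>N\<^esub>}"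
  defines "H \<equiv> Tor_over R S \<psi> (Suc j) (cyclic_module R I) N"
    and "V \<equiv> {v \<in> carrier (free_module S (T (Suc j))). base_change S R \<psi> (T j) (\<delta> j) v \<in> ideal_vectors S c (T j)}"
  shows "module S H" and "submodule V S (free_module S (T (Suc j)))"
    and "\<exists>\<pi>\<in>mod_hom S (free_module S (T (Suc j))\<lparr>carrier := V\<rparr>) H. \<pi> ` V = carrier H \<and>
      (\<forall>v\<in>V. \<pi> v = \<zero>\<^bsub>H\<^esub> \<longleftrightarrow> (\<exists>w\<in>carrier (free_module S (T (Suc (Suc j)))). \<exists>u\<in>ideal_vectors S c (T (Suc j)).
         v = base_change S R \<psi> (T (Suc j)) (\<delta> (Suc j)) w \<oplus>\<^bsub>free_module S (T (Suc j))\<^esub> u))" (is ?surj)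
proof -
  let ?X = "\<lambda>(P :: nat \<Rightarrow> ('a, ('a + 'a set) list \<Rightarrow> 'a) module, d). \<exists>e. projective_resolution R (cyclic_module R I) P d e"
  have inf: "infinite (UNIV :: ('a + 'a set) list set)" by (rule infinite_UNIV_listI)
  from minimal_resolution_of_cyclic[OF Nr R inf I, of undefined]
  obtain P0 d0 e0 where "projective_resolution R (cyclic_module R I) (P0 :: nat \<Rightarrow> ('a, ('a + 'a set) list \<Rightarrow> 'a) module) d0 e0"
    by (elim exE conjE) (rule that)
  then have "?X (P0, d0)" by auto
  then have "\<exists>Pd. ?X Pd" by (rule exI)
  then have "?X (SOME Pd. ?X Pd)" by (rule someI_ex)
  moreover obtain P d where Pd: "(SOME Pd. ?X Pd) = (P, d)" by (cases "SOME Pd. ?X Pd")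
  ultimately obtain e where P: "projective_resolution R (cyclic_module R I) P d e" by auto
  have H: "H = homology (\<lambda>j. tensor_over R S \<psi> (P j) N) (\<lambda>j. tensor_map R S \<psi> (P j) N (d j)) (Suc j)"
    unfolding H_def Tor_over_def Pd by simp
  note * = homology_of_tensored_resolution[OF R S psi cyclic_is_module[OF R I] P G N nu gen c, of j]
  show "module S H" "submodule V S (free_module S (T (Suc j)))" ?surj
    unfolding H V_def using * by auto
qed

section \<open>Annihilator primes and regular sequences\<close>

locale noetherian_cring = cring R + noetherian_ring R for R (structure)

context noetherian_cring
begin

lemma colon_single: "t \<in> colon R K {z} \<longleftrightarrow> t \<in> carrier R \<and> t \<otimes> z \<in> K"
  by (auto simp: colon_def)

lemma colon_single_ideal: "ideal K R \<Longrightarrow> z \<in> carrier R \<Longrightarrow> ideal (colon R K {z}) R"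
  by (rule colon_ideal) (auto intro: is_cring)

lemma nonunit_in_maximal:
  assumes loc: "local_ring R m" and x: "x \<in> carrier R" "x \<notin> m"
  shows "x \<in> Units R"
proof (rule ccontr)
  assume nu: "x \<notin> Units R"
  let ?S = "{I. ideal I R \<and> x \<in> I \<and> I \<noteq> carrier R}"
  have "PIdl x \<noteq> carrier R"
  proof
    assume "PIdl x = carrier R"
    then have "\<one> \<in> PIdl x" by simp
    then obtain y where "y \<in> carrier R" "\<one> = y \<otimes> x" by (auto simp: cgenideal_def)
    then have "x \<in> Units R" using x(1) m_comm unfolding Units_def by force
    then show False using nu by simp
  qed
  then have "PIdl x \<in> ?S" using cgenideal_ideal[OF x(1)] cgenideal_self[OF x(1)] by simp
  then have "?S \<noteq> {}" by blast
  from noetherian_maximal_ideal[OF noetherian_ring_axioms this] obtain I where I: "I \<in> ?S" "\<forall>J\<in>?S. I \<subseteq> J \<longrightarrow> J = I" by blast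
  have "maximalideal I R"
  proof (rule maximalidealI)
    show "ideal I R" "carrier R \<noteq> I" using I(1) by auto
    fix J assume "ideal J R" "I \<subseteq> J" "J \<subseteq> carrier R"
    then show "J = I \<or> J = carrier R" using I by blast
  qed
  then have "I = m" using loc by (simp add: local_ring_def)
  then show False using I(1) x(2) by simp
qed

lemma coefficient_in_maximal:
  assumes loc: "local_ring R m" and L: "ideal L R" and a: "a \<in> carrier R" and t: "t \<in> carrier R" "t \<notin> L" and at: "a \<otimes> t \<in> L"
  shows "a \<in> m"
proof (rule ccontr)
  assume "a \<notin> m"
  then have u: "a \<in> Units R" by (rule nonunit_in_maximal[OF loc a])
  have "inv a \<otimes> (a \<otimes> t) \<in> L" using ideal.I_l_closed[OF L at, of "inv a"] u by simp
  then have "(inv a \<otimes> a) \<otimes> t \<in> L" using u a t(1) by (subst m_assoc) simp_all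
  then show False using u t by simp
qed

lemma add_principal:
  assumes L: "ideal L R" and t: "t \<in> carrier R"
  shows "ideal (L <+>\<^bsub>R\<^esub> PIdl t) R" "L \<subseteq> L <+>\<^bsub>R\<^esub> PIdl t" "t \<in> L <+>\<^bsub>R\<^esub> PIdl t"
    and "y \<in> L <+>\<^bsub>R\<^esub> PIdl t \<longleftrightarrow> (\<exists>l\<in>L. \<exists>a\<in>carrier R. y = l \<oplus> a \<otimes> t)"
proof -
  interpret L: ideal L R by (rule L)
  show "ideal (L <+>\<^bsub>R\<^esub> PIdl t) R" by (rule add_ideals[OF L cgenideal_ideal[OF t]])
  show mem: "y \<in> L <+>\<^bsub>R\<^esub> PIdl t \<longleftrightarrow> (\<exists>l\<in>L. \<exists>a\<in>carrier R. y = l \<oplus> a \<otimes> t)" for y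
    by (auto simp: set_add_def' cgenideal_def)
  have "t = \<zero> \<oplus> \<one> \<otimes> t" using t by simp
  then show "t \<in> L <+>\<^bsub>R\<^esub> PIdl t" using mem L.zero_closed by blast
  show "L \<subseteq> L <+>\<^bsub>R\<^esub> PIdl t"
  proof
    fix l assume l: "l \<in> L"
    then have "l = l \<oplus> \<zero> \<otimes> t" using t L.Icarr by simp
    then show "l \<in> L <+>\<^bsub>R\<^esub> PIdl t" using mem l by blast
  qed
qed

text \<open>If \<open>a b z \<in> K\<close> but \<open>a z \<notin> K\<close>, then by maximality \<open>b\<close> already annihilates \<open>z\<close> modulo \<open>K\<close>.\<close>
lemma maximal_colon_prime:
  assumes K: "ideal K R" and z: "z \<in> carrier R" "z \<notin> K"
    and max: "\<And>a. a \<in> carrier R \<Longrightarrow> a \<otimes> z \<notin> K \<Longrightarrow> colon R K {z} \<subseteq> colon R K {a \<otimes> z} \<Longrightarrow> colon R K {a \<otimes> z} = colon R K {z}"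
  shows "primeideal (colon R K {z}) R"
proof (rule primeidealI[OF colon_single_ideal[OF K z(1)] is_cring])
  interpret K: ideal K R by fact
  have "\<one> \<notin> colon R K {z}" using z by (simp add: colon_single)
  then show "carrier R \<noteq> colon R K {z}" by auto
  fix a b assume ab: "a \<in> carrier R" "b \<in> carrier R" "a \<otimes> b \<in> colon R K {z}"
  show "a \<in> colon R K {z} \<or> b \<in> colon R K {z}"
  proof (rule disjCI)
    assume "b \<notin> colon R K {z}"
    then have bz: "b \<otimes> z \<notin> K" using ab by (simp add: colon_single)
    have "colon R K {z} \<subseteq> colon R K {b \<otimes> z}"
    proof
      fix t assume "t \<in> colon R K {z}"
      then have t: "t \<in> carrier R" "t \<otimes> z \<in> K" by (auto simp: colon_single)
      have "t \<otimes> (b \<otimes> z) = b \<otimes> (t \<otimes> z)" using t(1) ab z by (simp add: m_ac)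
      then show "t \<in> colon R K {b \<otimes> z}" using t ab(2) by (simp add: colon_single K.I_l_closed)
    qed
    then have "colon R K {b \<otimes> z} = colon R K {z}" using max[OF ab(2) bz] by simp
    moreover have "a \<in> colon R K {b \<otimes> z}" using ab z by (simp add: colon_single m_assoc)
    ultimately show "a \<in> colon R K {z}" by simp
  qed
qed

lemma prime_power_mem:
  assumes "primeideal P R" "x \<in> carrier R" "x [^] (k::nat) \<in> P"
  shows "x \<in> P"
proof -
  interpret P: primeideal P R by fact
  show ?thesis using assms(3)
  proof (induction k)
    case 0
    then show ?case using P.one_imp_carrier P.I_notcarr by simp
  next
    case (Suc k)
    then show ?case using P.I_prime[of "x [^] k" x] assms(2) by auto
  qed
qed

text
  \<open>Among the multiples of \<open>z\<close> outside \<open>K\<close>, choose one whose annihilator modulo \<open>K\<close> is as large as possible.  That annihilator is prime and contains a power of every element of \<open>m\<close>, hence contains \<open>m\<close>.\<close>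
lemma socle_multiple:
  assumes K: "ideal K R" and z: "z \<in> carrier R" "z \<notin> K" and m: "m \<subseteq> carrier R"
    and pow: "\<And>x. x \<in> m \<Longrightarrow> \<exists>k::nat. x [^] k \<otimes> z \<in> K"
  shows "\<exists>r\<in>carrier R. r \<otimes> z \<notin> K \<and> (\<forall>x\<in>m. x \<otimes> (r \<otimes> z) \<in> K)"
proof -
  interpret K: ideal K R by fact
  let ?S = "{colon R K {r \<otimes> z} | r. r \<in> carrier R \<and> r \<otimes> z \<notin> K}"
  have "\<one> \<otimes> z \<notin> K" using z by simp
  then have "?S \<noteq> {}" by blast
  moreover have "ideal I R" if "I \<in> ?S" for I using that colon_single_ideal[OF K] z(1) by auto
  ultimately obtain I where I: "I \<in> ?S" "\<forall>J\<in>?S. I \<subseteq> J \<longrightarrow> J = I"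
    using noetherian_maximal_ideal[OF noetherian_ring_axioms, of ?S] by blast
  then obtain r where r: "r \<in> carrier R" "r \<otimes> z \<notin> K" "I = colon R K {r \<otimes> z}" by blast
  have P: "primeideal I R" unfolding r(3)
  proof (rule maximal_colon_prime[OF K _ r(2)])
    show "r \<otimes> z \<in> carrier R" using r z by simp
    fix a assume a: "a \<in> carrier R" "a \<otimes> (r \<otimes> z) \<notin> K" "colon R K {r \<otimes> z} \<subseteq> colon R K {a \<otimes> (r \<otimes> z)}"
    have "a \<otimes> (r \<otimes> z) = (a \<otimes> r) \<otimes> z" using a r z by (simp add: m_assoc)
    then have "colon R K {a \<otimes> (r \<otimes> z)} \<in> ?S" using a r by (intro CollectI exI[of _ "a \<otimes> r"]) auto
    then show "colon R K {a \<otimes> (r \<otimes> z)} = colon R K {r \<otimes> z}" using I(2) a(3) r(3) by blast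
  qed
  have "x \<otimes> (r \<otimes> z) \<in> K" if x: "x \<in> m" for x
  proof -
    have xc: "x \<in> carrier R" using x m by auto
    obtain k :: nat where k: "x [^] k \<otimes> z \<in> K" using pow[OF x] by blast
    have "x [^] k \<otimes> (r \<otimes> z) = r \<otimes> (x [^] k \<otimes> z)" using xc r z by (simp add: m_ac)
    then have "x [^] k \<in> I" unfolding r(3) using k r xc by (simp add: colon_single K.I_l_closed)
    then have "x \<in> I" by (rule prime_power_mem[OF P xc])
    then show ?thesis by (simp add: r(3) colon_single)
  qed
  then show ?thesis using r by blast
qed

lemma nilpotent_socle:
  assumes loc: "local_ring R m" and nil: "\<And>x. x \<in> m \<Longrightarrow> \<exists>k::nat. x [^] k = \<zero>" and L: "ideal L R" and y: "y \<in> carrier R" "y \<notin> L"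
  shows "\<exists>r\<in>carrier R. r \<otimes> y \<notin> L \<and> (\<forall>x\<in>m. x \<otimes> (r \<otimes> y) \<in> L)"
proof (rule socle_multiple[OF L y])
  interpret m: maximalideal m R using loc by (simp add: local_ring_def)
  show "m \<subseteq> carrier R" by (rule m.a_subset)
  fix x assume "x \<in> m"
  from nil[OF this] obtain k :: nat where "x [^] k = \<zero>" by blast
  then have "x [^] k \<otimes> y \<in> L" using y(1) additive_subgroup.zero_closed[OF ideal.axioms(1)[OF L]] by simp
  then show "\<exists>k::nat. x [^] k \<otimes> y \<in> L" by blast
qed

lemma common_element_avoiding_prime:
  assumes P: "primeideal P R" and fin: "finite \<Q>" and Q: "\<And>Q. Q \<in> \<Q> \<Longrightarrow> ideal Q R \<and> \<not> Q \<subseteq> P"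
  shows "\<exists>c\<in>carrier R. c \<notin> P \<and> (\<forall>Q\<in>\<Q>. c \<in> Q)"
proof -
  interpret P: primeideal P R by fact
  show ?thesis using fin Q
  proof (induction \<Q> rule: finite_induct)
    case empty
    have "\<one> \<notin> P" using P.one_imp_carrier P.I_notcarr by auto
    then show ?case by blast
  next
    case (insert Q \<Q>)
    then obtain c where c: "c \<in> carrier R" "c \<notin> P" "\<forall>Q\<in>\<Q>. c \<in> Q" by blast
    obtain b where b: "b \<in> Q" "b \<notin> P" using insert by blast
    interpret Q: ideal Q R using insert by blast
    have bc: "b \<in> carrier R" using b by (auto intro: Q.Icarr)
    have "c \<otimes> b \<notin> P" using P.I_prime[OF c(1) bc] c b by blast
    moreover have "c \<otimes> b \<in> Q" using b c by (simp add: Q.I_l_closed)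
    moreover have "c \<otimes> b \<in> Q'" if "Q' \<in> \<Q>" for Q'
      using ideal.I_r_closed[of Q' R c b] insert(4)[of Q'] that c bc by blast
    ultimately show ?case using c bc by (intro bexI[of _ "c \<otimes> b"]) auto
  qed
qed

lemma prime_avoidance:
  assumes J: "ideal J R" and fin: "finite \<P>" and P: "\<And>P. P \<in> \<P> \<Longrightarrow> primeideal P R"
    and inc: "\<And>P Q. P \<in> \<P> \<Longrightarrow> Q \<in> \<P> \<Longrightarrow> P \<subseteq> Q \<Longrightarrow> P = Q" and sub: "J \<subseteq> \<Union>\<P>"
  shows "\<exists>P\<in>\<P>. J \<subseteq> P"
  using fin P inc sub
proof (induction \<P> rule: finite_induct)
  case empty
  interpret J: ideal J R by fact
  show ?case using empty J.zero_closed by auto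
next
  case (insert P \<P>)
  interpret J: ideal J R by fact
  interpret P: primeideal P R using insert by blast
  have Pi: "ideal P R" by (rule P.ideal_axioms)
  have iQ: "ideal Q R" if "Q \<in> \<P>" for Q using insert(4)[of Q] that by (auto dest: primeideal.axioms(1))
  show ?case
  proof (cases "J \<subseteq> \<Union>\<P>")
    case True
    have "\<exists>P\<in>\<P>. J \<subseteq> P" by (rule insert(3)) (use insert(4,5) True in auto)
    then show ?thesis by blast
  next
    case False
    then obtain x where x: "x \<in> J" "x \<notin> \<Union>\<P>" by blast
    then have xP: "x \<in> P" using insert(6) by blast
    show ?thesis
    proof (cases "J \<subseteq> P")
      case False
      then obtain j where j: "j \<in> J" "j \<notin> P" by blast
      have "\<exists>c\<in>carrier R. c \<notin> P \<and> (\<forall>Q\<in>\<P>. c \<in> Q)"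
      proof (rule common_element_avoiding_prime[OF P.primeideal_axioms insert(1)])
        fix Q assume Q: "Q \<in> \<P>"
        then have "\<not> Q \<subseteq> P" using insert(5)[of Q P] insert(2) by blast
        then show "ideal Q R \<and> \<not> Q \<subseteq> P" using iQ[OF Q] by simp
      qed
      then obtain c where c: "c \<in> carrier R" "c \<notin> P" "\<forall>Q\<in>\<P>. c \<in> Q" by blast
      have jc: "j \<in> carrier R" and xc: "x \<in> carrier R" using j x by (auto intro: J.Icarr)
      let ?y = "c \<otimes> j"
      have yJ: "?y \<in> J" using j c by (simp add: J.I_l_closed)
      have yP: "?y \<notin> P" using P.I_prime[OF c(1) jc] c j by blast
      have yc: "?y \<in> carrier R" using c jc by simp
      have eq: "(x \<oplus> ?y) \<ominus> x = ?y" "(x \<oplus> ?y) \<ominus> ?y = x"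
        using module_minus_cancel(5)[OF self_is_module[OF is_cring], of ?y x] module_minus_cancel(3)[OF self_is_module[OF is_cring], of x ?y] xc yc by simp_all
      have "x \<oplus> ?y \<in> J" using x yJ by simp
      then consider "x \<oplus> ?y \<in> P" | Q where "Q \<in> \<P>" "x \<oplus> ?y \<in> Q" using insert(6) by blast
      then have False
      proof cases
        case 1
        then have "(x \<oplus> ?y) \<oplus> \<ominus> x \<in> P" by (rule P.a_closed[OF _ P.a_inv_closed[OF xP]])
        then show False using eq(1) yP by (simp add: minus_eq)
      next
        case (2 Q)
        interpret Q: ideal Q R using iQ 2 by blast
        have yQ: "?y \<in> Q" using c(3) 2 jc by (simp add: Q.I_r_closed)
        have "(x \<oplus> ?y) \<oplus> \<ominus> ?y \<in> Q" by (rule Q.a_closed[OF 2(2) Q.a_inv_closed[OF yQ]])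
        then show False using eq(2) x(2) 2 by (auto simp: minus_eq)
      qed
      then show ?thesis ..
    qed simp
  qed
qed

lemma finite_subset_generates:
  assumes Z: "Z \<subseteq> carrier R"
  shows "\<exists>F. finite F \<and> F \<subseteq> Z \<and> Z \<subseteq> Idl F"
proof -
  let ?S = "{Idl F | F. finite F \<and> F \<subseteq> Z}"
  have "?S \<noteq> {}" by blast
  moreover have "ideal I R" if "I \<in> ?S" for I using that genideal_ideal Z by blast
  ultimately obtain I where I: "I \<in> ?S" "\<forall>J\<in>?S. I \<subseteq> J \<longrightarrow> J = I"
    using noetherian_maximal_ideal[OF noetherian_ring_axioms, of ?S] by blast
  then obtain F where F: "finite F" "F \<subseteq> Z" "I = Idl F" by blast
  have "z \<in> Idl F" if z: "z \<in> Z" for z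
  proof -
    have c: "insert z F \<subseteq> carrier R" using F z Z by blast
    have "Idl (insert z F) \<in> ?S" using F z by blast
    moreover have "Idl F \<subseteq> Idl (insert z F)"
      using genideal_self[OF c] by (intro genideal_minimal genideal_ideal[OF c]) blast
    ultimately have "Idl (insert z F) = Idl F" using I(2) F(3) by blast
    then show ?thesis using genideal_self[OF c] by blast
  qed
  then show ?thesis using F by blast
qed

text
  \<open>The maximal annihilators of elements modulo \<open>K\<close> are primes, finitely many because the elements that they annihilate generate a finitely generated ideal, and their union contains all zero divisors modulo \<open>K\<close>; prime avoidance puts \<open>J\<close> into one of them.\<close>
lemma zero_divisor_ideal_annihilated:
  assumes K: "ideal K R" and J: "ideal J R" and zd: "\<And>x. x \<in> J \<Longrightarrow> \<exists>r\<in>carrier R. r \<notin> K \<and> x \<otimes> r \<in> K"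
  shows "\<exists>z\<in>carrier R. z \<notin> K \<and> (\<forall>x\<in>J. x \<otimes> z \<in> K)"
proof -
  interpret K: ideal K R by fact
  interpret J: ideal J R by fact
  define \<A> where "\<A> = {colon R K {z} | z. z \<in> carrier R \<and> z \<notin> K}"
  define \<M> where "\<M> = {P \<in> \<A>. \<forall>Q\<in>\<A>. P \<subseteq> Q \<longrightarrow> Q = P}"
  have Ai: "ideal P R" if "P \<in> \<A>" for P using that colon_single_ideal[OF K] unfolding \<A>_def by auto
  have Mp: "primeideal P R" if P: "P \<in> \<M>" for P
  proof -
    obtain z where z: "z \<in> carrier R" "z \<notin> K" "P = colon R K {z}" using P unfolding \<M>_def \<A>_def by blast
    show ?thesis unfolding z(3)
    proof (rule maximal_colon_prime[OF K z(1,2)])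
      fix a assume a: "a \<in> carrier R" "a \<otimes> z \<notin> K" "colon R K {z} \<subseteq> colon R K {a \<otimes> z}"
      then have "colon R K {a \<otimes> z} \<in> \<A>" unfolding \<A>_def using z by blast
      then show "colon R K {a \<otimes> z} = colon R K {z}" using P a(3) z(3) unfolding \<M>_def by blast
    qed
  qed
  have below: "\<exists>P\<in>\<M>. Q \<subseteq> P" if Q: "Q \<in> \<A>" for Q
  proof -
    let ?S = "{P \<in> \<A>. Q \<subseteq> P}"
    have "?S \<noteq> {}" using Q by blast
    then obtain P where P: "P \<in> ?S" "\<forall>J\<in>?S. P \<subseteq> J \<longrightarrow> J = P"
      using noetherian_maximal_ideal[OF noetherian_ring_axioms, of ?S] Ai by blast
    then have "P \<in> \<M>" unfolding \<M>_def by blast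
    then show ?thesis using P by blast
  qed
  define Z where "Z = {z \<in> carrier R. z \<notin> K \<and> colon R K {z} \<in> \<M>}"
  have "Z \<subseteq> carrier R" by (auto simp: Z_def)
  from finite_subset_generates[OF this] obtain F where F: "finite F" "F \<subseteq> Z" "Z \<subseteq> Idl F" by blast
  have "\<M> \<subseteq> (\<lambda>z. colon R K {z}) ` F"
  proof
    fix P assume P: "P \<in> \<M>"
    then obtain z where z: "z \<in> carrier R" "z \<notin> K" "P = colon R K {z}" unfolding \<M>_def \<A>_def by blast
    then have zZ: "z \<in> Z" using P by (simp add: Z_def)
    show "P \<in> (\<lambda>z. colon R K {z}) ` F"
    proof (rule ccontr)
      assume no: "P \<notin> (\<lambda>z. colon R K {z}) ` F"
      have "\<exists>c\<in>carrier R. c \<notin> P \<and> (\<forall>Q\<in>(\<lambda>z. colon R K {z}) ` F. c \<in> Q)"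
      proof (rule common_element_avoiding_prime[OF Mp[OF P]])
        show "finite ((\<lambda>z. colon R K {z}) ` F)" using F(1) by simp
        fix Q assume Q: "Q \<in> (\<lambda>z. colon R K {z}) ` F"
        then have QM: "Q \<in> \<M>" using F(2) by (auto simp: Z_def)
        then have QA: "Q \<in> \<A>" by (simp add: \<M>_def)
        have "\<not> Q \<subseteq> P"
        proof
          assume "Q \<subseteq> P"
          then have "P = Q" using QM P unfolding \<M>_def by blast
          then show False using no Q by simp
        qed
        then show "ideal Q R \<and> \<not> Q \<subseteq> P" using Ai[OF QA] by simp
      qed
      then obtain c where c: "c \<in> carrier R" "c \<notin> P" "\<forall>y\<in>F. c \<in> colon R K {y}" by auto
      have "F \<subseteq> colon R K {c}"
      proof
        fix y assume y: "y \<in> F"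
        then have yc: "y \<in> carrier R" using F(2) by (auto simp: Z_def)
        have "c \<otimes> y \<in> K" using c(3) y by (simp add: colon_single)
        then show "y \<in> colon R K {c}" using yc c(1) by (simp add: colon_single m_comm)
      qed
      then have "Idl F \<subseteq> colon R K {c}" by (rule genideal_minimal[OF colon_single_ideal[OF K c(1)]])
      then have "z \<in> colon R K {c}" using F(3) zZ by blast
      then have "c \<in> P" using c(1) z by (simp add: colon_single m_comm)
      then show False using c(2) by simp
    qed
  qed
  then have fin: "finite \<M>" using F(1) finite_subset by blast
  have "J \<subseteq> \<Union>\<M>"
  proof
    fix x assume x: "x \<in> J"
    then have xc: "x \<in> carrier R" by (rule J.Icarr)
    obtain r where r: "r \<in> carrier R" "r \<notin> K" "x \<otimes> r \<in> K" using zd[OF x] by blast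
    then have "colon R K {r} \<in> \<A>" unfolding \<A>_def by blast
    moreover have "x \<in> colon R K {r}" using xc r by (simp add: colon_single)
    ultimately show "x \<in> \<Union>\<M>" using below by blast
  qed
  moreover have "P = Q" if "P \<in> \<M>" "Q \<in> \<M>" "P \<subseteq> Q" for P Q using that unfolding \<M>_def by blast
  ultimately have "\<exists>P\<in>\<M>. J \<subseteq> P" by (intro prime_avoidance[OF J fin Mp])
  then obtain P where P: "P \<in> \<M>" "J \<subseteq> P" by blast
  then obtain z where "z \<in> carrier R" "z \<notin> K" "P = colon R K {z}" unfolding \<M>_def \<A>_def by blast
  then show ?thesis using P(2) by (intro bexI[of _ z]) (auto simp: colon_single)
qed

text \<open>The ideals generated by the initial parts of a regular sequence.\<close>
definition regular_tower :: "nat \<Rightarrow> (nat \<Rightarrow> 'a) \<Rightarrow> (nat \<Rightarrow> 'a set) \<Rightarrow> bool" where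
  "regular_tower d x K \<longleftrightarrow> K 0 = {\<zero>} \<and> (\<forall>j\<le>d. ideal (K j) R) \<and>
    (\<forall>j<d. x j \<in> carrier R \<and> K (Suc j) = {k \<oplus> r \<otimes> x j | k r. k \<in> K j \<and> r \<in> carrier R} \<and>
       (\<forall>r\<in>carrier R. r \<otimes> x j \<in> K j \<longrightarrow> r \<in> K j))"

text
  \<open>A regular sequence in \<open>J\<close> that cannot be extended inside \<open>J\<close>: then \<open>J\<close> consists of zero divisors modulo \<open>K d\<close>.  Such a sequence exists because the ideals of an infinite one would ascend strictly.\<close>
lemma maximal_regular_tower:
  assumes J: "ideal J R" and ne: "J \<noteq> carrier R"
  shows "\<exists>d x K. regular_tower d x K \<and> (\<forall>j<d. x j \<in> J) \<and> K d \<subseteq> J \<and> (\<exists>z\<in>carrier R. z \<notin> K d \<and> (\<forall>y\<in>J. y \<otimes> z \<in> K d))"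
proof (rule ccontr)
  assume no: "\<not> ?thesis"
  interpret J: ideal J R by fact
  have 1: "\<one> \<notin> J" using J.one_imp_carrier ne by blast
  have step: "\<exists>y\<in>J. \<forall>r\<in>carrier R. r \<otimes> y \<in> K d \<longrightarrow> r \<in> K d" if "regular_tower d x K" "\<forall>j<d. x j \<in> J" "K d \<subseteq> J" for d x K
  proof (rule ccontr)
    assume "\<not> ?thesis"
    then have zd: "\<exists>r\<in>carrier R. r \<notin> K d \<and> y \<otimes> r \<in> K d" if "y \<in> J" for y
      using that m_comm[OF _ J.Icarr[OF that]] by metis
    have "ideal (K d) R" using that(1) by (simp add: regular_tower_def)
    from zero_divisor_ideal_annihilated[OF this J zd] show False using no that by blast
  qed
  have sum_ideal: "ideal {k \<oplus> r \<otimes> y | k r. k \<in> K \<and> r \<in> carrier R} R" if K: "ideal K R" and y: "y \<in> carrier R" for K y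
  proof -
    have "{k \<oplus> r \<otimes> y | k r. k \<in> K \<and> r \<in> carrier R} = K <+>\<^bsub>R\<^esub> PIdl y" using add_principal(4)[OF K y] by blast
    then show ?thesis using add_principal(1)[OF K y] by simp
  qed
  let ?nx = "\<lambda>K y. {k \<oplus> r \<otimes> y | k r. k \<in> K \<and> r \<in> carrier R}"
  let ?P = "\<lambda>(n::nat) K. ideal K R \<and> K \<subseteq> J \<and> (\<exists>x L. regular_tower n x L \<and> (\<forall>j<n. x j \<in> J) \<and> L n = K)"
  have "\<exists>f. \<forall>n. ?P n (f n) \<and> f n \<subset> f (Suc n)"
  proof (rule dependent_nat_choice)
    have "regular_tower 0 (\<lambda>_. \<zero>) (\<lambda>_. {\<zero>})" using zeroideal by (simp add: regular_tower_def)
    then show "\<exists>K. ?P 0 K" using zeroideal J.zero_closed by (intro exI[of _ "{\<zero>}"]) auto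
  next
    fix K n assume P: "?P n K"
    then obtain x L where L: "regular_tower n x L" "\<forall>j<n. x j \<in> J" "L n = K" by (elim conjE exE) (rule that)
    have KJ: "ideal K R" "K \<subseteq> J" using P by simp_all
    then have "L n \<subseteq> J" using L(3) by simp
    from step[OF L(1,2) this] obtain y where y: "y \<in> J" "\<forall>r\<in>carrier R. r \<otimes> y \<in> K \<longrightarrow> r \<in> K"
      unfolding L(3) by (elim bexE) (rule that)
    have yc: "y \<in> carrier R" using y by (auto intro: J.Icarr)
    interpret K: ideal K R by (rule KJ(1))
    have id: "ideal (?nx K y) R" by (rule sum_ideal[OF K.ideal_axioms yc])
    have sub: "?nx K y \<subseteq> J"
    proof
      fix t assume "t \<in> ?nx K y"
      then obtain k r where "t = k \<oplus> r \<otimes> y" "k \<in> K" "r \<in> carrier R" by blast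
      then show "t \<in> J" using KJ(2) J.I_l_closed[OF y(1)] by auto
    qed
    have yn: "y \<notin> K"
    proof
      assume "y \<in> K"
      then have "\<one> \<otimes> y \<in> K" using yc by simp
      then have "\<one> \<in> K" by (rule y(2)[rule_format, OF one_closed])
      then show False using KJ(2) 1 by auto
    qed
    have "k \<in> ?nx K y" if "k \<in> K" for k
    proof -
      have "k = k \<oplus> \<zero> \<otimes> y" using yc K.Icarr[OF that] by simp
      then show ?thesis using that by blast
    qed
    moreover have "y = \<zero> \<oplus> \<one> \<otimes> y" using yc by simp
    then have "y \<in> ?nx K y" using K.zero_closed by blast
    ultimately have lt: "K \<subset> ?nx K y" using yn by blast
    have "regular_tower (Suc n) (x(n := y)) (L(Suc n := ?nx K y))"
      unfolding regular_tower_def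
    proof (intro conjI allI impI)
      note L' = L(1)[unfolded regular_tower_def]
      show "(L(Suc n := ?nx K y)) 0 = {\<zero>}" using L' by simp
      show "ideal ((L(Suc n := ?nx K y)) j) R" if "j \<le> Suc n" for j using L' id that by (cases "j = Suc n") auto
      fix j assume j: "j < Suc n"
      show "(x(n := y)) j \<in> carrier R" using L' j yc by (cases "j = n") auto
      show "(L(Suc n := ?nx K y)) (Suc j) = {k \<oplus> r \<otimes> (x(n := y)) j | k r. k \<in> (L(Suc n := ?nx K y)) j \<and> r \<in> carrier R}"
      proof (cases "j = n")
        case True
        then show ?thesis using L(3) by simp
      next
        case False
        then have "j < n" using j by simp
        then show ?thesis using L' by simp
      qed
      show "\<forall>r\<in>carrier R. r \<otimes> (x(n := y)) j \<in> (L(Suc n := ?nx K y)) j \<longrightarrow> r \<in> (L(Suc n := ?nx K y)) j"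
      proof (cases "j = n")
        case True
        then show ?thesis using y(2) L(3) by (simp del: K.a_Hcarr)
      next
        case False
        then have "j < n" using j by simp
        then show ?thesis using L' by simp
      qed
    qed
    moreover have "\<forall>j<Suc n. (x(n := y)) j \<in> J" using L(2) y(1) by (auto simp: less_Suc_eq)
    ultimately show "\<exists>K'. ?P (Suc n) K' \<and> K \<subset> K'"
      using id sub lt by (intro exI[of _ "?nx K y"] conjI exI[of _ "x(n := y)"] exI[of _ "L(Suc n := ?nx K y)"]) auto
  qed
  then obtain f where f': "\<forall>n. ?P n (f n) \<and> f n \<subset> f (Suc n)" by (elim exE) (rule that)
  have f: "ideal (f n) R" "f n \<subset> f (Suc n)" for n using spec[OF f', of n] by simp_all
  have "range f \<noteq> {}" by blast
  moreover have "ideal I R" if "I \<in> range f" for I using that f(1) by auto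
  ultimately obtain n where n: "\<forall>J\<in>range f. f n \<subseteq> J \<longrightarrow> J = f n"
    using noetherian_maximal_ideal[OF noetherian_ring_axioms, of "range f"] by blast
  then show False using f(2)[of n] by blast
qed

end

section \<open>Acyclicity of the base-changed resolution\<close>

context noetherian_cring
begin

abbreviation "FM \<equiv> free_module R"
abbreviation "IV \<equiv> ideal_vectors R"
abbreviation "free_resolution I T \<equiv> projective_resolution R (cyclic_module R I) (\<lambda>i. free_module R (T i))"

lemma FM: "module R (FM T)" by (rule free_is_module[OF is_cring])

lemma FM_minus_apply: "u \<in> carrier (FM T) \<Longrightarrow> v \<in> carrier (FM T) \<Longrightarrow> (u \<ominus>\<^bsub>FM T\<^esub> v) k = u k \<ominus> v k"
  using mod_hom_minus[OF FM self_is_module[OF is_cring] eval_hom[OF is_cring], of u T v k] by simp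

lemma module_minus_add:
  assumes M: "module R M" and p: "p \<in> carrier M" "a \<in> carrier M" "r \<in> carrier M"
  shows "p \<ominus>\<^bsub>M\<^esub> r = (p \<ominus>\<^bsub>M\<^esub> (a \<oplus>\<^bsub>M\<^esub> r)) \<oplus>\<^bsub>M\<^esub> a"
proof -
  interpret M: module R M by (rule M)
  have "(p \<ominus>\<^bsub>M\<^esub> (a \<oplus>\<^bsub>M\<^esub> r)) \<oplus>\<^bsub>M\<^esub> a = (p \<oplus>\<^bsub>M\<^esub> \<ominus>\<^bsub>M\<^esub> r) \<oplus>\<^bsub>M\<^esub> (\<ominus>\<^bsub>M\<^esub> a \<oplus>\<^bsub>M\<^esub> a)"
    using p by (simp add: M.minus_eq M.minus_add M.a_ac)
  then show ?thesis using p by (simp add: M.minus_eq M.l_neg)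
qed

lemma module_minus_zero: "module R M \<Longrightarrow> p \<in> carrier M \<Longrightarrow> p \<ominus>\<^bsub>M\<^esub> \<zero>\<^bsub>M\<^esub> = p"
proof -
  assume M: "module R M" and p: "p \<in> carrier M"
  interpret M: module R M by (rule M)
  show ?thesis using module_minus_cancel(3)[OF M p M.M.zero_closed] p by simp
qed

lemma IV_D: "v \<in> IV K T \<Longrightarrow> v \<in> carrier (FM T)" "v \<in> IV K T \<Longrightarrow> v k \<in> K"
  by (auto simp: ideal_vectors_def)

lemma IV_I: "v \<in> carrier (FM T) \<Longrightarrow> (\<And>k. v k \<in> K) \<Longrightarrow> v \<in> IV K T"
  by (auto simp: ideal_vectors_def)

lemma IV_sub: "ideal K R \<Longrightarrow> submodule (IV K T) R (FM T)"
  by (rule ideal_vectors_submodule[OF is_cring])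

text \<open>\<open>K' = K + x R\<close>, where \<open>x\<close> is a non-zero-divisor modulo \<open>K\<close>.\<close>
definition regular_step :: "'a set \<Rightarrow> 'a \<Rightarrow> 'a set \<Rightarrow> bool" where
  "regular_step K x K' \<longleftrightarrow> ideal K R \<and> ideal K' R \<and> x \<in> carrier R \<and> K' = {k \<oplus> r \<otimes> x | k r. k \<in> K \<and> r \<in> carrier R} \<and>
     (\<forall>r\<in>carrier R. r \<otimes> x \<in> K \<longrightarrow> r \<in> K)"

lemma regular_step_D:
  assumes "regular_step K x K'"
  shows "ideal K R" "ideal K' R" "x \<in> carrier R"
proof -
  note t = assms[unfolded regular_step_def]
  show "ideal K R" by (rule t[THEN conjunct1])
  show "ideal K' R" by (rule t[THEN conjunct2, THEN conjunct1])
  show "x \<in> carrier R" by (rule t[THEN conjunct2, THEN conjunct2, THEN conjunct1])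
qed

lemma IV_regular:
  assumes "regular_step K x K'" "v \<in> carrier (FM T)" "x \<odot>\<^bsub>FM T\<^esub> v \<in> IV K T"
  shows "v \<in> IV K T"
proof (rule IV_I[OF assms(2)])
  fix k
  have vk: "v k \<in> carrier R" by (rule free_mem_closed[OF is_cring assms(2)])
  have x: "x \<in> carrier R" using assms(1) by (simp add: regular_step_def)
  have "v k \<otimes> x \<in> K" using IV_D(2)[OF assms(3), of k] vk x by (simp add: free_simps m_comm)
  then show "v k \<in> K" using assms(1) vk unfolding regular_step_def by blast
qed

lemma IV_combine:
  assumes "regular_step K x K'" "w \<in> IV K T" "t \<in> carrier (FM T)"
  shows "w \<oplus>\<^bsub>FM T\<^esub> x \<odot>\<^bsub>FM T\<^esub> t \<in> IV K' T"
proof -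
  interpret F: module R "FM T" by (rule FM)
  have x: "x \<in> carrier R" using assms(1) by (simp add: regular_step_def)
  show ?thesis
  proof (rule IV_I)
    show "w \<oplus>\<^bsub>FM T\<^esub> x \<odot>\<^bsub>FM T\<^esub> t \<in> carrier (FM T)" using IV_D(1)[OF assms(2)] assms(3) x by simp
    fix k
    have tk: "t k \<in> carrier R" by (rule free_mem_closed[OF is_cring assms(3)])
    have "w k \<oplus> t k \<otimes> x \<in> K'" using assms(1) tk IV_D(2)[OF assms(2), of k] unfolding regular_step_def by blast
    then show "(w \<oplus>\<^bsub>FM T\<^esub> x \<odot>\<^bsub>FM T\<^esub> t) k \<in> K'" using tk x by (simp add: free_simps m_comm)
  qed
qed

lemma IV_step_mono:
  assumes s: "regular_step K x K'" and w: "w \<in> IV K T"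
  shows "w \<in> IV K' T"
proof -
  interpret F: module R "FM T" by (rule FM)
  have x: "x \<in> carrier R" using s by (simp add: regular_step_def)
  have "w = w \<oplus>\<^bsub>FM T\<^esub> x \<odot>\<^bsub>FM T\<^esub> \<zero>\<^bsub>FM T\<^esub>" using IV_D(1)[OF w] x by simp
  then show ?thesis using IV_combine[OF s w F.M.zero_closed] by simp
qed

lemma IV_decompose:
  assumes s: "regular_step K x K'" and T: "finite T" and u: "u \<in> IV K' T"
  shows "\<exists>w\<in>IV K T. \<exists>t\<in>carrier (FM T). u = w \<oplus>\<^bsub>FM T\<^esub> x \<odot>\<^bsub>FM T\<^esub> t"
proof -
  note K = regular_step_D(1)[OF s] and x = regular_step_D(3)[OF s]
  interpret K: ideal K R by (rule K)
  have "\<forall>k\<in>T. \<exists>p. fst p \<in> K \<and> snd p \<in> carrier R \<and> u k = fst p \<oplus> snd p \<otimes> x"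
  proof
    fix k assume "k \<in> T"
    have "u k \<in> {k \<oplus> r \<otimes> x | k r. k \<in> K \<and> r \<in> carrier R}" using IV_D(2)[OF u, of k] s by (simp add: regular_step_def)
    then obtain a r where "u k = a \<oplus> r \<otimes> x" "a \<in> K" "r \<in> carrier R" by blast
    then show "\<exists>p. fst p \<in> K \<and> snd p \<in> carrier R \<and> u k = fst p \<oplus> snd p \<otimes> x" by (intro exI[of _ "(a, r)"]) simp
  qed
  from bchoice[OF this] obtain p where p: "\<And>k. k \<in> T \<Longrightarrow> fst (p k) \<in> K \<and> snd (p k) \<in> carrier R \<and> u k = fst (p k) \<oplus> snd (p k) \<otimes> x"
    by auto
  let ?w = "\<lambda>k. if k \<in> T then fst (p k) else \<zero>" and ?t = "\<lambda>k. if k \<in> T then snd (p k) else \<zero>"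
  have "?w \<in> carrier (FM T)" "?t \<in> carrier (FM T)" using p K.Icarr by (auto simp: free_mem_finite_iff[OF T])
  moreover have "?w k \<in> K" for k using p K.zero_closed by auto
  ultimately have "?w \<in> IV K T" "?t \<in> carrier (FM T)" by (auto intro!: IV_I)
  moreover have "u = ?w \<oplus>\<^bsub>FM T\<^esub> x \<odot>\<^bsub>FM T\<^esub> ?t"
  proof
    fix k show "u k = (?w \<oplus>\<^bsub>FM T\<^esub> x \<odot>\<^bsub>FM T\<^esub> ?t) k"
      using p[of k] x free_mem_off[OF IV_D(1)[OF u], of k] by (cases "k \<in> T") (simp_all add: free_simps m_comm)
  qed
  ultimately show ?thesis by blast
qed

text \<open>Exactness in degree \<open>i + 1\<close> of the complex modulo \<open>K\<close>, in terms of representatives.\<close>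
definition exact_mod :: "(nat \<Rightarrow> 'x set) \<Rightarrow> (nat \<Rightarrow> ('x \<Rightarrow> 'a) \<Rightarrow> ('x \<Rightarrow> 'a)) \<Rightarrow> 'a set \<Rightarrow> nat \<Rightarrow> bool" where
  "exact_mod T D K i \<longleftrightarrow> (\<forall>v\<in>carrier (FM (T (Suc i))). D i v \<in> IV K (T i) \<longrightarrow>
     (\<exists>w\<in>carrier (FM (T (Suc (Suc i)))). v \<ominus>\<^bsub>FM (T (Suc i))\<^esub> D (Suc i) w \<in> IV K (T (Suc i))))"

lemma exact_mod_D:
  assumes "exact_mod T D K i" "v \<in> carrier (FM (T (Suc i)))" "D i v \<in> IV K (T i)"
  obtains w where "w \<in> carrier (FM (T (Suc (Suc i))))" "v \<ominus>\<^bsub>FM (T (Suc i))\<^esub> D (Suc i) w \<in> IV K (T (Suc i))"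
  using assms unfolding exact_mod_def by blast

text
  \<open>The long exact homology sequence of \<open>0 \<rightarrow> C / K C \<rightarrow> C / K C \<rightarrow> C / K' C \<rightarrow> 0\<close>, the first map being multiplication by \<open>x\<close>.\<close>
lemma exact_mod_step_up:
  assumes s: "regular_step K x K'" and T: "\<And>i. finite (T i)"
    and D: "\<And>i. D i \<in> mod_hom R (FM (T (Suc i))) (FM (T i))"
    and DD: "\<And>i v. v \<in> carrier (FM (T (Suc (Suc i)))) \<Longrightarrow> D i (D (Suc i) v) = \<zero>\<^bsub>FM (T i)\<^esub>"
    and ex: "exact_mod T D K i" "exact_mod T D K (Suc i)"
  shows "exact_mod T D K' (Suc i)"
  unfolding exact_mod_def
proof (intro ballI impI)
  note K = regular_step_D(1)[OF s] and K' = regular_step_D(2)[OF s] and x = regular_step_D(3)[OF s]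
  let ?F = "\<lambda>i. FM (T i)" and ?A = "FM (T (Suc i))" and ?B = "FM (T (Suc (Suc i)))"
  note Dc = mod_hom_closed[OF D]
  interpret F0: module R "?F i" by (rule FM)
  interpret F1: module R "?A" by (rule FM)
  interpret F2: module R "?B" by (rule FM)
  fix v assume v: "v \<in> carrier (?B)" "D (Suc i) v \<in> IV K' (T (Suc i))"
  obtain w t where wt: "w \<in> IV K (T (Suc i))" "t \<in> carrier (?A)" "D (Suc i) v = w \<oplus>\<^bsub>?A\<^esub> x \<odot>\<^bsub>?A\<^esub> t"
    using IV_decompose[OF s T v(2)] by blast
  have wc: "w \<in> carrier (?A)" by (rule IV_D(1)[OF wt(1)])
  have Dw: "D i w \<in> IV K (T i)" by (rule ideal_vectors_hom[OF is_cring K D wt(1)])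
  have xt: "x \<odot>\<^bsub>?A\<^esub> t \<in> carrier (?A)" using x wt by simp
  have "D i w \<oplus>\<^bsub>?F i\<^esub> x \<odot>\<^bsub>?F i\<^esub> D i t = \<zero>\<^bsub>?F i\<^esub>"
    using DD[OF v(1)] unfolding wt(3) mod_hom_add[OF D wc xt] mod_hom_smult[OF D x wt(2)] .
  then have "x \<odot>\<^bsub>?F i\<^esub> D i t \<oplus>\<^bsub>?F i\<^esub> D i w = \<zero>\<^bsub>?F i\<^esub>"
    using x Dc[OF wt(2)] Dc[OF wc] by (simp add: F0.M.a_comm)
  then have "x \<odot>\<^bsub>?F i\<^esub> D i t \<oplus>\<^bsub>?F i\<^esub> D i w \<in> IV K (T i)" using submodule_zero[OF IV_sub[OF K]] by simp
  then have "x \<odot>\<^bsub>?F i\<^esub> D i t \<in> IV K (T i)"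
    by (rule submodule_add_cancel[OF FM IV_sub[OF K] F0.smult_closed[OF x Dc[OF wt(2)]] Dw])
  then have "D i t \<in> IV K (T i)" by (rule IV_regular[OF s Dc[OF wt(2)]])
  from exact_mod_D[OF ex(1) wt(2) this] obtain t' where t': "t' \<in> carrier (?B)"
    "t \<ominus>\<^bsub>?A\<^esub> D (Suc i) t' \<in> IV K (T (Suc i))" .
  let ?xt = "x \<odot>\<^bsub>?B\<^esub> t'"
  have xt': "?xt \<in> carrier (?B)" using x t' by simp
  let ?v = "v \<ominus>\<^bsub>?B\<^esub> ?xt"
  have v': "?v \<in> carrier (?B)" using v xt' by simp
  have "D (Suc i) ?v = (w \<oplus>\<^bsub>?A\<^esub> x \<odot>\<^bsub>?A\<^esub> t) \<ominus>\<^bsub>?A\<^esub> x \<odot>\<^bsub>?A\<^esub> D (Suc i) t'"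
    using mod_hom_minus[OF FM FM D v(1) xt'] mod_hom_smult[OF D x t'(1)] wt(3) by simp
  also have "\<dots> = w \<oplus>\<^bsub>?A\<^esub> x \<odot>\<^bsub>?A\<^esub> (t \<ominus>\<^bsub>?A\<^esub> D (Suc i) t')"
    using wc x wt(2) Dc[OF t'(1)] by (simp add: F1.M.minus_eq F1.smult_r_distr F1.smult_r_minus F1.M.a_assoc)
  also have "\<dots> \<in> IV K (T (Suc i))"
    by (intro submodule_add[OF IV_sub[OF K]] submodule_smult[OF IV_sub[OF K]] wt(1) x t'(2))
  finally have "D (Suc i) ?v \<in> IV K (T (Suc i))" .
  from exact_mod_D[OF ex(2) v' this] obtain w' where w': "w' \<in> carrier (?F (Suc (Suc (Suc i))))"
    "?v \<ominus>\<^bsub>?B\<^esub> D (Suc (Suc i)) w' \<in> IV K (T (Suc (Suc i)))" .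
  have "(?v \<ominus>\<^bsub>?B\<^esub> D (Suc (Suc i)) w') \<oplus>\<^bsub>?B\<^esub> ?xt \<in> IV K' (T (Suc (Suc i)))"
    by (rule IV_combine[OF s w'(2) t'(1)])
  also have "(?v \<ominus>\<^bsub>?B\<^esub> D (Suc (Suc i)) w') \<oplus>\<^bsub>?B\<^esub> ?xt = v \<ominus>\<^bsub>?B\<^esub> D (Suc (Suc i)) w'"
    using v(1) xt' Dc[OF w'(1)]
    by (subst module_minus_add[OF FM v(1) xt' Dc[OF w'(1)]]) (simp add: F2.M.minus_eq F2.M.minus_add F2.M.a_assoc)
  finally show "\<exists>w\<in>carrier (?F (Suc (Suc (Suc i)))). v \<ominus>\<^bsub>?B\<^esub> D (Suc (Suc i)) w \<in> IV K' (T (Suc (Suc i)))"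
    using w'(1) by blast
qed

text
  \<open>If a power of \<open>x\<close> is homotopic to zero, then \<open>x\<close> acts nilpotently on the homology of \<open>C / K C\<close>, while the vanishing of the next homology of \<open>C / K' C\<close> makes it act injectively.\<close>
lemma exact_mod_step_down:
  assumes s: "regular_step K x K'" and T: "\<And>i. finite (T i)"
    and D: "\<And>i. D i \<in> mod_hom R (FM (T (Suc i))) (FM (T i))"
    and DD: "\<And>i v. v \<in> carrier (FM (T (Suc (Suc i)))) \<Longrightarrow> D i (D (Suc i) v) = \<zero>\<^bsub>FM (T i)\<^esub>"
    and ex: "exact_mod T D K' (Suc i)"
    and h: "h \<in> mod_hom R (FM (T (Suc i))) (FM (T (Suc (Suc i))))" and h': "h' \<in> mod_hom R (FM (T i)) (FM (T (Suc i)))"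
    and hom: "\<And>v. v \<in> carrier (FM (T (Suc i))) \<Longrightarrow>
        (x [^] (N::nat)) \<odot>\<^bsub>FM (T (Suc i))\<^esub> v = D (Suc i) (h v) \<oplus>\<^bsub>FM (T (Suc i))\<^esub> h' (D i v)"
  shows "exact_mod T D K i"
  unfolding exact_mod_def
proof (intro ballI impI)
  note K = regular_step_D(1)[OF s] and K' = regular_step_D(2)[OF s] and x = regular_step_D(3)[OF s]
  let ?F = "\<lambda>i. FM (T i)" and ?A = "FM (T (Suc i))" and ?B = "FM (T (Suc (Suc i)))"
  note Dc = mod_hom_closed[OF D]
  interpret F1: module R "?A" by (rule FM)
  interpret F2: module R "?B" by (rule FM)
  fix v assume v: "v \<in> carrier (?A)" "D i v \<in> IV K (T i)"
  let ?Q = "\<lambda>y. \<exists>w\<in>carrier (?B). y \<ominus>\<^bsub>?A\<^esub> D (Suc i) w \<in> IV K (T (Suc i))"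
  have cancel: "?Q y" if y: "y \<in> carrier (?A)" and Q: "?Q (x \<odot>\<^bsub>?A\<^esub> y)" for y
  proof -
    obtain w where w: "w \<in> carrier (?B)" "x \<odot>\<^bsub>?A\<^esub> y \<ominus>\<^bsub>?A\<^esub> D (Suc i) w \<in> IV K (T (Suc i))"
      using Q by blast
    let ?u = "x \<odot>\<^bsub>?A\<^esub> y \<ominus>\<^bsub>?A\<^esub> D (Suc i) w"
    have xy: "x \<odot>\<^bsub>?A\<^esub> y \<in> carrier (?A)" using x y by simp
    have Dw: "D (Suc i) w \<in> carrier (?A)" by (rule Dc[OF w(1)])
    have uc: "?u \<in> carrier (?A)" using xy Dw by simp
    have u': "?u \<in> IV K' (T (Suc i))" by (rule IV_step_mono[OF s w(2)])
    have "\<zero>\<^bsub>?A\<^esub> \<oplus>\<^bsub>?A\<^esub> x \<odot>\<^bsub>?A\<^esub> y \<in> IV K' (T (Suc i))"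
      by (rule IV_combine[OF s submodule_zero[OF IV_sub[OF K]] y])
    then have "x \<odot>\<^bsub>?A\<^esub> y \<in> IV K' (T (Suc i))" using xy by simp
    then have "x \<odot>\<^bsub>?A\<^esub> y \<ominus>\<^bsub>?A\<^esub> ?u \<in> IV K' (T (Suc i))" by (rule submodule_minus[OF FM IV_sub[OF K'] _ u'])
    moreover have "x \<odot>\<^bsub>?A\<^esub> y \<ominus>\<^bsub>?A\<^esub> ?u = D (Suc i) w"
      using xy Dw by (simp add: F1.M.minus_eq F1.M.minus_add F1.M.a_ac F1.M.r_neg2 F1.M.r_neg1 F1.M.r_neg)
    ultimately have "D (Suc i) w \<in> IV K' (T (Suc i))" by simp
    from exact_mod_D[OF ex w(1) this] obtain w' where w': "w' \<in> carrier (?F (Suc (Suc (Suc i))))"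
      "w \<ominus>\<^bsub>?B\<^esub> D (Suc (Suc i)) w' \<in> IV K' (T (Suc (Suc i)))" .
    obtain a b where ab: "a \<in> IV K (T (Suc (Suc i)))" "b \<in> carrier (?B)"
      "w \<ominus>\<^bsub>?B\<^esub> D (Suc (Suc i)) w' = a \<oplus>\<^bsub>?B\<^esub> x \<odot>\<^bsub>?B\<^esub> b"
      using IV_decompose[OF s T w'(2)] by blast
    have ac: "a \<in> carrier (?B)" by (rule IV_D(1)[OF ab(1)])
    have xb: "x \<odot>\<^bsub>?B\<^esub> b \<in> carrier (?B)" using x ab by simp
    have "D (Suc i) (w \<ominus>\<^bsub>?B\<^esub> D (Suc (Suc i)) w') = D (Suc i) w"
      using mod_hom_minus[OF FM FM D w(1) Dc[OF w'(1)]] DD[OF w'(1)] module_minus_zero[OF FM Dw] by simp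
    then have Dw_eq: "D (Suc i) w = D (Suc i) a \<oplus>\<^bsub>?A\<^esub> x \<odot>\<^bsub>?A\<^esub> D (Suc i) b"
      unfolding ab(3) mod_hom_add[OF D ac xb] mod_hom_smult[OF D x ab(2)] by simp
    have Da: "D (Suc i) a \<in> IV K (T (Suc i))" by (rule ideal_vectors_hom[OF is_cring K D ab(1)])
    let ?y = "y \<ominus>\<^bsub>?A\<^esub> D (Suc i) b"
    have Dac: "D (Suc i) a \<in> carrier (?A)" and Dbc: "D (Suc i) b \<in> carrier (?A)" using Dc ac ab(2) by auto
    have yc: "?y \<in> carrier (?A)" using y Dbc by simp
    have xDb: "x \<odot>\<^bsub>?A\<^esub> D (Suc i) b \<in> carrier (?A)" by (rule F1.smult_closed[OF x Dbc])
    have "x \<odot>\<^bsub>?A\<^esub> ?y = x \<odot>\<^bsub>?A\<^esub> y \<ominus>\<^bsub>?A\<^esub> x \<odot>\<^bsub>?A\<^esub> D (Suc i) b"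
      using x y Dbc by (simp add: F1.M.minus_eq F1.smult_r_distr F1.smult_r_minus)
    also have "\<dots> = ?u \<oplus>\<^bsub>?A\<^esub> D (Suc i) a" unfolding Dw_eq by (rule module_minus_add[OF FM xy Dac xDb])
    also have "\<dots> \<in> IV K (T (Suc i))" by (rule submodule_add[OF IV_sub[OF K] w(2) Da])
    finally have "?y \<in> IV K (T (Suc i))" by (rule IV_regular[OF s yc])
    then show ?thesis using ab(2) by blast
  qed
  have "?Q ((x [^] k) \<odot>\<^bsub>?A\<^esub> v) \<Longrightarrow> ?Q v" for k :: nat
  proof (induction k)
    case 0
    then show ?case using v(1) by simp
  next
    case (Suc k)
    have y: "(x [^] k) \<odot>\<^bsub>?A\<^esub> v \<in> carrier (?A)" using x v(1) by simp
    have "(x [^] Suc k) \<odot>\<^bsub>?A\<^esub> v = x \<odot>\<^bsub>?A\<^esub> ((x [^] k) \<odot>\<^bsub>?A\<^esub> v)"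
      using x v(1) by (simp add: F1.smult_assoc1[symmetric] m_comm)
    then show ?case using Suc cancel[OF y] by simp
  qed
  moreover have "?Q ((x [^] N) \<odot>\<^bsub>?A\<^esub> v)"
  proof
    show hv: "h v \<in> carrier (?B)" by (rule mod_hom_closed[OF h v(1)])
    have I: "h' (D i v) \<in> IV K (T (Suc i))" by (rule ideal_vectors_hom[OF is_cring K h' v(2)])
    then show "(x [^] N) \<odot>\<^bsub>?A\<^esub> v \<ominus>\<^bsub>?A\<^esub> D (Suc i) (h v) \<in> IV K (T (Suc i))"
      unfolding hom[OF v(1)] using module_minus_cancel(5)[OF FM IV_D(1)[OF I] Dc[OF hv]] by simp
  qed
  ultimately show "?Q v" by blast
qed

lemma regular_tower_step:
  assumes "regular_tower d x K" "j < d"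
  shows "regular_step (K j) (x j) (K (Suc j))"
proof -
  note t = assms(1)[unfolded regular_tower_def]
  have K: "\<forall>j\<le>d. ideal (K j) R" using t by (elim conjE)
  have 1: "ideal (K j) R" by (rule K[rule_format]) (use assms(2) in simp)
  have 2: "ideal (K (Suc j)) R" by (rule K[rule_format]) (use assms(2) in simp)
  show ?thesis unfolding regular_step_def using 1 2 t assms(2) by blast
qed

lemma exact_mod_tower_up:
  assumes tower: "regular_tower d x K" and T: "\<And>i. finite (T i)"
    and D: "\<And>i. D i \<in> mod_hom R (FM (T (Suc i))) (FM (T i))"
    and DD: "\<And>i v. v \<in> carrier (FM (T (Suc (Suc i)))) \<Longrightarrow> D i (D (Suc i) v) = \<zero>\<^bsub>FM (T i)\<^esub>"
    and ex: "\<And>i. exact_mod T D {\<zero>} i"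
  shows "j \<le> d \<Longrightarrow> j \<le> i \<Longrightarrow> exact_mod T D (K j) i"
proof (induction j arbitrary: i)
  case 0
  have "K 0 = {\<zero>}" using tower by (simp add: regular_tower_def)
  then show ?case using ex by simp
next
  case (Suc j)
  then obtain i' where i: "i = Suc i'" by (cases i) auto
  show ?case unfolding i
    by (rule exact_mod_step_up[where T = T and D = D, OF regular_tower_step[OF tower] T D DD]) (use Suc i in simp_all)
qed

lemma exact_mod_tower_down:
  assumes tower: "regular_tower d x K" and T: "\<And>i. finite (T i)"
    and D: "\<And>i. D i \<in> mod_hom R (FM (T (Suc i))) (FM (T i))"
    and DD: "\<And>i v. v \<in> carrier (FM (T (Suc (Suc i)))) \<Longrightarrow> D i (D (Suc i) v) = \<zero>\<^bsub>FM (T i)\<^esub>"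
    and ex: "\<And>i. d \<le> i \<Longrightarrow> exact_mod T D (K d) i"
    and h: "\<And>i j. j < d \<Longrightarrow> h j i \<in> mod_hom R (FM (T i)) (FM (T (Suc i)))"
    and hom: "\<And>i j v. j < d \<Longrightarrow> v \<in> carrier (FM (T (Suc i))) \<Longrightarrow>
        (x j [^] (N::nat)) \<odot>\<^bsub>FM (T (Suc i))\<^esub> v = D (Suc i) (h j (Suc i) v) \<oplus>\<^bsub>FM (T (Suc i))\<^esub> h j i (D i v)"
  shows "exact_mod T D {\<zero>} i"
proof -
  have "k \<le> d \<Longrightarrow> \<forall>i\<ge>d - k. exact_mod T D (K (d - k)) i" for k
  proof (induction k)
    case 0
    then show ?case using ex by simp
  next
    case (Suc k)
    let ?j = "d - Suc k"
    have j: "?j < d" "Suc ?j = d - k" using Suc.prems by auto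
    show ?case
    proof (intro allI impI)
      fix i assume i: "?j \<le> i"
      show "exact_mod T D (K ?j) i"
      proof (rule exact_mod_step_down[where T = T and D = D, OF regular_tower_step[OF tower j(1)] T D DD _ h[OF j(1), of "Suc i"] h[OF j(1), of i] hom[OF j(1), of _ i]])
        have "d - k \<le> Suc i" using i j(2) by simp
        then show "exact_mod T D (K (Suc ?j)) (Suc i)" unfolding j(2) using Suc by simp
      qed
    qed
  qed
  from this[of d] have "exact_mod T D (K 0) i" by simp
  then show ?thesis using tower by (simp add: regular_tower_def)
qed

lemma resolution_exact_mod_zero:
  assumes G: "projective_resolution R M (\<lambda>i. FM (T i)) \<delta> \<epsilon>"
  shows "exact_mod T \<delta> {\<zero>} i"
  unfolding exact_mod_def
proof (intro ballI impI)
  interpret F1: module R "FM (T (Suc i))" by (rule FM)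
  fix v assume v: "v \<in> carrier (FM (T (Suc i)))" "\<delta> i v \<in> IV {\<zero>} (T i)"
  have "\<delta> i v = \<zero>\<^bsub>FM (T i)\<^esub>" using IV_D(2)[OF v(2)] by (auto simp: free_simps)
  then have "v \<in> \<delta> (Suc i) ` carrier (FM (T (Suc (Suc i))))" by (rule resolution_facts(9)[OF G v(1)])
  then obtain w where w: "w \<in> carrier (FM (T (Suc (Suc i))))" "v = \<delta> (Suc i) w" by blast
  have "v \<ominus>\<^bsub>FM (T (Suc i))\<^esub> \<delta> (Suc i) w = \<zero>\<^bsub>FM (T (Suc i))\<^esub>"
    using module_minus_cancel(4)[OF FM v(1) v(1)] w(2) by simp
  then show "\<exists>w\<in>carrier (FM (T (Suc (Suc i)))). v \<ominus>\<^bsub>FM (T (Suc i))\<^esub> \<delta> (Suc i) w \<in> IV {\<zero>} (T (Suc i))"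
    using w(1) submodule_zero[OF IV_sub[OF zeroideal]] by metis
qed

text
  \<open>The Auslander-Buchsbaum bound.  Modulo the regular sequence the resolution is still exact in degrees beyond \<open>d\<close>.  The socle element \<open>z\<close> times a basis vector of the last module is a cycle, because the entries of a minimal differential lie in \<open>m\<close>, and it is no boundary.\<close>
lemma resolution_length_le_depth:
  assumes loc: "local_ring R m" and G: "projective_resolution R M (\<lambda>i. FM (T i)) \<delta> \<epsilon>" and T: "\<And>i. finite (T i)"
    and min: "\<And>i y. y \<in> T (Suc i) \<Longrightarrow> \<delta> i (free_basis R y) \<in> IV m (T i)"
    and bounded: "\<And>i. n < i \<Longrightarrow> T i = {}"
    and tower: "regular_tower d x K" and z: "z \<in> carrier R" "z \<notin> K d" "\<And>y. y \<in> m \<Longrightarrow> y \<otimes> z \<in> K d"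
    and i: "d < i"
  shows "T i = {}"
proof (rule ccontr)
  assume ne: "T i \<noteq> {}"
  let ?S = "{i. T i \<noteq> {}}"
  have "?S \<subseteq> {..n}" using bounded by (auto simp: not_less[symmetric])
  then have fin: "finite ?S" by (rule finite_subset) simp
  define s where "s = Max ?S"
  have sS: "s \<in> ?S" unfolding s_def using ne by (intro Max_in[OF fin]) blast
  have "i \<le> s" unfolding s_def using ne by (intro Max_ge[OF fin]) simp
  then have ds: "d < s" using i by simp
  have "\<not> Suc s \<le> s" by simp
  then have last: "T (Suc s) = {}" using Max_ge[OF fin, of "Suc s"] unfolding s_def by blast
  obtain k where k: "s = Suc k" using ds by (cases s) auto
  note r = resolution_facts[OF G]
  have K: "ideal (K d) R" using tower by (simp add: regular_tower_def)
  interpret K: ideal "K d" R by (rule K)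
  have ex: "exact_mod T \<delta> (K d) k"
    by (rule exact_mod_tower_up[where T = T and D = \<delta>, OF tower T r(3) r(7) resolution_exact_mod_zero[OF G]]) (use ds k in simp_all)
  obtain y where y: "y \<in> T s" using sS by blast
  have e: "free_basis R y \<in> carrier (FM (T (Suc k)))" using y k by (intro free_basis_closed[OF is_cring]) simp
  let ?v = "z \<odot>\<^bsub>FM (T (Suc k))\<^esub> free_basis R y"
  interpret F1: module R "FM (T (Suc k))" by (rule FM)
  interpret F0: module R "FM (T k)" by (rule FM)
  have vc: "?v \<in> carrier (FM (T (Suc k)))" using z e by simp
  have "\<delta> k (free_basis R y) \<in> IV m (T k)" using min y k by simp
  note dm = this
  have "z \<odot>\<^bsub>FM (T k)\<^esub> \<delta> k (free_basis R y) \<in> IV (K d) (T k)"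
  proof (rule IV_I)
    show "z \<odot>\<^bsub>FM (T k)\<^esub> \<delta> k (free_basis R y) \<in> carrier (FM (T k))" using z IV_D(1)[OF dm] by simp
    fix a
    have "\<delta> k (free_basis R y) a \<in> m" by (rule IV_D(2)[OF dm])
    from z(3)[OF this] show "(z \<odot>\<^bsub>FM (T k)\<^esub> \<delta> k (free_basis R y)) a \<in> K d"
      using z(1) free_mem_closed[OF is_cring IV_D(1)[OF dm], of a] by (simp add: free_simps m_comm)
  qed
  then have "\<delta> k ?v \<in> IV (K d) (T k)" using mod_hom_smult[OF r(3) z(1) e] by simp
  from exact_mod_D[OF ex vc this] obtain w where w: "w \<in> carrier (FM (T (Suc (Suc k))))"
    "?v \<ominus>\<^bsub>FM (T (Suc k))\<^esub> \<delta> (Suc k) w \<in> IV (K d) (T (Suc k))" .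
  have "w a = \<zero>" for a using free_mem_off[OF w(1), of a] last k by simp
  then have "w = \<zero>\<^bsub>FM (T (Suc (Suc k)))\<^esub>" by (auto simp: free_simps)
  then have "\<delta> (Suc k) w = \<zero>\<^bsub>FM (T (Suc k))\<^esub>" using mod_hom_zero[OF FM FM r(3), of "Suc k"] by simp
  then have "?v \<in> IV (K d) (T (Suc k))" using w(2) module_minus_zero[OF FM vc] by simp
  from IV_D(2)[OF this, of y] show False using z(1,2) by (simp add: free_simps free_basis_def)
qed

lemma minimal_differential:
  assumes loc: "local_ring R m" and Jm: "J \<subseteq> m" and J: "ideal J R"
    and T0: "T 0 = {x0}" and G: "free_resolution J T \<delta> \<epsilon>" and eps: "\<And>v. \<epsilon> v = J +>\<^bsub>R\<^esub> v x0"
    and min: "\<forall>i. \<forall>c\<in>carrier (FM (T (Suc i))). \<delta> i c = \<zero>\<^bsub>FM (T i)\<^esub> \<longrightarrow> (\<forall>y. c y \<in> Units R \<longrightarrow> c y = \<zero>)"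
    and v: "v \<in> carrier (FM (T (Suc i)))"
  shows "\<delta> i v \<in> IV m (T i)"
proof -
  note r = resolution_facts[OF G]
  interpret m: maximalideal m R using loc by (simp add: local_ring_def)
  have dc: "\<delta> i v \<in> carrier (FM (T i))" by (rule mod_hom_closed[OF r(3) v])
  show ?thesis
  proof (cases i)
    case 0
    have "\<epsilon> (\<delta> 0 v) = J" using r(6) v 0 by (simp add: cyclic_simps(2)[OF is_cring J])
    then have "J +>\<^bsub>R\<^esub> \<delta> 0 v x0 = J" by (simp add: eps)
    then have x0: "\<delta> 0 v x0 \<in> m" using cyclic_simps(5)[OF is_cring J free_mem_closed[OF is_cring dc, of x0]] 0 Jm by auto
    show ?thesis
    proof (rule IV_I[OF dc])
      fix a show "\<delta> i v a \<in> m" using x0 free_mem_off[OF dc, of a] T0 0 by (cases "a = x0") auto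
    qed
  next
    case (Suc j)
    show ?thesis
    proof (rule IV_I[OF dc])
      fix a
      have ac: "\<delta> i v a \<in> carrier R" by (rule free_mem_closed[OF is_cring dc])
      have dc': "\<delta> i v \<in> carrier (FM (T (Suc j)))" using dc Suc by simp
      have "\<delta> j (\<delta> i v) = \<zero>\<^bsub>FM (T j)\<^esub>" using r(7)[of v j] v Suc by simp
      with min dc' have "\<delta> i v a \<in> Units R \<longrightarrow> \<delta> i v a = \<zero>" by blast
      then show "\<delta> i v a \<in> m" using nonunit_in_maximal[OF loc ac] m.zero_closed by auto
    qed
  qed
qed

text
  \<open>Comparison with a finite projective resolution makes the identity homotopic to zero in high degrees.  In a minimal resolution every map \<open>\<delta> t + t \<delta>\<close> takes values in \<open>m\<close> times the free module, so no basis vector can be left there.\<close>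
lemma minimal_resolution_stops:
  assumes loc: "local_ring R m" and Jm: "J \<subseteq> m" and J: "ideal J R"
    and T0: "T 0 = {x0}" and G: "free_resolution J T \<delta> \<epsilon>" and eps: "\<And>v. \<epsilon> v = J +>\<^bsub>R\<^esub> v x0"
    and min: "\<forall>i. \<forall>c\<in>carrier (FM (T (Suc i))). \<delta> i c = \<zero>\<^bsub>FM (T i)\<^esub> \<longrightarrow> (\<forall>y. c y \<in> Units R \<longrightarrow> c y = \<zero>)"
    and fpd: "finite_proj_dim R (ideal_module R J)"
  shows "\<exists>n. \<forall>i>n. T i = {}"
proof -
  note r = resolution_facts[OF G]
  interpret m: maximalideal m R using loc by (simp add: local_ring_def)
  have md: "\<delta> i v \<in> IV m (T i)" if "v \<in> carrier (FM (T (Suc i)))" for i v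
    by (rule minimal_differential[where m = m and J = J and T = T and \<delta> = \<delta> and \<epsilon> = \<epsilon> and ?x0.0 = x0, OF loc Jm J T0 G eps min that])
  let ?JM = "ideal_module R J"
  have JM: "module R ?JM" unfolding ideal_module_def
    by (rule restr_module[OF self_is_module[OF is_cring]]) (simp add: submodule_self_iff[OF is_cring] J)
  have JMs: "carrier ?JM = J" "ring.add ?JM = ring.add R" "ring.zero ?JM = \<zero>" "smult ?JM = monoid.mult R"
    unfolding ideal_module_def by simp_all
  have k0: "v \<in> \<delta> 0 ` carrier (FM (T (Suc 0))) \<longleftrightarrow> v \<in> carrier (FM (T 0)) \<and> v x0 \<in> J" for v
  proof -
    have "v \<in> \<delta> 0 ` carrier (FM (T (Suc 0))) \<longleftrightarrow> v \<in> a_kernel (FM (T 0)) (cyclic_module R J) \<epsilon>"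
      using G by (simp add: projective_resolution_def)
    also have "\<dots> \<longleftrightarrow> v \<in> carrier (FM (T 0)) \<and> v x0 \<in> J"
      using cyclic_simps(5)[OF is_cring J free_mem_closed[OF is_cring, of v "T 0" x0]]
      by (auto simp: a_kernel_iff eps cyclic_simps(2)[OF is_cring J])
    finally show ?thesis .
  qed
  let ?e = "\<lambda>v. \<delta> 0 v x0"
  have e: "?e \<in> mod_hom R (FM (T (Suc 0))) ?JM"
  proof (rule mod_homI)
    fix v assume v: "v \<in> carrier (FM (T (Suc 0)))"
    then show "?e v \<in> carrier ?JM" using k0[of "\<delta> 0 v"] by (simp add: JMs)
    fix w assume w: "w \<in> carrier (FM (T (Suc 0)))"
    show "?e (v \<oplus>\<^bsub>FM (T (Suc 0))\<^esub> w) = ?e v \<oplus>\<^bsub>?JM\<^esub> ?e w"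
      using mod_hom_add[OF r(3) v w] by (simp add: JMs free_simps)
  next
    fix a v assume "a \<in> carrier R" "v \<in> carrier (FM (T (Suc 0)))"
    then show "?e (a \<odot>\<^bsub>FM (T (Suc 0))\<^esub> v) = a \<odot>\<^bsub>?JM\<^esub> ?e v"
      using mod_hom_smult[OF r(3), of a v 0] by (simp add: JMs free_simps)
  qed
  have eJ: "?e ` carrier (FM (T (Suc 0))) = carrier ?JM"
  proof
    show "?e ` carrier (FM (T (Suc 0))) \<subseteq> carrier ?JM" using mod_hom_closed[OF e] by auto
    show "carrier ?JM \<subseteq> ?e ` carrier (FM (T (Suc 0)))"
    proof
      fix a assume a: "a \<in> carrier ?JM"
      then have aJ: "a \<in> J" by (simp add: JMs)
      then have ac: "a \<in> carrier R" using ideal.Icarr[OF J] by blast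
      interpret F0: module R "FM (T 0)" by (rule FM)
      let ?v = "a \<odot>\<^bsub>FM (T 0)\<^esub> free_basis R x0"
      have "?v \<in> carrier (FM (T 0))" using ac T0 by (intro F0.smult_closed free_basis_closed[OF is_cring]) simp_all
      moreover have "?v x0 = a" using ac by (simp add: free_simps free_basis_def)
      ultimately have "?v \<in> \<delta> 0 ` carrier (FM (T (Suc 0)))" using k0 aJ by simp
      then obtain w where "w \<in> carrier (FM (T (Suc 0)))" "?v = \<delta> 0 w" by blast
      then show "a \<in> ?e ` carrier (FM (T (Suc 0)))" using \<open>?v x0 = a\<close> by (intro image_eqI[of _ _ w]) simp_all
    qed
  qed
  have eker: "\<delta> (Suc 0) ` carrier (FM (T (Suc (Suc 0)))) = a_kernel (FM (T (Suc 0))) ?JM ?e"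
  proof -
    have "v \<in> a_kernel (FM (T (Suc 0))) ?JM ?e \<longleftrightarrow> v \<in> a_kernel (FM (T (Suc 0))) (FM (T 0)) (\<delta> 0)" for v
    proof (cases "v \<in> carrier (FM (T (Suc 0)))")
      case True
      note c = mod_hom_closed[OF r(3) True]
      have "\<delta> 0 v = \<zero>\<^bsub>FM (T 0)\<^esub> \<longleftrightarrow> \<delta> 0 v x0 = \<zero>"
      proof
        assume "\<delta> 0 v x0 = \<zero>"
        then have "\<delta> 0 v a = \<zero>" for a using free_mem_off[OF c, of a] T0 by (cases "a = x0") auto
        then show "\<delta> 0 v = \<zero>\<^bsub>FM (T 0)\<^esub>" by (auto simp: free_simps)
      qed (simp add: free_simps)
      then show ?thesis using True by (simp add: a_kernel_iff JMs)
    qed (simp add: a_kernel_iff)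
    then have "a_kernel (FM (T (Suc 0))) ?JM ?e = a_kernel (FM (T (Suc 0))) (FM (T 0)) (\<delta> 0)" by blast
    then show ?thesis using G by (simp add: projective_resolution_def)
  qed
  have G': "projective_resolution R ?JM (\<lambda>i. FM (T (Suc i))) (\<lambda>i. \<delta> (Suc i)) ?e"
    unfolding projective_resolution_def
  proof (intro conjI allI)
    show "projective_module R (FM (T (Suc i)))" for i by (rule r(2))
    show "\<delta> (Suc i) \<in> mod_hom R (FM (T (Suc (Suc i)))) (FM (T (Suc i)))" for i by (rule r(3))
    show "\<delta> (Suc (Suc i)) ` carrier (FM (T (Suc (Suc (Suc i))))) = a_kernel (FM (T (Suc (Suc i)))) (FM (T (Suc i))) (\<delta> (Suc i))" for i
      using G by (simp add: projective_resolution_def)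
  qed (rule e eJ eker)+
  note r' = resolution_facts[OF G']
  from fpd obtain P d \<eta> n where P: "projective_resolution R ?JM (P :: nat \<Rightarrow> ('a, ('a + 'a) list \<Rightarrow> 'a) module) d \<eta>"
    and Pn: "\<forall>i>n. carrier (P i) = {\<zero>\<^bsub>P i\<^esub>}"
    unfolding finite_proj_dim_def by (elim exE conjE) (rule that)
  note rP = resolution_facts[OF P]
  let ?G = "\<lambda>i. FM (T (Suc i))"
  obtain f where f: "\<And>i. f i \<in> mod_hom R (?G i) (P i)" "\<And>x. x \<in> carrier (?G 0) \<Longrightarrow> \<eta> (f 0 x) = ?e x"
    "\<And>i x. x \<in> carrier (?G (Suc i)) \<Longrightarrow> d i (f (Suc i) x) = f i (\<delta> (Suc i) x)"
    using chain_map_exists[OF JM G' P] by blast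
  obtain g where g: "\<And>i. g i \<in> mod_hom R (P i) (?G i)" "\<And>x. x \<in> carrier (P 0) \<Longrightarrow> ?e (g 0 x) = \<eta> x"
    "\<And>i x. x \<in> carrier (P (Suc i)) \<Longrightarrow> \<delta> (Suc i) (g (Suc i) x) = g i (d i x)"
    using chain_map_exists[OF JM P G'] by blast
  note fc = mod_hom_closed[OF f(1)] and gc = mod_hom_closed[OF g(1)]
  have gf: "(\<lambda>x. g i (f i x)) \<in> mod_hom R (?G i) (?G i)" for i by (rule mod_hom_comp[OF g(1) f(1)])
  have "\<exists>t. (\<forall>i. t i \<in> mod_hom R (?G i) (?G (Suc i))) \<and>
    (\<forall>i. \<forall>x\<in>carrier (?G (Suc i)). g (Suc i) (f (Suc i) x) \<ominus>\<^bsub>?G (Suc i)\<^esub> x = \<delta> (Suc (Suc i)) (t (Suc i) x) \<oplus>\<^bsub>?G (Suc i)\<^esub> t i (\<delta> (Suc i) x))"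
    by (rule lift_of_identity_homotopic[OF JM G' gf]) (simp_all add: f g fc)
  then obtain t where t: "\<forall>i. t i \<in> mod_hom R (?G i) (?G (Suc i))"
    "\<forall>i. \<forall>x\<in>carrier (?G (Suc i)). g (Suc i) (f (Suc i) x) \<ominus>\<^bsub>?G (Suc i)\<^esub> x = \<delta> (Suc (Suc i)) (t (Suc i) x) \<oplus>\<^bsub>?G (Suc i)\<^esub> t i (\<delta> (Suc i) x)"
    by (elim exE conjE) (rule that)
  have "T (Suc (Suc i)) = {}" if i: "n < Suc i" for i
  proof (rule ccontr)
    assume "T (Suc (Suc i)) \<noteq> {}"
    then obtain y where y: "y \<in> T (Suc (Suc i))" by blast
    let ?x = "free_basis R y"
    have x: "?x \<in> carrier (?G (Suc i))" by (rule free_basis_closed[OF is_cring y])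
    interpret G1: module R "?G (Suc i)" by (rule FM)
    have "f (Suc i) ?x \<in> carrier (P (Suc i))" by (rule fc[OF x])
    then have "f (Suc i) ?x = \<zero>\<^bsub>P (Suc i)\<^esub>" using Pn i by auto
    then have "g (Suc i) (f (Suc i) ?x) = \<zero>\<^bsub>?G (Suc i)\<^esub>" using mod_hom_zero[OF rP(1) FM g(1)] by simp
    then have "\<zero>\<^bsub>?G (Suc i)\<^esub> \<ominus>\<^bsub>?G (Suc i)\<^esub> ?x = \<delta> (Suc (Suc i)) (t (Suc i) ?x) \<oplus>\<^bsub>?G (Suc i)\<^esub> t i (\<delta> (Suc i) ?x)" using t(2) x by metis
    also have "\<dots> \<in> IV m (T (Suc (Suc i)))"
    proof (rule submodule_add[OF IV_sub[OF m.ideal_axioms]])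
      show "\<delta> (Suc (Suc i)) (t (Suc i) ?x) \<in> IV m (T (Suc (Suc i)))"
        by (rule md[OF mod_hom_closed[OF spec[OF t(1)] x]])
      show "t i (\<delta> (Suc i) ?x) \<in> IV m (T (Suc (Suc i)))"
        by (rule ideal_vectors_hom[OF is_cring m.ideal_axioms spec[OF t(1)] md[OF x]])
    qed
    finally have "(\<zero>\<^bsub>?G (Suc i)\<^esub> \<ominus>\<^bsub>?G (Suc i)\<^esub> ?x) y \<in> m" by (rule IV_D(2))
    then have "\<ominus> \<one> \<in> m" using FM_minus_apply[OF G1.M.zero_closed x, of y] by (simp add: free_simps free_basis_def minus_eq)
    then have "\<one> \<in> m" using m.a_inv_closed[of "\<ominus> \<one>"] by simp
    then show False using m.one_imp_carrier m.I_notcarr by simp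
  qed
  then have "\<forall>i>Suc n. T i = {}"
    by (metis Suc_lessE less_Suc_eq_0_disj not_less_eq)
  then show ?thesis by blast
qed

text
  \<open>The theorem of Peskine and Szpiro for an ideal that contains powers of all elements of \<open>m\<close>.  The base-changed complex has the length of the minimal resolution, which is at most the length \<open>d\<close> of a maximal regular sequence in \<open>J\<close>; this starts the descent along the sequence.\<close>
lemma base_change_acyclic:
  assumes loc: "local_ring R m" and J: "ideal J R" and Jm: "J \<subseteq> m" and pow: "\<And>x. x \<in> m \<Longrightarrow> \<exists>k::nat. x [^] k \<in> J"
    and T: "\<And>i. finite (T i)" and T0: "T 0 = {x0}" and G: "free_resolution J T \<delta> \<epsilon>"
    and eps: "\<And>v. \<epsilon> v = J +>\<^bsub>R\<^esub> v x0"
    and min: "\<forall>i. \<forall>c\<in>carrier (FM (T (Suc i))). \<delta> i c = \<zero>\<^bsub>FM (T i)\<^esub> \<longrightarrow> (\<forall>y. c y \<in> Units R \<longrightarrow> c y = \<zero>)"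
    and fpd: "finite_proj_dim R (ideal_module R J)"
    and psi: "\<psi> \<in> ring_hom R R" and psiN: "\<And>a. a \<in> J \<Longrightarrow> \<psi> a = a [^] (N::nat)"
    and v: "v \<in> carrier (FM (T (Suc i)))" "base_change R R \<psi> (T i) (\<delta> i) v = \<zero>\<^bsub>FM (T i)\<^esub>"
  shows "v \<in> base_change R R \<psi> (T (Suc i)) (\<delta> (Suc i)) ` carrier (FM (T (Suc (Suc i))))"
proof -
  note r = resolution_facts[OF G]
  interpret m: maximalideal m R using loc by (simp add: local_ring_def)
  have "\<one> \<notin> m" using m.one_imp_carrier m.I_notcarr by auto
  then have ne: "J \<noteq> carrier R" using Jm by auto
  from maximal_regular_tower[OF J ne] obtain d x K z0 where tower: "regular_tower d x K" and xJ: "\<And>j. j < d \<Longrightarrow> x j \<in> J"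
    and z0: "z0 \<in> carrier R" "z0 \<notin> K d" "\<forall>y\<in>J. y \<otimes> z0 \<in> K d" by auto
  have Kd: "ideal (K d) R" using tower by (simp add: regular_tower_def)
  have "\<exists>k::nat. y [^] k \<otimes> z0 \<in> K d" if "y \<in> m" for y using pow[OF that] z0(3) by blast
  from socle_multiple[OF Kd z0(1,2) m.a_subset this] obtain q where q: "q \<in> carrier R" "q \<otimes> z0 \<notin> K d" "\<forall>y\<in>m. y \<otimes> (q \<otimes> z0) \<in> K d"
    by blast
  obtain n where n: "\<forall>i>n. T i = {}" using minimal_resolution_stops[where m = m and J = J and T = T and \<delta> = \<delta> and \<epsilon> = \<epsilon> and ?x0.0 = x0, OF loc Jm J T0 G eps min fpd] by blast
  have Td: "T i = {}" if "d < i" for i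
  proof (rule resolution_length_le_depth[where T = T, OF loc G T _ _ tower _ q(2) _ that])
    show "\<delta> i (free_basis R y) \<in> IV m (T i)" if "y \<in> T (Suc i)" for i y
      by (rule minimal_differential[where m = m and J = J and T = T and \<delta> = \<delta> and \<epsilon> = \<epsilon> and ?x0.0 = x0, OF loc Jm J T0 G eps min free_basis_closed[OF is_cring that]])
  qed (use n q z0 in auto)
  let ?F = "\<lambda>i. FM (T i)"
  let ?D = "\<lambda>i. base_change R R \<psi> (T i) (\<delta> i)"
  have Mm: "module R (cyclic_module R J)" by (rule cyclic_is_module[OF is_cring J])
  have D: "?D i \<in> mod_hom R (?F (Suc i)) (?F i)" for i by (rule base_change_hom[OF is_cring is_cring psi r(3)])
  have DD: "?D i (?D (Suc i) w) = \<zero>\<^bsub>?F i\<^esub>" if w: "w \<in> carrier (?F (Suc (Suc i)))" for i w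
    using base_change_comp[OF is_cring is_cring psi r(3) r(3) w]
      base_change_zero[OF is_cring is_cring psi mod_hom_comp[OF r(3) r(3)] r(7) w] by simp
  \<comment> \<open>multiplication by an element of \<open>J\<close> is homotopic to zero on the resolution\<close>
  have "\<exists>s. \<forall>j\<in>{..<d}. (\<forall>i. s j i \<in> mod_hom R (?F i) (?F (Suc i))) \<and>
    (\<forall>i. \<forall>v\<in>carrier (?F (Suc i)). x j \<odot>\<^bsub>?F (Suc i)\<^esub> v = \<delta> (Suc i) (s j (Suc i) v) \<oplus>\<^bsub>?F (Suc i)\<^esub> s j i (\<delta> i v))"
  proof (rule bchoice, rule ballI)
    fix j assume "j \<in> {..<d}"
    then have xj: "x j \<in> J" using xJ by simp
    then have xc: "x j \<in> carrier R" using ideal.Icarr[OF J] by blast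
    have "\<exists>s. (\<forall>i. s i \<in> mod_hom R (?F i) (?F (Suc i))) \<and> (\<forall>v\<in>carrier (?F 0). x j \<odot>\<^bsub>?F 0\<^esub> v = \<delta> 0 (s 0 v)) \<and>
      (\<forall>i. \<forall>v\<in>carrier (?F (Suc i)). x j \<odot>\<^bsub>?F (Suc i)\<^esub> v = \<delta> (Suc i) (s (Suc i) v) \<oplus>\<^bsub>?F (Suc i)\<^esub> s i (\<delta> i v))"
    proof (rule chain_homotopy_exists[OF Mm Mm G G, where F = "\<lambda>i v. x j \<odot>\<^bsub>?F i\<^esub> v"])
      show "(\<lambda>v. x j \<odot>\<^bsub>?F i\<^esub> v) \<in> mod_hom R (?F i) (?F i)" for i by (rule mod_hom_scale[OF FM mod_hom_id xc])
      show "\<epsilon> (x j \<odot>\<^bsub>?F 0\<^esub> v) = \<zero>\<^bsub>cyclic_module R J\<^esub>" if v: "v \<in> carrier (?F 0)" for v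
      proof -
        have vc: "v x0 \<in> carrier R" by (rule free_mem_closed[OF is_cring v])
        have "x j \<otimes> v x0 \<in> J" by (rule ideal.I_r_closed[OF J xj vc])
        then show ?thesis using cyclic_simps(5)[OF is_cring J, of "x j \<otimes> v x0"] xc vc
          by (simp add: eps free_simps cyclic_simps(2)[OF is_cring J])
      qed
      show "\<delta> i (x j \<odot>\<^bsub>?F (Suc i)\<^esub> v) = x j \<odot>\<^bsub>?F i\<^esub> \<delta> i v" if "v \<in> carrier (?F (Suc i))" for i v
        by (rule mod_hom_smult[OF r(3) xc that])
    qed
    then show "\<exists>s. (\<forall>i. s i \<in> mod_hom R (?F i) (?F (Suc i))) \<and>
      (\<forall>i. \<forall>v\<in>carrier (?F (Suc i)). x j \<odot>\<^bsub>?F (Suc i)\<^esub> v = \<delta> (Suc i) (s (Suc i) v) \<oplus>\<^bsub>?F (Suc i)\<^esub> s i (\<delta> i v))" by blast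
  qed
  then obtain s where s0: "\<forall>j\<in>{..<d}. (\<forall>i. s j i \<in> mod_hom R (?F i) (?F (Suc i))) \<and>
    (\<forall>i. \<forall>v\<in>carrier (?F (Suc i)). x j \<odot>\<^bsub>?F (Suc i)\<^esub> v = \<delta> (Suc i) (s j (Suc i) v) \<oplus>\<^bsub>?F (Suc i)\<^esub> s j i (\<delta> i v))"
    by (elim exE) (rule that)
  have s: "s j i \<in> mod_hom R (?F i) (?F (Suc i))" if "j < d" for j i using s0 that by simp
  have sh: "x j \<odot>\<^bsub>?F (Suc i)\<^esub> v = \<delta> (Suc i) (s j (Suc i) v) \<oplus>\<^bsub>?F (Suc i)\<^esub> s j i (\<delta> i v)"
    if "j < d" "v \<in> carrier (?F (Suc i))" for j i v using bspec[OF s0, of j] that by simp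
  let ?S = "\<lambda>j i. base_change R R \<psi> (T (Suc i)) (s j i)"
  have S: "?S j i \<in> mod_hom R (?F i) (?F (Suc i))" if "j < d" for j i by (rule base_change_hom[OF is_cring is_cring psi s[OF that]])
  have Sh: "(x j [^] N) \<odot>\<^bsub>?F (Suc i)\<^esub> v = ?D (Suc i) (?S j (Suc i) v) \<oplus>\<^bsub>?F (Suc i)\<^esub> ?S j i (?D i v)"
    if j: "j < d" and v: "v \<in> carrier (?F (Suc i))" for j i v
  proof -
    have xc: "x j \<in> carrier R" using xJ[OF j] ideal.Icarr[OF J] by blast
    have h1: "(\<lambda>v. \<delta> (Suc i) (s j (Suc i) v)) \<in> mod_hom R (?F (Suc i)) (?F (Suc i))" by (rule mod_hom_comp[OF r(3) s[OF j]])
    have h2: "(\<lambda>v. s j i (\<delta> i v)) \<in> mod_hom R (?F (Suc i)) (?F (Suc i))" by (rule mod_hom_comp[OF s[OF j] r(3)])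
    have "(x j [^] N) \<odot>\<^bsub>?F (Suc i)\<^esub> v = base_change R R \<psi> (T (Suc i)) (\<lambda>v. x j \<odot>\<^bsub>?F (Suc i)\<^esub> v) v"
      using base_change_scale[OF is_cring is_cring psi xc v] psiN[OF xJ[OF j]] by simp
    also have "\<dots> = base_change R R \<psi> (T (Suc i)) (\<lambda>v. \<delta> (Suc i) (s j (Suc i) v) \<oplus>\<^bsub>?F (Suc i)\<^esub> s j i (\<delta> i v)) v"
      by (rule base_change_cong[OF is_cring is_cring psi mod_hom_scale[OF FM mod_hom_id xc] sh[OF j] v])
    also have "\<dots> = ?D (Suc i) (?S j (Suc i) v) \<oplus>\<^bsub>?F (Suc i)\<^esub> ?S j i (?D i v)"
      using base_change_add[OF is_cring is_cring psi h1 h2 v] base_change_comp[OF is_cring is_cring psi s[OF j] r(3) v]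
        base_change_comp[OF is_cring is_cring psi r(3) s[OF j] v] by simp
    finally show ?thesis .
  qed
  have top: "exact_mod T ?D (K d) i" if "d \<le> i" for i
    unfolding exact_mod_def
  proof (intro ballI impI)
    interpret F1: module R "?F (Suc i)" by (rule FM)
    interpret F2: module R "?F (Suc (Suc i))" by (rule FM)
    fix v assume v: "v \<in> carrier (?F (Suc i))"
    have "v a = \<zero>" for a using free_mem_off[OF v, of a] Td[of "Suc i"] that by simp
    then have "v = \<zero>\<^bsub>?F (Suc i)\<^esub>" by (auto simp: free_simps)
    then have "v \<ominus>\<^bsub>?F (Suc i)\<^esub> ?D (Suc i) \<zero>\<^bsub>?F (Suc (Suc i))\<^esub> = \<zero>\<^bsub>?F (Suc i)\<^esub>"
      using mod_hom_zero[OF FM FM D, of "Suc i"] module_minus_zero[OF FM F1.M.zero_closed] by simp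
    then show "\<exists>w\<in>carrier (?F (Suc (Suc i))). v \<ominus>\<^bsub>?F (Suc i)\<^esub> ?D (Suc i) w \<in> IV (K d) (T (Suc i))"
      using submodule_zero[OF IV_sub[OF Kd], of "T (Suc i)"] by (intro bexI[of _ "\<zero>\<^bsub>?F (Suc (Suc i))\<^esub>"]) simp_all
  qed
  have ex: "exact_mod T ?D {\<zero>} i" by (rule exact_mod_tower_down[where T = T and D = ?D and h = ?S, OF tower T D DD top S Sh])
  have "?D i v \<in> IV {\<zero>} (T i)" using v(2) submodule_zero[OF IV_sub[OF zeroideal]] by simp
  from exact_mod_D[OF ex v(1) this] obtain w where w: "w \<in> carrier (?F (Suc (Suc i)))"
    "v \<ominus>\<^bsub>?F (Suc i)\<^esub> ?D (Suc i) w \<in> IV {\<zero>} (T (Suc i))" .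
  have "v \<ominus>\<^bsub>?F (Suc i)\<^esub> ?D (Suc i) w = \<zero>\<^bsub>?F (Suc i)\<^esub>" using IV_D(2)[OF w(2)] by (auto simp: free_simps)
  then have "v = ?D (Suc i) w" using module_minus_cancel(4)[OF FM v(1) mod_hom_closed[OF D w(1)]] by simp
  then show ?thesis using w(1) by blast
qed

end

section \<open>Self-injectivity of Artinian Gorenstein rings\<close>

context noetherian_cring
begin

text \<open>\<open>x\<^sup>n = a x\<^sup>n\<^sup>+\<^sup>1\<close> for some \<open>n\<close>, and \<open>1 - a x\<close> is a unit.\<close>
lemma artinian_local_nilpotent:
  assumes loc: "local_ring R m" and art: "artinian_ring R" and x: "x \<in> m"
  shows "\<exists>k::nat. x [^] k = \<zero>"
proof -
  interpret m: maximalideal m R using loc by (simp add: local_ring_def)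
  have xc: "x \<in> carrier R" using x by (rule m.Icarr)
  define A where "A i = PIdl (x [^] i)" for i :: nat
  have 1: "\<forall>i. ideal (A i) R" unfolding A_def using xc by (auto intro: cgenideal_ideal)
  have 2: "\<forall>i. A (Suc i) \<subseteq> A i"
  proof
    fix i
    show "A (Suc i) \<subseteq> A i" unfolding A_def
      using xc by (intro cgenideal_minimal cgenideal_ideal) (auto simp: cgenideal_def m_comm)
  qed
  have "\<exists>n. \<forall>k\<ge>n. A k = A n" using art 1 2 unfolding artinian_ring_def by blast
  then have "\<exists>n::nat. \<forall>k\<ge>n. PIdl (x [^] k) = PIdl (x [^] n)" unfolding A_def .
  then obtain n :: nat where "\<forall>k\<ge>n. PIdl (x [^] k) = PIdl (x [^] n)" by blast
  then have "PIdl (x [^] Suc n) = PIdl (x [^] n)" by (meson le_Suc_eq order_refl)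
  then have "x [^] n \<in> PIdl (x [^] Suc n)" using cgenideal_self[of "x [^] n"] xc by simp
  then obtain a where a: "a \<in> carrier R" "x [^] n = a \<otimes> x [^] Suc n" by (auto simp: cgenideal_def)
  have ax: "a \<otimes> x \<in> m" using a x by (simp add: m.I_l_closed)
  let ?u = "\<one> \<ominus> a \<otimes> x"
  have uc: "?u \<in> carrier R" using a xc by simp
  have "?u \<notin> m"
  proof
    assume "?u \<in> m"
    then have "?u \<oplus> a \<otimes> x \<in> m" using ax by simp
    then have "\<one> \<in> m" using module_minus_cancel(1)[OF self_is_module[OF is_cring], of \<one> "a \<otimes> x"] a xc by simp
    then show False using m.one_imp_carrier m.I_notcarr by simp
  qed
  then have u: "?u \<in> Units R" by (rule nonunit_in_maximal[OF loc uc])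
  have "?u \<otimes> x [^] n = x [^] n \<ominus> a \<otimes> x [^] Suc n"
    using a(1) xc by (simp add: minus_eq l_distr l_minus m_assoc m_comm[of x "x [^] n"])
  also have "\<dots> = \<zero>" using a xc by (simp add: minus_eq r_neg)
  finally have "inv ?u \<otimes> (?u \<otimes> x [^] n) = \<zero>" using u by simp
  then have "(inv ?u \<otimes> ?u) \<otimes> x [^] n = \<zero>" using u uc xc by (subst m_assoc) simp_all
  then have "x [^] n = \<zero>" using u xc by simp
  then show ?thesis by blast
qed

text
  \<open>Baer's criterion for the submodule \<open>K\<close> of \<open>E\<close>: a homomorphism from an ideal to \<open>K\<close> is multiplication by an element of \<open>K\<close>.\<close>
definition extends_from_ideals :: "('a, 'c) module \<Rightarrow> 'c set \<Rightarrow> bool" where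
  "extends_from_ideals E K \<longleftrightarrow> (\<forall>L h. ideal L R \<and> h \<in> mod_hom R ((self_module R)\<lparr>carrier := L\<rparr>) E \<and> h ` L \<subseteq> K
     \<longrightarrow> (\<exists>k\<in>K. \<forall>l\<in>L. h l = l \<odot>\<^bsub>E\<^esub> k))"

lemma injective_extends_from_ideals:
  assumes "injective_module R E"
  shows "extends_from_ideals E (carrier E)"
  unfolding extends_from_ideals_def
proof (intro allI impI, elim conjE)
  fix L h assume L: "ideal L R" and h: "h \<in> mod_hom R ((self_module R)\<lparr>carrier := L\<rparr>) E"
  have S: "module R (self_module R)" by (rule self_is_module[OF is_cring])
  have "submodule L R (self_module R)" using L submodule_self_iff[OF is_cring] by simp
  with assms S h obtain h' where h': "h' \<in> mod_hom R (self_module R) E" "\<forall>x\<in>L. h' x = h x"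
    unfolding injective_module_def by blast
  have "h l = l \<odot>\<^bsub>E\<^esub> h' \<one>" if l: "l \<in> L" for l
    using mod_hom_smult[OF h'(1), of l \<one>] h'(2) l ideal.Icarr[OF L l] by simp
  moreover have "h' \<one> \<in> carrier E" using mod_hom_closed[OF h'(1)] by simp
  ultimately show "\<exists>k\<in>carrier E. \<forall>l\<in>L. h l = l \<odot>\<^bsub>E\<^esub> k" by blast
qed

text \<open>The hypothesis on \<open>v\<close> makes \<open>l + a t \<mapsto> a v\<close> well defined on \<open>L + t R\<close>; extend it to \<open>R\<close>.\<close>
lemma extend_annihilated:
  assumes E: "module R E" and K: "submodule K R E" and ext: "extends_from_ideals E K" and L: "ideal L R"
    and t: "t \<in> carrier R" and v: "v \<in> K" and ann: "\<And>a. a \<in> carrier R \<Longrightarrow> a \<otimes> t \<in> L \<Longrightarrow> a \<odot>\<^bsub>E\<^esub> v = \<zero>\<^bsub>E\<^esub>"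
  shows "\<exists>k\<in>K. (\<forall>l\<in>L. l \<odot>\<^bsub>E\<^esub> k = \<zero>\<^bsub>E\<^esub>) \<and> t \<odot>\<^bsub>E\<^esub> k = v"
proof -
  interpret E: module R E by (rule E)
  interpret L: ideal L R by (rule L)
  have vc: "v \<in> carrier E" by (rule submodule_subset[OF K v])
  let ?L = "L <+>\<^bsub>R\<^esub> PIdl t"
  note L'i = add_principal(1)[OF L t] and L'mem = add_principal(4)[OF L t]
  define h where "h y = (SOME a. a \<in> carrier R \<and> (\<exists>l\<in>L. y = l \<oplus> a \<otimes> t)) \<odot>\<^bsub>E\<^esub> v" for y
  have h: "h (l \<oplus> a \<otimes> t) = a \<odot>\<^bsub>E\<^esub> v" if l: "l \<in> L" and a: "a \<in> carrier R" for l a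
  proof -
    let ?b = "SOME b. b \<in> carrier R \<and> (\<exists>l'\<in>L. l \<oplus> a \<otimes> t = l' \<oplus> b \<otimes> t)"
    have "\<exists>b. b \<in> carrier R \<and> (\<exists>l'\<in>L. l \<oplus> a \<otimes> t = l' \<oplus> b \<otimes> t)" using l a by blast
    from someI_ex[OF this] obtain l' where b: "?b \<in> carrier R" "l' \<in> L" "l \<oplus> a \<otimes> t = l' \<oplus> ?b \<otimes> t" by blast
    have lc: "l \<in> carrier R" "l' \<in> carrier R" using l b(2) by (auto intro: L.Icarr)
    have "(a \<ominus> ?b) \<otimes> t = (a \<otimes> t) \<ominus> ?b \<otimes> t" using a b(1) t by (simp add: minus_eq l_distr l_minus)
    also have "\<dots> = ((l \<oplus> a \<otimes> t) \<ominus> l) \<ominus> ?b \<otimes> t"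
      using module_minus_cancel(5)[OF self_is_module[OF is_cring], of "a \<otimes> t" l] lc a t by simp
    also have "\<dots> = ((l' \<oplus> ?b \<otimes> t) \<ominus> l) \<ominus> ?b \<otimes> t" using b(3) by simp
    also have "\<dots> = (?b \<otimes> t \<oplus> (l' \<ominus> l)) \<ominus> ?b \<otimes> t" using lc b(1) t by (simp add: minus_eq a_ac)
    also have "\<dots> = l' \<ominus> l"
      using module_minus_cancel(5)[OF self_is_module[OF is_cring], of "l' \<ominus> l" "?b \<otimes> t"] lc b(1) t by simp
    also have "\<dots> \<in> L" unfolding minus_eq by (rule L.a_closed[OF b(2) L.a_inv_closed[OF l]])
    finally have "(a \<ominus> ?b) \<odot>\<^bsub>E\<^esub> v = \<zero>\<^bsub>E\<^esub>" using a b(1) by (intro ann) simp_all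
    moreover have "(a \<ominus> ?b) \<odot>\<^bsub>E\<^esub> v = a \<odot>\<^bsub>E\<^esub> v \<ominus>\<^bsub>E\<^esub> ?b \<odot>\<^bsub>E\<^esub> v"
      using a b(1) vc by (simp add: minus_eq E.M.minus_eq E.smult_l_distr E.smult_l_minus)
    ultimately have "a \<odot>\<^bsub>E\<^esub> v = ?b \<odot>\<^bsub>E\<^esub> v" using module_minus_cancel(4)[OF E, of "a \<odot>\<^bsub>E\<^esub> v" "?b \<odot>\<^bsub>E\<^esub> v"] a b(1) vc by simp
    then show ?thesis unfolding h_def by simp
  qed
  have hom: "h \<in> mod_hom R ((self_module R)\<lparr>carrier := ?L\<rparr>) E"
  proof (rule mod_homI)
    fix x assume "x \<in> carrier ((self_module R)\<lparr>carrier := ?L\<rparr>)"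
    then obtain l a where x: "x = l \<oplus> a \<otimes> t" "l \<in> L" "a \<in> carrier R" using L'mem by auto
    then show "h x \<in> carrier E" using vc by (simp add: h)
    have lc: "l \<in> carrier R" using x by (auto intro: L.Icarr)
    fix y assume "y \<in> carrier ((self_module R)\<lparr>carrier := ?L\<rparr>)"
    then obtain l' a' where y: "y = l' \<oplus> a' \<otimes> t" "l' \<in> L" "a' \<in> carrier R" using L'mem by auto
    have lc': "l' \<in> carrier R" using y by (auto intro: L.Icarr)
    have "x \<oplus> y = (l \<oplus> l') \<oplus> (a \<oplus> a') \<otimes> t" using x y lc lc' t by (simp add: l_distr a_ac)
    then have "h (x \<oplus> y) = (a \<oplus> a') \<odot>\<^bsub>E\<^esub> v" using h[of "l \<oplus> l'" "a \<oplus> a'"] x y by simp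
    also have "\<dots> = h x \<oplus>\<^bsub>E\<^esub> h y" using x y vc by (simp add: h E.smult_l_distr)
    finally show "h (x \<oplus>\<^bsub>(self_module R)\<lparr>carrier := ?L\<rparr>\<^esub> y) = h x \<oplus>\<^bsub>E\<^esub> h y" by simp
  next
    fix r x assume r: "r \<in> carrier R" and "x \<in> carrier ((self_module R)\<lparr>carrier := ?L\<rparr>)"
    then obtain l a where x: "x = l \<oplus> a \<otimes> t" "l \<in> L" "a \<in> carrier R" using L'mem by auto
    have lc: "l \<in> carrier R" using x by (auto intro: L.Icarr)
    have "r \<otimes> x = r \<otimes> l \<oplus> (r \<otimes> a) \<otimes> t" using x lc r t by (simp add: r_distr m_assoc)
    then have "h (r \<otimes> x) = (r \<otimes> a) \<odot>\<^bsub>E\<^esub> v" using h[of "r \<otimes> l" "r \<otimes> a"] x r by (simp add: L.I_l_closed)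
    also have "\<dots> = r \<odot>\<^bsub>E\<^esub> h x" using x r vc by (simp add: h E.smult_assoc1)
    finally show "h (r \<odot>\<^bsub>(self_module R)\<lparr>carrier := ?L\<rparr>\<^esub> x) = r \<odot>\<^bsub>E\<^esub> h x" by simp
  qed
  have "h ` ?L \<subseteq> K"
  proof
    fix z assume "z \<in> h ` ?L"
    then obtain y where "y \<in> ?L" "z = h y" by blast
    then obtain l a where "l \<in> L" "a \<in> carrier R" "z = h (l \<oplus> a \<otimes> t)" using L'mem by auto
    then show "z \<in> K" using h submodule_smult[OF K _ v] by simp
  qed
  with ext L'i hom obtain k where k: "k \<in> K" "\<forall>l\<in>?L. h l = l \<odot>\<^bsub>E\<^esub> k" unfolding extends_from_ideals_def by blast
  have "l \<odot>\<^bsub>E\<^esub> k = \<zero>\<^bsub>E\<^esub>" if l: "l \<in> L" for l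
  proof -
    have eq: "l = l \<oplus> \<zero> \<otimes> t" using t L.Icarr[OF l] by simp
    have "l \<in> ?L" using add_principal(2)[OF L t] l by blast
    then have "l \<odot>\<^bsub>E\<^esub> k = h l" using k(2) by simp
    also have "\<dots> = \<zero> \<odot>\<^bsub>E\<^esub> v" using h[OF l zero_closed] eq by simp
    finally show ?thesis using vc by simp
  qed
  moreover have "t \<odot>\<^bsub>E\<^esub> k = v"
  proof -
    have eq: "t = \<zero> \<oplus> \<one> \<otimes> t" using t by simp
    have "t \<odot>\<^bsub>E\<^esub> k = h t" using k(2) add_principal(3)[OF L t] by simp
    also have "\<dots> = \<one> \<odot>\<^bsub>E\<^esub> v" using h[OF L.zero_closed one_closed] eq by simp
    finally show ?thesis using vc by simp
  qed
  ultimately show ?thesis using k(1) by blast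
qed

text
  \<open>From a cosyzygy \<open>K'\<close> to the preceding one.  It suffices to lift every element of \<open>K'\<close> annihilated by an ideal \<open>L\<close> to an element of \<open>E\<close> annihilated by \<open>L\<close>.  Take \<open>L\<close> maximal such that this fails, say for \<open>w\<close>, and \<open>t\<close> in the socle modulo \<open>L\<close>.  The element \<open>t w\<close> spans a quotient of the residue field, which the socle element \<open>z\<close> embeds into \<open>R\<close>; hence \<open>t w = z w\<^sub>0\<close>, and lifting \<open>w\<^sub>0\<close> solves the problem up to an element annihilated by \<open>L + t R\<close>.\<close>
lemma extends_from_ideals_step:
  assumes loc: "local_ring R m" and nil: "\<And>x. x \<in> m \<Longrightarrow> \<exists>k::nat. x [^] k = \<zero>"
    and E: "injective_module R E" and E': "module R E'" and d: "d \<in> mod_hom R E E'"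
    and K': "submodule K' R E'" "d ` carrier E = K'" and ext: "extends_from_ideals E' K'"
  shows "extends_from_ideals E (a_kernel E E' d)"
proof -
  have Em: "module R E" using E by (simp add: injective_module_def)
  interpret E: module R E by (rule Em)
  interpret E': module R E' by (rule E')
  interpret m: maximalideal m R using loc by (simp add: local_ring_def)
  note dc = mod_hom_closed[OF d]
  have 1: "\<one> \<notin> m" using m.one_imp_carrier m.I_notcarr by auto
  then have ne: "\<one> \<notin> {\<zero>}" using m.zero_closed by auto
  from nilpotent_socle[OF loc nil zeroideal one_closed ne]
  obtain z where z: "z \<in> carrier R" "z \<noteq> \<zero>" "\<And>x. x \<in> m \<Longrightarrow> x \<otimes> z = \<zero>" by auto
  define bad where "bad L \<longleftrightarrow> (\<exists>w\<in>K'. (\<forall>l\<in>L. l \<odot>\<^bsub>E'\<^esub> w = \<zero>\<^bsub>E'\<^esub>) \<and> \<not> (\<exists>f\<in>carrier E. (\<forall>l\<in>L. l \<odot>\<^bsub>E\<^esub> f = \<zero>\<^bsub>E\<^esub>) \<and> d f = w))" for L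
  have lift: "\<not> bad L" if L0: "ideal L R" for L
  proof
    assume "bad L"
    then have "{L. ideal L R \<and> bad L} \<noteq> {}" using L0 by blast
    from noetherian_maximal_ideal[OF noetherian_ring_axioms this] obtain L where
      L: "ideal L R" and bad: "bad L" and Lmax: "\<And>J. ideal J R \<Longrightarrow> bad J \<Longrightarrow> L \<subseteq> J \<Longrightarrow> J = L" by auto
    interpret L: ideal L R by (rule L)
    from bad obtain w where w: "w \<in> K'" "\<forall>l\<in>L. l \<odot>\<^bsub>E'\<^esub> w = \<zero>\<^bsub>E'\<^esub>"
      and no: "\<not> (\<exists>f\<in>carrier E. (\<forall>l\<in>L. l \<odot>\<^bsub>E\<^esub> f = \<zero>\<^bsub>E\<^esub>) \<and> d f = w)" unfolding bad_def by blast
    have wc: "w \<in> carrier E'" by (rule submodule_subset[OF K'(1) w(1)])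
    have "\<one> \<notin> L"
    proof
      assume "\<one> \<in> L"
      then have "w = \<zero>\<^bsub>E'\<^esub>" using w(2) wc by force
      then have "d \<zero>\<^bsub>E\<^esub> = w" using mod_hom_zero[OF Em E' d] by simp
      then show False using no L.Icarr by (metis E.M.zero_closed E.smult_r_null)
    qed
    from nilpotent_socle[OF loc nil L one_closed \<open>\<one> \<notin> L\<close>]
    obtain t where t: "t \<in> carrier R" "t \<notin> L" "\<And>x. x \<in> m \<Longrightarrow> x \<otimes> t \<in> L" by auto
    have tw: "t \<odot>\<^bsub>E'\<^esub> w \<in> K'" by (rule submodule_smult[OF K'(1) t(1) w(1)])
    have "\<exists>k\<in>K'. (\<forall>l\<in>{\<zero>}. l \<odot>\<^bsub>E'\<^esub> k = \<zero>\<^bsub>E'\<^esub>) \<and> z \<odot>\<^bsub>E'\<^esub> k = t \<odot>\<^bsub>E'\<^esub> w"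
    proof (rule extend_annihilated[OF E' K'(1) ext zeroideal z(1) tw])
      fix a assume a: "a \<in> carrier R" "a \<otimes> z \<in> {\<zero>}"
      then have "a \<in> m" using coefficient_in_maximal[OF loc zeroideal a(1) z(1)] z(2) by simp
      then have "(a \<otimes> t) \<odot>\<^bsub>E'\<^esub> w = \<zero>\<^bsub>E'\<^esub>" using w(2) t(3) by simp
      then show "a \<odot>\<^bsub>E'\<^esub> (t \<odot>\<^bsub>E'\<^esub> w) = \<zero>\<^bsub>E'\<^esub>" using E'.smult_assoc1[OF a(1) t(1) wc] by simp
    qed
    then obtain w0 where w0: "w0 \<in> K'" "z \<odot>\<^bsub>E'\<^esub> w0 = t \<odot>\<^bsub>E'\<^esub> w" by blast
    obtain f0 where f0: "f0 \<in> carrier E" "w0 = d f0" using w0(1) K'(2) by blast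
    have zf: "z \<odot>\<^bsub>E\<^esub> f0 \<in> carrier E" using z f0 by simp
    have "\<exists>k\<in>carrier E. (\<forall>l\<in>L. l \<odot>\<^bsub>E\<^esub> k = \<zero>\<^bsub>E\<^esub>) \<and> t \<odot>\<^bsub>E\<^esub> k = z \<odot>\<^bsub>E\<^esub> f0"
    proof (rule extend_annihilated[OF Em submodule_carrier[OF Em] injective_extends_from_ideals[OF E] L t(1) zf])
      fix a assume a: "a \<in> carrier R" "a \<otimes> t \<in> L"
      then have "a \<in> m" using coefficient_in_maximal[OF loc L a(1) t(1,2) a(2)] by simp
      then show "a \<odot>\<^bsub>E\<^esub> (z \<odot>\<^bsub>E\<^esub> f0) = \<zero>\<^bsub>E\<^esub>" using E.smult_assoc1[OF a(1) z(1) f0(1)] z(3)[of a] f0(1) by simp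
    qed
    then obtain f2 where f2: "f2 \<in> carrier E" "\<forall>l\<in>L. l \<odot>\<^bsub>E\<^esub> f2 = \<zero>\<^bsub>E\<^esub>" "t \<odot>\<^bsub>E\<^esub> f2 = z \<odot>\<^bsub>E\<^esub> f0" by blast
    let ?w = "w \<ominus>\<^bsub>E'\<^esub> d f2"
    have df2: "d f2 \<in> K'" using f2(1) K'(2) by blast
    have w'K: "?w \<in> K'" by (rule submodule_minus[OF E' K'(1) w(1) df2])
    have sm: "r \<odot>\<^bsub>E'\<^esub> ?w = r \<odot>\<^bsub>E'\<^esub> w \<ominus>\<^bsub>E'\<^esub> d (r \<odot>\<^bsub>E\<^esub> f2)" if "r \<in> carrier R" for r
      using that wc f2(1) dc[OF f2(1)] by (simp add: mod_hom_smult[OF d] E'.M.minus_eq E'.smult_r_distr E'.smult_r_minus)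
    have z0: "d \<zero>\<^bsub>E\<^esub> = \<zero>\<^bsub>E'\<^esub>" by (rule mod_hom_zero[OF Em E' d])
    have Lw: "l \<odot>\<^bsub>E'\<^esub> ?w = \<zero>\<^bsub>E'\<^esub>" if l: "l \<in> L" for l
      using sm[OF L.Icarr[OF l]] w(2) f2(2) l z0 module_minus_zero[OF E' E'.M.zero_closed] by simp
    have "d (t \<odot>\<^bsub>E\<^esub> f2) = t \<odot>\<^bsub>E'\<^esub> w" using f2(3) w0(2) f0 mod_hom_smult[OF d z(1) f0(1)] by simp
    then have tw0: "t \<odot>\<^bsub>E'\<^esub> ?w = \<zero>\<^bsub>E'\<^esub>" using sm[OF t(1)] module_minus_cancel(4)[OF E', of "t \<odot>\<^bsub>E'\<^esub> w" "t \<odot>\<^bsub>E'\<^esub> w"] t(1) wc by simp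
    let ?L = "L <+>\<^bsub>R\<^esub> PIdl t"
    note L'i = add_principal(1)[OF L t(1)] and LL = add_principal(2)[OF L t(1)] and L'mem = add_principal(4)[OF L t(1)]
    have "?L \<noteq> L" using add_principal(3)[OF L t(1)] t(2) by blast
    then have good: "\<not> bad ?L" using Lmax[OF L'i _ LL] by blast
    have w'c: "?w \<in> carrier E'" by (rule submodule_subset[OF K'(1) w'K])
    have "y \<odot>\<^bsub>E'\<^esub> ?w = \<zero>\<^bsub>E'\<^esub>" if yL: "y \<in> ?L" for y
    proof -
      obtain l a where y: "l \<in> L" "a \<in> carrier R" "y = l \<oplus> a \<otimes> t" using yL L'mem by auto
      have "y \<odot>\<^bsub>E'\<^esub> ?w = l \<odot>\<^bsub>E'\<^esub> ?w \<oplus>\<^bsub>E'\<^esub> a \<odot>\<^bsub>E'\<^esub> (t \<odot>\<^bsub>E'\<^esub> ?w)"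
        using y t(1) w'c L.Icarr by (simp add: E'.smult_l_distr E'.smult_assoc1)
      then show ?thesis using Lw[OF y(1)] tw0 y(2) by simp
    qed
    with good[unfolded bad_def] w'K obtain f3 where f3: "f3 \<in> carrier E" "\<forall>l\<in>?L. l \<odot>\<^bsub>E\<^esub> f3 = \<zero>\<^bsub>E\<^esub>" "d f3 = ?w" by blast
    have "d (f2 \<oplus>\<^bsub>E\<^esub> f3) = w"
      using mod_hom_add[OF d f2(1) f3(1)] f3(3) module_minus_cancel(2)[OF E' wc dc[OF f2(1)]] by simp
    moreover have "l \<odot>\<^bsub>E\<^esub> (f2 \<oplus>\<^bsub>E\<^esub> f3) = \<zero>\<^bsub>E\<^esub>" if l: "l \<in> L" for l
      using E.smult_r_distr[OF L.Icarr[OF l] f2(1) f3(1)] f2(2) f3(2) LL l by auto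
    moreover have "f2 \<oplus>\<^bsub>E\<^esub> f3 \<in> carrier E" using f2 f3 by simp
    ultimately show False using no by blast
  qed
  show ?thesis unfolding extends_from_ideals_def
  proof (intro allI impI, elim conjE)
    fix L h assume L: "ideal L R" and h: "h \<in> mod_hom R ((self_module R)\<lparr>carrier := L\<rparr>) E" and hK: "h ` L \<subseteq> a_kernel E E' d"
    have "h ` L \<subseteq> carrier E" using hK by (auto simp: a_kernel_iff)
    with injective_extends_from_ideals[OF E] L h obtain e where e: "e \<in> carrier E" "\<forall>l\<in>L. h l = l \<odot>\<^bsub>E\<^esub> e"
      unfolding extends_from_ideals_def by blast
    have "d e \<in> K'" using K'(2) e(1) by blast
    moreover have "l \<odot>\<^bsub>E'\<^esub> d e = \<zero>\<^bsub>E'\<^esub>" if l: "l \<in> L" for l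
    proof -
      have "h l \<in> a_kernel E E' d" using hK l by blast
      then have "d (l \<odot>\<^bsub>E\<^esub> e) = \<zero>\<^bsub>E'\<^esub>" using e(2) l by (simp add: a_kernel_iff)
      then show ?thesis using mod_hom_smult[OF d ideal.Icarr[OF L l] e(1)] by simp
    qed
    ultimately obtain f where f: "f \<in> carrier E" "\<forall>l\<in>L. l \<odot>\<^bsub>E\<^esub> f = \<zero>\<^bsub>E\<^esub>" "d f = d e"
      using lift[OF L, unfolded bad_def] by blast
    have "d (e \<ominus>\<^bsub>E\<^esub> f) = \<zero>\<^bsub>E'\<^esub>"
      using mod_hom_minus[OF Em E' d e(1) f(1)] f(3) module_minus_cancel(4)[OF E' dc[OF e(1)] dc[OF e(1)]] by simp
    then have "e \<ominus>\<^bsub>E\<^esub> f \<in> a_kernel E E' d" using e(1) f(1) by (simp add: a_kernel_iff)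
    moreover have "h l = l \<odot>\<^bsub>E\<^esub> (e \<ominus>\<^bsub>E\<^esub> f)" if l: "l \<in> L" for l
    proof -
      have lc: "l \<in> carrier R" by (rule ideal.Icarr[OF L l])
      have "l \<odot>\<^bsub>E\<^esub> (e \<ominus>\<^bsub>E\<^esub> f) = l \<odot>\<^bsub>E\<^esub> e \<ominus>\<^bsub>E\<^esub> l \<odot>\<^bsub>E\<^esub> f" using lc e(1) f(1)
        by (simp add: E.M.minus_eq E.smult_r_distr E.smult_r_minus)
      then show ?thesis using e(2) f(2) l module_minus_zero[OF Em E.smult_closed[OF lc e(1)]] by simp
    qed
    ultimately show "\<exists>k\<in>a_kernel E E' d. \<forall>l\<in>L. h l = l \<odot>\<^bsub>E\<^esub> k" by blast
  qed
qed

text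
  \<open>If \<open>y \<notin> K\<close>, then some multiple \<open>t\<close> of \<open>y\<close> is a non-zero socle element modulo \<open>K\<close>, and by self-injectivity the map from \<open>K + t R\<close> to the socle of \<open>R\<close> that kills \<open>K\<close> and sends \<open>t\<close> to \<open>z\<close> is multiplication by some \<open>c\<close>; this \<open>c\<close> annihilates \<open>K\<close> but not \<open>y\<close>.\<close>
lemma gorenstein_double_annihilator:
  assumes loc: "local_ring R m" and art: "artinian_ring R" and fid: "finite_inj_dim R (self_module R)"
    and K: "ideal K R" and y: "y \<in> carrier R" and ann: "\<And>c. c \<in> carrier R \<Longrightarrow> (\<And>k. k \<in> K \<Longrightarrow> k \<otimes> c = \<zero>) \<Longrightarrow> y \<otimes> c = \<zero>"
  shows "y \<in> K"
proof (rule ccontr)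
  assume yK: "y \<notin> K"
  interpret m: maximalideal m R using loc by (simp add: local_ring_def)
  interpret K: ideal K R by (rule K)
  have nil: "\<exists>k::nat. x [^] k = \<zero>" if "x \<in> m" for x by (rule artinian_local_nilpotent[OF loc art that])
  from fid obtain E d e n where res: "injective_resolution R (self_module R) (E :: nat \<Rightarrow> ('a, ('a + 'a) list) module) d e"
    and En: "\<forall>i>n. carrier (E i) = {\<zero>\<^bsub>E i\<^esub>}" unfolding finite_inj_dim_def by (elim exE conjE) (rule that)
  note res' = res[unfolded injective_resolution_def]
  have inj: "injective_module R (E i)" for i using res' by blast
  have Em: "module R (E i)" for i using inj by (simp add: injective_module_def)
  have d: "d i \<in> mod_hom R (E i) (E (Suc i))" for i using res' by blast
  have e: "e \<in> mod_hom R (self_module R) (E 0)" and ei: "inj_on e (carrier R)" using res' by simp_all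
  have eim: "e ` carrier R = a_kernel (E 0) (E (Suc 0)) (d 0)" using res' by simp
  have im: "d i ` carrier (E i) = a_kernel (E (Suc i)) (E (Suc (Suc i))) (d (Suc i))" for i using res' by simp
  let ?K = "\<lambda>i. a_kernel (E i) (E (Suc i)) (d i)"
  have Ks: "submodule (?K i) R (E i)" for i by (rule submodule_a_kernel[OF Em Em d])
  have top: "extends_from_ideals (E i) (?K i)" if i: "n < i" for i
    unfolding extends_from_ideals_def
  proof (intro allI impI, elim conjE)
    fix L h assume L: "ideal L R" and h: "h \<in> mod_hom R ((self_module R)\<lparr>carrier := L\<rparr>) (E i)"
    interpret Ei: module R "E i" by (rule Em)
    have "h l = l \<odot>\<^bsub>E i\<^esub> \<zero>\<^bsub>E i\<^esub>" if "l \<in> L" for l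
      using mod_hom_closed[OF h, of l] that En i ideal.Icarr[OF L that] by auto
    then show "\<exists>k\<in>?K i. \<forall>l\<in>L. h l = l \<odot>\<^bsub>E i\<^esub> k" using submodule_zero[OF Ks] by blast
  qed
  have "extends_from_ideals (E (Suc n - j)) (?K (Suc n - j))" if "j \<le> Suc n" for j
    using that
  proof (induction j)
    case 0
    then show ?case using top by simp
  next
    case (Suc j)
    let ?i = "Suc n - Suc j"
    have i: "Suc ?i = Suc n - j" using Suc.prems by simp
    have "extends_from_ideals (E (Suc ?i)) (?K (Suc ?i))" unfolding i using Suc by simp
    from extends_from_ideals_step[OF loc nil inj Em d Ks im this] show ?case .
  qed
  from this[of "Suc n"] have ext: "extends_from_ideals (E 0) (?K 0)" by simp
  have "\<one> \<notin> m" using m.one_imp_carrier m.I_notcarr by auto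
  then have ne: "\<one> \<notin> {\<zero>}" using m.zero_closed by auto
  from nilpotent_socle[OF loc nil zeroideal one_closed ne]
  obtain z where z: "z \<in> carrier R" "z \<noteq> \<zero>" "\<And>x. x \<in> m \<Longrightarrow> x \<otimes> z = \<zero>" by auto
  from nilpotent_socle[OF loc nil K y yK] obtain r where r: "r \<in> carrier R" "r \<otimes> y \<notin> K" by blast
  let ?t = "r \<otimes> y"
  have tc: "?t \<in> carrier R" using r y by simp
  have ez: "e z \<in> ?K 0" using z(1) eim by blast
  note e0 = mod_hom_zero[OF self_is_module[OF is_cring] Em e, simplified]
  have "\<exists>k\<in>?K 0. (\<forall>l\<in>K. l \<odot>\<^bsub>E 0\<^esub> k = \<zero>\<^bsub>E 0\<^esub>) \<and> ?t \<odot>\<^bsub>E 0\<^esub> k = e z"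
  proof (rule extend_annihilated[OF Em Ks ext K tc ez])
    fix a assume a: "a \<in> carrier R" "a \<otimes> ?t \<in> K"
    have "a \<in> m" by (rule coefficient_in_maximal[OF loc K a(1) tc r(2) a(2)])
    then have "e (a \<otimes> z) = \<zero>\<^bsub>E 0\<^esub>" using z(3) e0 by simp
    then show "a \<odot>\<^bsub>E 0\<^esub> e z = \<zero>\<^bsub>E 0\<^esub>" using mod_hom_smult[OF e a(1), of z] z(1) by simp
  qed
  then obtain k where k: "k \<in> ?K 0" "\<forall>l\<in>K. l \<odot>\<^bsub>E 0\<^esub> k = \<zero>\<^bsub>E 0\<^esub>" "?t \<odot>\<^bsub>E 0\<^esub> k = e z" by blast
  then obtain c where c: "c \<in> carrier R" "k = e c" using eim by blast
  have ec: "e (l \<otimes> c) = l \<odot>\<^bsub>E 0\<^esub> k" if "l \<in> carrier R" for l using mod_hom_smult[OF e that, of c] c by simp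
  have "l \<otimes> c = \<zero>" if l: "l \<in> K" for l
  proof (rule inj_onD[OF ei])
    have lc: "l \<in> carrier R" using l by (rule K.Icarr)
    show "e (l \<otimes> c) = e \<zero>" using ec[OF lc] k(2) l e0 by simp
    show "l \<otimes> c \<in> carrier R" using lc c by simp
  qed simp
  from ann[OF c(1) this] have "y \<otimes> c = \<zero>" .
  then have "?t \<otimes> c = \<zero>" using r y c(1) by (simp add: m_assoc)
  moreover have "?t \<otimes> c = z"
    by (rule inj_onD[OF ei]) (use ec[OF tc] k(3) tc c z in simp_all)
  ultimately show False using z(2) by simp
qed

end

section \<open>The Frobenius endomorphism\<close>

lemma (in cring) binomial_expansion:
  assumes x: "x \<in> carrier R" and y: "y \<in> carrier R"
  shows "(x \<oplus> y) [^] (n::nat) = (\<Oplus>k\<in>{..n}. add_pow R (n choose k) (x [^] k \<otimes> y [^] (n - k)))"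
proof (induction n)
  case 0
  show ?case using x y by (simp add: add_pow_def)
next
  case (Suc n)
  define g where "g n k = add_pow R (n choose k) (x [^] k \<otimes> y [^] (n - k))" for n k :: nat
  have gc: "g n k \<in> carrier R" for n k using x y by (simp add: g_def)
  have pascal: "g (Suc n) (Suc k) = g n k \<otimes> x \<oplus> g n (Suc k) \<otimes> y" for k
  proof -
    have a: "x [^] Suc k \<otimes> y [^] (n - k) \<in> carrier R" using x y by simp
    have 1: "g n k \<otimes> x = add_pow R (n choose k) (x [^] Suc k \<otimes> y [^] (n - k))"
      unfolding g_def using x y by (subst add_pow_ldistr) (simp_all add: m_ac)
    have 2: "g n (Suc k) \<otimes> y = add_pow R (n choose Suc k) (x [^] Suc k \<otimes> y [^] (n - k))"
    proof (cases "Suc k \<le> n")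
      case True
      then have "n - k = Suc (n - Suc k)" by simp
      then have "y [^] (n - k) = y [^] (n - Suc k) \<otimes> y" by simp
      then show ?thesis unfolding g_def using x y by (subst add_pow_ldistr) (simp_all add: m_assoc)
    next
      case False
      then have 0: "n choose Suc k = 0" by (simp add: binomial_eq_0)
      show ?thesis unfolding g_def 0 using x y by simp
    qed
    show ?thesis unfolding 1 2 using a by (simp add: g_def add.nat_pow_mult)
  qed
  have "(x \<oplus> y) [^] Suc n = (\<Oplus>k\<in>{..n}. g n k) \<otimes> (x \<oplus> y)" using Suc by (simp add: g_def)
  also have "\<dots> = (\<Oplus>k\<in>{..n}. g n k) \<otimes> x \<oplus> (\<Oplus>k\<in>{..n}. g n k) \<otimes> y" using x y gc by (simp add: r_distr)
  also have "\<dots> = (\<Oplus>k\<in>{..n}. g n k \<otimes> x) \<oplus> (\<Oplus>k\<in>{..n}. g n k \<otimes> y)" using x y gc by (simp add: finsum_ldistr)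
  also have "(\<Oplus>k\<in>{..n}. g n k \<otimes> y) = (\<Oplus>k\<in>{..Suc n}. g n k \<otimes> y)"
  proof -
    have 0: "n choose Suc n = 0" by (simp add: binomial_eq_0)
    have "g n (Suc n) \<otimes> y = \<zero>" unfolding g_def 0 using x y by simp
    then show ?thesis using gc y by (simp add: finsum_Suc)
  qed
  also have "\<dots> = (\<Oplus>k\<in>{..n}. g n (Suc k) \<otimes> y) \<oplus> g n 0 \<otimes> y" using gc y by (subst finsum_Suc2) auto
  also have "(\<Oplus>k\<in>{..n}. g n k \<otimes> x) \<oplus> ((\<Oplus>k\<in>{..n}. g n (Suc k) \<otimes> y) \<oplus> g n 0 \<otimes> y) =
      (\<Oplus>k\<in>{..n}. g n k \<otimes> x \<oplus> g n (Suc k) \<otimes> y) \<oplus> g n 0 \<otimes> y"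
    using gc x y by (simp add: finsum_addf a_assoc)
  also have "\<dots> = (\<Oplus>k\<in>{..n}. g (Suc n) (Suc k)) \<oplus> g (Suc n) 0"
  proof -
    have "g n 0 \<otimes> y = g (Suc n) 0" unfolding g_def using y by (simp add: add_pow_def)
    then show ?thesis by (simp add: pascal)
  qed
  also have "\<dots> = (\<Oplus>k\<in>{..Suc n}. g (Suc n) k)" using gc by (subst finsum_Suc2) auto
  finally show ?case unfolding g_def .
qed

lemma (in cring) frobenius_add:
  assumes p: "Factorial_Ring.prime p" and char: "characteristic R = p" and x: "x \<in> carrier R" and y: "y \<in> carrier R"
  shows "(x \<oplus> y) [^] (p::nat) = x [^] p \<oplus> y [^] p"
proof -
  have p0: "0 < p" using p by (simp add: prime_gt_0_nat)
  have "add_pow R p \<one> = \<zero>"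
    using add.pow_ord_eq_1[OF one_closed] char unfolding characteristic_def by simp
  then have kill: "add_pow R (p * j) a = \<zero>" if a: "a \<in> carrier R" for j a
  proof -
    have "add_pow R p a = add_pow R p \<one> \<otimes> a" using a by (subst add_pow_ldistr) simp_all
    then have "add_pow R p a = \<zero>" using a \<open>add_pow R p \<one> = \<zero>\<close> by simp
    then show ?thesis using a by (simp add: add.nat_pow_pow[symmetric])
  qed
  define g where "g k = add_pow R (p choose k) (x [^] k \<otimes> y [^] (p - k))" for k :: nat
  have gc: "g k \<in> carrier R" for k using x y by (simp add: g_def)
  have "g k = \<zero>" if "k \<in> {1..<p}" for k
  proof -
    have "p dvd (p choose k)" by (rule dvd_choose_prime) (use that p in auto)
    then obtain j where "p choose k = p * j" by blast
    then show ?thesis unfolding g_def using kill x y by simp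
  qed
  then have z: "(\<Oplus>k\<in>{1..<p}. g k) = \<zero>" by (intro add.finprod_one_eqI)
  have "{..p} = insert 0 (insert p {1..<p})" using p0 by auto
  then have "(\<Oplus>k\<in>{..p}. g k) = g 0 \<oplus> (g p \<oplus> (\<Oplus>k\<in>{1..<p}. g k))" using p0 gc by (simp add: finsum_insert Pi_def)
  also have "\<dots> = x [^] p \<oplus> y [^] p" unfolding z using x y gc by (simp add: g_def a_comm)
  finally show ?thesis using binomial_expansion[OF x y, of p] by (simp add: g_def)
qed

lemma (in cring) frobenius_iterate:
  assumes p: "Factorial_Ring.prime p" and char: "characteristic R = p"
  shows "frobenius R p ^^ n \<in> ring_hom R R" and "r \<in> carrier R \<Longrightarrow> (frobenius R p ^^ n) r = r [^] (p ^ n)"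
proof -
  have F: "frobenius R p \<in> ring_hom R R" unfolding frobenius_def
    by (rule ring_hom_memI) (simp_all add: frobenius_add[OF p char] nat_pow_distrib)
  have Fn: "frobenius R p ^^ n \<in> ring_hom R R" for n
  proof (induction n)
    case 0
    then show ?case by (simp add: ring_hom_def)
  next
    case (Suc n)
    then show ?case using ring_hom_trans[OF Suc F] by (simp only: funpow.simps(2))
  qed
  then show "frobenius R p ^^ n \<in> ring_hom R R" .
  show "r \<in> carrier R \<Longrightarrow> (frobenius R p ^^ n) r = r [^] (p ^ n)"
  proof (induction n)
    case (Suc n)
    then show ?case by (simp add: frobenius_def nat_pow_pow mult.commute)
  qed simp
qed

section \<open>Lengths over the local ring\<close>

context noetherian_cring
begin

abbreviation "SM \<equiv> self_module R"
abbreviation "colength I \<equiv> interval_length R (self_module R) I (carrier R)"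

lemma SM: "module R SM" by (rule self_is_module[OF is_cring])

lemma SM_sub: "submodule I R SM \<longleftrightarrow> ideal I R" by (rule submodule_self_iff[OF is_cring])

lemma Idl_span: "A \<subseteq> carrier R \<Longrightarrow> Idl A = submodule_span R SM A"
proof
  assume A: "A \<subseteq> carrier R"
  have "ideal (submodule_span R SM A) R" unfolding SM_sub[symmetric] by (rule span_submodule[OF SM]) (simp add: A)
  then show "Idl A \<subseteq> submodule_span R SM A" by (rule genideal_minimal[OF _ span_superset])
  show "submodule_span R SM A \<subseteq> Idl A"
    by (rule span_least) (simp_all add: SM_sub genideal_ideal[OF A] genideal_self[OF A])
qed

text
  \<open>Take \<open>L\<close> maximal among the ideals above \<open>\<aa>\<close> of infinite colength.  A socle element \<open>t\<close> modulo \<open>L\<close> gives \<open>L + t R\<close> of finite colength, and \<open>(L + t R) / L\<close> is a quotient of \<open>R / m\<close>.\<close>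
lemma residue_length_finite:
  assumes loc: "local_ring R m" and a: "ideal \<aa> R" and pow: "\<And>x. x \<in> m \<Longrightarrow> \<exists>k::nat. x [^] k \<in> \<aa>"
  shows "colength \<aa> \<noteq> \<infinity>"
proof
  assume inf: "colength \<aa> = \<infinity>"
  interpret m: maximalideal m R using loc by (simp add: local_ring_def)
  let ?S = "{L. ideal L R \<and> \<aa> \<subseteq> L \<and> colength L = \<infinity>}"
  have "\<aa> \<in> ?S" using a inf by simp
  then have "?S \<noteq> {}" by blast
  from noetherian_maximal_ideal[OF noetherian_ring_axioms this] obtain L where
    L: "ideal L R" "\<aa> \<subseteq> L" "colength L = \<infinity>" and Lmax: "\<forall>J\<in>?S. L \<subseteq> J \<longrightarrow> J = L" by auto
  interpret L: ideal L R by (rule L(1))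
  have "\<one> \<notin> L"
  proof
    assume "\<one> \<in> L"
    then have "L = carrier R" by (rule L.one_imp_carrier)
    moreover have "colength (carrier R) \<le> enat (card ({} :: 'a set)) * interval_length R SM {} (carrier R)"
      by (rule interval_length_generators_le[OF SM]) (use submodule_carrier[OF SM] span_superset[of "carrier R" R SM] in auto)
    ultimately show False using L(3) by (simp add: zero_enat_def[symmetric])
  qed
  have "\<exists>k::nat. x [^] k \<otimes> \<one> \<in> L" if x: "x \<in> m" for x
  proof -
    obtain k :: nat where "x [^] k \<in> \<aa>" using pow[OF x] by blast
    then have "x [^] k \<otimes> \<one> \<in> L" using L(2) m.Icarr[OF x] by auto
    then show ?thesis by blast
  qed
  from socle_multiple[OF L(1) one_closed \<open>\<one> \<notin> L\<close> m.a_subset this]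
  obtain t where t: "t \<in> carrier R" "t \<notin> L" "\<And>x. x \<in> m \<Longrightarrow> x \<otimes> t \<in> L" by auto
  let ?L = "L <+>\<^bsub>R\<^esub> PIdl t"
  note L'i = add_principal(1)[OF L(1) t(1)] and LL = add_principal(2)[OF L(1) t(1)] and L'mem = add_principal(4)[OF L(1) t(1)]
  have "?L \<noteq> L" using add_principal(3)[OF L(1) t(1)] t(2) by blast
  then have "?L \<notin> ?S" using Lmax LL by blast
  then have fin1: "colength ?L \<noteq> \<infinity>" using L'i subset_trans[OF L(2) LL] by simp
  have "colength m \<le> 1" unfolding interval_length_le_iff
  proof (intro allI impI)
    fix n assume "has_chain R SM n m (carrier R)"
    then obtain N where N: "\<forall>i\<le>n. submodule (N i) R SM" "\<forall>i<n. N i \<subset> N (Suc i)" "m \<subseteq> N 0" "N n \<subseteq> carrier R"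
      unfolding has_chain_def by (elim exE conjE) (rule that)
    have "n \<le> 1"
    proof (rule ccontr)
      assume "\<not> n \<le> 1"
      then have lt: "N 0 \<subset> N 1" "N 1 \<subset> N 2" using spec[OF N(2), of 0] spec[OF N(2), of 1] by (simp_all add: numeral_2_eq_2)
      have "submodule (N 1) R SM" "submodule (N 2) R SM" using spec[OF N(1), of 1] spec[OF N(1), of 2] \<open>\<not> n \<le> 1\<close> by simp_all
      then have id: "ideal (N 1) R" "ideal (N 2) R" by (simp_all only: SM_sub)
      have c: "N 1 \<subseteq> carrier R" "N 2 \<subseteq> carrier R" using ideal.Icarr[OF id(1)] ideal.Icarr[OF id(2)] by (auto simp only: subset_iff)
      have "m \<subseteq> N 1" using N(3) lt(1) by (rule order.trans[OF _ psubset_imp_subset])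
      then have "N 1 = m \<or> N 1 = carrier R" by (rule m.I_maximal[OF id(1) _ c(1)])
      then show False using lt N(3) c by (elim disjE) simp_all
    qed
    then show "enat n \<le> 1" by (simp add: one_enat_def)
  qed
  moreover have "interval_length R SM L ?L \<le> colength m"
    by (rule interval_length_cyclic_le[OF SM, of _ t]) (use L(1) SM_sub t m.a_subset L'mem in auto)
  ultimately have "interval_length R SM L ?L \<le> 1" by (rule order.trans[rotated])
  then have fin2: "interval_length R SM L ?L \<noteq> \<infinity>" by (metis infinity_ileE one_enat_def)
  have "colength L = interval_length R SM L ?L + colength ?L"
    using ideal.Icarr[OF L'i] by (intro interval_length_add[OF SM _ _ submodule_carrier[OF SM, simplified] LL]) (simp_all add: SM_sub L(1) L'i subset_iff)
  then show False using fin1 fin2 L(3) by (metis plus_eq_infty_iff_enat)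
qed

lemma fg_length_finite:
  assumes lam: "colength \<aa> \<noteq> \<infinity>" and a: "\<aa> \<subseteq> carrier R" and T: "finite T"
    and A: "submodule A R (FM T)" and U: "submodule U R (FM T)" and AX: "\<And>r x. r \<in> \<aa> \<Longrightarrow> x \<in> U \<Longrightarrow> r \<odot>\<^bsub>FM T\<^esub> x \<in> A"
  shows "interval_length R (FM T) A U \<noteq> \<infinity>"
proof -
  obtain G where G: "finite G" "spanning R (FM T) G U"
    using free_submodule_finitely_generated[OF noetherian_ring_axioms is_cring T U] by blast
  have GX: "G \<subseteq> U" using G(2) by (simp add: spanning_def)
  have "U = submodule_span R (FM T) G" using spanning_iff[OF FM U] G(2) by simp
  also have "\<dots> \<subseteq> submodule_span R (FM T) (A \<union> G)" by (rule span_mono) simp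
  finally have "interval_length R (FM T) A U \<le> enat (card G) * colength \<aa>"
    using AX GX submodule_subset[OF U] by (intro interval_length_generators_le[OF FM A G(1) _ _ a]) auto
  moreover obtain l where "colength \<aa> = enat l" using lam by auto
  ultimately have "interval_length R (FM T) A U \<le> enat (card G * l)" by simp
  then show ?thesis by (metis infinity_ileE)
qed

section \<open>Linkage duality\<close>

lemma quotient_simps:
  assumes "ideal J R"
  shows "carrier (R Quot J) = (\<lambda>x. J +> x) ` carrier R" "\<zero>\<^bsub>R Quot J\<^esub> = J" "\<one>\<^bsub>R Quot J\<^esub> = J +> \<one>"
    "x \<in> carrier R \<Longrightarrow> y \<in> carrier R \<Longrightarrow> (J +> x) \<otimes>\<^bsub>R Quot J\<^esub> (J +> y) = J +> (x \<otimes> y)"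
    "x \<in> carrier R \<Longrightarrow> (J +> x) [^]\<^bsub>R Quot J\<^esub> (k::nat) = J +> (x [^] k)"
proof -
  show "carrier (R Quot J) = (\<lambda>x. J +> x) ` carrier R" "\<zero>\<^bsub>R Quot J\<^esub> = J" "\<one>\<^bsub>R Quot J\<^esub> = J +> \<one>"
    by (auto simp: FactRing_def A_RCOSETS_def')
  show m: "(J +> x) \<otimes>\<^bsub>R Quot J\<^esub> (J +> y) = J +> (x \<otimes> y)" if "x \<in> carrier R" "y \<in> carrier R" for x y
    using ideal.rcoset_mult_add[OF assms that] by (simp add: FactRing_def)
  show "(J +> x) [^]\<^bsub>R Quot J\<^esub> k = J +> (x [^] k)" if x: "x \<in> carrier R"
  proof (induction k)
    case 0
    show ?case by (simp add: FactRing_def nat_pow_def)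
  next
    case (Suc k)
    show ?case using Suc m[OF nat_pow_closed[OF x] x] by (simp add: nat_pow_def)
  qed
qed

context
  fixes Jq
  assumes Jq: "ideal Jq R" and art: "artinian_ring (R Quot Jq)" and gor: "gorenstein_local_ring (R Quot Jq)"
begin

lemma quotient_noetherian_cring: "noetherian_cring (R Quot Jq)"
  by (rule noetherian_cring.intro[OF ideal.quotient_is_cring[OF Jq is_cring]])
    (rule gor[unfolded gorenstein_local_ring_def, THEN conjunct2, THEN conjunct1])

lemma double_colon:
  assumes K: "ideal K R" and sub: "Jq \<subseteq> K"
  shows "colon R Jq (colon R Jq K) = K"
proof
  interpret K: ideal K R by (rule K)
  interpret Jq: ideal Jq R by (rule Jq)
  interpret A: noetherian_cring "R Quot Jq" by (rule quotient_noetherian_cring)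
  note qs = quotient_simps[OF Jq] and cs = cyclic_simps[OF is_cring Jq]
  show "K \<subseteq> colon R Jq (colon R Jq K)"
  proof
    fix k assume k: "k \<in> K"
    have "k \<otimes> x \<in> Jq" if "x \<in> colon R Jq K" for x using that k K.Icarr[OF k] m_comm[of k x] by (auto simp: colon_def)
    then show "k \<in> colon R Jq (colon R Jq K)" using K.Icarr[OF k] by (simp add: colon_def)
  qed
  show "colon R Jq (colon R Jq K) \<subseteq> K"
  proof
    fix y assume "y \<in> colon R Jq (colon R Jq K)"
    then have y: "y \<in> carrier R" "\<And>c. c \<in> colon R Jq K \<Longrightarrow> y \<otimes> c \<in> Jq" by (auto simp: colon_def)
    obtain m' where loc: "local_ring (R Quot Jq) m'" and fid: "finite_inj_dim (R Quot Jq) (self_module (R Quot Jq))"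
      using gor unfolding gorenstein_local_ring_def by blast
    have "Jq +> y \<in> (\<lambda>x. Jq +> x) ` K"
    proof (rule A.gorenstein_double_annihilator[OF loc art fid])
      show "ideal ((\<lambda>x. Jq +> x) ` K) (R Quot Jq)" by (rule ring_ideal_imp_quot_ideal[OF Jq K])
      show "Jq +> y \<in> carrier (R Quot Jq)" using y(1) qs(1) by simp
      fix C assume C: "C \<in> carrier (R Quot Jq)" and ann: "\<And>k. k \<in> (\<lambda>x. Jq +> x) ` K \<Longrightarrow> k \<otimes>\<^bsub>R Quot Jq\<^esub> C = \<zero>\<^bsub>R Quot Jq\<^esub>"
      then obtain c where c: "c \<in> carrier R" "C = Jq +> c" using qs(1) by auto
      have "c \<otimes> k \<in> Jq" if k: "k \<in> K" for k
      proof -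
        have kc: "k \<in> carrier R" using k by (rule K.Icarr)
        have "(Jq +> k) \<otimes>\<^bsub>R Quot Jq\<^esub> (Jq +> c) = \<zero>\<^bsub>R Quot Jq\<^esub>" using ann[of "Jq +> k"] k c(2) by blast
        then have "Jq +> (k \<otimes> c) = Jq" using qs(4)[OF kc c(1)] qs(2) by simp
        then show ?thesis using cs(5)[of "k \<otimes> c"] kc c(1) m_comm[of k c] by simp
      qed
      then have "y \<otimes> c \<in> Jq" using y(2) c(1) by (simp add: colon_def)
      then have "Jq +> (y \<otimes> c) = Jq" using cs(5)[of "y \<otimes> c"] y(1) c(1) by simp
      then show "(Jq +> y) \<otimes>\<^bsub>R Quot Jq\<^esub> C = \<zero>\<^bsub>R Quot Jq\<^esub>" unfolding c(2) qs(4)[OF y(1) c(1)] qs(2) .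
    qed
    then obtain k where k: "k \<in> K" "Jq +> y = Jq +> k" by blast
    have "y \<ominus> k \<in> Jq" using cs(6)[OF y(1) K.Icarr[OF k(1)]] k(2) by simp
    then have "y \<ominus> k \<in> K" using sub by blast
    then show "y \<in> K" using submodule_minus_iff[OF SM, of K y k] K y(1) k(1) SM_sub by simp
  qed
qed

lemma colon_antimono: "K \<subseteq> L \<Longrightarrow> colon R Jq L \<subseteq> colon R Jq K"
  unfolding colon_def by blast

lemma colon_contains: "L \<subseteq> carrier R \<Longrightarrow> Jq \<subseteq> colon R Jq L"
proof
  assume L: "L \<subseteq> carrier R"
  interpret Jq: ideal Jq R by (rule Jq)
  fix x assume x: "x \<in> Jq"
  then have "x \<otimes> l \<in> Jq" if "l \<in> L" for l using that L by (intro Jq.I_r_closed) auto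
  then show "x \<in> colon R Jq L" using Jq.Icarr[OF x] by (simp add: colon_def)
qed

lemma has_chain_colon:
  assumes U: "Jq \<subseteq> U" and ch: "has_chain R SM n U Y"
  shows "has_chain R SM n (colon R Jq Y) (colon R Jq U)"
proof -
  obtain N where N: "\<forall>i\<le>n. submodule (N i) R SM" "\<forall>i<n. N i \<subset> N (Suc i)" "U \<subseteq> N 0" "N n \<subseteq> Y"
    using ch unfolding has_chain_def by (elim exE conjE) (rule that)
  have Ni: "ideal (N i) R" "Jq \<subseteq> N i" if "i \<le> n" for i
    using N(1) that SM_sub chain_subset[OF N(2), of 0 i] N(3) U by auto
  let ?M = "\<lambda>i. colon R Jq (N (n - i))"
  have "?M i \<subset> ?M (Suc i)" if i: "i < n" for i
  proof -
    have lt: "N (n - Suc i) \<subset> N (n - i)" using spec[OF N(2), of "n - Suc i"] i by (simp add: Suc_diff_Suc)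
    have "?M i \<noteq> ?M (Suc i)"
    proof
      assume eq: "?M i = ?M (Suc i)"
      have "colon R Jq (?M j) = N (n - j)" for j by (rule double_colon[OF Ni]) simp_all
      from this[of i] this[of "Suc i"] have "N (n - i) = N (n - Suc i)" unfolding eq by simp
      then show False using lt by simp
    qed
    moreover have "?M i \<subseteq> ?M (Suc i)" by (rule colon_antimono) (use lt in auto)
    ultimately show ?thesis by blast
  qed
  moreover have "submodule (?M i) R SM" if "i \<le> n" for i
    unfolding SM_sub by (rule colon_ideal[OF is_cring Jq]) (use ideal.Icarr[OF Ni(1)[of "n - i"]] in auto)
  moreover have "colon R Jq Y \<subseteq> ?M 0" using colon_antimono[OF N(4)] by simp
  moreover have "?M n \<subseteq> colon R Jq U" using colon_antimono[OF N(3)] by simp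
  ultimately show ?thesis unfolding has_chain_def by (intro exI[of _ ?M] conjI allI impI)
qed

text \<open>The colon ideals form an inclusion-reversing involution on the ideals above \<open>Jq\<close>, so they turn chains around.\<close>
lemma interval_length_colon:
  assumes U: "ideal U R" "Jq \<subseteq> U" and Y: "ideal Y R" "Jq \<subseteq> Y"
  shows "interval_length R SM U Y = interval_length R SM (colon R Jq Y) (colon R Jq U)"
proof (rule antisym; rule interval_length_le)
  show "has_chain R SM n U Y \<Longrightarrow> has_chain R SM n (colon R Jq Y) (colon R Jq U)" for n by (rule has_chain_colon[OF U(2)])
  show "has_chain R SM n U Y" if "has_chain R SM n (colon R Jq Y) (colon R Jq U)" for n
    using has_chain_colon[OF colon_contains that] ideal.Icarr[OF Y(1)] double_colon[OF U] double_colon[OF Y] by auto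
qed

text \<open>Duality over \<open>R / Jq\<close>: the colon ideal of \<open>W\<close> is \<open>I : \<aa>\<close> and that of \<open>B\<close> is \<open>I\<close>.\<close>
lemma length_hom_eq_dual:
  assumes I: "ideal I R" "Jq \<subseteq> I" and a: "ideal \<aa> R" and B: "B = colon R Jq I"
    and W: "W = submodule_sum SM Jq (ideal_smult R SM \<aa> B)"
  shows "interval_length R SM I (colon R I \<aa>) = interval_length R SM W B" "ideal W R" "ideal B R"
proof -
  interpret I: ideal I R by (rule I(1))
  interpret a: ideal \<aa> R by (rule a)
  interpret Jq: ideal Jq R by (rule Jq)
  show Bi: "ideal B R" unfolding B by (rule colon_ideal[OF is_cring Jq I.a_subset])
  interpret B: ideal B R by (rule Bi)
  have aB: "submodule (ideal_smult R SM \<aa> B) R SM" by (rule ideal_smult_submodule[OF SM a.a_subset]) (use B.a_subset in simp)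
  have JqS: "submodule Jq R SM" using Jq SM_sub by simp
  show Wi: "ideal W R" using sum_submodule[OF SM JqS aB] unfolding W SM_sub .
  interpret W: ideal W R by (rule Wi)
  have JW: "Jq \<subseteq> W" and aW: "ideal_smult R SM \<aa> B \<subseteq> W" unfolding W using sum_upper[OF SM JqS aB] by auto
  have II: "colon R Jq B = I" unfolding B by (rule double_colon[OF I])
  have "colon R Jq W = colon R I \<aa>"
  proof
    show "colon R Jq W \<subseteq> colon R I \<aa>"
    proof
      fix t assume t: "t \<in> colon R Jq W"
      then have tc: "t \<in> carrier R" by (simp add: colon_def)
      have "t \<otimes> r \<in> I" if r: "r \<in> \<aa>" for r
      proof -
        have rc: "r \<in> carrier R" using r by (rule a.Icarr)
        have "(t \<otimes> r) \<otimes> b \<in> Jq" if b: "b \<in> B" for b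
        proof -
          have "r \<otimes> b \<in> ideal_smult R SM \<aa> B" using ideal_smult_mem[OF r b, of SM R] by simp
          then have "t \<otimes> (r \<otimes> b) \<in> Jq" using t aW by (auto simp: colon_def)
          then show ?thesis using tc rc B.Icarr[OF b] by (simp add: m_assoc)
        qed
        then have "t \<otimes> r \<in> colon R Jq B" using tc rc by (simp add: colon_def)
        then show ?thesis unfolding II .
      qed
      then show "t \<in> colon R I \<aa>" using tc by (simp add: colon_def)
    qed
    show "colon R I \<aa> \<subseteq> colon R Jq W"
    proof
      fix t assume t: "t \<in> colon R I \<aa>"
      then have tc: "t \<in> carrier R" by (simp add: colon_def)
      have T: "submodule (colon R Jq {t}) R SM" unfolding SM_sub by (rule colon_single_ideal[OF Jq tc])
      have "W \<subseteq> colon R Jq {t}" unfolding W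
      proof (rule sum_least[OF T])
        show "Jq \<subseteq> colon R Jq {t}" by (rule colon_contains) (simp add: tc)
        show "ideal_smult R SM \<aa> B \<subseteq> colon R Jq {t}"
        proof (rule ideal_smult_least[OF T])
          fix r b assume r: "r \<in> \<aa>" and b: "b \<in> B"
          have rc: "r \<in> carrier R" and bc: "b \<in> carrier R" using a.Icarr[OF r] B.Icarr[OF b] by auto
          have "t \<otimes> r \<in> colon R Jq B" unfolding II using t r by (simp add: colon_def)
          then have "(t \<otimes> r) \<otimes> b \<in> Jq" using b by (simp add: colon_def)
          moreover have "(r \<otimes> b) \<otimes> t = (t \<otimes> r) \<otimes> b" using rc bc tc by (simp add: m_ac)
          ultimately show "r \<odot>\<^bsub>SM\<^esub> b \<in> colon R Jq {t}" using rc bc by (simp add: colon_single)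
        qed
      qed
      then have "t \<otimes> w \<in> Jq" if "w \<in> W" for w using that m_comm[OF tc W.Icarr[OF that]] by (auto simp: colon_single)
      then show "t \<in> colon R Jq W" using tc by (simp add: colon_def)
    qed
  qed
  moreover have "interval_length R SM W B = interval_length R SM (colon R Jq B) (colon R Jq W)"
    by (rule interval_length_colon[OF Wi JW Bi]) (unfold B, rule colon_contains[OF I.a_subset])
  ultimately show "interval_length R SM I (colon R I \<aa>) = interval_length R SM W B" using II by simp
qed

lemma power_in_ideal_of_artinian_quotient:
  assumes loc: "local_ring R m"
  shows "Jq \<subseteq> m" and "x \<in> m \<Longrightarrow> \<exists>k::nat. x [^] k \<in> Jq"
proof -
  interpret m: maximalideal m R using loc by (simp add: local_ring_def)
  interpret Jq: ideal Jq R by (rule Jq)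
  interpret A: noetherian_cring "R Quot Jq" by (rule quotient_noetherian_cring)
  note qs = quotient_simps[OF Jq] and cs = cyclic_simps[OF is_cring Jq]
  obtain m' where loc': "local_ring (R Quot Jq) m'" using gor unfolding gorenstein_local_ring_def by blast
  interpret m': maximalideal m' "R Quot Jq" using loc' by (simp add: local_ring_def)
  have 1: "\<one> \<notin> Jq"
  proof
    assume "\<one> \<in> Jq"
    then have "\<one>\<^bsub>R Quot Jq\<^esub> = \<zero>\<^bsub>R Quot Jq\<^esub>" using cs(5)[OF one_closed] qs(2,3) by simp
    then have "\<one>\<^bsub>R Quot Jq\<^esub> \<in> m'" using m'.zero_closed by simp
    then show False using m'.one_imp_carrier m'.I_notcarr by simp
  qed
  show sub: "Jq \<subseteq> m"
  proof
    fix x assume x: "x \<in> Jq"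
    show "x \<in> m"
    proof (rule ccontr)
      assume "x \<notin> m"
      then have u: "x \<in> Units R" by (rule nonunit_in_maximal[OF loc Jq.Icarr[OF x]])
      have "inv x \<otimes> x \<in> Jq" using x u by (intro Jq.I_l_closed) auto
      then show False using u 1 by simp
    qed
  qed
  show "\<exists>k::nat. x [^] k \<in> Jq" if x: "x \<in> m"
  proof -
    have xc: "x \<in> carrier R" using x by (rule m.Icarr)
    have Xc: "Jq +> x \<in> carrier (R Quot Jq)" using xc qs(1) by simp
    have "Jq +> x \<in> m'"
    proof (rule ccontr)
      assume "Jq +> x \<notin> m'"
      then have "Jq +> x \<in> Units (R Quot Jq)" by (rule A.nonunit_in_maximal[OF loc' Xc])
      then obtain Y where "Y \<in> carrier (R Quot Jq)" "Y \<otimes>\<^bsub>R Quot Jq\<^esub> (Jq +> x) = \<one>\<^bsub>R Quot Jq\<^esub>" unfolding Units_def by blast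
      then obtain y where y: "y \<in> carrier R" "(Jq +> y) \<otimes>\<^bsub>R Quot Jq\<^esub> (Jq +> x) = \<one>\<^bsub>R Quot Jq\<^esub>" using qs(1) by auto
      then have "Jq +> (y \<otimes> x) = Jq +> \<one>" using qs(3,4) xc by simp
      then have "\<one> \<ominus> y \<otimes> x \<in> Jq" using cs(6)[of \<one> "y \<otimes> x"] y(1) xc by simp
      then have "\<one> \<ominus> y \<otimes> x \<in> m" using sub by blast
      moreover have "y \<otimes> x \<in> m" using x y(1) by (rule m.I_l_closed)
      ultimately have "\<one> \<in> m"
        using submodule_minus_iff[OF SM, of m \<one> "y \<otimes> x"] m.ideal_axioms SM_sub by simp
      then show False using m.one_imp_carrier m.I_notcarr by simp
    qed
    from A.artinian_local_nilpotent[OF loc' art this] obtain k :: nat where "(Jq +> x) [^]\<^bsub>R Quot Jq\<^esub> k = \<zero>\<^bsub>R Quot Jq\<^esub>" by blast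
    then have "Jq +> (x [^] k) = Jq" using qs(2) qs(5)[OF xc, of k] by simp
    then have "x [^] k \<in> Jq" using cs(5)[of "x [^] k"] xc by simp
    then show ?thesis by blast
  qed
qed

end

end

section \<open>Lengths of the first two Tor modules of a cyclic module\<close>

lemma ideal_smult_restr:
  assumes M: "module R M" and Z: "submodule Z R M" and I: "I \<subseteq> carrier R" and U: "U \<subseteq> Z"
  shows "ideal_smult R (M\<lparr>carrier := Z\<rparr>) I U = ideal_smult R M I U"
proof -
  have "(\<lambda>x. x) \<in> mod_hom R (M\<lparr>carrier := Z\<rparr>) M" by (rule mod_homI) (use submodule_subset[OF Z] in auto)
  from ideal_smult_image[OF restr_module[OF M Z] M this I, of U] U show ?thesis by simp
qed

text \<open>The length of \<open>H / \<aa> H\<close> for a quotient \<open>H = Z / K\<close>.\<close>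
lemma interval_length_quotient:
  assumes M: "module R M" and H: "module R H" and Z: "submodule Z R M" and a: "\<aa> \<subseteq> carrier R"
    and pi: "\<pi> \<in> mod_hom R (M\<lparr>carrier := Z\<rparr>) H" and onto: "\<pi> ` Z = carrier H"
    and K: "submodule K R M" and KZ: "K \<subseteq> Z" and ker: "\<And>v. v \<in> Z \<Longrightarrow> \<pi> v = \<zero>\<^bsub>H\<^esub> \<longleftrightarrow> v \<in> K"
  shows "interval_length R H (ideal_smult R H \<aa> (carrier H)) (carrier H) =
    interval_length R M (submodule_sum M K (ideal_smult R M \<aa> Z)) Z"
proof -
  let ?MZ = "M\<lparr>carrier := Z\<rparr>" and ?aZ = "ideal_smult R M \<aa> Z" and ?aH = "ideal_smult R H \<aa> (carrier H)"
  interpret H: module R H by (rule H)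
  interpret M: module R M by (rule M)
  have ZM: "Z \<subseteq> carrier M" using submodule_subset[OF Z] by blast
  have aZ: "submodule ?aZ R M" by (rule ideal_smult_submodule[OF M a ZM])
  have aZZ: "?aZ \<subseteq> Z" by (rule ideal_smult_least[OF Z submodule_smult[OF Z]]) (use a in auto)
  have MZ: "module R ?MZ" by (rule restr_module[OF M Z])
  have aH: "submodule ?aH R H" by (rule ideal_smult_submodule[OF H a order.refl])
  have im: "?aH = \<pi> ` ?aZ"
    using ideal_smult_image[OF MZ H pi a, of Z] ideal_smult_restr[OF M Z a order.refl] onto by simp
  note add = mod_hom_add[OF pi, simplified] and cl = mod_hom_closed[OF pi, simplified]
  have "{x \<in> Z. \<pi> x \<in> ?aH} = submodule_sum M K ?aZ"
  proof (intro equalityI subsetI)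
    fix x assume x: "x \<in> {x \<in> Z. \<pi> x \<in> ?aH}"
    then obtain z where z: "z \<in> ?aZ" "\<pi> x = \<pi> z" unfolding im by blast
    have zZ: "z \<in> Z" using z(1) aZZ by blast
    have d: "x \<ominus>\<^bsub>M\<^esub> z \<in> Z" using submodule_minus[OF M Z _ zZ] x by simp
    have s: "(x \<ominus>\<^bsub>M\<^esub> z) \<oplus>\<^bsub>M\<^esub> z = x" using module_minus_cancel(1)[OF M] ZM x zZ by auto
    have "\<pi> (x \<ominus>\<^bsub>M\<^esub> z) \<oplus>\<^bsub>H\<^esub> \<pi> z = \<pi> z" using add[OF d zZ] s z(2) by simp
    then have "\<pi> (x \<ominus>\<^bsub>M\<^esub> z) = \<zero>\<^bsub>H\<^esub>" using H.M.add.l_cancel_one[OF cl[OF zZ] cl[OF d]] H.a_comm[OF cl[OF zZ] cl[OF d]] by simp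
    then have "x \<ominus>\<^bsub>M\<^esub> z \<in> K" using ker[OF d] by simp
    then show "x \<in> submodule_sum M K ?aZ" unfolding submodule_sum_def using z(1) s by force
  next
    fix x assume "x \<in> submodule_sum M K ?aZ"
    then obtain k z where kz: "k \<in> K" "z \<in> ?aZ" "x = k \<oplus>\<^bsub>M\<^esub> z" unfolding submodule_sum_def by blast
    then have Zs: "k \<in> Z" "z \<in> Z" using KZ aZZ by auto
    then have "\<pi> x = \<pi> z" using add ker[OF Zs(1)] kz cl by simp
    then show "x \<in> {x \<in> Z. \<pi> x \<in> ?aH}" using kz Zs submodule_add[OF Z] unfolding im by auto
  qed
  moreover have "{x \<in> Z. \<pi> x \<in> carrier H} = Z" using cl by auto
  ultimately have "interval_length R H ?aH (carrier H) = interval_length R ?MZ (submodule_sum M K ?aZ) Z"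
    using interval_length_vimage[OF MZ H pi _ aH submodule_carrier[OF H]] onto by simp
  then show ?thesis using interval_length_restr[OF M Z order.refl] by simp
qed

context noetherian_cring
begin

text \<open>The form in which boundedness is used: \<open>\<aa>\<close> kills the image of a free module of fixed rank modulo \<open>A\<close>.\<close>
lemma interval_length_image_le:
  assumes M: "module R M" and A: "submodule A R M" and T: "finite T" and h: "h \<in> mod_hom R (FM T) M"
    and a: "\<aa> \<subseteq> carrier R" and ann: "\<And>r w. r \<in> \<aa> \<Longrightarrow> w \<in> carrier (FM T) \<Longrightarrow> r \<odot>\<^bsub>M\<^esub> h w \<in> A"
    and C: "C \<subseteq> submodule_sum M A (h ` carrier (FM T))"
  shows "interval_length R M A C \<le> enat (card T) * colength \<aa>"
proof -
  let ?G = "(\<lambda>k. h (free_basis R k)) ` T"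
  have G: "?G \<subseteq> carrier M" using mod_hom_closed[OF h free_basis_closed[OF is_cring]] by auto
  have S: "submodule (submodule_span R M (A \<union> ?G)) R M" by (rule span_submodule[OF M]) (use G submodule_subset[OF A] in auto)
  have "h w \<in> submodule_span R M (A \<union> ?G)" if w: "w \<in> carrier (FM T)" for w
  proof -
    have "h w = free_lift R M (\<lambda>k. h (free_basis R k)) w" by (rule hom_eq_free_lift[OF is_cring M h w refl])
    also have "\<dots> \<in> submodule_span R M (A \<union> ?G)"
      by (rule free_lift_in_submodule[OF M S _ w]) (use span_superset[of "A \<union> ?G" R M] in auto)
    finally show ?thesis .
  qed
  then have "submodule_sum M A (h ` carrier (FM T)) \<subseteq> submodule_span R M (A \<union> ?G)"
    by (intro sum_least[OF S]) (use span_superset[of "A \<union> ?G" R M] in auto)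
  then have "interval_length R M A C \<le> enat (card ?G) * colength \<aa>"
    using T G ann free_basis_closed[OF is_cring, of _ T] C by (intro interval_length_generators_le[OF M A _ _ _ a]) auto
  also have "\<dots> \<le> enat (card T) * colength \<aa>"
    by (rule mult_right_mono) (simp_all add: card_image_le[OF T])
  finally show ?thesis .
qed

definition relations :: "'x set \<Rightarrow> ('x \<Rightarrow> 'a) \<Rightarrow> ('x \<Rightarrow> 'a) set" where
  "relations T c = {v \<in> carrier (FM T). free_lift R SM c v = \<zero>}"

lemma relations_submodule: "c \<in> T \<rightarrow> carrier R \<Longrightarrow> submodule (relations T c) R (FM T)"
proof -
  assume c: "c \<in> T \<rightarrow> carrier R"
  have "free_lift R SM c \<in> mod_hom R (FM T) SM" by (rule free_lift_hom[OF SM]) (use c in simp)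
  from submodule_a_kernel[OF FM SM this] show ?thesis
    by (simp add: relations_def a_kernel_iff Collect_conj_eq[symmetric] a_kernel_def kernel_def Int_def)
qed

lemma base_change_identity:
  assumes h: "h \<in> mod_hom R (FM T) (FM U)" and v: "v \<in> carrier (FM T)"
  shows "base_change R R (\<lambda>r. r) U h v = h v"
proof -
  have "(\<lambda>r. r) \<in> ring_hom R R" by (simp add: ring_hom_def)
  from base_change_psi[OF is_cring is_cring this h v] show ?thesis by (simp add: comp_def)
qed

context
  fixes T :: "nat \<Rightarrow> nat set" and \<delta> \<epsilon> and c :: "nat \<Rightarrow> 'a" and I :: "'a set" and x0 :: nat
  assumes T0: "T 0 = {x0}" and fin: "\<And>i. finite (T i)" and I: "ideal I R" and c: "c \<in> T (Suc 0) \<rightarrow> carrier R"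
    and G: "free_resolution I T \<delta> \<epsilon>"
    and d0: "\<forall>k\<in>T (Suc 0). \<delta> 0 (free_basis R k) = c k \<odot>\<^bsub>FM {x0}\<^esub> free_basis R x0"
begin

abbreviation "boundaries \<psi> \<equiv> base_change R R \<psi> (T (Suc 0)) (\<delta> (Suc 0)) ` carrier (FM (T (Suc (Suc 0))))"

lemma first_differential:
  assumes psi: "\<psi> \<in> ring_hom R R" and v: "v \<in> carrier (FM (T (Suc 0)))"
  shows "base_change R R \<psi> (T 0) (\<delta> 0) v = \<zero>\<^bsub>FM (T 0)\<^esub> \<longleftrightarrow> v \<in> relations (T (Suc 0)) (\<lambda>k. \<psi> (c k))"
proof -
  note r = resolution_facts[OF G]
  let ?D = "base_change R R \<psi> (T 0) (\<delta> 0)"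
  have D: "?D \<in> mod_hom R (FM (T (Suc 0))) (FM (T 0))" by (rule base_change_hom[OF is_cring is_cring psi r(3)])
  have "?D v x0 = free_lift R SM (\<lambda>k. \<psi> (c k)) v"
  proof (rule hom_eq_free_lift[OF is_cring SM mod_hom_comp[OF eval_hom[OF is_cring] D] v])
    fix k assume k: "k \<in> T (Suc 0)"
    then have "c k \<in> carrier R" using c by auto
    then show "?D (free_basis R k) x0 = \<psi> (c k)"
      using base_change_basis[OF is_cring is_cring psi r(3) k] bspec[OF d0 k] by (simp add: free_simps free_basis_def)
  qed
  moreover have "?D v = \<zero>\<^bsub>FM (T 0)\<^esub> \<longleftrightarrow> ?D v x0 = \<zero>"

  proof -
    have "?D v x = \<zero>" if "x \<noteq> x0" for x using free_mem_off[OF mod_hom_closed[OF D v], of x] T0 that by simp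
    then show ?thesis unfolding free_simps fun_eq_iff by metis
  qed
  ultimately show ?thesis using v by (simp add: relations_def)
qed

lemma boundaries_facts:
  assumes psi: "\<psi> \<in> ring_hom R R"
  shows "submodule (boundaries \<psi>) R (FM (T (Suc 0)))" "boundaries \<psi> \<subseteq> relations (T (Suc 0)) (\<lambda>k. \<psi> (c k))"
    and "v \<in> relations (T (Suc 0)) c \<Longrightarrow> \<psi> \<circ> v \<in> boundaries \<psi>"
proof -
  note r = resolution_facts[OF G]
  let ?D = "\<lambda>i. base_change R R \<psi> (T i) (\<delta> i)"
  have D: "?D i \<in> mod_hom R (FM (T (Suc i))) (FM (T i))" for i by (rule base_change_hom[OF is_cring is_cring psi r(3)])
  show "submodule (boundaries \<psi>) R (FM (T (Suc 0)))" by (rule submodule_image[OF FM FM D submodule_carrier[OF FM]])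
  show "boundaries \<psi> \<subseteq> relations (T (Suc 0)) (\<lambda>k. \<psi> (c k))"
  proof
    fix v assume "v \<in> boundaries \<psi>"
    then obtain w where w: "w \<in> carrier (FM (T (Suc (Suc 0))))" "v = ?D (Suc 0) w" by blast
    have "?D 0 v = \<zero>\<^bsub>FM (T 0)\<^esub>" unfolding w(2)
      using base_change_comp[OF is_cring is_cring psi r(3) r(3) w(1)]
        base_change_zero[OF is_cring is_cring psi mod_hom_comp[OF r(3) r(3)] r(7) w(1)] by simp
    then show "v \<in> relations (T (Suc 0)) (\<lambda>k. \<psi> (c k))"
      using first_differential[OF psi] mod_hom_closed[OF D w(1)] w(2) by simp
  qed
  show "\<psi> \<circ> v \<in> boundaries \<psi>" if v: "v \<in> relations (T (Suc 0)) c"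
  proof -
    have id: "(\<lambda>r. r) \<in> ring_hom R R" by (simp add: ring_hom_def)
    have vF: "v \<in> carrier (FM (T (Suc 0)))" using v by (simp add: relations_def)
    have "\<delta> 0 v = \<zero>\<^bsub>FM (T 0)\<^esub>" using first_differential[OF id vF] base_change_identity[OF r(3) vF] v by simp
    then obtain y where y: "y \<in> carrier (FM (T (Suc (Suc 0))))" "v = \<delta> (Suc 0) y" using r(9)[OF vF] by blast
    have "\<psi> \<circ> v = ?D (Suc 0) (\<psi> \<circ> y)" using base_change_psi[OF is_cring is_cring psi r(3) y(1)] y(2) by simp
    then show ?thesis using psi_vector[OF is_cring is_cring psi y(1)] by blast
  qed
qed

text
  \<open>Along \<open>\<psi>\<close>, the first Tor of \<open>R / I\<close> consists of the relations between the \<open>\<psi> (c k)\<close> modulo the images of the relations between the \<open>c k\<close>.\<close>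
lemma length_Tor1_tensor_cyclic:
  assumes psi: "\<psi> \<in> ring_hom R R" and a: "ideal \<aa> R"
  defines "Z \<equiv> relations (T (Suc 0)) (\<lambda>k. \<psi> (c k))"
  shows "module_length R (tensor_product R (Tor_over R R \<psi> (Suc 0) (cyclic_module R I) SM) (cyclic_module R \<aa>)) =
    interval_length R (FM (T (Suc 0))) (submodule_sum (FM (T (Suc 0))) (boundaries \<psi>) (ideal_smult R (FM (T (Suc 0))) \<aa> Z)) Z"
proof -
  interpret a: ideal \<aa> R by (rule a)
  let ?N = "{s \<in> carrier R. s \<odot>\<^bsub>SM\<^esub> \<one> = \<zero>\<^bsub>SM\<^esub>}"
  have N0: "?N = {\<zero>}" by auto
  have gen: "\<exists>s\<in>carrier R. y = s \<odot>\<^bsub>SM\<^esub> \<one>" if "y \<in> carrier SM" for y using that by (intro bexI[of _ y]) auto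
  have one: "\<one> \<in> carrier SM" by simp
  note t = Tor_over_cyclic[where j = 0, OF noetherian_ring_axioms is_cring is_cring psi I G SM one gen refl, unfolded N0]
  let ?V = "{v \<in> carrier (FM (T (Suc 0))). base_change R R \<psi> (T 0) (\<delta> 0) v \<in> IV {\<zero>} (T 0)}"
  have D: "base_change R R \<psi> (T 0) (\<delta> 0) \<in> mod_hom R (FM (T (Suc 0))) (FM (T 0))"
    by (rule base_change_hom[OF is_cring is_cring psi resolution_facts(3)[OF G]])
  have IV0: "w \<in> IV {\<zero>} U \<longleftrightarrow> w \<in> carrier (FM U) \<and> w = \<zero>\<^bsub>FM U\<^esub>" for w :: "nat \<Rightarrow> 'a" and U
    by (auto simp: ideal_vectors_def free_simps fun_eq_iff)
  have V: "?V = Z"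
  proof (intro equalityI subsetI)
    fix v assume "v \<in> ?V"
    then show "v \<in> Z" using first_differential[OF psi, of v] unfolding Z_def IV0 by blast
  next
    fix v assume v: "v \<in> Z"
    then have vF: "v \<in> carrier (FM (T (Suc 0)))" unfolding Z_def relations_def by blast
    then show "v \<in> ?V" using first_differential[OF psi vF] v mod_hom_closed[OF D vF] unfolding Z_def IV0 by blast
  qed
  let ?H = "Tor_over R R \<psi> (Suc 0) (cyclic_module R I) SM"
  have H: "module R ?H" and Z: "submodule Z R (FM (T (Suc 0)))" using t(1,2) V by simp_all
  from t(3) V obtain \<pi> where pi: "\<pi> \<in> mod_hom R ((FM (T (Suc 0)))\<lparr>carrier := Z\<rparr>) ?H" "\<pi> ` Z = carrier ?H"
    and ker: "\<forall>v\<in>Z. \<pi> v = \<zero>\<^bsub>?H\<^esub> \<longleftrightarrow> (\<exists>w\<in>carrier (FM (T (Suc (Suc 0)))). \<exists>u\<in>IV {\<zero>} (T (Suc 0)).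
         v = base_change R R \<psi> (T (Suc 0)) (\<delta> (Suc 0)) w \<oplus>\<^bsub>FM (T (Suc 0))\<^esub> u)" by auto
  note b = boundaries_facts[OF psi]
  interpret F: module R "FM (T (Suc 0))" by (rule FM)
  have "\<pi> v = \<zero>\<^bsub>?H\<^esub> \<longleftrightarrow> v \<in> boundaries \<psi>" if v: "v \<in> Z" for v
  proof -
    have bc: "base_change R R \<psi> (T (Suc 0)) (\<delta> (Suc 0)) w \<in> carrier (FM (T (Suc 0)))" if "w \<in> carrier (FM (T (Suc (Suc 0))))" for w
      by (rule submodule_subset[OF b(1)]) (use that in blast)
    show ?thesis using bspec[OF ker v] bc F.M.zero_closed by (auto simp: IV0 image_iff)
  qed
  from interval_length_quotient[OF FM H Z a.a_subset pi b(1) b(2)[folded Z_def] this]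
  show ?thesis unfolding module_length_tensor_cyclic[OF is_cring H a] .
qed

text
  \<open>\<open>Tor\<^sub>2(R / I, R / \<aa>) = Tor\<^sub>1(I, R / \<aa>)\<close> is the kernel of \<open>Z / \<aa> Z \<rightarrow> F / \<aa> F\<close>, where \<open>Z\<close> is the kernel of the surjection of the free module \<open>F\<close> onto \<open>I\<close>.\<close>
lemma length_Tor2_cyclic:
  assumes a: "ideal \<aa> R"
  defines "Z \<equiv> relations (T (Suc 0)) c"
  shows "module_length R (Tor_over R R (\<lambda>r. r) (Suc (Suc 0)) (cyclic_module R I) (cyclic_module R \<aa>)) =
    interval_length R (FM (T (Suc 0))) (ideal_smult R (FM (T (Suc 0))) \<aa> Z) (Z \<inter> IV \<aa> (T (Suc 0)))"
proof -
  interpret a: ideal \<aa> R by (rule a)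
  note r = resolution_facts[OF G] and cs = cyclic_simps[OF is_cring a]
  let ?F1 = "FM (T (Suc 0))" and ?F2 = "FM (T (Suc (Suc 0)))" and ?F3 = "FM (T (Suc (Suc (Suc 0))))"
  let ?Q = "cyclic_module R \<aa>"
  have id: "(\<lambda>r. r) \<in> ring_hom R R" by (simp add: ring_hom_def)
  have nu: "\<aa> +> \<one> \<in> carrier ?Q" using cs(1) by blast
  have ann: "\<aa> = {s \<in> carrier R. s \<odot>\<^bsub>?Q\<^esub> (\<aa> +> \<one>) = \<zero>\<^bsub>?Q\<^esub>}"
  proof (intro equalityI subsetI)
    show "s \<in> {s \<in> carrier R. s \<odot>\<^bsub>?Q\<^esub> (\<aa> +> \<one>) = \<zero>\<^bsub>?Q\<^esub>}" if "s \<in> \<aa>" for s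
      using a.Icarr[OF that] cs(2) cs(4)[of s \<one>] cs(5)[of s] that by simp
    show "s \<in> \<aa>" if "s \<in> {s \<in> carrier R. s \<odot>\<^bsub>?Q\<^esub> (\<aa> +> \<one>) = \<zero>\<^bsub>?Q\<^esub>}" for s
      using cs(2) cs(4)[of s \<one>] cs(5)[of s] that by simp
  qed
  have gen: "\<exists>s\<in>carrier R. y = s \<odot>\<^bsub>?Q\<^esub> (\<aa> +> \<one>)" if "y \<in> carrier ?Q" for y
  proof -
    obtain s where "s \<in> carrier R" "y = \<aa> +> s" using \<open>y \<in> carrier ?Q\<close> unfolding cs(1) by blast
    then show ?thesis using cs(4)[of s \<one>] by (intro bexI[of _ s]) simp_all
  qed
  note t = Tor_over_cyclic[where j = "Suc 0", OF noetherian_ring_axioms is_cring is_cring id I G cyclic_is_module[OF is_cring a] nu gen ann]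
  let ?H = "Tor_over R R (\<lambda>r. r) (Suc (Suc 0)) (cyclic_module R I) ?Q"
  let ?V = "{v \<in> carrier ?F2. \<delta> (Suc 0) v \<in> IV \<aa> (T (Suc 0))}"
  have V: "{v \<in> carrier ?F2. base_change R R (\<lambda>r. r) (T (Suc 0)) (\<delta> (Suc 0)) v \<in> IV \<aa> (T (Suc 0))} = ?V"
    using base_change_identity[OF r(3)] by auto
  have H: "module R ?H" and Vs: "submodule ?V R ?F2" using t(1,2) V by simp_all
  from t(3) V obtain \<pi> where pi: "\<pi> \<in> mod_hom R (?F2\<lparr>carrier := ?V\<rparr>) ?H" "\<pi> ` ?V = carrier ?H"
    and ker: "\<forall>v\<in>?V. \<pi> v = \<zero>\<^bsub>?H\<^esub> \<longleftrightarrow> (\<exists>w\<in>carrier ?F3. \<exists>u\<in>IV \<aa> (T (Suc (Suc 0))).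
         v = base_change R R (\<lambda>r. r) (T (Suc (Suc 0))) (\<delta> (Suc (Suc 0))) w \<oplus>\<^bsub>?F2\<^esub> u)" by auto
  let ?K = "{v \<in> ?V. \<pi> v = \<zero>\<^bsub>?H\<^esub>}"
  have "a_kernel (?F2\<lparr>carrier := ?V\<rparr>) ?H \<pi> = ?K" by (auto simp: a_kernel_iff)
  then have len: "module_length R ?H = interval_length R ?F2 ?K ?V"
    using module_length_surj[OF restr_module[OF FM Vs] H pi(1)] pi(2) interval_length_restr[OF FM Vs order.refl] by simp
  have Z: "submodule Z R ?F1" unfolding Z_def by (rule relations_submodule[OF c])
  have ZF: "Z \<subseteq> carrier ?F1" using submodule_subset[OF Z] by blast
  have Zk: "v \<in> Z \<longleftrightarrow> \<delta> 0 v = \<zero>\<^bsub>FM (T 0)\<^esub>" if "v \<in> carrier ?F1" for v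
    using first_differential[OF id that] base_change_identity[OF r(3) that] by (simp add: Z_def)
  let ?M = "?F1\<lparr>carrier := Z\<rparr>"
  have M: "module R ?M" by (rule restr_module[OF FM Z])
  have dZ: "\<delta> (Suc 0) v \<in> Z" if "v \<in> carrier ?F2" for v using Zk[OF mod_hom_closed[OF r(3) that]] r(7)[OF that] by simp
  have h: "\<delta> (Suc 0) \<in> mod_hom R ?F2 ?M"
    by (rule mod_homI) (use dZ mod_hom_add[OF r(3)] mod_hom_smult[OF r(3)] in auto)
  have onto: "\<delta> (Suc 0) ` carrier ?F2 = Z" using dZ r(9)[of _ 0] Zk ZF by blast
  let ?aZ = "ideal_smult R ?F1 \<aa> Z"
  have aZ: "submodule ?aZ R ?F1" by (rule ideal_smult_submodule[OF FM a.a_subset ZF])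
  have aZZ: "?aZ \<subseteq> Z" by (rule ideal_smult_least[OF Z submodule_smult[OF Z]]) auto
  have smIV: "s \<odot>\<^bsub>FM U\<^esub> v \<in> IV \<aa> U" if "s \<in> \<aa>" "v \<in> carrier (FM U)" for s U and v :: "nat \<Rightarrow> 'a"
  proof -
    interpret F: module R "FM U" by (rule FM)
    show ?thesis using that free_mem_closed[OF is_cring that(2)] F.smult_closed[of s v]
      by (intro IV_I) (auto simp: free_simps a.I_r_closed)
  qed
  have aZI: "?aZ \<subseteq> IV \<aa> (T (Suc 0))" by (rule ideal_smult_least[OF IV_sub[OF a] smIV]) (use ZF in auto)
  have aZM: "submodule ?aZ R ?M" and ZIM: "submodule (Z \<inter> IV \<aa> (T (Suc 0))) R ?M"
    using submodule_restr[OF FM Z] aZ aZZ submodule_Int[OF FM Z IV_sub[OF a]] by auto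
  have e1: "{x \<in> carrier ?F2. \<delta> (Suc 0) x \<in> Z \<inter> IV \<aa> (T (Suc 0))} = ?V" using dZ by auto
  have e2: "{x \<in> carrier ?F2. \<delta> (Suc 0) x \<in> ?aZ} = ?K"
  proof (intro equalityI subsetI)
    interpret F2: module R ?F2 by (rule FM)
    fix x assume x: "x \<in> {x \<in> carrier ?F2. \<delta> (Suc 0) x \<in> ?aZ}"
    then have xc: "x \<in> carrier ?F2" by simp
    have "?aZ = \<delta> (Suc 0) ` ideal_smult R ?F2 \<aa> (carrier ?F2)"
      using ideal_smult_image[OF FM FM r(3) a.a_subset order.refl] onto by simp
    moreover have "ideal_smult R ?F2 \<aa> (carrier ?F2) \<subseteq> IV \<aa> (T (Suc (Suc 0)))" by (rule ideal_smult_least[OF IV_sub[OF a] smIV])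
    ultimately obtain u where u: "u \<in> IV \<aa> (T (Suc (Suc 0)))" "\<delta> (Suc 0) x = \<delta> (Suc 0) u" using x by blast
    have uc: "u \<in> carrier ?F2" by (rule IV_D(1)[OF u(1)])
    have "\<delta> (Suc 0) (x \<ominus>\<^bsub>?F2\<^esub> u) = \<zero>\<^bsub>?F1\<^esub>"
      using mod_hom_minus[OF FM FM r(3) xc uc] u(2) module_minus_cancel(4)[OF FM mod_hom_closed[OF r(3) uc] mod_hom_closed[OF r(3) uc]] by simp
    moreover have "x \<ominus>\<^bsub>?F2\<^esub> u \<in> carrier ?F2" using xc uc by (rule F2.minus_closed)
    ultimately obtain w where w: "w \<in> carrier ?F3" "x \<ominus>\<^bsub>?F2\<^esub> u = \<delta> (Suc (Suc 0)) w" using r(9) by blast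
    have "x = base_change R R (\<lambda>r. r) (T (Suc (Suc 0))) (\<delta> (Suc (Suc 0))) w \<oplus>\<^bsub>?F2\<^esub> u"
      using module_minus_cancel(1)[OF FM xc uc] w(2) base_change_identity[OF r(3) w(1)] by simp
    moreover have xV: "x \<in> ?V" using x aZI by auto
    ultimately show "x \<in> ?K" using bspec[OF ker xV] w(1) u(1) by blast
  next
    fix x assume "x \<in> ?K"
    then have xV: "x \<in> ?V" and x0: "\<pi> x = \<zero>\<^bsub>?H\<^esub>" by auto
    from bspec[OF ker xV] x0 obtain w u where w: "w \<in> carrier ?F3" and u: "u \<in> IV \<aa> (T (Suc (Suc 0)))"
      and x: "x = base_change R R (\<lambda>r. r) (T (Suc (Suc 0))) (\<delta> (Suc (Suc 0))) w \<oplus>\<^bsub>?F2\<^esub> u" by auto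
    interpret F1: module R ?F1 by (rule FM)
    have uc: "u \<in> carrier ?F2" by (rule IV_D(1)[OF u])
    have "\<delta> (Suc 0) x = \<delta> (Suc 0) (\<delta> (Suc (Suc 0)) w \<oplus>\<^bsub>?F2\<^esub> u)" unfolding x base_change_identity[OF r(3) w] ..
    also have "\<dots> = \<delta> (Suc 0) u"
      using mod_hom_add[OF r(3) mod_hom_closed[OF r(3) w] uc] r(7)[OF w] mod_hom_closed[OF r(3) uc] by simp
    also have "\<dots> \<in> ?aZ"
      by (rule hom_of_ideal_vector[OF is_cring M h aZM _ u]) (simp add: ideal_smult_mem)
    finally show "x \<in> {x \<in> carrier ?F2. \<delta> (Suc 0) x \<in> ?aZ}" using xV by simp
  qed
  have "interval_length R ?M ?aZ (Z \<inter> IV \<aa> (T (Suc 0))) = interval_length R ?F2 ?K ?V"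
    using interval_length_vimage[OF FM M h _ aZM ZIM] onto unfolding e1 e2 by simp
  then show ?thesis unfolding len using interval_length_restr[OF FM Z, of "Z \<inter> IV \<aa> (T (Suc 0))"] by simp
qed

end

end

context noetherian_cring
begin

lemma length_Tor2_of_generators:
  assumes fin: "finite (U :: nat set)" and c: "c \<in> U \<rightarrow> carrier R" and a: "ideal \<aa> R"
  shows "module_length R (Tor_over R R (\<lambda>r. r) (Suc (Suc 0)) (cyclic_module R (submodule_span R SM (c ` U))) (cyclic_module R \<aa>)) =
    interval_length R (FM U) (ideal_smult R (FM U) \<aa> (relations U c)) (relations U c \<inter> IV \<aa> U)"
proof -
  have I: "ideal (submodule_span R SM (c ` U)) R" unfolding SM_sub[symmetric] by (rule span_submodule[OF SM]) (use c in auto)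
  obtain T :: "nat \<Rightarrow> nat set" and \<delta> \<epsilon> where T: "T 0 = {0}" "T (Suc 0) = U" "\<forall>i. finite (T i)"
    "free_resolution (submodule_span R SM (c ` U)) T \<delta> \<epsilon>"
    "\<forall>k\<in>U. \<delta> 0 (free_basis R k) = c k \<odot>\<^bsub>FM {0}\<^esub> free_basis R 0"
    using resolution_of_cyclic_from_generators[OF noetherian_ring_axioms is_cring infinite_UNIV_nat fin c, of 0]
    by (elim exE conjE) (rule that)
  have c': "c \<in> T (Suc 0) \<rightarrow> carrier R" using c T(2) by simp
  have d: "\<forall>k\<in>T (Suc 0). \<delta> 0 (free_basis R k) = c k \<odot>\<^bsub>FM {0}\<^esub> free_basis R 0" using T(2,5) by simp
  show ?thesis using length_Tor2_cyclic[where T = T, OF T(1) spec[OF T(3)] I c' T(4) d a] unfolding T(2) .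
qed

text
  \<open>The elements that \<open>\<psi>\<close> maps into a given ideal form an ideal, because \<open>\<psi>\<close> is additive and multiplicative; so generators suffice.\<close>
lemma frobenius_power_span:
  assumes psi: "\<psi> \<in> ring_hom R R" and q: "\<And>r. r \<in> carrier R \<Longrightarrow> \<psi> r = r [^] (q::nat)" and C: "C \<subseteq> carrier R"
  shows "frobenius_power R (submodule_span R SM C) q = submodule_span R SM (\<psi> ` C)"
proof -
  interpret psi: ring_hom_cring R R \<psi> by (intro ring_hom_cring.intro ring_hom_cring_axioms.intro psi is_cring)
  let ?S = "submodule_span R SM C" and ?K = "submodule_span R SM (\<psi> ` C)"
  have S: "submodule ?S R SM" by (rule span_submodule[OF SM]) (use C in simp)
  then have Sc: "?S \<subseteq> carrier R" using submodule_subset[OF S] by auto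
  have pC: "\<psi> ` C \<subseteq> carrier R" using C by auto
  have K: "submodule ?K R SM" by (rule span_submodule[OF SM]) (use pC in simp)
  have im: "(\<lambda>x. x [^] q) ` ?S = \<psi> ` ?S" using q Sc by (intro image_cong) auto
  have V: "submodule {x \<in> carrier R. \<psi> x \<in> ?K} R SM"
    by (rule submoduleI'[OF SM]) (use submodule_zero[OF K] submodule_add[OF K] submodule_smult[OF K] in auto)
  have "?S \<subseteq> {x \<in> carrier R. \<psi> x \<in> ?K}" by (rule span_least[OF V]) (use C span_superset[of "\<psi> ` C" R SM] in auto)
  then have sub: "\<psi> ` ?S \<subseteq> ?K" by auto
  have "frobenius_power R ?S q = submodule_span R SM (\<psi> ` ?S)"
    unfolding frobenius_power_def im using Sc by (intro Idl_span) auto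
  also have "\<dots> = ?K"
    by (rule equalityI[OF span_least[OF K sub] span_mono[OF image_mono[OF span_superset]]])
  finally show ?thesis .
qed

lemma resolution_generators:
  assumes I: "ideal I R" and T0: "T 0 = {x0}" and G: "free_resolution I T \<delta> \<epsilon>"
    and eps: "\<And>v. \<epsilon> v = I +> v x0"
  defines "g \<equiv> \<lambda>k. \<delta> 0 (free_basis R k) x0"
  shows "g \<in> T (Suc 0) \<rightarrow> carrier R" and "I = submodule_span R SM (g ` T (Suc 0))"
    and "k \<in> T (Suc 0) \<Longrightarrow> \<delta> 0 (free_basis R k) = g k \<odot>\<^bsub>FM {x0}\<^esub> free_basis R x0"
proof -
  note r = resolution_facts[OF G] and cs = cyclic_simps[OF is_cring I]
  have b: "\<delta> 0 (free_basis R k) \<in> carrier (FM {x0})" if "k \<in> T (Suc 0)" for k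
    using mod_hom_closed[OF r(3) free_basis_closed[OF is_cring that]] T0 by simp
  show g: "g \<in> T (Suc 0) \<rightarrow> carrier R" unfolding g_def using free_mem_closed[OF is_cring b] by blast
  show "\<delta> 0 (free_basis R k) = g k \<odot>\<^bsub>FM {x0}\<^esub> free_basis R x0" if k: "k \<in> T (Suc 0)"
  proof
    fix x
    have "g k \<in> carrier R" using g k by blast
    then show "\<delta> 0 (free_basis R k) x = (g k \<odot>\<^bsub>FM {x0}\<^esub> free_basis R x0) x"
      using free_mem_off[OF b[OF k], of x] by (cases "x = x0") (simp_all add: g_def free_simps free_basis_def)
  qed
  have gI: "g k \<in> I" if k: "k \<in> T (Suc 0)" for k
  proof -
    have "I +> g k = I" using r(6)[OF free_basis_closed[OF is_cring k]] eps cs(2) by (simp add: g_def)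
    then show ?thesis using cs(5)[of "g k"] g k by auto
  qed
  have S: "submodule (submodule_span R SM (g ` T (Suc 0))) R SM" by (rule span_submodule[OF SM]) (use g in auto)
  show "I = submodule_span R SM (g ` T (Suc 0))"
  proof
    show "submodule_span R SM (g ` T (Suc 0)) \<subseteq> I" by (rule span_least) (use I gI SM_sub in auto)
    show "I \<subseteq> submodule_span R SM (g ` T (Suc 0))"
    proof
      fix x assume x: "x \<in> I"
      have xc: "x \<in> carrier R" by (rule ideal.Icarr[OF I x])
      interpret F: module R "FM {x0}" by (rule FM)
      let ?v = "x \<odot>\<^bsub>FM {x0}\<^esub> free_basis R x0"
      have v: "?v \<in> carrier (FM (T 0))" using F.smult_closed[OF xc free_basis_closed[OF is_cring, of x0]] T0 by simp
      have vx: "?v x0 = x" using xc by (simp add: free_simps free_basis_def)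
      have "\<epsilon> ?v = \<zero>\<^bsub>cyclic_module R I\<^esub>" unfolding eps vx using cs(2) cs(5)[OF xc] x by simp
      then obtain w where w: "w \<in> carrier (FM (T (Suc 0)))" "?v = \<delta> 0 w" using r(8)[OF v] by blast
      have "x = \<delta> 0 w x0" using w(2) vx by simp
      also have "\<dots> = free_lift R SM g w"
        by (rule hom_eq_free_lift[OF is_cring SM mod_hom_comp[OF eval_hom[OF is_cring] r(3)] w(1)]) (simp add: g_def)
      also have "\<dots> \<in> submodule_span R SM (g ` T (Suc 0))"
        by (rule free_lift_in_submodule[OF SM S _ w(1)]) (use span_superset[of "g ` T (Suc 0)" R SM] in auto)
      finally show "x \<in> submodule_span R SM (g ` T (Suc 0))" .
    qed
  qed
qed

section \<open>Adding one generator\<close>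

context
  fixes T T' :: "nat \<Rightarrow> nat set" and \<delta> \<epsilon> \<delta>' \<epsilon>' and c :: "nat \<Rightarrow> 'a" and I J :: "'a set" and x0 k0 :: nat and \<psi> :: "'a \<Rightarrow> 'a"
  assumes T0: "T 0 = {x0}" and fin: "\<And>i. finite (T i)" and I: "ideal I R" and c: "c \<in> T (Suc 0) \<rightarrow> carrier R"
    and G: "free_resolution I T \<delta> \<epsilon>"
    and d0: "\<forall>k\<in>T (Suc 0). \<delta> 0 (free_basis R k) = c k \<odot>\<^bsub>FM {x0}\<^esub> free_basis R x0"
    and T0': "T' 0 = {x0}" and fin': "\<And>i. finite (T' i)" and J: "ideal J R"
    and G': "free_resolution J T' \<delta>' \<epsilon>'"
    and d0': "\<forall>k\<in>T' (Suc 0). \<delta>' 0 (free_basis R k) = c k \<odot>\<^bsub>FM {x0}\<^esub> free_basis R x0"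
    and T1: "T (Suc 0) = insert k0 (T' (Suc 0))" and k0: "k0 \<notin> T' (Suc 0)"
    and psi: "\<psi> \<in> ring_hom R R"
    and acyclic: "\<forall>v\<in>carrier (FM (T' (Suc 0))). base_change R R \<psi> (T' 0) (\<delta>' 0) v = \<zero>\<^bsub>FM (T' 0)\<^esub> \<longrightarrow>
      v \<in> base_change R R \<psi> (T' (Suc 0)) (\<delta>' (Suc 0)) ` carrier (FM (T' (Suc (Suc 0))))"
begin

abbreviation "Fr \<equiv> FM (T (Suc 0))"
abbreviation "Bd \<equiv> base_change R R \<psi> (T (Suc 0)) (\<delta> (Suc 0)) ` carrier (FM (T (Suc (Suc 0))))"
abbreviation "Zq \<equiv> relations (T (Suc 0)) (\<lambda>k. \<psi> (c k))"
abbreviation "Jq \<equiv> submodule_span R SM ((\<lambda>k. \<psi> (c k)) ` T' (Suc 0))"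
abbreviation "Iq \<equiv> submodule_span R SM ((\<lambda>k. \<psi> (c k)) ` T (Suc 0))"
abbreviation "Bq \<equiv> colon R Jq Iq"

lemma c_closed: "k \<in> T (Suc 0) \<Longrightarrow> c k \<in> carrier R" "k \<in> T (Suc 0) \<Longrightarrow> \<psi> (c k) \<in> carrier R"
proof -
  show c': "c k \<in> carrier R" if "k \<in> T (Suc 0)" for k using c that by (rule funcset_mem)
  show "\<psi> (c k) \<in> carrier R" if "k \<in> T (Suc 0)" by (rule ring_hom_closed[OF psi c'[OF that]])
qed

lemma Bd_facts: "submodule Bd R Fr" "Bd \<subseteq> Zq" "v \<in> relations (T (Suc 0)) c \<Longrightarrow> \<psi> \<circ> v \<in> Bd"
proof -
  note b = boundaries_facts[where T = T, OF T0 fin I c G d0 psi]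
  show "submodule Bd R Fr" "Bd \<subseteq> Zq" "v \<in> relations (T (Suc 0)) c \<Longrightarrow> \<psi> \<circ> v \<in> Bd" by (fact b)+
qed

text
  \<open>This is where finite projective dimension is used: by acyclicity, a relation between the \<open>\<psi> (c k)\<close>, \<open>k \<noteq> k0\<close>, is a combination of images of relations between the \<open>c k\<close>.\<close>
lemma relations_of_old_generators_in_Bd:
  assumes v: "v \<in> relations (T' (Suc 0)) (\<lambda>k. \<psi> (c k))"
  shows "v \<in> Bd"
proof -
  note r' = resolution_facts[OF G']
  have sub: "T' (Suc 0) \<subseteq> T (Suc 0)" using T1 by auto
  have c': "c \<in> T' (Suc 0) \<rightarrow> carrier R" using c sub by auto
  have id: "(\<lambda>r. r) \<in> ring_hom R R" by (simp add: ring_hom_def)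
  note fd = first_differential[where T = T', OF T0' fin' J c' G' d0']
  let ?D = "base_change R R \<psi> (T' (Suc 0)) (\<delta>' (Suc 0))"
  have vF: "v \<in> carrier (FM (T' (Suc 0)))" using v by (simp add: relations_def)
  from bspec[OF acyclic vF] fd[OF psi vF] v obtain w where w: "w \<in> carrier (FM (T' (Suc (Suc 0))))" "v = ?D w" by auto
  have D: "?D \<in> mod_hom R (FM (T' (Suc (Suc 0)))) Fr"
  proof -
    have "?D \<in> mod_hom R (FM (T' (Suc (Suc 0)))) (FM (T' (Suc 0)))" by (rule base_change_hom[OF is_cring is_cring psi r'(3)])
    from mod_hom_closed[OF this] mod_hom_add[OF this] mod_hom_smult[OF this] show ?thesis
      by (intro mod_homI) (simp_all add: free_subset[OF sub is_cring] free_simps)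
  qed
  have "v = free_lift R Fr (\<lambda>k. \<psi> \<circ> \<delta>' (Suc 0) (free_basis R k)) w" unfolding w(2)
    by (rule hom_eq_free_lift[where g = "\<lambda>k. \<psi> \<circ> \<delta>' (Suc 0) (free_basis R k)", OF is_cring FM D w(1)])
      (rule base_change_basis[OF is_cring is_cring psi r'(3)])
  also have "\<dots> \<in> Bd"
  proof (rule free_lift_in_submodule[OF FM Bd_facts(1) _ w(1)], rule Pi_I, rule Bd_facts(3))
    fix k assume k: "k \<in> T' (Suc (Suc 0))"
    let ?r = "\<delta>' (Suc 0) (free_basis R k)"
    have rF: "?r \<in> carrier (FM (T' (Suc 0)))" by (rule mod_hom_closed[OF r'(3) free_basis_closed[OF is_cring k]])
    have "\<delta>' 0 ?r = \<zero>\<^bsub>FM (T' 0)\<^esub>" by (rule r'(7)[OF free_basis_closed[OF is_cring k]])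
    then have "?r \<in> relations (T' (Suc 0)) c" using fd[OF id rF] base_change_identity[OF r'(3) rF] by simp
    then show "?r \<in> relations (T (Suc 0)) c" using free_subset[OF sub is_cring rF] by (simp add: relations_def)
  qed
  finally show ?thesis .
qed

lemma Jq_sub: "submodule Jq R SM" and Iq_sub: "submodule Iq R SM" and Jq_Iq: "Jq \<subseteq> Iq"
  and Zq_sub: "submodule Zq R Fr"
proof -
  show "submodule Jq R SM" "submodule Iq R SM" by (rule span_submodule[OF SM]; use c_closed T1 in auto)+
  show "Jq \<subseteq> Iq" by (rule span_mono) (use T1 in auto)
  show "submodule Zq R Fr" by (rule relations_submodule) (use c_closed in auto)
qed

lemma mem_Bq:
  assumes b: "b \<in> carrier R"
  shows "b \<in> Bq \<longleftrightarrow> b \<otimes> \<psi> (c k0) \<in> Jq"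
proof
  have J: "ideal Jq R" using Jq_sub SM_sub by simp
  have k: "k0 \<in> T (Suc 0)" using T1 by simp
  have "\<psi> (c k0) \<in> Iq" by (rule subsetD[OF span_superset]) (use k in auto)
  then show "b \<in> Bq \<Longrightarrow> b \<otimes> \<psi> (c k0) \<in> Jq" by (simp add: colon_def)
  assume bk: "b \<otimes> \<psi> (c k0) \<in> Jq"
  have "Iq \<subseteq> colon R Jq {b}"
  proof (rule span_least)
    show "submodule (colon R Jq {b}) R SM" unfolding SM_sub by (rule colon_single_ideal[OF J b])
    show "(\<lambda>k. \<psi> (c k)) ` T (Suc 0) \<subseteq> colon R Jq {b}"
    proof (rule image_subsetI)
      fix k assume k: "k \<in> T (Suc 0)"
      have "\<psi> (c k) \<otimes> b \<in> Jq"
      proof (cases "k = k0")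
        case True
        then show ?thesis using bk b c_closed(2)[OF k] m_comm by simp
      next
        case False
        then have "\<psi> (c k) \<in> Jq" using k T1 by (intro subsetD[OF span_superset]) auto
        then show ?thesis by (rule ideal.I_r_closed[OF J _ b])
      qed
      then show "\<psi> (c k) \<in> colon R Jq {b}" using c_closed(2)[OF k] by (simp add: colon_single)
    qed
  qed
  then show "b \<in> Bq" using b submodule_subset[OF Iq_sub] m_comm[OF b] by (auto simp: colon_def subset_iff)
qed

lemma new_coordinate:
  assumes w: "w \<in> carrier (FM (T' (Suc 0)))" and b: "b \<in> carrier R"
  shows "w \<oplus>\<^bsub>Fr\<^esub> b \<odot>\<^bsub>Fr\<^esub> free_basis R k0 \<in> carrier Fr" "(w \<oplus>\<^bsub>Fr\<^esub> b \<odot>\<^bsub>Fr\<^esub> free_basis R k0) k0 = b"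
    and "\<And>g. g \<in> T (Suc 0) \<rightarrow> carrier R \<Longrightarrow> free_lift R SM g (w \<oplus>\<^bsub>Fr\<^esub> b \<odot>\<^bsub>Fr\<^esub> free_basis R k0) = free_lift R SM g w \<oplus> b \<otimes> g k0"
proof -
  interpret F: module R Fr by (rule FM)
  have k: "k0 \<in> T (Suc 0)" using T1 by simp
  have wF: "w \<in> carrier Fr" by (rule free_subset[OF _ is_cring w]) (use T1 in auto)
  have e: "free_basis R k0 \<in> carrier Fr" by (rule free_basis_closed[OF is_cring k])
  show "w \<oplus>\<^bsub>Fr\<^esub> b \<odot>\<^bsub>Fr\<^esub> free_basis R k0 \<in> carrier Fr" using wF e b by simp
  show "(w \<oplus>\<^bsub>Fr\<^esub> b \<odot>\<^bsub>Fr\<^esub> free_basis R k0) k0 = b" using free_mem_off[OF w k0] b by (simp add: free_simps free_basis_def)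
  fix g assume g: "g \<in> T (Suc 0) \<rightarrow> carrier R"
  have h: "free_lift R SM g \<in> mod_hom R Fr SM" by (rule free_lift_hom[OF SM]) (use g in simp)
  have "free_lift R SM g (free_basis R k0) = g k0" by (rule free_lift_basis[OF SM]) (use g k in auto)
  then show "free_lift R SM g (w \<oplus>\<^bsub>Fr\<^esub> b \<odot>\<^bsub>Fr\<^esub> free_basis R k0) = free_lift R SM g w \<oplus> b \<otimes> g k0"
    using mod_hom_add[OF h wF F.smult_closed[OF b e]] mod_hom_smult[OF h b e] by simp
qed

lemma drop_coordinate:
  assumes v: "v \<in> carrier Fr"
  shows "v(k0 := \<zero>) \<in> carrier (FM (T' (Suc 0)))" "v = v(k0 := \<zero>) \<oplus>\<^bsub>Fr\<^esub> v k0 \<odot>\<^bsub>Fr\<^esub> free_basis R k0"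
proof -
  note cl = free_mem_closed[OF is_cring v]
  show "v(k0 := \<zero>) \<in> carrier (FM (T' (Suc 0)))"
    using cl free_mem_off[OF v] T1 by (auto simp: free_mem_finite_iff[OF fin'])
  show "v = v(k0 := \<zero>) \<oplus>\<^bsub>Fr\<^esub> v k0 \<odot>\<^bsub>Fr\<^esub> free_basis R k0"
    using cl by (intro ext) (simp add: free_simps free_basis_def)
qed

text \<open>\<open>b\<close> is the last coefficient of a relation exactly if \<open>b \<psi>(c k0)\<close> is a combination of the other \<open>\<psi> (c k)\<close>.\<close>
lemma Zq_image: "(\<lambda>v. v k0) ` Zq = Bq"
proof (intro equalityI subsetI)
  have psic: "(\<lambda>k. \<psi> (c k)) \<in> T (Suc 0) \<rightarrow> carrier R" using c_closed by auto
  have psic': "(\<lambda>k. \<psi> (c k)) \<in> T' (Suc 0) \<rightarrow> carrier SM" using c_closed T1 by auto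
  have k: "\<psi> (c k0) \<in> carrier R" using c_closed T1 by auto
  have im: "free_lift R SM (\<lambda>k. \<psi> (c k)) ` carrier (FM (T' (Suc 0))) = Jq" by (rule free_lift_image[OF SM psic'])
  {
    fix b assume "b \<in> (\<lambda>v. v k0) ` Zq"
    then obtain v where v: "v \<in> carrier Fr" "free_lift R SM (\<lambda>k. \<psi> (c k)) v = \<zero>" "b = v k0" by (auto simp: relations_def)
    let ?w = "v(k0 := \<zero>)" and ?f = "free_lift R SM (\<lambda>k. \<psi> (c k))"
    have b: "b \<in> carrier R" using free_mem_closed[OF is_cring v(1)] v(3) by simp
    have wJ: "?f ?w \<in> Jq" using im drop_coordinate(1)[OF v(1)] by blast
    then have wc: "?f ?w \<in> carrier R" using submodule_subset[OF Jq_sub] by simp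
    have "?f ?w \<oplus> b \<otimes> \<psi> (c k0) = \<zero>"
      using new_coordinate(3)[OF drop_coordinate(1)[OF v(1)] b psic] drop_coordinate(2)[OF v(1)] v(2,3) by simp
    then have "b \<otimes> \<psi> (c k0) = \<ominus> ?f ?w" using sum_zero_eq_neg[of "b \<otimes> \<psi> (c k0)" "?f ?w"] wc b k by (simp add: a_comm)
    also have "\<dots> \<in> Jq" using submodule_inv[OF Jq_sub wJ] by simp
    finally show "b \<in> Bq" using mem_Bq[OF b] by simp
  next
    fix b assume bB: "b \<in> Bq"
    then have b: "b \<in> carrier R" by (simp add: colon_def)
    have bk: "b \<otimes> \<psi> (c k0) \<in> Jq" using bB mem_Bq[OF b] by simp
    then have "\<ominus> (b \<otimes> \<psi> (c k0)) \<in> Jq" using submodule_inv[OF Jq_sub bk] by simp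
    then obtain w where w: "w \<in> carrier (FM (T' (Suc 0)))" "free_lift R SM (\<lambda>k. \<psi> (c k)) w = \<ominus> (b \<otimes> \<psi> (c k0))" unfolding im[symmetric] by force
    let ?v = "w \<oplus>\<^bsub>Fr\<^esub> b \<odot>\<^bsub>Fr\<^esub> free_basis R k0"
    have "?v \<in> Zq" unfolding relations_def using new_coordinate(1)[OF w(1) b] new_coordinate(3)[OF w(1) b psic] w(2) b k by (simp add: l_neg)
    moreover have "?v k0 = b" by (rule new_coordinate(2)[OF w(1) b])
    ultimately show "b \<in> (\<lambda>v. v k0) ` Zq" by (intro image_eqI[where x = ?v] sym[of "?v k0" b])
  }
qed

lemma Zq_kernel: "v \<in> Zq \<Longrightarrow> v k0 = \<zero> \<Longrightarrow> v \<in> Bd"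
proof (rule relations_of_old_generators_in_Bd)
  assume v: "v \<in> Zq" "v k0 = \<zero>"
  then have "v(k0 := \<zero>) = v" by auto
  then show "v \<in> relations (T' (Suc 0)) (\<lambda>k. \<psi> (c k))" using v drop_coordinate(1)[of v] by (simp add: relations_def)
qed

lemma eval_k0: "(\<lambda>v. v k0) \<in> mod_hom R Fr SM" by (rule eval_hom[OF is_cring])

text \<open>The Koszul relation between \<open>c k\<close> and \<open>c k0\<close> has last coefficient \<open>c k\<close>.\<close>
lemma Jq_in_Bd_image: "Jq \<subseteq> (\<lambda>v. v k0) ` Bd"
proof (rule span_least[OF submodule_image[OF FM SM eval_k0 Bd_facts(1)]], rule image_subsetI)
  fix k assume k: "k \<in> T' (Suc 0)"
  interpret F': module R "FM (T' (Suc 0))" by (rule FM)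
  have ck: "c k \<in> carrier R" "c k0 \<in> carrier R" using k T1 c_closed by auto
  let ?w = "(\<ominus> c k0) \<odot>\<^bsub>FM (T' (Suc 0))\<^esub> free_basis R k"
  let ?v = "?w \<oplus>\<^bsub>Fr\<^esub> c k \<odot>\<^bsub>Fr\<^esub> free_basis R k0"
  have e: "free_basis R k \<in> carrier (FM (T' (Suc 0)))" by (rule free_basis_closed[OF is_cring k])
  have w: "?w \<in> carrier (FM (T' (Suc 0)))" using ck e by simp
  have c': "c \<in> T' (Suc 0) \<rightarrow> carrier SM" using c T1 by auto
  have "free_lift R SM c (free_basis R k) = c k" by (rule free_lift_basis[OF SM]) (use ck in simp)
  then have "free_lift R SM c ?w = (\<ominus> c k0) \<otimes> c k"
    using mod_hom_smult[OF free_lift_hom[OF SM c'] _ e, of "\<ominus> c k0"] ck by simp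
  then have "free_lift R SM c ?v = \<zero>" using new_coordinate(3)[OF w ck(1) c] ck by (simp add: l_minus m_comm[of "c k"] l_neg)
  then have "?v \<in> relations (T (Suc 0)) c" unfolding relations_def using new_coordinate(1)[OF w ck(1)] by simp
  then have "\<psi> \<circ> ?v \<in> Bd" by (rule Bd_facts(3))
  moreover have "(\<psi> \<circ> ?v) k0 = \<psi> (c k)" using new_coordinate(2)[OF w ck(1)] by simp
  ultimately show "\<psi> (c k) \<in> (\<lambda>v. v k0) ` Bd" by - (rule rev_image_eqI, assumption, erule sym)
qed

text
  \<open>Evaluation at the last coordinate carries \<open>Zq / (Bd + \<aa> Zq)\<close> isomorphically onto a quotient of \<open>Bq\<close>, because the kernel of the evaluation lies in \<open>Bd\<close>.  The ideal divided out there exceeds \<open>Jq + \<aa> Bq\<close> only by the image of \<open>Bd\<close>.\<close>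
lemma length_dual_eq_length_Tor1_plus_bounded:
  assumes a: "ideal \<aa> R"
  shows "\<exists>w. w \<le> enat (card (T (Suc (Suc 0)))) * colength \<aa> \<and>
    interval_length R SM (submodule_sum SM Jq (ideal_smult R SM \<aa> Bq)) Bq =
    w + interval_length R Fr (submodule_sum Fr Bd (ideal_smult R Fr \<aa> Zq)) Zq"
proof -
  interpret a: ideal \<aa> R by (rule a)
  let ?pr = "\<lambda>v::nat \<Rightarrow> 'a. v k0"
  let ?aZ = "ideal_smult R Fr \<aa> Zq" and ?aB = "ideal_smult R SM \<aa> Bq"
  let ?S = "submodule_sum Fr Bd ?aZ" and ?W = "submodule_sum SM Jq ?aB"
  let ?P = "?pr ` ?S"
  have Zc: "Zq \<subseteq> carrier Fr" by (auto simp: relations_def)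
  have aZ: "submodule ?aZ R Fr" by (rule ideal_smult_submodule[OF FM a.a_subset Zc])
  have S: "submodule ?S R Fr" by (rule sum_submodule[OF FM Bd_facts(1) aZ])
  have BdS: "Bd \<subseteq> ?S" and aZS: "?aZ \<subseteq> ?S" using sum_upper[OF FM Bd_facts(1) aZ] by auto
  have "?aZ \<subseteq> Zq" by (rule ideal_smult_least[OF Zq_sub submodule_smult[OF Zq_sub]]) auto
  then have SZ: "?S \<subseteq> Zq" by (rule sum_least[OF Zq_sub Bd_facts(2)])
  have B: "submodule Bq R SM" using submodule_image[OF FM SM eval_k0 Zq_sub] Zq_image by simp
  have aB: "submodule ?aB R SM" by (rule ideal_smult_submodule[OF SM a.a_subset]) (auto simp: colon_def)
  have W: "submodule ?W R SM" by (rule sum_submodule[OF SM Jq_sub aB])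
  have P: "submodule ?P R SM" by (rule submodule_image[OF FM SM eval_k0 S])
  have PB: "?P \<subseteq> Bq" using SZ Zq_image by blast
  have aBP: "?pr ` ?aZ = ?aB" using ideal_smult_image[OF FM SM eval_k0 a.a_subset Zc] Zq_image by simp
  have WP: "?W \<subseteq> ?P" by (rule sum_least[OF P]) (use Jq_in_Bd_image BdS aBP aZS in blast)+
  have "interval_length R (SM\<lparr>carrier := Bq\<rparr>) ?P Bq = interval_length R (Fr\<lparr>carrier := Zq\<rparr>) ?S Zq"
  proof -
    have h: "?pr \<in> mod_hom R (Fr\<lparr>carrier := Zq\<rparr>) (SM\<lparr>carrier := Bq\<rparr>)"
      by (rule mod_homI) (use Zq_image in \<open>auto simp: free_simps\<close>)
    have PR: "submodule ?P R (SM\<lparr>carrier := Bq\<rparr>)" "submodule Bq R (SM\<lparr>carrier := Bq\<rparr>)"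
      using P B PB submodule_restr[OF SM B] by auto
    have "{v \<in> Zq. ?pr v \<in> ?P} = ?S"
    proof (intro equalityI subsetI)
      fix v assume "v \<in> {v \<in> Zq. ?pr v \<in> ?P}"
      then obtain s where s: "v \<in> Zq" "s \<in> ?S" "v k0 = s k0" by auto
      have sZ: "s \<in> Zq" using s(2) SZ by blast
      have vc: "v \<in> carrier Fr" "s \<in> carrier Fr" using s(1) sZ Zc by auto
      have "(v \<ominus>\<^bsub>Fr\<^esub> s) k0 = \<zero>" using FM_minus_apply[OF vc, of k0] s(3) free_mem_closed[OF is_cring vc(2), of k0] by (simp add: minus_eq r_neg)
      then have "v \<ominus>\<^bsub>Fr\<^esub> s \<in> ?S" using Zq_kernel[OF submodule_minus[OF FM Zq_sub s(1) sZ]] BdS by blast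
      then show "v \<in> ?S" using submodule_minus_iff[OF FM S vc(1) s(2)] by simp
    qed (use SZ in auto)
    moreover have "{v \<in> Zq. ?pr v \<in> Bq} = Zq" using Zq_image by blast
    ultimately show ?thesis
      using interval_length_vimage[OF restr_module[OF FM Zq_sub] restr_module[OF SM B] h _ PR] Zq_image by simp
  qed
  then have "interval_length R SM ?P Bq = interval_length R Fr ?S Zq"
    using interval_length_restr[OF SM B order.refl] interval_length_restr[OF FM Zq_sub order.refl] by simp
  moreover have "interval_length R SM ?W Bq = interval_length R SM ?W ?P + interval_length R SM ?P Bq"
    by (rule interval_length_add[OF SM W P B WP PB])
  moreover have "interval_length R SM ?W ?P \<le> enat (card (T (Suc (Suc 0)))) * colength \<aa>"
  proof (rule interval_length_image_le[OF SM W fin _ a.a_subset])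
    let ?D = "base_change R R \<psi> (T (Suc 0)) (\<delta> (Suc 0))"
    have D: "?D \<in> mod_hom R (FM (T (Suc (Suc 0)))) Fr" by (rule base_change_hom[OF is_cring is_cring psi resolution_facts(3)[OF G]])
    show h: "(\<lambda>w. ?D w k0) \<in> mod_hom R (FM (T (Suc (Suc 0)))) SM" by (rule mod_hom_comp[OF eval_k0 D])
    show "r \<odot>\<^bsub>SM\<^esub> ?D w k0 \<in> ?W" if "r \<in> \<aa>" "w \<in> carrier (FM (T (Suc (Suc 0))))" for r w
    proof -
      have "?D w \<in> Zq" by (rule subsetD[OF Bd_facts(2) imageI[OF that(2)]])
      then have "?D w k0 \<in> Bq" using Zq_image by blast
      then show ?thesis by (intro subsetD[OF sum_upper(2)[OF SM Jq_sub aB]] ideal_smult_mem[OF that(1)])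
    qed
    show "?P \<subseteq> submodule_sum SM ?W ((\<lambda>w. ?D w k0) ` carrier (FM (T (Suc (Suc 0)))))"
    proof
      fix p assume "p \<in> ?P"
      then obtain w z where wz: "w \<in> carrier (FM (T (Suc (Suc 0))))" "z \<in> ?aZ" "p = (?D w \<oplus>\<^bsub>Fr\<^esub> z) k0"
        unfolding submodule_sum_def by (elim imageE CollectE exE conjE bexE) (rule that, auto)
      have "?D w k0 \<in> carrier R" using mod_hom_closed[OF h wz(1)] by simp
      moreover have zB: "z k0 \<in> ?aB" using imageI[OF wz(2), of ?pr] unfolding aBP .
      ultimately have "p = z k0 \<oplus>\<^bsub>SM\<^esub> ?D w k0" using submodule_subset[OF aB zB] wz(3) by (simp add: free_simps a_comm)
      moreover have "z k0 \<in> ?W" by (rule subsetD[OF sum_upper(2)[OF SM Jq_sub aB] zB])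
      ultimately show "p \<in> submodule_sum SM ?W ((\<lambda>w. ?D w k0) ` carrier (FM (T (Suc (Suc 0)))))"
        unfolding submodule_sum_def using wz(1) by blast
    qed
  qed
  ultimately show ?thesis by (intro exI[of _ "interval_length R SM ?W ?P"]) simp
qed

end

end

section \<open>Comparison of the three length functions\<close>

context noetherian_cring
begin

lemma length_Hom_finite:
  assumes a: "ideal \<aa> R" and lam: "colength \<aa> \<noteq> \<infinity>" and I: "ideal I R"
  shows "module_length R (hom_module R (cyclic_module R \<aa>) (cyclic_module R I)) \<noteq> \<infinity>"
proof -
  interpret a: ideal \<aa> R by (rule a)
  have C: "ideal (colon R I \<aa>) R" by (rule colon_ideal[OF is_cring I a.a_subset])
  obtain A where A: "A \<subseteq> carrier R" "finite A" "colon R I \<aa> = Idl A" using finetely_gen[OF C] by blast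
  have AC: "A \<subseteq> colon R I \<aa>" unfolding A(3) by (rule genideal_self[OF A(1)])
  have "colon R I \<aa> = submodule_span R SM A" using A(3) Idl_span[OF A(1)] by simp
  also have "\<dots> \<subseteq> submodule_span R SM (I \<union> A)" by (rule span_mono) simp
  finally have "interval_length R SM I (colon R I \<aa>) \<le> enat (card A) * colength \<aa>"
  proof (rule interval_length_generators_le[OF SM _ A(2) _ _ a.a_subset, rotated -1])
    show "submodule I R SM" using I SM_sub by simp
    show "A \<subseteq> carrier SM" using A(1) by simp
    fix r g assume rg: "r \<in> \<aa>" "g \<in> A"
    then have "g \<otimes> r \<in> I" using AC by (auto simp: colon_def)
    then show "r \<odot>\<^bsub>SM\<^esub> g \<in> I" using rg A(1) a.Icarr m_comm[of g r] by auto
  qed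
  moreover obtain l where "colength \<aa> = enat l" using lam by auto
  ultimately have "interval_length R SM I (colon R I \<aa>) \<le> enat (card A * l)" by simp
  then show ?thesis unfolding module_length_hom_cyclic[OF is_cring a I] by (metis infinity_ileE)
qed

text
  \<open>Both comparisons go through one presentation of \<open>I\<close> that does not depend on \<open>n\<close>, so the bound \<open>b\<close> is uniform.  One \<open>n\<close> with Artinian quotient suffices to show that \<open>J\<close> contains powers of all elements of \<open>m\<close>.\<close>
lemma frobenius_length_comparison:
  assumes loc: "local_ring R m" and p: "Factorial_Ring.prime p" and char: "characteristic R = p"
    and Iprim: "primary_to R m I" and aprim: "primary_to R m \<aa>"
    and J: "ideal J R" and u: "u \<in> carrier R" and IJ: "I = J <+>\<^bsub>R\<^esub> PIdl\<^bsub>R\<^esub> u"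
    and fpd: "finite_proj_dim R (ideal_module R J)"
    and good: "good = (\<lambda>n. artinian_ring (R Quot frobenius_power R J (p ^ n)) \<and> gorenstein_local_ring (R Quot frobenius_power R J (p ^ n)))"
    and n0: "good (n0 :: nat)"
  defines "L1 \<equiv> \<lambda>n. module_length R (hom_module R (cyclic_module R \<aa>) (cyclic_module R (frobenius_power R I (p ^ n))))"
    and "L2 \<equiv> \<lambda>n. module_length R (tensor_product R (Tor_frobenius R p n 1 (cyclic_module R I)) (cyclic_module R \<aa>))"
    and "L3 \<equiv> \<lambda>n. module_length R (Tor R 2 (cyclic_module R (frobenius_power R I (p ^ n))) (cyclic_module R \<aa>))"
  shows "\<exists>b :: nat. \<forall>n. L1 n \<noteq> \<infinity> \<and> (\<exists>s t. s \<le> enat b \<and> t \<le> enat b \<and> L3 n + s = t + L2 n \<and> L3 n + s \<noteq> \<infinity>) \<and>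
    (good n \<longrightarrow> (\<exists>w. w \<le> enat b \<and> L1 n = w + L2 n))"
proof -
  interpret m: maximalideal m R using loc by (simp add: local_ring_def)
  have ai: "ideal \<aa> R" and arad: "radical R \<aa> = m" and Ii: "ideal I R" and Irad: "radical R I = m"
    using Iprim aprim by (auto simp: primary_to_def primary_ideal_def)
  interpret a: ideal \<aa> R by (rule ai)
  interpret I: ideal I R by (rule Ii)
  interpret J: ideal J R by (rule J)
  have apow: "\<exists>k::nat. x [^] k \<in> \<aa>" if "x \<in> m" for x using that arad by (auto simp: radical_def)
  have lam: "colength \<aa> \<noteq> \<infinity>" by (rule residue_length_finite[OF loc ai apow])
  then obtain l where l: "colength \<aa> = enat l" by auto
  note JI = add_principal(2)[OF J u, folded IJ] and uI = add_principal(3)[OF J u, folded IJ]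
    and IJmem = add_principal(4)[OF J u, folded IJ]
  have Im: "I \<subseteq> m"
  proof
    fix x assume x: "x \<in> I"
    then have "x [^] (1::nat) \<in> I" using I.Icarr[OF x] by simp
    then show "x \<in> m" unfolding Irad[symmetric] radical_def using I.Icarr[OF x] by blast
  qed
  have Jm: "J \<subseteq> m" using JI Im by blast
  define \<phi> where "\<phi> n = frobenius R p ^^ n" for n
  have phi: "\<phi> n \<in> ring_hom R R" and phi_eq: "\<And>r. r \<in> carrier R \<Longrightarrow> \<phi> n r = r [^] (p ^ n)" for n
    unfolding \<phi>_def by (rule frobenius_iterate[OF p char])+
  have fpi: "ideal (frobenius_power R K q) R" if "K \<subseteq> carrier R" for K q
    unfolding frobenius_power_def by (rule genideal_ideal) (use that in auto)
  have Jpow: "\<exists>k::nat. x [^] k \<in> J" if x: "x \<in> m" for x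
  proof -
    have "(\<lambda>x. x [^] (p ^ n0)) ` J \<subseteq> J"
    proof (rule image_subsetI)
      fix y assume y: "y \<in> J"
      have "p ^ n0 \<noteq> 0" using p by auto
      then obtain q where q: "p ^ n0 = Suc q" using not0_implies_Suc by blast
      have "y [^] q \<otimes> y \<in> J" using y J.Icarr[OF y] by (intro J.I_l_closed) simp_all
      then show "y [^] (p ^ n0) \<in> J" unfolding q by simp
    qed
    then have "frobenius_power R J (p ^ n0) \<subseteq> J" unfolding frobenius_power_def by (rule genideal_minimal[OF J])
    moreover have "\<exists>k::nat. x [^] k \<in> frobenius_power R J (p ^ n0)"
      by (rule power_in_ideal_of_artinian_quotient(2)[OF fpi[OF J.a_subset] _ _ loc x]) (use n0 good in auto)
    ultimately show ?thesis by blast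
  qed
  \<comment> \<open>a minimal resolution of \<open>R / J\<close> provides generators of \<open>J\<close>; adjoining \<open>u\<close> gives generators of \<open>I\<close>\<close>
  obtain T' :: "nat \<Rightarrow> nat set" and \<delta>' \<epsilon>' where T': "T' 0 = {0}" "\<forall>i. finite (T' i)"
    "free_resolution J T' \<delta>' \<epsilon>'" "\<forall>v. \<epsilon>' v = J +> v 0"
    "\<forall>i. \<forall>c\<in>carrier (FM (T' (Suc i))). \<delta>' i c = \<zero>\<^bsub>FM (T' i)\<^esub> \<longrightarrow> (\<forall>y. c y \<in> Units R \<longrightarrow> c y = \<zero>)"
    using minimal_resolution_of_cyclic[OF noetherian_ring_axioms is_cring infinite_UNIV_nat J, of 0] by (elim exE conjE) (rule that)
  obtain k0 where k0: "k0 \<notin> T' (Suc 0)" using ex_new_if_finite[OF infinite_UNIV_nat spec[OF T'(2)]] by blast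
  define g where "g k = \<delta>' 0 (free_basis R k) 0" for k
  note rg = resolution_generators[where T = T', OF J T'(1,3) spec[OF T'(4)], folded g_def]
  define c where "c = g(k0 := u)"
  let ?U = "T' (Suc 0)" and ?Tc = "insert k0 (T' (Suc 0))"
  have cU: "c k = g k" if "k \<in> ?U" for k using that k0 unfolding c_def by auto
  have ck0: "c k0 = u" by (simp add: c_def)
  have cU_im: "c ` ?U = g ` ?U" using cU by (rule image_cong[OF refl])
  have c: "c \<in> ?Tc \<rightarrow> carrier R" using rg(1) cU ck0 u by auto
  have J_span: "J = submodule_span R SM (c ` ?U)" using rg(2) cU_im by simp
  have S: "submodule (submodule_span R SM (c ` ?Tc)) R SM" by (rule span_submodule[OF SM]) (use c in auto)
  have I_span: "I = submodule_span R SM (c ` ?Tc)"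
  proof
    have "g k \<in> J" if "k \<in> ?U" for k unfolding J_span by (rule subsetD[OF span_superset]) (use that cU in force)
    then have "c ` ?Tc \<subseteq> I" using JI uI cU ck0 by auto
    then show "submodule_span R SM (c ` ?Tc) \<subseteq> I" by (intro span_least) (use Ii SM_sub in auto)
    show "I \<subseteq> submodule_span R SM (c ` ?Tc)"
    proof
      fix x assume "x \<in> I"
      then obtain j r where jr: "j \<in> J" "r \<in> carrier R" "x = j \<oplus> r \<otimes> u" using IJmem by blast
      have "J \<subseteq> submodule_span R SM (c ` ?Tc)" unfolding J_span by (rule span_mono) auto
      moreover have "u \<in> submodule_span R SM (c ` ?Tc)" by (rule subsetD[OF span_superset]) (use ck0 in auto)
      ultimately show "x \<in> submodule_span R SM (c ` ?Tc)"
        using jr submodule_add[OF S, of j "r \<otimes> u"] submodule_smult[OF S, of r u] by auto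
    qed
  qed
  have finTc: "finite ?Tc" using T'(2) by simp
  obtain T :: "nat \<Rightarrow> nat set" and \<delta> \<epsilon> where T: "T 0 = {0}" "T (Suc 0) = ?Tc" "\<forall>i. finite (T i)"
    "free_resolution I T \<delta> \<epsilon>"
    "\<forall>k\<in>?Tc. \<delta> 0 (free_basis R k) = c k \<odot>\<^bsub>FM {0}\<^esub> free_basis R 0"
    using resolution_of_cyclic_from_generators[OF noetherian_ring_axioms is_cring infinite_UNIV_nat finTc c, of 0, folded I_span]
    by (elim exE conjE) (rule that)
  have cT: "c \<in> T (Suc 0) \<rightarrow> carrier R" and d0: "\<forall>k\<in>T (Suc 0). \<delta> 0 (free_basis R k) = c k \<odot>\<^bsub>FM {0}\<^esub> free_basis R 0"
    using c T(2,5) by simp_all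
  have d0': "\<forall>k\<in>?U. \<delta>' 0 (free_basis R k) = c k \<odot>\<^bsub>FM {0}\<^esub> free_basis R 0" using rg(3) cU by simp
  let ?F = "FM (T (Suc 0))"
  define Z where "Z n = relations (T (Suc 0)) (\<lambda>k. \<phi> n (c k))" for n
  define Bd where "Bd n = base_change R R (\<phi> n) (T (Suc 0)) (\<delta> (Suc 0)) ` carrier (FM (T (Suc (Suc 0))))" for n
  define aZ where "aZ n = ideal_smult R ?F \<aa> (Z n)" for n
  define b where "b = (card (T (Suc 0)) + card (T (Suc (Suc 0)))) * l"
  have psic: "(\<lambda>k. \<phi> n (c k)) \<in> T (Suc 0) \<rightarrow> carrier R" for n using cT ring_hom_closed[OF phi] by blast
  have Jq: "frobenius_power R J (p ^ n) = submodule_span R SM ((\<lambda>k. \<phi> n (c k)) ` ?U)"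
    and Iq: "frobenius_power R I (p ^ n) = submodule_span R SM ((\<lambda>k. \<phi> n (c k)) ` T (Suc 0))" for n
    unfolding J_span I_span T(2)
    by (subst frobenius_power_span[OF phi[of n] phi_eq]; use c in \<open>auto simp: image_image\<close>)+
  show ?thesis
  proof (rule exI[of _ b], intro allI conjI impI)
    fix n
    show "L1 n \<noteq> \<infinity>" unfolding L1_def by (rule length_Hom_finite[OF ai lam fpi[OF I.a_subset]])
    have bb: "enat (card (T (Suc 0))) * colength \<aa> \<le> enat b"
      "enat (card (T (Suc (Suc 0)))) * colength \<aa> \<le> enat b"
      by (simp_all add: l b_def add_mult_distrib)
    note bf = boundaries_facts[where T = T, OF T(1) spec[OF T(3)] Ii cT T(4) d0 phi[of n], folded Bd_def Z_def]
    have L2: "L2 n = interval_length R ?F (submodule_sum ?F (Bd n) (aZ n)) (Z n)"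
      unfolding L2_def Tor_frobenius_def One_nat_def \<phi>_def[symmetric] Bd_def aZ_def Z_def
      by (rule length_Tor1_tensor_cyclic[where T = T, OF T(1) spec[OF T(3)] Ii cT T(4) d0 phi ai])
    have L3: "L3 n = interval_length R ?F (aZ n) (Z n \<inter> IV \<aa> (T (Suc 0)))"
      unfolding L3_def Tor_def numeral_2_eq_2 Iq aZ_def Z_def
      by (rule length_Tor2_of_generators[OF spec[OF T(3)] psic ai])
    have Zs: "submodule (Z n) R ?F" unfolding Z_def by (rule relations_submodule[OF psic])
    have ZF: "Z n \<subseteq> carrier ?F" using submodule_subset[OF Zs] by blast
    have aZs: "submodule (aZ n) R ?F" unfolding aZ_def by (rule ideal_smult_submodule[OF FM a.a_subset ZF])
    have aZZ: "aZ n \<subseteq> Z n" unfolding aZ_def by (rule ideal_smult_least[OF Zs submodule_smult[OF Zs]]) auto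
    have ZIs: "submodule (Z n \<inter> IV \<aa> (T (Suc 0))) R ?F" by (rule submodule_Int[OF FM Zs IV_sub[OF ai]])
    have smIV: "r \<odot>\<^bsub>?F\<^esub> v \<in> IV \<aa> (T (Suc 0))" if "r \<in> \<aa>" "v \<in> carrier ?F" for r v
      using that module.smult_closed[OF FM a.Icarr[OF that(1)] that(2)] free_mem_closed[OF is_cring that(2)]
      by (intro IV_I) (auto simp: free_simps a.I_r_closed)
    have aZI: "aZ n \<subseteq> IV \<aa> (T (Suc 0))" unfolding aZ_def by (rule ideal_smult_least[OF IV_sub[OF ai] smIV]) (use ZF in auto)
    have Ss: "submodule (submodule_sum ?F (Bd n) (aZ n)) R ?F" by (rule sum_submodule[OF FM bf(1) aZs])
    have SZ: "submodule_sum ?F (Bd n) (aZ n) \<subseteq> Z n" by (rule sum_least[OF Zs bf(2) aZZ])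
    have aZS: "aZ n \<subseteq> submodule_sum ?F (Bd n) (aZ n)" by (rule sum_upper(2)[OF FM bf(1) aZs])
    have z_fin: "interval_length R ?F (aZ n) (Z n) \<noteq> \<infinity>"
      by (rule fg_length_finite[OF lam a.a_subset spec[OF T(3)] aZs Zs]) (simp add: aZ_def ideal_smult_mem)
    have z3: "interval_length R ?F (aZ n) (Z n) = L3 n + interval_length R ?F (Z n \<inter> IV \<aa> (T (Suc 0))) (Z n)"
      unfolding L3 by (rule interval_length_add[OF FM aZs ZIs Zs]) (use aZZ aZI in auto)
    have z2: "interval_length R ?F (aZ n) (Z n) = interval_length R ?F (aZ n) (submodule_sum ?F (Bd n) (aZ n)) + L2 n"
      unfolding L2 by (rule interval_length_add[OF FM aZs Ss Zs aZS SZ])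
    have s_le: "interval_length R ?F (Z n \<inter> IV \<aa> (T (Suc 0))) (Z n) \<le> enat b"
    proof -
      have "interval_length R ?F (Z n \<inter> IV \<aa> (T (Suc 0))) (Z n) \<le> interval_length R ?F (IV \<aa> (T (Suc 0))) (carrier ?F)"
        by (rule interval_length_Int_le[OF FM Zs IV_sub[OF ai]])
      also have "\<dots> \<le> enat (card (T (Suc 0))) * colength \<aa>"
        by (rule interval_length_image_le[OF FM IV_sub[OF ai] spec[OF T(3)] mod_hom_id a.a_subset smIV])
          (use sum_upper(2)[OF FM IV_sub[OF ai] submodule_carrier[OF FM]] in auto)
      finally show ?thesis by (rule order.trans[OF _ bb(1)])
    qed
    have t_le: "interval_length R ?F (aZ n) (submodule_sum ?F (Bd n) (aZ n)) \<le> enat b"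
    proof -
      let ?D = "base_change R R (\<phi> n) (T (Suc 0)) (\<delta> (Suc 0))"
      have D: "?D \<in> mod_hom R (FM (T (Suc (Suc 0)))) ?F"
        by (rule base_change_hom[OF is_cring is_cring phi[of n] resolution_facts(3)[OF T(4), of "Suc 0"]])
      have "interval_length R ?F (aZ n) (submodule_sum ?F (Bd n) (aZ n)) \<le>
          enat (card (T (Suc (Suc 0)))) * colength \<aa>"
      proof (rule interval_length_image_le[OF FM aZs spec[OF T(3)] D a.a_subset])
        show "r \<odot>\<^bsub>?F\<^esub> ?D w \<in> aZ n" if "r \<in> \<aa>" "w \<in> carrier (FM (T (Suc (Suc 0))))" for r w
          unfolding aZ_def by (rule ideal_smult_mem[OF that(1) subsetD[OF bf(2)]]) (use that(2) in \<open>simp add: Bd_def\<close>)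
        have Y: "submodule (submodule_sum ?F (aZ n) (Bd n)) R ?F" by (rule sum_submodule[OF FM aZs bf(1)])
        show "submodule_sum ?F (Bd n) (aZ n) \<subseteq> submodule_sum ?F (aZ n) (?D ` carrier (FM (T (Suc (Suc 0)))))"
          unfolding Bd_def[symmetric] by (rule sum_least[OF Y sum_upper(2,1)[OF FM aZs bf(1)]])
      qed
      then show ?thesis by (rule order.trans[OF _ bb(2)])
    qed
    show "\<exists>s t. s \<le> enat b \<and> t \<le> enat b \<and> L3 n + s = t + L2 n \<and> L3 n + s \<noteq> \<infinity>"
      using s_le t_le z2 z3 z_fin
      by (intro exI[of _ "interval_length R ?F (Z n \<inter> IV \<aa> (T (Suc 0))) (Z n)"]
        exI[of _ "interval_length R ?F (aZ n) (submodule_sum ?F (Bd n) (aZ n))"]) simp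
    assume gd: "good n"
    have acyc: "\<forall>v\<in>carrier (FM ?U). base_change R R (\<phi> n) (T' 0) (\<delta>' 0) v = \<zero>\<^bsub>FM (T' 0)\<^esub> \<longrightarrow>
      v \<in> base_change R R (\<phi> n) ?U (\<delta>' (Suc 0)) ` carrier (FM (T' (Suc (Suc 0))))"
    proof (intro ballI impI)
      fix v assume v: "v \<in> carrier (FM ?U)" "base_change R R (\<phi> n) (T' 0) (\<delta>' 0) v = \<zero>\<^bsub>FM (T' 0)\<^esub>"
      show "v \<in> base_change R R (\<phi> n) ?U (\<delta>' (Suc 0)) ` carrier (FM (T' (Suc (Suc 0))))"
      proof (rule base_change_acyclic[where m = m and J = J and T = T' and ?x0.0 = 0 and \<delta> = \<delta>' and \<epsilon> = \<epsilon>' and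
              \<psi> = "\<phi> n" and N = "p ^ n" and i = 0])
        show "\<exists>k::nat. x [^] k \<in> J" if "x \<in> m" for x by (rule Jpow[OF that])
        show "\<phi> n a = a [^] (p ^ n)" if "a \<in> J" for a by (rule phi_eq[OF J.Icarr[OF that]])
      qed (rule loc J Jm spec[OF T'(2)] T'(1,3) spec[OF T'(4)] T'(5) fpd phi v)+
    qed
    let ?Jq = "frobenius_power R J (p ^ n)" and ?Iq = "frobenius_power R I (p ^ n)"
    let ?Bq = "colon R ?Jq ?Iq"
    have "\<exists>w. w \<le> enat (card (T (Suc (Suc 0)))) * colength \<aa> \<and>
      interval_length R SM (submodule_sum SM ?Jq (ideal_smult R SM \<aa> ?Bq)) ?Bq = w + L2 n"
      unfolding L2 Bd_def aZ_def Z_def Jq Iq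
      by (rule length_dual_eq_length_Tor1_plus_bounded[where T = T and T' = T' and c = c,
            OF T(1) spec[OF T(3)] Ii cT T(4) d0 T'(1) spec[OF T'(2)] J T'(3) d0' T(2) k0 phi acyc ai])
    then obtain w where w: "w \<le> enat (card (T (Suc (Suc 0)))) * colength \<aa>"
      "interval_length R SM (submodule_sum SM ?Jq (ideal_smult R SM \<aa> ?Bq)) ?Bq = w + L2 n" by (elim exE conjE)
    have JqIq: "?Jq \<subseteq> ?Iq" unfolding Jq Iq T(2) by (rule span_mono) auto
    have "L1 n = interval_length R SM ?Iq (colon R ?Iq \<aa>)"
      unfolding L1_def by (rule module_length_hom_cyclic[OF is_cring ai fpi[OF I.a_subset]])
    also have "\<dots> = w + L2 n" unfolding w(2)[symmetric]
      by (rule length_hom_eq_dual(1)[OF fpi[OF J.a_subset] _ _ fpi[OF I.a_subset] JqIq ai refl refl]) (use gd good in auto)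
    finally show "\<exists>w. w \<le> enat b \<and> L1 n = w + L2 n" using order.trans[OF w(1) bb(2)] by (intro exI[of _ w]) simp
  qed
qed

end

lemma the_enat_diff_le:
  assumes "x + s = t + y" "x + s \<noteq> \<infinity>" "s \<le> enat b" "t \<le> enat b"
  shows "x \<noteq> \<infinity>" "y \<noteq> \<infinity>" "\<bar>real (the_enat y) - real (the_enat x)\<bar> \<le> real b"
proof -
  show x: "x \<noteq> \<infinity>" using assms(2) by (metis plus_eq_infty_iff_enat)
  show y: "y \<noteq> \<infinity>" using assms(1,2) by (metis plus_eq_infty_iff_enat)
  obtain i j k l where "x = enat i" "y = enat j" "s = enat k" "t = enat l"
    using x y assms(3,4) by (metis enat_ile not_infinity_eq)
  with assms show "\<bar>real (the_enat y) - real (the_enat x)\<bar> \<le> real b" by auto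
qed

theorem theorem6p1:
  fixes R :: "('a, 'r) ring_scheme" and m I \<aa> J :: "'a set" and u :: 'a and p :: nat
  assumes "local_ring R m" and "noetherian_ring R"
    and "Factorial_Ring.prime p" and "characteristic R = p"
    and "primary_to R m I" and "primary_to R m \<aa>"
    and "ideal J R" and "u \<in> carrier R" and "I = J <+>\<^bsub>R\<^esub> PIdl\<^bsub>R\<^esub> u"
    and "finite_proj_dim R (ideal_module R J)"
    and "\<forall>\<^sub>F n in sequentially.
           artinian_ring (R Quot frobenius_power R J (p ^ n)) \<and>
           gorenstein_local_ring (R Quot frobenius_power R J (p ^ n))"
  shows "let
      L1 = (\<lambda>n. module_length R
              (hom_module R (cyclic_module R \<aa>) (cyclic_module R (frobenius_power R I (p ^ n)))));
      L2 = (\<lambda>n. module_length R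
              (tensor_product R (Tor_frobenius R p n 1 (cyclic_module R I)) (cyclic_module R \<aa>)));
      L3 = (\<lambda>n. module_length R
              (Tor R 2 (cyclic_module R (frobenius_power R I (p ^ n))) (cyclic_module R \<aa>)))
    in (\<forall>n. L1 n \<noteq> \<infinity> \<and> L2 n \<noteq> \<infinity> \<and> L3 n \<noteq> \<infinity>) \<and>
       Bseq (\<lambda>n. real (the_enat (L1 n)) - real (the_enat (L2 n))) \<and>
       Bseq (\<lambda>n. real (the_enat (L1 n)) - real (the_enat (L3 n))) \<and>
       Bseq (\<lambda>n. real (the_enat (L2 n)) - real (the_enat (L3 n)))"
proof -
  define L1 where "L1 n = module_length R (hom_module R (cyclic_module R \<aa>) (cyclic_module R (frobenius_power R I (p ^ n))))" for n
  define L2 where "L2 n = module_length R (tensor_product R (Tor_frobenius R p n 1 (cyclic_module R I)) (cyclic_module R \<aa>))" for n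
  define L3 where "L3 n = module_length R (Tor R 2 (cyclic_module R (frobenius_power R I (p ^ n))) (cyclic_module R \<aa>))" for n
  define good where "good = (\<lambda>n. artinian_ring (R Quot frobenius_power R J (p ^ n)) \<and> gorenstein_local_ring (R Quot frobenius_power R J (p ^ n)))"
  interpret noetherian_cring R
    by (rule noetherian_cring.intro[OF assms(1)[unfolded local_ring_def, THEN conjunct1] assms(2)])
  have ev: "\<forall>\<^sub>F n in sequentially. good n" using assms(11) unfolding good_def .
  then obtain n0 where n0: "good n0" unfolding eventually_sequentially by blast
  from frobenius_length_comparison[OF assms(1,3-10) good_def n0, folded L1_def L2_def L3_def]
  obtain b :: nat where b': "\<forall>n. L1 n \<noteq> \<infinity> \<and> (\<exists>s t. s \<le> enat b \<and> t \<le> enat b \<and> L3 n + s = t + L2 n \<and> L3 n + s \<noteq> \<infinity>) \<and>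
      (good n \<longrightarrow> (\<exists>w. w \<le> enat b \<and> L1 n = w + L2 n))" by (elim exE)
  have b: "L1 n \<noteq> \<infinity>" "\<exists>s t. s \<le> enat b \<and> t \<le> enat b \<and> L3 n + s = t + L2 n \<and> L3 n + s \<noteq> \<infinity>"
    "good n \<Longrightarrow> \<exists>w. w \<le> enat b \<and> L1 n = w + L2 n" for n
    using spec[OF b', of n] by simp_all
  have L23: "L3 n \<noteq> \<infinity>" "L2 n \<noteq> \<infinity>" "\<bar>real (the_enat (L2 n)) - real (the_enat (L3 n))\<bar> \<le> real b" for n
  proof -
    from b(2)[of n] obtain s t where st: "L3 n + s = t + L2 n" "L3 n + s \<noteq> \<infinity>" "s \<le> enat b" "t \<le> enat b" by (elim exE conjE)
    show "L3 n \<noteq> \<infinity>" "L2 n \<noteq> \<infinity>" "\<bar>real (the_enat (L2 n)) - real (the_enat (L3 n))\<bar> \<le> real b"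
      by (rule the_enat_diff_le[OF st])+
  qed
  have L12: "\<bar>real (the_enat (L1 n)) - real (the_enat (L2 n))\<bar> \<le> real b" if "good n" for n
  proof -
    obtain w where w: "w \<le> enat b" "L1 n = w + L2 n" using b(3)[OF \<open>good n\<close>] by (elim exE conjE)
    have "L2 n + w = 0 + L1 n" "L2 n + w \<noteq> \<infinity>" using w(2) b(1)[of n] by (simp_all add: add.commute)
    from the_enat_diff_le(3)[OF this w(1)] show ?thesis by simp
  qed
  have "Bseq (\<lambda>n. real (the_enat (L1 n)) - real (the_enat (L2 n)))"
    by (rule BfunI[where K = "real b"], rule eventually_mono[OF ev]) (simp add: L12)
  moreover have "Bseq (\<lambda>n. real (the_enat (L2 n)) - real (the_enat (L3 n)))"
    by (rule BfunI[where K = "real b"]) (simp add: L23)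
  moreover have "Bseq (\<lambda>n. real (the_enat (L1 n)) - real (the_enat (L3 n)))"
  proof (rule BfunI[where K = "real b + real b"], rule eventually_mono[OF ev])
    fix n assume "good n"
    from L12[OF this] L23(3)[of n] show "norm (real (the_enat (L1 n)) - real (the_enat (L3 n))) \<le> real b + real b" by simp
  qed
  ultimately show ?thesis unfolding Let_def using b(1) L23(1,2) unfolding L1_def L2_def L3_def by blast
qed

end
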